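(* Let $K$ be a local field of characteristic $p$, let $\psi$ be a Drinfeld $A$-module of good reduction over $\mathcal O_K$, and let $M\subset(\mathcal P_{K^{\rm perf}},\psi)$ be a finitely generated $A$-submodule. If $|j(M)|=\mathrm{rank}_A(M)$, then $\rho_M(J_K)$ is open in $\mathrm{Hom}_A(M,T^\circ_{\rm ad}(\psi))$.
   Context: Fields and Galois groups. $K$ is a local field of characteristic $p$ with finite residue field and normalized valuation $v$, extended to a fixed algebraic closure $K^{\rm alg}$; $K^{\rm perf}\subset K^{\rm alg}$ is the perfection of $K$. For an intermediate field $K'$ of $K^{\rm alg}/K$, $\mathcal O_{K'}$ and $\mathfrak m_{K'}$ denote its valuation ring and maximal ideal. $\mathcal P_{K^{\rm perf}}:=K^{\rm perf}/\mathcal O_{K^{\rm perf}}$. $I_K\subset\mathrm{Gal}(K^{\rm alg}/K^{\rm perf})\cong\mathrm{Gal}(K^{\rm sep}/K)$ is the inertia group, and $J_K:=I_K^{\rm ab}/(I_K^{\rm ab})^p$ is its maximal (profinite) quotient that is abelian of exponent $p$. The invariant $j$. For $\xi\in K^{\rm perf}\setminus\mathcal O_{K^{\rm perf}}$ write $v(\xi)=-p^\nu j$ with unique integers $\nu$ and $j>0$, $p\nmid j$; these depend only on the class $m=[\xi]\in\mathcal P_{K^{\rm perf}}$, and we set $j(m):=j$. Set $j(M):=\{j(m)\mid m\in M\setminus\{0\}\}$. Drinfeld modules. $A$ is the ring of elements of a global function field $F$ of characteristic $p$ that are regular outside a fixed place $\infty$. A Drinfeld $A$-module $\psi$ of good reduction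 over $\mathcal O_K$ is a ring homomorphism $A\to\mathcal O_K[\tau]$ ($\tau x=x^p\tau$), $a\mapsto\psi_a$, of positive rank, such that for every $a\ne0$ the highest coefficient of $\psi_a$ is a unit. Polynomials $\sum f_i\tau^i$ act by $\xi\mapsto\sum f_i\xi^{p^i}$, and $(H,\psi)$ denotes $H$ with $A$ acting through $\psi$. The $A$-module $(\mathcal P_{K^{\rm perf}},\psi)$ is torsion free. $T^\circ_{\rm ad}(\psi):=\mathrm{Hom}_A\bigl(F/A,(K^{\rm alg}/\mathfrak m_{K^{\rm alg}},\psi)\bigr)$ carries its natural profinite topology (as the inverse limit of the finite groups $\mathrm{Hom}_A(\frac1aA/A,\ldots)$), and $\mathrm{Hom}_A(M,T^\circ_{\rm ad}(\psi))$ the induced profinite topology. Local Kummer pairing. For $\xi\in K^{\rm perf}$ and $\gamma\in I_K$, $[\xi,\gamma)_\psi\in T^\circ_{\rm ad}(\psi)$ is the map sending $\frac ba+A$ ($a,b\in A$, $a\ne0$) to $[\psi_b(\gamma(\xi_a)-\xi_a)]$, where $\xi_a\in K^{\rm alg}$ is any element with $\psi_a(\xi_a)=\xi$. It is well defined and depends only on $[\xi]\in\mathcal P_{K^{\rm perf}}$ and $[\gamma]\in J_K$. $\rho_M:J_K\to\mathrm{Hom}_A(M,T^\circ_{\rm ad}(\psi))$ is $\rho_M([\gamma]):=(m\mapsto[m,\gamma)_\psi)$. *)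

theory Defs
  imports
    "HOL-Analysis.Analysis"
    "HOL-Algebra.Algebra"
    "HOL-Algebra.Generated_Fields"
    "HOL-Algebra.Finite_Extensions"
    "HOL-Algebra.Algebraic_Closure_Type"
    "HOL-Library.Set_Algebras"
begin

section \<open>Valuations and local fields\<close>

definition valuation :: "('a::field \<Rightarrow> ereal) \<Rightarrow> bool" where
  "valuation v \<longleftrightarrow>
     (\<forall>x. v x \<noteq> -\<infinity>) \<and> (\<forall>x. v x = \<infinity> \<longleftrightarrow> x = 0) \<and>
     (\<forall>x y. v (x * y) = v x + v y) \<and> (\<forall>x y. min (v x) (v y) \<le> v (x + y))"

definition normalized_valuation :: "('a::field \<Rightarrow> ereal) \<Rightarrow> bool" where
  "normalized_valuation v \<longleftrightarrow>
     valuation v \<and> v ` (UNIV - {0}) = range (\<lambda>n::int. ereal (real_of_int n))"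

definition val_ring :: "('a::field \<Rightarrow> ereal) \<Rightarrow> 'a set \<Rightarrow> 'a set" where
  "val_ring v L = {x \<in> L. 0 \<le> v x}"

definition max_ideal :: "('a::field \<Rightarrow> ereal) \<Rightarrow> 'a set \<Rightarrow> 'a set" where
  "max_ideal v L = {x \<in> L. 0 < v x}"

definition quotient_set :: "'a::ab_group_add set \<Rightarrow> 'a set \<Rightarrow> 'a set set" where
  "quotient_set H S = (\<lambda>x. x +o S) ` H"

definition complete_valuation :: "('a::field \<Rightarrow> ereal) \<Rightarrow> bool" where
  "complete_valuation v \<longleftrightarrow>
     (\<forall>s :: nat \<Rightarrow> 'a.
        (\<forall>C::real. \<exists>N. \<forall>m\<ge>N. \<forall>n\<ge>N. ereal C \<le> v (s m - s n)) \<longrightarrow>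
        (\<exists>l. \<forall>C::real. \<exists>N. \<forall>n\<ge>N. ereal C \<le> v (s n - l)))"

definition local_field :: "('a::field \<Rightarrow> ereal) \<Rightarrow> bool" where
  "local_field v \<longleftrightarrow>
     normalized_valuation v \<and> complete_valuation v \<and>
     finite (quotient_set (val_ring v UNIV) (max_ideal v UNIV))"

text \<open>
  In the following, the local field is a type \<open>'k\<close>, its algebraic closure is
  \<open>'k alg_closure\<close>, and \<open>v\<close> is a valuation on \<open>'k alg_closure\<close>; the valuation
  of the local field itself is the restriction of \<open>v\<close> along \<open>to_ac\<close>.
\<close>

definition base_val :: "('k::field alg_closure \<Rightarrow> ereal) \<Rightarrow> 'k \<Rightarrow> ereal" where
  "base_val v x = v (to_ac x)"

definition perfection :: "'k::field alg_closure set" where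
  "perfection = {x. \<exists>n. x ^ (CHAR('k) ^ n) \<in> range to_ac}"


section \<open>Galois group, inertia group and its quotient \<open>J\<close>\<close>

definition gal :: "('k::field alg_closure \<Rightarrow> 'k alg_closure) set" where
  "gal = {\<gamma> \<in> ring_iso ring_of_type_algebra ring_of_type_algebra. \<forall>x\<in>perfection. \<gamma> x = x}"

definition krull_topology :: "('k::field alg_closure \<Rightarrow> 'k alg_closure) topology" where
  "krull_topology = topology_generated_by
     {{\<tau> \<in> gal. \<forall>x\<in>L. \<tau> x = \<sigma> x} | \<sigma> L.
        \<sigma> \<in> gal \<and> subfield L ring_of_type_algebra \<and> perfection \<subseteq> L \<and>
        ring.finite_dimension ring_of_type_algebra perfection L}"

definition inertia ::
    "('k::field alg_closure \<Rightarrow> ereal) \<Rightarrow> ('k alg_closure \<Rightarrow> 'k alg_closure) set" where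
  "inertia v = {\<gamma> \<in> gal. \<forall>x \<in> val_ring v UNIV. \<gamma> x - x \<in> max_ideal v UNIV}"

definition inertia_group ::
    "('k::field alg_closure \<Rightarrow> ereal) \<Rightarrow> ('k alg_closure \<Rightarrow> 'k alg_closure) monoid" where
  "inertia_group v = \<lparr>carrier = inertia v, monoid.mult = (\<circ>), one = id\<rparr>"

text \<open>The abelianization is the topological one: the quotient by the closure of the
  commutator subgroup.\<close>

definition inertia_ab ::
    "('k::field alg_closure \<Rightarrow> ereal) \<Rightarrow> ('k alg_closure \<Rightarrow> 'k alg_closure) set monoid" where
  "inertia_ab v = inertia_group v Mod
     (subtopology krull_topology (inertia v) closure_of derived (inertia_group v) (inertia v))"

definition J_group ::
    "('k::field alg_closure \<Rightarrow> ereal) \<Rightarrow> ('k alg_closure \<Rightarrow> 'k alg_closure) set set monoid" where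
  "J_group v = inertia_ab v Mod
     ((\<lambda>x. x [^]\<^bsub>inertia_ab v\<^esub> CHAR('k)) ` carrier (inertia_ab v))"


section \<open>Modules\<close>

text \<open>The module \<open>H/S\<close> whose scalar multiplication is induced by \<open>act\<close>. The ring
  multiplication and the unit of the \<open>module\<close> record play no role.\<close>

definition quotient_module ::
    "('a \<Rightarrow> 'b::ab_group_add \<Rightarrow> 'b) \<Rightarrow> 'b set \<Rightarrow> 'b set \<Rightarrow> ('a, 'b set) module" where
  "quotient_module act H S =
     \<lparr>carrier = quotient_set H S, monoid.mult = undefined, one = undefined,
      ring.zero = S, add = (\<lambda>U V. U + V), smult = (\<lambda>a U. \<Union>x\<in>U. act a x +o S)\<rparr>"

definition lin_indep :: "('a, 'c) ring_scheme \<Rightarrow> ('a, 'b, 'd) module_scheme \<Rightarrow> 'b set \<Rightarrow> bool" where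
  "lin_indep R N S \<longleftrightarrow> finite S \<and> S \<subseteq> carrier N \<and>
     (\<forall>c \<in> S \<rightarrow> carrier R.
        finsum N (\<lambda>s. c s \<odot>\<^bsub>N\<^esub> s) S = \<zero>\<^bsub>N\<^esub> \<longrightarrow> (\<forall>s\<in>S. c s = \<zero>\<^bsub>R\<^esub>))"

definition fin_gen :: "('a, 'c) ring_scheme \<Rightarrow> ('a, 'b, 'd) module_scheme \<Rightarrow> bool" where
  "fin_gen R N \<longleftrightarrow> (\<exists>S. finite S \<and> S \<subseteq> carrier N \<and>
     carrier N = {finsum N (\<lambda>s. c s \<odot>\<^bsub>N\<^esub> s) S | c. c \<in> S \<rightarrow> carrier R})"

text \<open>The rank of a finitely generated module over a domain: the maximal number of
  linearly independent elements.\<close>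

definition mod_rank :: "('a, 'c) ring_scheme \<Rightarrow> ('a, 'b, 'd) module_scheme \<Rightarrow> nat" where
  "mod_rank R N = (GREATEST n. \<exists>S. lin_indep R N S \<and> card S = n)"

definition module_homs ::
    "('a, 'c) ring_scheme \<Rightarrow> ('a, 'b, 'd) module_scheme \<Rightarrow> ('a, 'e, 'g) module_scheme \<Rightarrow>
     ('b \<Rightarrow> 'e) set" where
  "module_homs R N N' = {h \<in> carrier N \<rightarrow>\<^sub>E carrier N'.
     (\<forall>x\<in>carrier N. \<forall>y\<in>carrier N. h (x \<oplus>\<^bsub>N\<^esub> y) = h x \<oplus>\<^bsub>N'\<^esub> h y) \<and>
     (\<forall>a\<in>carrier R. \<forall>x\<in>carrier N. h (a \<odot>\<^bsub>N\<^esub> x) = a \<odot>\<^bsub>N'\<^esub> h x)}"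

definition hom_module ::
    "('a, 'c) ring_scheme \<Rightarrow> ('a, 'b, 'd) module_scheme \<Rightarrow> ('a, 'e, 'g) module_scheme \<Rightarrow>
     ('a, 'b \<Rightarrow> 'e) module" where
  "hom_module R N N' =
     \<lparr>carrier = module_homs R N N', monoid.mult = undefined, one = undefined,
      ring.zero = (\<lambda>x\<in>carrier N. \<zero>\<^bsub>N'\<^esub>),
      add = (\<lambda>f g. \<lambda>x\<in>carrier N. f x \<oplus>\<^bsub>N'\<^esub> g x),
      smult = (\<lambda>a f. \<lambda>x\<in>carrier N. a \<odot>\<^bsub>N'\<^esub> f x)\<rparr>"


section \<open>Global function fields and Drinfeld modules\<close>

text \<open>\<open>generate_field _ {}\<close> is the prime field. Global function fields of
  characteristic \<open>p\<close> are the finite extensions of \<open>\<bbbF>\<^sub>p(t)\<close>, \<open>t\<close> transcendental over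
  \<open>\<bbbF>\<^sub>p\<close>.\<close>

definition global_function_field :: "'f::field itself \<Rightarrow> bool" where
  "global_function_field ty \<longleftrightarrow> Factorial_Ring.prime CHAR('f) \<and>
     (let F = ring_of_type_algebra :: 'f ring in
      \<exists>t. ring.transcendental F (generate_field F {}) t \<and>
          ring.finite_dimension F (generate_field F {t}) UNIV)"

text \<open>The places of a global function field correspond bijectively to its normalized
  discrete valuations. The elements regular outside the place \<open>vinf\<close> are those that are
  integral at all the other places.\<close>

definition regular_outside :: "('f::field \<Rightarrow> ereal) \<Rightarrow> 'f set" where
  "regular_outside vinf = {a. \<forall>w. normalized_valuation w \<and> w \<noteq> vinf \<longrightarrow> 0 \<le> w a}"

definition ring_A :: "('f::field \<Rightarrow> ereal) \<Rightarrow> 'f ring" where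
  "ring_A vinf = ring_of_type_algebra \<lparr>carrier := regular_outside vinf\<rparr>"

text \<open>The twisted polynomial ring \<open>R[\<tau>]\<close> with \<open>\<tau> x = x\<^sup>p \<tau>\<close>. The element
  \<open>\<Sum>i. f\<^sub>i \<tau>\<^sup>i\<close> is represented by the ordinary polynomial with coefficients \<open>f\<^sub>i\<close>.\<close>

definition twisted_poly_ring :: "'k::field set \<Rightarrow> 'k poly ring" where
  "twisted_poly_ring R =
     \<lparr>carrier = {f. \<forall>i. Polynomial.coeff f i \<in> R},
      monoid.mult = (\<lambda>f g. \<Sum>i\<le>Polynomial.degree f. \<Sum>j\<le>Polynomial.degree g.
         Polynomial.monom (Polynomial.coeff f i * Polynomial.coeff g j ^ (CHAR('k) ^ i)) (i + j)),
      one = 1, ring.zero = 0, add = (+)\<rparr>"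

definition tw_eval :: "'k::field poly \<Rightarrow> 'k alg_closure \<Rightarrow> 'k alg_closure" where
  "tw_eval f x = (\<Sum>i\<le>Polynomial.degree f. to_ac (Polynomial.coeff f i) * x ^ (CHAR('k) ^ i))"

text \<open>The rank \<open>r\<close> is characterized by \<open>deg\<^sub>\<tau>(\<psi>\<^sub>a) = r \<cdot> deg(a)\<close> for all nonzero \<open>a\<close>,
  where \<open>p\<^bsup>deg(a)\<^esup> = |A/aA|\<close>.\<close>

definition drinfeld_rank ::
    "('f::field \<Rightarrow> ereal) \<Rightarrow> ('f \<Rightarrow> 'k::field poly) \<Rightarrow> nat \<Rightarrow> bool" where
  "drinfeld_rank vinf \<psi> r \<longleftrightarrow>
     (\<forall>a \<in> regular_outside vinf - {0}.
        CHAR('k) ^ Polynomial.degree (\<psi> a) =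
        card (quotient_set (regular_outside vinf) ((*) a ` regular_outside vinf)) ^ r)"

text \<open>Only the restriction of \<open>\<psi>\<close> to \<open>A\<close> is relevant.\<close>

definition good_drinfeld_module ::
    "('f::field \<Rightarrow> ereal) \<Rightarrow> ('k::field \<Rightarrow> ereal) \<Rightarrow> ('f \<Rightarrow> 'k poly) \<Rightarrow> bool" where
  "good_drinfeld_module vinf u \<psi> \<longleftrightarrow>
     \<psi> \<in> ring_hom (ring_A vinf) (twisted_poly_ring (val_ring u UNIV)) \<and>
     (\<exists>r>0. drinfeld_rank vinf \<psi> r) \<and>
     (\<forall>a \<in> regular_outside vinf - {0}.
        Polynomial.lead_coeff (\<psi> a) \<in>
          Units (ring_of_type_algebra \<lparr>carrier := val_ring u UNIV\<rparr>))"

definition P_module ::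
    "('k::field alg_closure \<Rightarrow> ereal) \<Rightarrow> ('f \<Rightarrow> 'k poly) \<Rightarrow> ('f, 'k alg_closure set) module" where
  "P_module v \<psi> =
     quotient_module (\<lambda>a. tw_eval (\<psi> a)) perfection (val_ring v perfection)"

definition alg_mod_max ::
    "('k::field alg_closure \<Rightarrow> ereal) \<Rightarrow> ('f \<Rightarrow> 'k poly) \<Rightarrow> ('f, 'k alg_closure set) module" where
  "alg_mod_max v \<psi> =
     quotient_module (\<lambda>a. tw_eval (\<psi> a)) UNIV (max_ideal v UNIV)"

definition F_mod_A :: "('f::field \<Rightarrow> ereal) \<Rightarrow> ('f, 'f set) module" where
  "F_mod_A vinf = quotient_module (*) UNIV (regular_outside vinf)"


section \<open>The invariant \<open>j\<close>\<close>

definition j_inv :: "('k::field alg_closure \<Rightarrow> ereal) \<Rightarrow> 'k alg_closure set \<Rightarrow> nat" where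
  "j_inv v m = (THE j. 0 < j \<and> \<not> CHAR('k) dvd j \<and>
     (\<exists>\<xi>\<in>m. \<exists>\<nu>::int. v \<xi> = ereal (- (real CHAR('k) powi \<nu> * real j))))"

definition j_set :: "('k::field alg_closure \<Rightarrow> ereal) \<Rightarrow> 'k alg_closure set set \<Rightarrow> nat set" where
  "j_set v M = j_inv v ` (M - {val_ring v perfection})"


section \<open>The adelic Tate module and the local Kummer pairing\<close>

definition tate_module ::
    "('f::field \<Rightarrow> ereal) \<Rightarrow> ('k::field alg_closure \<Rightarrow> ereal) \<Rightarrow> ('f \<Rightarrow> 'k poly) \<Rightarrow>
     ('f, 'f set \<Rightarrow> 'k alg_closure set) module" where
  "tate_module vinf v \<psi> = hom_module (ring_A vinf) (F_mod_A vinf) (alg_mod_max v \<psi>)"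

definition frac_mod_A :: "('f::field \<Rightarrow> ereal) \<Rightarrow> 'f \<Rightarrow> 'f set set" where
  "frac_mod_A vinf a =
     quotient_set ((\<lambda>b. b / a) ` regular_outside vinf) (regular_outside vinf)"

text \<open>The inverse limit topology: the coarsest one for which the restriction maps to the
  discrete groups \<open>Hom\<^sub>A(a\<^sup>-\<^sup>1A/A, _)\<close> are continuous.\<close>

definition tate_topology ::
    "('f::field \<Rightarrow> ereal) \<Rightarrow> ('k::field alg_closure \<Rightarrow> ereal) \<Rightarrow> ('f \<Rightarrow> 'k poly) \<Rightarrow>
     ('f set \<Rightarrow> 'k alg_closure set) topology" where
  "tate_topology vinf v \<psi> = topology_generated_by
     {{g \<in> carrier (tate_module vinf v \<psi>). \<forall>U \<in> frac_mod_A vinf a. g U = f U} | a f.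
        a \<in> regular_outside vinf - {0} \<and> f \<in> carrier (tate_module vinf v \<psi>)}"

text \<open>\<open>Hom\<^sub>A(M, T)\<close> with the topology induced from \<open>T\<close>, i.e. that of pointwise
  convergence.\<close>

definition hom_topology ::
    "('f::field \<Rightarrow> ereal) \<Rightarrow> ('k::field alg_closure \<Rightarrow> ereal) \<Rightarrow> ('f \<Rightarrow> 'k poly) \<Rightarrow>
     'k alg_closure set set \<Rightarrow>
     ('k alg_closure set \<Rightarrow> 'f set \<Rightarrow> 'k alg_closure set) topology" where
  "hom_topology vinf v \<psi> M =
     subtopology (product_topology (\<lambda>_. tate_topology vinf v \<psi>) M)
       (module_homs (ring_A vinf) (P_module v \<psi> \<lparr>carrier := M\<rparr>) (tate_module vinf v \<psi>))"

definition kummer ::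
    "('f::field \<Rightarrow> ereal) \<Rightarrow> ('k::field alg_closure \<Rightarrow> ereal) \<Rightarrow> ('f \<Rightarrow> 'k poly) \<Rightarrow>
     'k alg_closure \<Rightarrow> ('k alg_closure \<Rightarrow> 'k alg_closure) \<Rightarrow> 'f set \<Rightarrow> 'k alg_closure set" where
  "kummer vinf v \<psi> \<xi> \<gamma> =
     (\<lambda>U \<in> carrier (F_mod_A vinf). THE V. \<exists>a b \<xi>\<^sub>a.
        a \<in> regular_outside vinf - {0} \<and> b \<in> regular_outside vinf \<and>
        U = b / a +o regular_outside vinf \<and> tw_eval (\<psi> a) \<xi>\<^sub>a = \<xi> \<and>
        V = tw_eval (\<psi> b) (\<gamma> \<xi>\<^sub>a - \<xi>\<^sub>a) +o max_ideal v UNIV)"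

text \<open>An element \<open>c\<close> of \<open>J\<close> is a set of cosets in the inertia group, and the automorphisms
  representing it are the elements of \<open>\<Union>c\<close>.\<close>

definition rho ::
    "('f::field \<Rightarrow> ereal) \<Rightarrow> ('k::field alg_closure \<Rightarrow> ereal) \<Rightarrow> ('f \<Rightarrow> 'k poly) \<Rightarrow>
     'k alg_closure set set \<Rightarrow> ('k alg_closure \<Rightarrow> 'k alg_closure) set set \<Rightarrow>
     'k alg_closure set \<Rightarrow> 'f set \<Rightarrow> 'k alg_closure set" where
  "rho vinf v \<psi> M c =
     (\<lambda>m\<in>M. THE f. \<exists>\<xi>\<in>m. \<exists>\<gamma>\<in>\<Union>c. f = kummer vinf v \<psi> \<xi> \<gamma>)"

end

theory Submission
  imports Defs "HOL-Library.Function_Algebras"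
begin

text \<open>
  Fix \<open>\<xi>\<^sub>1, \<dots>, \<xi>\<^sub>r\<close> representing elements of \<open>M\<close> with distinct invariants \<open>j\<close>. For \<open>a \<in> A\<close>, the
  differences \<open>\<gamma>(x) - x\<close> with \<open>\<psi>\<^sub>a(x) = \<xi>\<^sub>i\<close>, taken modulo the maximal ideal, form a subgroup \<open>H\<^sub>a\<close> of
  \<open>X\<^sub>a\<^bsup>r\<^esup>\<close>, where \<open>X\<^sub>a\<close> is the \<open>a\<close>-torsion of the reduction. The key point is that the index of \<open>H\<^sub>a\<close> is
  bounded independently of \<open>a\<close>: if \<open>H\<^sub>a\<close> were too small, there would be a linear relation among
  the functions \<open>h \<mapsto> h\<^sub>i\<^bsup>p\<^sup>k\<^esup>\<close> on it, hence an inertia invariant combination of Frobenius powers of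
  Kummer generators, whose valuation is not an integer because the \<open>j\<close> are distinct. So the index
  is constant for all multiples of some \<open>a\<^sub>0\<close>, and then \<open>H\<^sub>a\<close> contains the kernel of
  \<open>X\<^sub>a\<^bsup>r\<^esup> \<rightarrow> X\<^bsub>a\<^sub>0\<^esub>\<^bsup>r\<^esup>\<close>. By compactness of the inertia group, every homomorphism that agrees with
  \<open>\<rho>\<^sub>M([\<gamma>])\<close> on the \<open>a\<^sub>0\<close>-torsion of \<open>F/A\<close> at the \<open>\<xi>\<^sub>i\<close> is itself in the image; it is determined by
  its values at the \<open>\<xi>\<^sub>i\<close> because \<open>r\<close> is the rank of \<open>M\<close> and the Tate module is torsion free. That \<open>F\<close>
  is the fraction field of \<open>A\<close> follows from a dimension count in the style of Riemann and Roch.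
\<close>

section \<open>Linear algebra over a subfield\<close>

text \<open>The bound on the index counts Frobenius powers. On the maximal unramified extension the
  absolute values are integral powers of \<open>exp 1\<close>. To each \<open>\<xi> i\<close>
  belongs a Kummer generator \<open>y i\<close> with
  \<open>nrm (y i) ^ (p ^ n') = nrm (\<xi> i)\<close>, where \<open>p ^ n'\<close> is at least the
  number of torsion points of the reduction. If \<open>nrm (\<xi> i) < exp (p ^ N)\<close>, then for
  \<open>k < n' - N\<close> the power of \<open>y i\<close> with exponent \<open>p ^ k\<close> has
  absolute value strictly between 1 and \<open>exp 1\<close>. So at most \<open>N\<close> powers are
  lost for each \<open>i\<close>, and the factor \<open>p ^ (r * N)\<close> depends on the
  \<open>\<xi> i\<close> alone. Two obstacles shape the argument. The operator attached to
  \<open>a\<close> may be inseparable, which is repaired by passing to Frobenius powers; and its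
  torsion points may be ramified, which is repaired by an additive polynomial that kills those with
  zero reduction. Separability over the unramified extension enters as the property of a ring to be
  spanned by its own p-th powers. In characteristic \<open>p\<close> the residue field lifts to a
  field of constants, so reductions are computed inside a field.\<close>

definition subfld :: "'a::field set \<Rightarrow> bool" where
  "subfld E \<longleftrightarrow> 0 \<in> E \<and> 1 \<in> E \<and> (\<forall>x\<in>E. \<forall>y\<in>E. x + y \<in> E \<and> x * y \<in> E) \<and>
     (\<forall>x\<in>E. - x \<in> E \<and> inverse x \<in> E)"

lemma subfldD:
  assumes "subfld E"
  shows "0 \<in> E" "1 \<in> E" "\<And>x y. x \<in> E \<Longrightarrow> y \<in> E \<Longrightarrow> x + y \<in> E"
    "\<And>x y. x \<in> E \<Longrightarrow> y \<in> E \<Longrightarrow> x * y \<in> E" "\<And>x. x \<in> E \<Longrightarrow> - x \<in> E"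
    "\<And>x. x \<in> E \<Longrightarrow> inverse x \<in> E" "\<And>x y. x \<in> E \<Longrightarrow> y \<in> E \<Longrightarrow> x - y \<in> E"
    "\<And>x y. x \<in> E \<Longrightarrow> y \<in> E \<Longrightarrow> x / y \<in> E" "\<And>x n. x \<in> E \<Longrightarrow> x ^ (n::nat) \<in> E"
proof -
  show *: "0 \<in> E" "1 \<in> E" "\<And>x y. x \<in> E \<Longrightarrow> y \<in> E \<Longrightarrow> x + y \<in> E"
    "\<And>x y. x \<in> E \<Longrightarrow> y \<in> E \<Longrightarrow> x * y \<in> E" "\<And>x. x \<in> E \<Longrightarrow> - x \<in> E"
    "\<And>x. x \<in> E \<Longrightarrow> inverse x \<in> E"
    using assms by (auto simp: subfld_def)
  show "x - y \<in> E" if "x \<in> E" "y \<in> E" for x y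
    using *(3)[OF that(1) *(5)[OF that(2)]] by simp
  show "x / y \<in> E" if "x \<in> E" "y \<in> E" for x y
    using *(4)[OF that(1) *(6)[OF that(2)]] by (simp add: field_simps)
  show "x ^ n \<in> E" if "x \<in> E" for x and n :: nat
    by (induction n) (use * that in auto)
qed

lemma subfld_sum: "subfld E \<Longrightarrow> (\<And>j. j \<in> J \<Longrightarrow> f j \<in> E) \<Longrightarrow> (\<Sum>j\<in>J. f j) \<in> E"
  by (induction J rule: infinite_finite_induct) (auto intro: subfldD)

text \<open>Gaussian elimination, one equation per induction step. All divisions take place in
  \<open>E\<close>, so the solution has its entries in this subfield although the ambient field may
  be larger.\<close>

lemma homogeneous_system:
  fixes A :: "'q \<Rightarrow> 'j \<Rightarrow> 'a::field"
  assumes "finite Q" "subfld E" "finite J" "card Q < card J" "\<forall>q\<in>Q. \<forall>j\<in>J. A q j \<in> E"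
  shows "\<exists>c. (\<forall>j\<in>J. c j \<in> E) \<and> (\<exists>j\<in>J. c j \<noteq> 0) \<and> (\<forall>q\<in>Q. (\<Sum>j\<in>J. A q j * c j) = 0)"
  using assms(1,3-5)
proof (induction Q arbitrary: J A rule: finite_induct)
  case empty
  then have "J \<noteq> {}" by auto
  then show ?case using subfldD(2)[OF assms(2)] by (intro exI[of _ "\<lambda>_. 1"]) auto
next
  case (insert q Q)
  show ?case
  proof (cases "\<forall>j\<in>J. A q j = 0")
    case True
    have "card Q < card J" using insert by simp
    from insert.IH[OF insert.prems(1) this] insert.prems(3)
    obtain c where c: "\<forall>j\<in>J. c j \<in> E" "\<exists>j\<in>J. c j \<noteq> 0" "\<forall>q\<in>Q. (\<Sum>j\<in>J. A q j * c j) = 0"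
      by (metis insert_iff)
    have "(\<Sum>j\<in>J. A q j * c j) = 0" using True by (intro sum.neutral) auto
    then show ?thesis using c by auto
  next
    case False
    then obtain l where l: "l \<in> J" "A q l \<noteq> 0" by auto
    let ?J = "J - {l}"
    \<comment> \<open>The remaining equations after equation \<open>q\<close> has been solved for
      the unknown \<open>l\<close>, whose value \<open>- s\<close> is inserted at the end.\<close>
    define A' where "A' = (\<lambda>r j. A r j - A r l * (A q j / A q l))"
    have cJ: "card Q < card ?J" using insert.prems insert.hyps l by simp
    have fJ: "finite ?J" using insert.prems by simp
    have AE: "\<forall>r\<in>Q. \<forall>j\<in>?J. A' r j \<in> E"
      unfolding A'_def using insert.prems(3) l assms(2) by (auto intro!: subfldD)
    from insert.IH[OF fJ cJ AE]
    obtain c where c: "\<forall>j\<in>?J. c j \<in> E" "\<exists>j\<in>?J. c j \<noteq> 0" "\<forall>r\<in>Q. (\<Sum>j\<in>?J. A' r j * c j) = 0"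
      by blast
    define s where "s = (\<Sum>j\<in>?J. A q j / A q l * c j)"
    define c' where "c' = c(l := - s)"
    have sE: "s \<in> E" unfolding s_def
      using insert.prems(3) l assms(2) c(1) by (intro subfld_sum) (auto intro!: subfldD)
    have split: "(\<Sum>j\<in>J. A r j * c' j) = - (A r l * s) + (\<Sum>j\<in>?J. A r j * c j)" for r
      using sum.remove[OF insert.prems(1) l(1), of "\<lambda>j. A r j * c' j"]
      by (simp add: c'_def)
    have "(\<Sum>j\<in>J. A r j * c' j) = 0" if "r \<in> Q" for r
    proof -
      have "0 = (\<Sum>j\<in>?J. A r j * c j) - A r l * s"
        using c(3) that unfolding A'_def s_def sum_distrib_left sum_subtractf[symmetric]
        by (simp add: left_diff_distrib mult.assoc)
      then show ?thesis using split[of r] by simp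
    qed
    moreover have "(\<Sum>j\<in>J. A q j * c' j) = 0"
    proof -
      have "A q l * s = (\<Sum>j\<in>?J. A q j * c j)"
        unfolding s_def sum_distrib_left using l by (intro sum.cong) auto
      then show ?thesis using split[of q] by simp
    qed
    moreover have "\<forall>j\<in>J. c' j \<in> E" using c(1) sE subfldD(5)[OF assms(2)] by (auto simp: c'_def)
    moreover have "\<exists>j\<in>J. c' j \<noteq> 0" using c(2) by (auto simp: c'_def)
    ultimately show ?thesis by (intro exI[of _ c']) auto
  qed
qed

text \<open>Families instead of sets: one index set serves both for a family and for its p-th
  powers, and repeated values do no harm.\<close>

definition lspan :: "'a::field set \<Rightarrow> ('j \<Rightarrow> 'a) \<Rightarrow> 'j set \<Rightarrow> 'a set" where
  "lspan E b J = {\<Sum>j\<in>J. c j * b j | c. \<forall>j\<in>J. c j \<in> E}"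

definition linindep :: "'a::field set \<Rightarrow> ('j \<Rightarrow> 'a) \<Rightarrow> 'j set \<Rightarrow> bool" where
  "linindep E b J \<longleftrightarrow>
     (\<forall>c. (\<forall>j\<in>J. c j \<in> E) \<and> (\<Sum>j\<in>J. c j * b j) = 0 \<longrightarrow> (\<forall>j\<in>J. c j = 0))"

lemma lspan_zero: "subfld E \<Longrightarrow> 0 \<in> lspan E b J"
  unfolding lspan_def by (rule CollectI, rule exI[of _ "\<lambda>_. 0"]) (auto intro: subfldD)

lemma lspan_add:
  assumes "subfld E" "x \<in> lspan E b J" "y \<in> lspan E b J"
  shows "x + y \<in> lspan E b J"
proof -
  from assms obtain c d where "x = (\<Sum>j\<in>J. c j * b j)" "y = (\<Sum>j\<in>J. d j * b j)"
    "\<forall>j\<in>J. c j \<in> E" "\<forall>j\<in>J. d j \<in> E" unfolding lspan_def by auto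
  then have "x + y = (\<Sum>j\<in>J. (c j + d j) * b j)" "\<forall>j\<in>J. c j + d j \<in> E"
    using assms(1) by (auto simp: sum.distrib algebra_simps intro: subfldD)
  then show ?thesis unfolding lspan_def by auto
qed

lemma lspan_scale:
  assumes "subfld E" "x \<in> lspan E b J" "e \<in> E"
  shows "e * x \<in> lspan E b J"
proof -
  from assms obtain c where "x = (\<Sum>j\<in>J. c j * b j)" "\<forall>j\<in>J. c j \<in> E"
    unfolding lspan_def by auto
  then have "e * x = (\<Sum>j\<in>J. (e * c j) * b j)" "\<forall>j\<in>J. e * c j \<in> E"
    using assms(1,3) by (auto simp: sum_distrib_left algebra_simps intro: subfldD)
  then show ?thesis unfolding lspan_def by auto
qed

lemma lspan_sum:
  "subfld E \<Longrightarrow> (\<And>k. k \<in> Q \<Longrightarrow> f k \<in> lspan E b J) \<Longrightarrow> (\<Sum>k\<in>Q. f k) \<in> lspan E b J"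
  by (induction Q rule: infinite_finite_induct) (auto intro: lspan_add lspan_zero)

lemma lspan_base:
  assumes "subfld E" "finite J" "j \<in> J" shows "b j \<in> lspan E b J"
proof -
  have "b j = (\<Sum>i\<in>J. (if i = j then 1 else 0) * b i)"
    using assms by (simp add: if_distrib[of "\<lambda>x. x * _"] cong: if_cong)
  then show ?thesis unfolding lspan_def
    using assms by (auto intro!: exI[of _ "\<lambda>i. if i = j then 1 else 0"] intro: subfldD)
qed

lemma lspan_subset:
  assumes "subfld E" "\<And>j. j \<in> J \<Longrightarrow> b j \<in> lspan E d Q"
  shows "lspan E b J \<subseteq> lspan E d Q"
proof
  fix x assume "x \<in> lspan E b J"
  then obtain c where c: "x = (\<Sum>j\<in>J. c j * b j)" "\<forall>j\<in>J. c j \<in> E" unfolding lspan_def by auto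
  show "x \<in> lspan E d Q" unfolding c(1)
    by (intro lspan_sum lspan_scale assms) (use c(2) in auto)
qed

lemma lspan_mono: "subfld E \<Longrightarrow> finite Q \<Longrightarrow> J \<subseteq> Q \<Longrightarrow> lspan E b J \<subseteq> lspan E b Q"
  by (rule lspan_subset) (auto intro: lspan_base)

text \<open>The coordinates of the \<open>u i\<close> form \<open>card J\<close> equations in
  \<open>card M\<close> unknowns; a solution in \<open>E\<close> is a linear relation.\<close>

lemma lspan_dependent:
  fixes u :: "'i \<Rightarrow> 'a::field"
  assumes "subfld E" "finite J" "finite M" "card J < card M" "\<And>i. i \<in> M \<Longrightarrow> u i \<in> lspan E b J"
  shows "\<not> linindep E u M"
proof -
  have "\<forall>i\<in>M. \<exists>c. u i = (\<Sum>j\<in>J. c j * b j) \<and> (\<forall>j\<in>J. c j \<in> E)"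
    using assms(5) unfolding lspan_def by auto
  then obtain a where a: "\<forall>i\<in>M. u i = (\<Sum>j\<in>J. a i j * b j) \<and> (\<forall>j\<in>J. a i j \<in> E)" by metis
  from homogeneous_system[OF assms(2,1,3,4), of "\<lambda>j i. a i j"] a
  obtain c where c: "\<forall>i\<in>M. c i \<in> E" "\<exists>i\<in>M. c i \<noteq> 0" "\<forall>j\<in>J. (\<Sum>i\<in>M. a i j * c i) = 0"
    by auto
  have "(\<Sum>i\<in>M. c i * u i) = (\<Sum>i\<in>M. \<Sum>j\<in>J. a i j * c i * b j)"
    using a by (intro sum.cong) (auto simp: sum_distrib_left mult_ac)
  also have "\<dots> = (\<Sum>j\<in>J. \<Sum>i\<in>M. a i j * c i * b j)" by (rule sum.swap)
  also have "\<dots> = (\<Sum>j\<in>J. (\<Sum>i\<in>M. a i j * c i) * b j)"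
    by (simp add: sum_distrib_right)
  also have "\<dots> = 0" using c(3) by simp
  finally show ?thesis using c unfolding linindep_def by auto
qed

lemma linindep_extend:
  assumes "subfld E" "linindep E u J" "finite J" "k \<notin> J" "u k \<notin> lspan E u J"
  shows "linindep E u (insert k J)"
  unfolding linindep_def
proof (intro allI impI)
  fix c assume c: "(\<forall>j\<in>insert k J. c j \<in> E) \<and> (\<Sum>j\<in>insert k J. c j * u j) = 0"
  have eq: "c k * u k + (\<Sum>j\<in>J. c j * u j) = 0" using c assms by simp
  have "c k = 0"
  proof (rule ccontr)
    assume ck: "c k \<noteq> 0"
    have "c k * u k = - (\<Sum>j\<in>J. c j * u j)" using eq by (simp add: eq_neg_iff_add_eq_0)
    then have "u k = (- inverse (c k)) * (\<Sum>j\<in>J. c j * u j)" using ck by (simp add: field_simps)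
    moreover have "(\<Sum>j\<in>J. c j * u j) \<in> lspan E u J" using c unfolding lspan_def by auto
    moreover have "- inverse (c k) \<in> E" using subfldD(5,6)[OF assms(1)] c by auto
    ultimately have "u k \<in> lspan E u J"
      using lspan_scale[OF assms(1)] by metis
    then show False using assms by simp
  qed
  then show "\<forall>j\<in>insert k J. c j = 0" using eq c assms(2) unfolding linindep_def by auto
qed

lemma char_p_sum_power:
  fixes f :: "'j \<Rightarrow> 'a::field"
  assumes "Factorial_Ring.prime CHAR('a)"
  shows "(\<Sum>j\<in>J. f j) ^ (CHAR('a) ^ n) = (\<Sum>j\<in>J. f j ^ (CHAR('a) ^ n))"
  using freshmans_dream_sum'[OF assms refl] by simp

text \<open>Extend \<open>u\<close> to a maximal independent family \<open>w\<close> in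
  \<open>N\<close>. The p-th powers of \<open>w\<close> again span \<open>N\<close>, because
  \<open>N\<close> is generated by p-th powers of its own elements, and a spanning family with as
  many members as an independent one has no relations. This is the separability criterion behind
  \<open>aut_moving\<close>.\<close>

lemma linindep_frobenius:
  fixes u :: "nat \<Rightarrow> 'a::field"
  assumes p: "Factorial_Ring.prime CHAR('a)" and E: "subfld E"
    and N: "finite J" "N \<subseteq> lspan E b J"
    and gen: "\<And>x. x \<in> N \<Longrightarrow> \<exists>I. I \<subseteq> N \<and> x \<in> lspan E (\<lambda>y. y ^ CHAR('a)) I"
    and u: "\<And>i. i < m \<Longrightarrow> u i \<in> N" "linindep E u {..<m}"
  shows "linindep E (\<lambda>i. u i ^ CHAR('a)) {..<m}"
proof -
  let ?p = "CHAR('a)"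
  \<comment> \<open>The possible lengths of independent extensions of \<open>u\<close> inside
    \<open>N\<close>. They are bounded by \<open>card J\<close>, so a longest one exists.\<close>
  define P where "P = (\<lambda>M. \<exists>w. (\<forall>i<m. w i = u i) \<and> (\<forall>i<M. w i \<in> N) \<and> linindep E w {..<M} \<and> m \<le> M)"
  have "linindep E u {..<m}" using u by auto
  then have Pm: "P m" unfolding P_def using u by auto
  have bound: "M \<le> card J" if PM: "P M" for M
  proof (rule ccontr)
    assume "\<not> M \<le> card J"
    then have "card J < card {..<M}" by simp
    moreover obtain w where "\<forall>i<M. w i \<in> N" "linindep E w {..<M}" using PM unfolding P_def by auto
    ultimately show False using lspan_dependent[OF E N(1), of "{..<M}" w b] N(2) by auto
  qed
  define M where "M = (GREATEST M. P M)"
  have PM: "P M" unfolding M_def by (rule GreatestI_nat[of P m "card J"]) (use Pm bound in auto)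
  have maxM: "\<not> P (Suc M)" 
  proof
    assume "P (Suc M)"
    then have "Suc M \<le> M" unfolding M_def by (rule Greatest_le_nat[where b = "card J"]) (use bound in auto)
    then show False by simp
  qed
  obtain w where w: "\<forall>i<m. w i = u i" "\<forall>i<M. w i \<in> N" "linindep E w {..<M}" "m \<le> M"
    using PM unfolding P_def by auto
  have span: "N \<subseteq> lspan E w {..<M}"
  proof (rule subsetI, rule ccontr)
    fix x assume x: "x \<in> N" "x \<notin> lspan E w {..<M}"
    have same: "lspan E (w(M := x)) {..<M} = lspan E w {..<M}"
      unfolding lspan_def by (intro Collect_cong ex_cong1 conj_cong refl) (auto intro!: sum.cong)
    have "linindep E (w(M := x)) {..<M}"
    proof -
      have "(\<Sum>j<M. c j * (w(M := x)) j) = (\<Sum>j<M. c j * w j)" for c by (intro sum.cong) auto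
      then show ?thesis using w(3) unfolding linindep_def by presburger
    qed
    then have "linindep E (w(M := x)) (insert M {..<M})"
      using same x by (intro linindep_extend[OF E]) auto
    then have "P (Suc M)" unfolding P_def using w x
      by (intro exI[of _ "w(M := x)"]) (auto simp: lessThan_Suc less_Suc_eq)
    then show False using maxM by simp
  qed
  have spanp: "N \<subseteq> lspan E (\<lambda>i. w i ^ ?p) {..<M}"
  proof
    fix x assume "x \<in> N"
    then obtain I where I: "I \<subseteq> N" "x \<in> lspan E (\<lambda>y. y ^ ?p) I" using gen by blast
    have "y ^ ?p \<in> lspan E (\<lambda>i. w i ^ ?p) {..<M}" if y: "y \<in> I" for y
    proof -
      obtain d where d: "y = (\<Sum>j<M. d j * w j)" "\<forall>j<M. d j \<in> E"
        using subsetD[OF span, of y] y I(1) unfolding lspan_def by auto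
      have "y ^ ?p = (\<Sum>j<M. d j ^ ?p * w j ^ ?p)"
        unfolding d(1) using char_p_sum_power[OF p, where n = 1 and f = "\<lambda>j. d j * w j" and J = "{..<M}"]
        by (simp add: power_mult_distrib)
      then show ?thesis unfolding lspan_def using d(2) subfldD(9)[OF E] by auto
    qed
    then show "x \<in> lspan E (\<lambda>i. w i ^ ?p) {..<M}"
      using lspan_subset[OF E, of I "\<lambda>y. y ^ ?p"] I(2) by blast
  qed
  have "linindep E (\<lambda>i. w i ^ ?p) {..<M}"
  proof (rule ccontr)
    assume "\<not> linindep E (\<lambda>i. w i ^ ?p) {..<M}"
    then obtain c k where c: "\<forall>j<M. c j \<in> E" "(\<Sum>j<M. c j * w j ^ ?p) = 0" "k < M" "c k \<noteq> 0"
      unfolding linindep_def by auto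
    let ?J = "{..<M} - {k}"
    have "c k * w k ^ ?p + (\<Sum>j\<in>?J. c j * w j ^ ?p) = 0"
      using c(2,3) sum.remove[of "{..<M}" k "\<lambda>j. c j * w j ^ ?p"] by simp
    then have "c k * w k ^ ?p = - (\<Sum>j\<in>?J. c j * w j ^ ?p)" by (simp add: eq_neg_iff_add_eq_0)
    then have wk: "w k ^ ?p = (- inverse (c k)) * (\<Sum>j\<in>?J. c j * w j ^ ?p)"
      using c(4) by (simp add: field_simps)
    have "(\<Sum>j\<in>?J. c j * w j ^ ?p) \<in> lspan E (\<lambda>i. w i ^ ?p) ?J"
      using c(1) unfolding lspan_def by auto
    then have "w k ^ ?p \<in> lspan E (\<lambda>i. w i ^ ?p) ?J"
      unfolding wk by (rule lspan_scale[OF E]) (use subfldD(5,6)[OF E] c(1,3) in auto)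
    then have "lspan E (\<lambda>i. w i ^ ?p) {..<M} \<subseteq> lspan E (\<lambda>i. w i ^ ?p) ?J"
      by (intro lspan_subset[OF E]) (use lspan_base[OF E, of ?J _ "\<lambda>i. w i ^ ?p"] in blast)
    then have "\<And>i. i \<in> {..<M} \<Longrightarrow> w i \<in> lspan E (\<lambda>i. w i ^ ?p) ?J" using w(2) spanp by auto
    moreover have "card ?J < card {..<M}" using c(3) by simp
    ultimately show False using lspan_dependent[OF E, of ?J "{..<M}" w] w(3) by auto
  qed
  then show ?thesis unfolding linindep_def
  proof (intro allI impI ballI)
    fix c j
    assume ind: "\<forall>c. (\<forall>j\<in>{..<M}. c j \<in> E) \<and> (\<Sum>j<M. c j * w j ^ ?p) = 0 \<longrightarrow> (\<forall>j\<in>{..<M}. c j = 0)"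
      and c: "(\<forall>j\<in>{..<m}. c j \<in> E) \<and> (\<Sum>j<m. c j * u j ^ ?p) = 0" and j: "j \<in> {..<m}"
    define c' where "c' = (\<lambda>i. if i < m then c i else 0)"
    have "(\<Sum>i<M. c' i * w i ^ ?p) = (\<Sum>i<m. c i * u i ^ ?p)"
      using w(1,4) by (intro sum.mono_neutral_cong_right) (auto simp: c'_def)
    moreover have "\<forall>i\<in>{..<M}. c' i \<in> E" using c subfldD(1)[OF E] by (auto simp: c'_def)
    ultimately have "\<forall>j\<in>{..<M}. c' j = 0" using ind c by auto
    then have "c' j = 0" using j w(4) by simp
    then show "c j = 0" using j by (simp add: c'_def)
  qed
qed

section \<open>Elementary abelian groups\<close>

text \<open>Multiples in a bare \<open>ab_group_add\<close>, so that the same lemmas apply to field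
  elements and to groups of tuples.\<close>

primrec nmul :: "nat \<Rightarrow> 'b::ab_group_add \<Rightarrow> 'b" where
  "nmul 0 h = 0"
| "nmul (Suc k) h = h + nmul k h"

lemma nmul_add: "nmul (k + l) h = nmul k h + nmul l h"
  by (induction k) (auto simp: algebra_simps)

lemma nmul_mult: "nmul (k * l) h = nmul k (nmul l h)"
  by (induction k) (auto simp: nmul_add)

lemma nmul_closed:
  assumes "0 \<in> G" "\<And>g g'. g \<in> G \<Longrightarrow> g' \<in> G \<Longrightarrow> g + g' \<in> G" "h \<in> G" shows "nmul k h \<in> G"
  by (induction k) (use assms in auto)

lemma nmul_zero [simp]: "nmul k 0 = 0"
  by (induction k) auto

text \<open>Dimension over the prime field, phrased by counting. Among the subgroups of order
  \<open>p ^ card S\<close> with generating set \<open>S\<close>, a maximal one is all of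
  \<open>H\<close>, since adjoining an outside element multiplies the order by \<open>p\<close>.
  Closure under sums suffices for generation because \<open>- h\<close> is a multiple of
  \<open>h\<close>.\<close>

lemma elementary_abelian_generators:
  fixes H :: "'b::ab_group_add set"
  assumes p: "Factorial_Ring.prime (p::nat)" and fin: "finite H" and H0: "0 \<in> H"
    and Hadd: "\<And>g h. g \<in> H \<Longrightarrow> h \<in> H \<Longrightarrow> g + h \<in> H"
    and Hp: "\<And>h. h \<in> H \<Longrightarrow> nmul p h = 0"
  shows "\<exists>S\<subseteq>H. card H = p ^ card S \<and>
    (\<forall>G. 0 \<in> G \<and> (\<forall>g\<in>G. \<forall>h\<in>G. g + h \<in> G) \<and> S \<subseteq> G \<longrightarrow> H \<subseteq> G)"
proof -
  define P where "P = (\<lambda>H'. H' \<subseteq> H \<and> 0 \<in> H' \<and> (\<forall>g\<in>H'. \<forall>h\<in>H'. g + h \<in> H') \<and>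
    (\<exists>S\<subseteq>H'. card H' = p ^ card S \<and>
    (\<forall>G. 0 \<in> G \<and> (\<forall>g\<in>G. \<forall>h\<in>G. g + h \<in> G) \<and> S \<subseteq> G \<longrightarrow> H' \<subseteq> G)))"
  have "P {0}" unfolding P_def using H0 by (auto intro!: exI[of _ "{}"])
  moreover have "finite {H'. P H'}"
    by (rule finite_subset[of _ "Pow H"]) (auto simp: P_def fin)
  ultimately obtain H' where H': "P H'" and max: "\<And>H''. P H'' \<Longrightarrow> \<not> H' \<subset> H''"
    using finite_has_maximal[of "{H'. P H'}"] by (metis empty_iff mem_Collect_eq psubsetE)
  have "\<exists>S\<subseteq>H'. card H' = p ^ card S \<and>
    (\<forall>G. 0 \<in> G \<and> (\<forall>g\<in>G. \<forall>h\<in>G. g + h \<in> G) \<and> S \<subseteq> G \<longrightarrow> H' \<subseteq> G)"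
    using H' unfolding P_def by (elim conjE)
  then obtain S where S: "S \<subseteq> H'" "card H' = p ^ card S"
      "\<And>G. 0 \<in> G \<Longrightarrow> (\<forall>g\<in>G. \<forall>h\<in>G. g + h \<in> G) \<Longrightarrow> S \<subseteq> G \<Longrightarrow> H' \<subseteq> G"
    by (elim exE conjE) simp
  have sub: "H' \<subseteq> H" "0 \<in> H'" "\<And>g h. g \<in> H' \<Longrightarrow> h \<in> H' \<Longrightarrow> g + h \<in> H'"
    using H' unfolding P_def by auto
  have finS: "finite S" "finite H'"
    using finite_subset[OF sub(1) fin] finite_subset[OF S(1)] by simp_all
  have p1: "p > 1" using prime_gt_1_nat[OF p] .
  have neg: "- h = nmul (p - 1) h" if "h \<in> H" for h
    using Hp[OF that] nmul_add[of 1 "p - 1" h] p1 by (simp add: eq_neg_iff_add_eq_0 add.commute neg_eq_iff_add_eq_0)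
  have subd: "g - h \<in> H'" if "g \<in> H'" "h \<in> H'" for g h
    using that neg[of h] sub nmul_closed[of H' h "p - 1"] by (metis diff_conv_add_uminus subsetD)
  have "H' = H"
  proof (rule ccontr)
    assume "H' \<noteq> H"
    then obtain h where h: "h \<in> H" "h \<notin> H'" using sub by auto
    define f where "f = (\<lambda>(k, g). nmul k h + g)"
    define H'' where "H'' = f ` ({..<p} \<times> H')"
    have inj1: False if "k < l" "l < p" "nmul k h + g = nmul l h + g'" "g \<in> H'" "g' \<in> H'" for k l g g'
    proof -
      have "nmul l h = nmul k h + nmul (l - k) h" using nmul_add[of k "l - k" h] that by simp
      then have "nmul (l - k) h = g - g'" using that(3) by (simp add: algebra_simps)
      then have *: "nmul (l - k) h \<in> H'" using subd that by simp
      \<comment> \<open>\<open>l - k\<close> is invertible modulo \<open>p\<close>, so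
        \<open>h\<close> would be a multiple of \<open>nmul (l - k) h\<close> and lie in
        \<open>H'\<close>.\<close>
      have "\<not> p dvd (l - k)" using that by (auto dest: dvd_imp_le)
      then have "coprime (l - k) p" using p by (simp add: prime_imp_coprime coprime_commute)
      moreover have "l - k \<noteq> 0" using that(1) by simp
      ultimately obtain x y where xy: "(l - k) * x = p * y + 1"
        using bezout_nat[of "l - k" p] by (auto simp: coprime_iff_gcd_eq_1)
      have "nmul ((l - k) * x) h = nmul x (nmul (l - k) h)" using nmul_mult[of x "l - k" h] by (simp add: mult.commute)
      also have "\<dots> \<in> H'" 
        by (rule nmul_closed; (rule sub(3) sub(2) *; assumption?))
      finally have "nmul (p * y + 1) h \<in> H'" using xy by simp
      moreover have "nmul (p * y + 1) h = h"
        using nmul_mult[of y p h] Hp[OF h(1)] by (simp add: nmul_add mult.commute)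
      ultimately show False using h by simp
    qed
    have "inj_on f ({..<p} \<times> H')"
    proof (rule inj_onI, clarsimp simp: f_def)
      fix k g l g' assume *: "nmul k h + g = nmul l h + g'" "k < p" "l < p" "g \<in> H'" "g' \<in> H'"
      then have "k = l" using inj1[of k l g g'] inj1[of l k g' g] by (metis linorder_neqE_nat)
      then show "k = l \<and> g = g'" using * by simp
    qed
    moreover have hS: "h \<notin> S" using h S(1) by auto
    ultimately have card: "card H'' = p ^ card (insert h S)"
      unfolding H''_def using S(2) hS finS by (simp add: card_image card_cartesian_product)
    have subH: "H'' \<subseteq> H" 
    proof
      fix y assume "y \<in> H''"
      then obtain k g where y: "y = nmul k h + g" "g \<in> H'" unfolding H''_def f_def by auto
      have "nmul k h \<in> H" by (rule nmul_closed; (rule H0 Hadd h; assumption?))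
      then show "y \<in> H" unfolding y(1) using y(2) sub(1) by (intro Hadd) auto
    qed
    have zero: "g \<in> H''" if "g \<in> H'" for g
      unfolding H''_def f_def using that p1 by (intro image_eqI[of _ _ "(0, g)"]) auto
    have hin: "h \<in> H''" unfolding H''_def f_def using sub p1 by (intro image_eqI[of _ _ "(1, 0)"]) auto
    have add: "x + y \<in> H''" if xy: "x \<in> H''" "y \<in> H''" for x y
    proof -
      obtain k g l g' where kg: "x = nmul k h + g" "y = nmul l h + g'" "k < p" "l < p" "g \<in> H'" "g' \<in> H'"
        using xy unfolding H''_def f_def by auto
      have "nmul (k + l) h = nmul ((k + l) mod p) h"
      proof -
        have "nmul (k + l) h = nmul (((k + l) div p) * p + (k + l) mod p) h" by simp
        also have "\<dots> = nmul ((k + l) mod p) h" unfolding nmul_add nmul_mult using Hp[OF h(1)] by simp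
        finally show ?thesis .
      qed
      then have "x + y = f ((k + l) mod p, g + g')" unfolding f_def using kg
        by (simp add: nmul_add[symmetric] algebra_simps)
      moreover have "((k + l) mod p, g + g') \<in> {..<p} \<times> H'" using kg p1 sub(3) by simp
      ultimately show ?thesis unfolding H''_def by blast
    qed
    have gen: "H'' \<subseteq> G" if G: "0 \<in> G" "\<forall>g\<in>G. \<forall>h\<in>G. g + h \<in> G" "insert h S \<subseteq> G" for G
    proof
      fix y assume "y \<in> H''"
      then obtain k g where y: "y = nmul k h + g" "g \<in> H'" unfolding H''_def f_def by auto
      have "nmul k h \<in> G" by (rule nmul_closed) (use G in auto)
      moreover have "g \<in> G" using S(3)[OF G(1,2)] G(3) y(2) by auto
      ultimately show "y \<in> G" unfolding y(1) using G(2) by simp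
    qed
    have "insert h S \<subseteq> H''" using hin S(1) zero by auto
    then have "\<exists>S\<subseteq>H''. card H'' = p ^ card S \<and>
      (\<forall>G. 0 \<in> G \<and> (\<forall>g\<in>G. \<forall>h\<in>G. g + h \<in> G) \<and> S \<subseteq> G \<longrightarrow> H'' \<subseteq> G)"
      using card gen by (intro exI[of _ "insert h S"]) simp
    then have "P H''" unfolding P_def using subH zero[OF sub(2)] add by simp
    moreover have "H' \<subset> H''" using zero hin h by auto
    ultimately show False using max by blast
  qed
  then show ?thesis using S by (intro exI[of _ S]) simp
qed

text \<open>With fewer than \<open>card J\<close> generators of \<open>H\<close>, the equations at
  the generators would have a non-zero solution \<open>c\<close> in \<open>E\<close>. Additivity
  spreads the vanishing from the generators to all of \<open>H\<close>, against
  \<open>ind\<close>.\<close>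

lemma card_ge_independent_additive:
  fixes H :: "'b::ab_group_add set" and \<phi> :: "'j \<Rightarrow> 'b \<Rightarrow> 'a::field"
  assumes p: "Factorial_Ring.prime (p::nat)" and H: "finite H" "0 \<in> H"
      "\<And>g h. g \<in> H \<Longrightarrow> h \<in> H \<Longrightarrow> g + h \<in> H" "\<And>h. h \<in> H \<Longrightarrow> nmul p h = 0"
    and E: "subfld E" and J: "finite J"
    and \<phi>: "\<And>j h. j \<in> J \<Longrightarrow> h \<in> H \<Longrightarrow> \<phi> j h \<in> E"
      "\<And>j g h. j \<in> J \<Longrightarrow> g \<in> H \<Longrightarrow> h \<in> H \<Longrightarrow> \<phi> j (g + h) = \<phi> j g + \<phi> j h"
    and ind: "\<And>c. (\<And>j. j \<in> J \<Longrightarrow> c j \<in> E) \<Longrightarrow> (\<And>h. h \<in> H \<Longrightarrow> (\<Sum>j\<in>J. \<phi> j h * c j) = 0) \<Longrightarrow>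
       \<forall>j\<in>J. c j = 0"
  shows "p ^ card J \<le> card H"
proof (rule ccontr)
  assume less: "\<not> p ^ card J \<le> card H"
  have "\<exists>S\<subseteq>H. card H = p ^ card S \<and>
    (\<forall>G. 0 \<in> G \<and> (\<forall>g\<in>G. \<forall>h\<in>G. g + h \<in> G) \<and> S \<subseteq> G \<longrightarrow> H \<subseteq> G)"
    by (rule elementary_abelian_generators[OF p H(1,2)]) (fact H)+
  then obtain S where S: "S \<subseteq> H" "card H = p ^ card S"
    "\<And>G. 0 \<in> G \<Longrightarrow> (\<forall>g\<in>G. \<forall>h\<in>G. g + h \<in> G) \<Longrightarrow> S \<subseteq> G \<Longrightarrow> H \<subseteq> G"
    by (elim exE conjE) simp
  have finS: "finite S" using finite_subset[OF S(1) H(1)] .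
  have "card S < card J" using less S(2) prime_gt_1_nat[OF p] by simp
  moreover have "\<forall>h\<in>S. \<forall>j\<in>J. \<phi> j h \<in> E" using \<phi>(1) S(1) by auto
  ultimately have "\<exists>c. (\<forall>j\<in>J. c j \<in> E) \<and> (\<exists>j\<in>J. c j \<noteq> 0) \<and> (\<forall>h\<in>S. (\<Sum>j\<in>J. \<phi> j h * c j) = 0)"
    by (rule homogeneous_system[OF finS E J])
  then obtain c where c: "\<forall>j\<in>J. c j \<in> E" "\<exists>j\<in>J. c j \<noteq> 0" "\<forall>h\<in>S. (\<Sum>j\<in>J. \<phi> j h * c j) = 0"
    by (elim exE conjE)
  define G where "G = {h \<in> H. (\<Sum>j\<in>J. \<phi> j h * c j) = 0}"
  have \<phi>0: "\<phi> j 0 = 0" if "j \<in> J" for j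
  proof -
    have "\<phi> j 0 = \<phi> j 0 + \<phi> j 0" using \<phi>(2)[OF that H(2) H(2)] by (simp only: add_0)
    then show ?thesis by (metis add_cancel_right_right)
  qed
  have "H \<subseteq> G"
    by (rule S(3)) (use S(1) c(3) H \<phi> \<phi>0 in \<open>auto simp: G_def distrib_right sum.distrib\<close>)
  then have "\<forall>j\<in>J. c j = 0" using ind[of c] c(1) unfolding G_def by blast
  then show False using c(2) by auto
qed

section \<open>Extension of field embeddings\<close>

definition algebraic_over :: "'a::field set \<Rightarrow> 'a \<Rightarrow> bool" where
  "algebraic_over E x \<longleftrightarrow> (\<exists>P. P \<noteq> 0 \<and> (\<forall>i. Polynomial.coeff P i \<in> E) \<and> poly P x = 0)"

lemma algebraic_over_mono: "algebraic_over E x \<Longrightarrow> E \<subseteq> D \<Longrightarrow> algebraic_over D x"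
  unfolding algebraic_over_def by blast

text \<open>\<open>gring G\<close> says that \<open>G\<close> is the graph of a ring homomorphism defined on a subring.\<close>

definition gring :: "('a::field \<times> 'a) set \<Rightarrow> bool" where
  "gring G \<longleftrightarrow> (0, 0) \<in> G \<and> (1, 1) \<in> G \<and> (\<forall>y. (0, y) \<in> G \<longrightarrow> y = 0) \<and>
     (\<forall>a b c d. (a, b) \<in> G \<longrightarrow> (c, d) \<in> G \<longrightarrow> (a + c, b + d) \<in> G \<and> (a * c, b * d) \<in> G) \<and>
     (\<forall>a b. (a, b) \<in> G \<longrightarrow> (- a, - b) \<in> G)"

lemma gringD:
  assumes "gring G"
  shows "(0, 0) \<in> G" "(1, 1) \<in> G" "\<And>y. (0, y) \<in> G \<Longrightarrow> y = 0"
    "\<And>a b c d. (a, b) \<in> G \<Longrightarrow> (c, d) \<in> G \<Longrightarrow> (a + c, b + d) \<in> G"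
    "\<And>a b c d. (a, b) \<in> G \<Longrightarrow> (c, d) \<in> G \<Longrightarrow> (a * c, b * d) \<in> G"
    "\<And>a b. (a, b) \<in> G \<Longrightarrow> (- a, - b) \<in> G"
    "\<And>a b c d. (a, b) \<in> G \<Longrightarrow> (c, d) \<in> G \<Longrightarrow> (a - c, b - d) \<in> G"
    "\<And>a b c. (a, b) \<in> G \<Longrightarrow> (a, c) \<in> G \<Longrightarrow> b = c"
proof -
  show *: "(0, 0) \<in> G" "(1, 1) \<in> G" "\<And>y. (0, y) \<in> G \<Longrightarrow> y = 0"
    "\<And>a b c d. (a, b) \<in> G \<Longrightarrow> (c, d) \<in> G \<Longrightarrow> (a + c, b + d) \<in> G"
    "\<And>a b c d. (a, b) \<in> G \<Longrightarrow> (c, d) \<in> G \<Longrightarrow> (a * c, b * d) \<in> G"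
    "\<And>a b. (a, b) \<in> G \<Longrightarrow> (- a, - b) \<in> G"
    using assms unfolding gring_def by auto
  show diff: "(a - c, b - d) \<in> G" if "(a, b) \<in> G" "(c, d) \<in> G" for a b c d
    using *(4)[OF that(1) *(6)[OF that(2)]] by simp
  show "b = c" if "(a, b) \<in> G" "(a, c) \<in> G" for a b c
    using *(3)[of "b - c"] diff[OF that] by simp
qed

lemma gring_sum:
  "gring G \<Longrightarrow> (\<And>i. i \<in> I \<Longrightarrow> (f i, g i) \<in> G) \<Longrightarrow> ((\<Sum>i\<in>I. f i), (\<Sum>i\<in>I. g i)) \<in> G"
  by (induction I rule: infinite_finite_induct) (auto intro: gringD)

lemma gring_power: "gring G \<Longrightarrow> (a, b) \<in> G \<Longrightarrow> (a ^ n, b ^ n) \<in> G"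
  by (induction n) (auto intro: gringD)

text \<open>Dividing an algebraic relation by the lowest power of \<open>x\<close> that occurs
  leaves a non-zero constant term, so the inverse is a polynomial in \<open>x\<close>. Subrings and
  graphs of ring homomorphisms thereby inherit inverses from ring operations alone.\<close>

lemma algebraic_inverse:
  assumes "algebraic_over E x" "subfld E" "x \<noteq> 0"
  shows "\<exists>n c. (\<forall>i. c i \<in> E) \<and> x * (\<Sum>i<(n::nat). c i * x ^ i) = 1"
proof -
  obtain P where P: "P \<noteq> 0" "\<forall>i. Polynomial.coeff P i \<in> E" "poly P x = 0"
    using assms(1) unfolding algebraic_over_def by auto
  define k where "k = (LEAST k. Polynomial.coeff P k \<noteq> 0)"
  have ck: "Polynomial.coeff P k \<noteq> 0" unfolding k_def
    by (rule LeastI_ex) (use P(1) leading_coeff_0_iff in blast)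
  have below: "Polynomial.coeff P i = 0" if "i < k" for i
    using not_less_Least[of i] that unfolding k_def by auto
  let ?n = "Polynomial.degree P - k"
  have kd: "k \<le> Polynomial.degree P" using ck by (simp add: le_degree)
  have "0 = (\<Sum>i\<le>Polynomial.degree P. Polynomial.coeff P i * x ^ i)" using P(3) by (simp add: poly_altdef)
  also have "\<dots> = (\<Sum>i\<in>{k..Polynomial.degree P}. Polynomial.coeff P i * x ^ i)"
    by (intro sum.mono_neutral_right) (use below in \<open>auto simp: not_le\<close>)
  also have "\<dots> = (\<Sum>i\<le>?n. Polynomial.coeff P (i + k) * x ^ (i + k))"
    using kd by (intro sum.reindex_bij_witness[of _ "\<lambda>i. i + k" "\<lambda>i. i - k"]) auto
  also have "\<dots> = x ^ k * (\<Sum>i\<le>?n. Polynomial.coeff P (i + k) * x ^ i)"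
    by (simp add: sum_distrib_left power_add mult_ac)
  finally have "(\<Sum>i\<le>?n. Polynomial.coeff P (i + k) * x ^ i) = 0" using assms(3) by simp
  then have "Polynomial.coeff P k + (\<Sum>i<?n. Polynomial.coeff P (Suc i + k) * x ^ Suc i) = 0"
    using sum.lessThan_Suc_shift[of "\<lambda>i. Polynomial.coeff P (i + k) * x ^ i" ?n]
    by (simp only: lessThan_Suc_atMost[symmetric]) simp
  then have e: "x * (\<Sum>i<?n. Polynomial.coeff P (Suc i + k) * x ^ i) = - Polynomial.coeff P k"
    by (simp add: sum_distrib_left mult_ac eq_neg_iff_add_eq_0 add.commute)
  let ?c = "\<lambda>i. - inverse (Polynomial.coeff P k) * Polynomial.coeff P (Suc i + k)"
  have "x * (\<Sum>i<?n. ?c i * x ^ i) = - inverse (Polynomial.coeff P k) * (x * (\<Sum>i<?n. Polynomial.coeff P (Suc i + k) * x ^ i))"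
    by (simp only: sum_distrib_left mult_ac)
  also have "\<dots> = 1" unfolding e using ck by simp
  finally show ?thesis
    using P(2) by (intro exI[of _ ?n] exI[of _ ?c]) (auto intro!: subfldD[OF assms(2)])
qed

lemma subring_inverse:
  assumes "algebraic_over E x" "subfld E" "E \<subseteq> B" "x \<in> B" "x \<noteq> 0"
    "\<And>a b. a \<in> B \<Longrightarrow> b \<in> B \<Longrightarrow> a + b \<in> B \<and> a * b \<in> B"
  shows "inverse x \<in> B"
proof -
  obtain n c where c: "\<forall>i. c i \<in> E" "x * (\<Sum>i<(n::nat). c i * x ^ i) = 1"
    using algebraic_inverse[OF assms(1,2,5)] by auto
  have 01: "0 \<in> B" "1 \<in> B" using subfldD(1,2)[OF assms(2)] assms(3) by auto
  have "x ^ i \<in> B" for i by (induction i) (use 01 assms in auto)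
  moreover have "c i \<in> B" for i using c(1) assms(3) by auto
  ultimately have "(\<Sum>i<n. c i * x ^ i) \<in> B" using assms(6) 01(1) by (induction n) simp_all
  moreover have "inverse x = (\<Sum>i<n. c i * x ^ i)" using c(2) by (simp add: inverse_unique)
  ultimately show ?thesis by simp
qed

lemma gring_inverse:
  assumes G: "gring G" and E: "subfld E" "\<And>e. e \<in> E \<Longrightarrow> (e, e) \<in> G"
    and a: "algebraic_over E a" "(a, b) \<in> G" "a \<noteq> 0"
  shows "b \<noteq> 0" "(inverse a, inverse b) \<in> G"
proof -
  obtain n c where c: "\<forall>i. c i \<in> E" "a * (\<Sum>i<(n::nat). c i * a ^ i) = 1"
    using algebraic_inverse[OF a(1) E(1) a(3)] by auto
  have q: "((\<Sum>i<n. c i * a ^ i), (\<Sum>i<n. c i * b ^ i)) \<in> G"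
    by (intro gring_sum[OF G] gringD(5)[OF G] gring_power[OF G] a E) (use c in auto)
  have "(a * (\<Sum>i<n. c i * a ^ i), b * (\<Sum>i<n. c i * b ^ i)) \<in> G" by (intro gringD(5)[OF G] a q)
  then have "b * (\<Sum>i<n. c i * b ^ i) = 1" using gringD(2,8)[OF G] c(2) by metis
  then show "b \<noteq> 0" "(inverse a, inverse b) \<in> G" using q c(2) by (auto simp: inverse_unique)
qed

text \<open>The candidate extension, sending \<open>x\<close> to \<open>y\<close>, of the
  homomorphism with graph \<open>G\<close>: \<open>Q\<close> is the image of \<open>P\<close>
  coefficient by coefficient. As a set of pairs it can be formed before it is known to be
  single-valued.\<close>

definition adjoin :: "('a::field \<times> 'a) set \<Rightarrow> 'a \<Rightarrow> 'a \<Rightarrow> ('a \<times> 'a) set" where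
  "adjoin G x y = {(poly P x, poly Q y) | P Q. \<forall>i. (Polynomial.coeff P i, Polynomial.coeff Q i) \<in> G}"

text \<open>Only single-valuedness is at stake, and this is \<open>key\<close>. Subtracting
  multiples of the monic minimal polynomial from \<open>P\<close>, and the corresponding multiples
  of \<open>\<nu>\<close> from \<open>Q\<close>, lowers the degree of \<open>P\<close>; below degree
  \<open>m\<close> minimality forces \<open>P = 0\<close>.\<close>

lemma adjoin_gring:
  assumes G: "gring G" and \<mu>: "\<forall>i. (Polynomial.coeff \<mu> i, Polynomial.coeff \<nu> i) \<in> G"
      "Polynomial.coeff \<mu> m = 1" "\<forall>i>m. Polynomial.coeff \<mu> i = 0" "poly \<mu> x = 0" "poly \<nu> y = 0"
    and min: "\<And>R. R \<noteq> 0 \<Longrightarrow> \<forall>i. Polynomial.coeff R i \<in> fst ` G \<Longrightarrow> poly R x = 0 \<Longrightarrow> m \<le> Polynomial.degree R"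
  shows "gring (adjoin G x y)" "G \<subseteq> adjoin G x y" "(x, y) \<in> adjoin G x y"
proof -
  have \<nu>: "Polynomial.coeff \<nu> m = 1" "\<forall>i>m. Polynomial.coeff \<nu> i = 0"
    using gringD(1,2,8)[OF G] \<mu>(1-3) by metis+
  have key: "poly Q y = 0"
    if "\<forall>i. (Polynomial.coeff P i, Polynomial.coeff Q i) \<in> G" "\<forall>i\<ge>n. Polynomial.coeff P i = 0" "poly P x = 0" for P Q n
    using that
  proof (induction n arbitrary: P Q)
    case 0
    then have "P = 0" by (intro poly_eqI) auto
    then have "Q = 0" using 0(1) gringD(3)[OF G] by (intro poly_eqI) auto
    then show ?case by simp
  next
    case (Suc n)
    show ?case
    proof (cases "n < m")
      case True
      have "P = 0"
      proof (rule ccontr)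
        assume "P \<noteq> 0"
        moreover have "\<forall>i. Polynomial.coeff P i \<in> fst ` G" using Suc.prems(1) by force
        ultimately have "m \<le> Polynomial.degree P" using min Suc.prems(3) by blast
        then have "Polynomial.coeff P (Polynomial.degree P) = 0" using Suc.prems(2) True by auto
        then show False using \<open>P \<noteq> 0\<close> by simp
      qed
      then have "Q = 0" using Suc.prems(1) gringD(3)[OF G] by (intro poly_eqI) auto
      then show ?thesis by simp
    next
      case False
      let ?a = "Polynomial.coeff P n" and ?b = "Polynomial.coeff Q n"
      define P' where "P' = P - Polynomial.monom ?a (n - m) * \<mu>"
      define Q' where "Q' = Q - Polynomial.monom ?b (n - m) * \<nu>"
      have cP: "Polynomial.coeff P' i = Polynomial.coeff P i - (if n - m \<le> i then ?a * Polynomial.coeff \<mu> (i - (n - m)) else 0)" for i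
        unfolding P'_def by (simp add: coeff_monom_mult)
      have cQ: "Polynomial.coeff Q' i = Polynomial.coeff Q i - (if n - m \<le> i then ?b * Polynomial.coeff \<nu> (i - (n - m)) else 0)" for i
        unfolding Q'_def by (simp add: coeff_monom_mult)
      have "\<forall>i. (Polynomial.coeff P' i, Polynomial.coeff Q' i) \<in> G"
        unfolding cP cQ using Suc.prems(1) \<mu>(1) by (auto intro: gringD[OF G])
      moreover have "\<forall>i\<ge>n. Polynomial.coeff P' i = 0"
      proof (intro allI impI)
        fix i assume "n \<le> i"
        then show "Polynomial.coeff P' i = 0"
          unfolding cP using Suc.prems(2) \<mu>(2,3) False by (cases "i = n") auto
      qed
      moreover have "poly P' x = 0" unfolding P'_def using Suc.prems(3) \<mu>(4) by simp
      ultimately have "poly Q' y = 0" by (rule Suc.IH)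
      then show ?thesis unfolding Q'_def using \<mu>(5) by simp
    qed
  qed
  show "gring (adjoin G x y)" unfolding gring_def
  proof (intro conjI allI impI)
    show "(0, 0) \<in> adjoin G x y" unfolding adjoin_def
      using gringD(1)[OF G] by (auto intro!: exI[of _ 0])
    show "(1, 1) \<in> adjoin G x y" unfolding adjoin_def
      using gringD(1,2)[OF G] by (auto intro!: exI[of _ 1] simp: coeff_1)
    fix y' assume "(0, y') \<in> adjoin G x y"
    then obtain P Q where PQ': "(0, y') = (poly P x, poly Q y)"
        "\<forall>i. (Polynomial.coeff P i, Polynomial.coeff Q i) \<in> G"
      unfolding adjoin_def by blast
    then have PQ: "poly P x = 0" "y' = poly Q y" by simp_all
    have PQ0: "\<forall>i\<ge>Suc (Polynomial.degree P). Polynomial.coeff P i = 0" by (simp add: coeff_eq_0)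
    show "y' = 0" unfolding PQ(2)
      by (rule key[OF PQ'(2) PQ0 PQ(1)])
  next
    fix a b c d assume "(a, b) \<in> adjoin G x y" "(c, d) \<in> adjoin G x y"
    then obtain P Q R S where *: "a = poly P x" "b = poly Q y" "c = poly R x" "d = poly S y"
        "\<forall>i. (Polynomial.coeff P i, Polynomial.coeff Q i) \<in> G" "\<forall>i. (Polynomial.coeff R i, Polynomial.coeff S i) \<in> G"
      unfolding adjoin_def by blast
    show "(a + c, b + d) \<in> adjoin G x y" unfolding adjoin_def
      using * by (intro CollectI exI[of _ "P + R"] exI[of _ "Q + S"]) (auto intro: gringD[OF G])
    show "(a * c, b * d) \<in> adjoin G x y" unfolding adjoin_def
      using * by (intro CollectI exI[of _ "P * R"] exI[of _ "Q * S"])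
        (auto simp: coeff_mult intro!: gring_sum[OF G] gringD(5)[OF G])
  next
    fix a b assume "(a, b) \<in> adjoin G x y"
    then obtain P Q where *: "a = poly P x" "b = poly Q y"
        "\<forall>i. (Polynomial.coeff P i, Polynomial.coeff Q i) \<in> G"
      unfolding adjoin_def by blast
    show "(- a, - b) \<in> adjoin G x y" unfolding adjoin_def
      using * by (intro CollectI exI[of _ "- P"] exI[of _ "- Q"]) (auto intro: gringD[OF G])
  qed
  show "G \<subseteq> adjoin G x y"
  proof (clarify)
    fix a b assume "(a, b) \<in> G"
    then show "(a, b) \<in> adjoin G x y" unfolding adjoin_def using gringD(1)[OF G]
      by (intro CollectI exI[of _ "[:a:]"] exI[of _ "[:b:]"]) (auto simp: coeff_pCons split: nat.splits)
  qed
  show "(x, y) \<in> adjoin G x y" unfolding adjoin_def using gringD(1,2)[OF G]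
    by (intro CollectI exI[of _ "[:0, 1:]"] exI[of _ "[:0, 1:]"]) (auto simp: coeff_pCons split: nat.splits)
qed

lemma minimal_poly:
  assumes D: "subfld D" and x: "algebraic_over D x"
  obtains \<mu> where "\<forall>i. Polynomial.coeff \<mu> i \<in> D" "Polynomial.coeff \<mu> (Polynomial.degree \<mu>) = 1" "poly \<mu> x = 0"
    "Polynomial.degree \<mu> > 0"
    "\<And>R. R \<noteq> 0 \<Longrightarrow> \<forall>i. Polynomial.coeff R i \<in> D \<Longrightarrow> poly R x = 0 \<Longrightarrow> Polynomial.degree \<mu> \<le> Polynomial.degree R"
proof -
  define Q where "Q = (\<lambda>n. \<exists>P. P \<noteq> 0 \<and> (\<forall>i. Polynomial.coeff P i \<in> D) \<and> poly P x = 0 \<and> Polynomial.degree P = n)"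
  have "\<exists>n. Q n" using x unfolding algebraic_over_def Q_def by auto
  then have "Q (LEAST n. Q n)" by (rule LeastI_ex)
  then obtain P where P: "P \<noteq> 0" "\<forall>i. Polynomial.coeff P i \<in> D" "poly P x = 0" "Polynomial.degree P = (LEAST n. Q n)"
    unfolding Q_def by auto
  let ?\<mu> = "Polynomial.smult (inverse (Polynomial.lead_coeff P)) P"
  have deg: "Polynomial.degree ?\<mu> = Polynomial.degree P" using P(1) by simp
  show thesis
  proof (rule that[of ?\<mu>])
    show "\<forall>i. Polynomial.coeff ?\<mu> i \<in> D" using P(2) subfldD[OF D] by auto
    show "Polynomial.coeff ?\<mu> (Polynomial.degree ?\<mu>) = 1" unfolding deg using P(1) by simp
    show "poly ?\<mu> x = 0" using P(3) by simp
    show "Polynomial.degree ?\<mu> > 0" unfolding deg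
      using P(1,3) by (metis degree_eq_zeroE gr0I mult_zero_right pCons_0_0 poly_0 poly_pCons add.right_neutral)
    fix R assume "R \<noteq> 0" "\<forall>i. Polynomial.coeff R i \<in> D" "poly R x = 0"
    then have "Q (Polynomial.degree R)" unfolding Q_def by auto
    then show "Polynomial.degree ?\<mu> \<le> Polynomial.degree R"
      using Least_le[of Q "Polynomial.degree R"] P(4) deg by simp
  qed
qed

lemma minimal_poly_linindep:
  assumes D: "subfld D" and m: "0 < m"
    and min: "\<And>R. R \<noteq> 0 \<Longrightarrow> \<forall>i. Polynomial.coeff R i \<in> D \<Longrightarrow> poly R z = 0 \<Longrightarrow> m \<le> Polynomial.degree R"
  shows "linindep D (\<lambda>i. z ^ i) {..<m}"
  unfolding linindep_def
proof (intro allI impI ballI)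
  fix c i assume c: "(\<forall>j\<in>{..<m}. c j \<in> D) \<and> (\<Sum>j<m. c j * z ^ j) = 0" and i: "i \<in> {..<m}"
  define R where "R = (\<Sum>j<m. Polynomial.monom (c j) j)"
  have cR: "Polynomial.coeff R i = (if i < m then c i else 0)" for i
    unfolding R_def by (simp add: coeff_sum if_distrib cong: if_cong)
  have "Polynomial.degree R \<le> m - 1" by (rule degree_le) (use cR in auto)
  then have "Polynomial.degree R < m" using m by simp
  moreover have "poly R z = 0" unfolding R_def using c by (simp add: poly_sum poly_monom)
  moreover have "\<forall>i. Polynomial.coeff R i \<in> D" using c subfldD(1)[OF D] by (auto simp: cR)
  ultimately have "R = 0" using min[of R] by fastforce
  then show "c i = 0" using cR[of i] i by simp
qed

lemma powers_in_span:
  assumes D: "subfld D" and \<mu>: "\<forall>i. Polynomial.coeff \<mu> i \<in> D" "Polynomial.coeff \<mu> (Polynomial.degree \<mu>) = 1"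
    "poly \<mu> x = 0"
  shows "x ^ m \<in> lspan D (\<lambda>i. x ^ i) {..<Polynomial.degree \<mu>}"
proof (induction m rule: less_induct)
  case (less m)
  let ?n = "Polynomial.degree \<mu>"
  show ?case
  proof (cases "m < ?n")
    case True
    then show ?thesis using lspan_base[OF D, of "{..<?n}" m "\<lambda>i. x ^ i"] by simp
  next
    case False
    have "0 = (\<Sum>i<?n. Polynomial.coeff \<mu> i * x ^ i) + x ^ ?n"
      using \<mu>(2,3) by (simp add: poly_altdef lessThan_Suc_atMost[symmetric])
    then have "x ^ ?n = (\<Sum>i<?n. (- Polynomial.coeff \<mu> i) * x ^ i)"
      by (simp add: sum_negf eq_neg_iff_add_eq_0 add.commute)
    then have "x ^ (m - ?n) * x ^ ?n = (\<Sum>i<?n. (- Polynomial.coeff \<mu> i) * x ^ (m - ?n + i))"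
      by (simp add: sum_distrib_left power_add mult_ac)
    then have e: "x ^ m = (\<Sum>i<?n. (- Polynomial.coeff \<mu> i) * x ^ (m - ?n + i))"
      using False by (simp add: power_add[symmetric])
    show ?thesis unfolding e
      by (intro lspan_sum[OF D] lspan_scale[OF D] less.IH) (use False \<mu>(1) subfldD(5)[OF D] in auto)
  qed
qed

text \<open>The ring generated by finitely many algebraic elements is finite-dimensional. The last
  clause, minimality of \<open>B\<close>, allows properties of its elements to be checked on the
  generators.\<close>

lemma finite_algebra:
  fixes A :: "'a::field set"
  assumes E: "subfld E" and "finite A" and alg: "\<And>x. x \<in> A \<Longrightarrow> algebraic_over E x"
  shows "\<exists>B J. finite J \<and> B \<subseteq> lspan E (\<lambda>x. x) J \<and> E \<subseteq> B \<and> A \<subseteq> B \<and>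
    (\<forall>x\<in>B. \<forall>y\<in>B. x + y \<in> B \<and> x * y \<in> B) \<and>
    (\<forall>C. E \<subseteq> C \<and> A \<subseteq> C \<and> (\<forall>x\<in>C. \<forall>y\<in>C. x + y \<in> C \<and> x * y \<in> C) \<longrightarrow> B \<subseteq> C)"
  using assms(2,3)
proof (induction A rule: finite_induct)
  case empty
  have "E \<subseteq> lspan E (\<lambda>x. x) {1}"
  proof
    fix e assume "e \<in> E"
    then show "e \<in> lspan E (\<lambda>x. x) {1}" unfolding lspan_def
      by (intro CollectI exI[of _ "\<lambda>_. e"]) simp
  qed
  then show ?case using subfldD(3,4)[OF E] by (intro exI[of _ E] exI[of _ "{1}"]) simp
next
  case (insert g A)
  then obtain B J where B: "finite J" "B \<subseteq> lspan E (\<lambda>x. x) J" "E \<subseteq> B" "A \<subseteq> B"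
    "\<And>x y. x \<in> B \<Longrightarrow> y \<in> B \<Longrightarrow> x + y \<in> B" "\<And>x y. x \<in> B \<Longrightarrow> y \<in> B \<Longrightarrow> x * y \<in> B"
    "\<And>C. E \<subseteq> C \<Longrightarrow> A \<subseteq> C \<Longrightarrow> (\<forall>x\<in>C. \<forall>y\<in>C. x + y \<in> C \<and> x * y \<in> C) \<Longrightarrow> B \<subseteq> C"
    by (metis insertCI)
  obtain \<mu> where \<mu>: "\<forall>i. Polynomial.coeff \<mu> i \<in> E" "Polynomial.coeff \<mu> (Polynomial.degree \<mu>) = 1" "poly \<mu> g = 0"
    using minimal_poly[OF E insert.prems[of g]] by (metis insertCI)
  let ?m = "Polynomial.degree \<mu>"
  have B0: "0 \<in> B" "1 \<in> B" using B(3) subfldD(1,2)[OF E] by auto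
  \<comment> \<open>Polynomials in \<open>g\<close> over \<open>B\<close> of degree less than that
    of the minimal polynomial; they are closed under products because every power of
    \<open>g\<close> reduces to such a polynomial.\<close>
  define B' where "B' = {\<Sum>i<?m. a i * g ^ i | a. \<forall>i<?m. a i \<in> B}"
  have add: "x + y \<in> B'" if x: "x \<in> B'" and y: "y \<in> B'" for x y
  proof -
    obtain a where a: "x = (\<Sum>i<?m. a i * g ^ i)" "\<forall>i<?m. a i \<in> B" using x unfolding B'_def by auto
    obtain c where c: "y = (\<Sum>i<?m. c i * g ^ i)" "\<forall>i<?m. c i \<in> B" using y unfolding B'_def by auto
    have "x + y = (\<Sum>i<?m. (a i + c i) * g ^ i)" unfolding a(1) c(1) by (simp only: distrib_right sum.distrib)
    moreover have "\<forall>i<?m. a i + c i \<in> B" using a(2) c(2) B(5) by simp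
    ultimately show ?thesis unfolding B'_def by (intro CollectI exI[of _ "\<lambda>i. a i + c i"]) simp
  qed
  have z: "0 \<in> B'" unfolding B'_def using B0 by (intro CollectI exI[of _ "\<lambda>_. 0"]) simp
  have sm: "(\<Sum>i\<in>I. f i) \<in> B'" if "\<And>i. i \<in> I \<Longrightarrow> f i \<in> B'" for I :: "nat set" and f
    using that
  proof (induction I rule: infinite_finite_induct)
    case (insert i I)
    have "(\<Sum>i\<in>I. f i) \<in> B'" by (rule insert.IH) (use insert.prems in simp)
    then show ?case using insert.hyps add[of "f i"] insert.prems[of i] by simp
  qed (use z in simp_all)
  have pw: "b * g ^ k \<in> B'" if b: "b \<in> B" for b k
  proof -
    obtain c where c: "g ^ k = (\<Sum>i<?m. c i * g ^ i)" "\<forall>i<?m. c i \<in> E"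
      using powers_in_span[OF E \<mu>, of k] unfolding lspan_def by auto
    have "b * g ^ k = (\<Sum>i<?m. (b * c i) * g ^ i)" unfolding c(1) by (simp only: sum_distrib_left mult.assoc)
    moreover have "\<forall>i<?m. b * c i \<in> B" using c(2) b B(3) B(6) by blast
    ultimately show ?thesis unfolding B'_def by (intro CollectI exI[of _ "\<lambda>i. b * c i"]) simp
  qed
  have mult: "x * y \<in> B'" if x: "x \<in> B'" and y: "y \<in> B'" for x y
  proof -
    obtain a where a: "x = (\<Sum>i<?m. a i * g ^ i)" "\<forall>i<?m. a i \<in> B" using x unfolding B'_def by auto
    obtain c where c: "y = (\<Sum>i<?m. c i * g ^ i)" "\<forall>i<?m. c i \<in> B" using y unfolding B'_def by auto
    have "x * y = (\<Sum>i<?m. \<Sum>j<?m. (a i * c j) * g ^ (i + j))"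
      unfolding a(1) c(1) sum_product by (intro sum.cong refl) (simp add: power_add)
    also have "\<dots> \<in> B'" using a(2) c(2) B(6) by (intro sm pw) simp
    finally show ?thesis .
  qed
  have BB': "B \<subseteq> B'" using pw[of _ 0] by auto
  have gB': "g \<in> B'" using pw[OF B0(2), of 1] by simp
  define J' where "J' = (\<lambda>(j, i). j * g ^ i) ` (J \<times> {..<?m})"
  have fJ': "finite J'" unfolding J'_def using B(1) by simp
  have span: "B' \<subseteq> lspan E (\<lambda>x. x) J'"
  proof
    fix x assume "x \<in> B'"
    then obtain a where a: "x = (\<Sum>i<?m. a i * g ^ i)" "\<forall>i<?m. a i \<in> B" unfolding B'_def by auto
    show "x \<in> lspan E (\<lambda>x. x) J'" unfolding a(1)
    proof (rule lspan_sum[OF E])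
      fix i assume i: "i \<in> {..<?m}"
      then obtain c where c: "a i = (\<Sum>j\<in>J. c j * j)" "\<forall>j\<in>J. c j \<in> E"
        using subsetD[OF B(2), of "a i"] a(2) unfolding lspan_def by auto
      have "j * g ^ i \<in> lspan E (\<lambda>x. x) J'" if "j \<in> J" for j
        by (rule lspan_base[OF E fJ', of "j * g ^ i" "\<lambda>x. x"]) (use that i in \<open>auto simp: J'_def\<close>)
      then have "(\<Sum>j\<in>J. c j * (j * g ^ i)) \<in> lspan E (\<lambda>x. x) J'"
        using c(2) by (intro lspan_sum[OF E] lspan_scale[OF E, where e = "c _"]) simp_all
      then show "a i * g ^ i \<in> lspan E (\<lambda>x. x) J'" unfolding c(1) by (simp only: sum_distrib_right mult.assoc)
    qed
  qed
  have min: "B' \<subseteq> C" if C: "E \<subseteq> C" "insert g A \<subseteq> C" "\<forall>x\<in>C. \<forall>y\<in>C. x + y \<in> C \<and> x * y \<in> C" for C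
  proof
    fix x assume "x \<in> B'"
    then obtain a where a: "x = (\<Sum>i<?m. a i * g ^ i)" "\<forall>i<?m. a i \<in> B" unfolding B'_def by auto
    have BC: "B \<subseteq> C" by (rule B(7)) (use C in auto)
    have gk: "g ^ k \<in> C" for k using BC B0 C(2,3) by (induction k) auto
    have "(\<Sum>i<k. a i * g ^ i) \<in> C" if "k \<le> ?m" for k
      using that
    proof (induction k)
      case (Suc k)
      then show ?case using C(3) a(2) BC gk[of k] by simp (metis Suc_le_lessD subsetD)
    qed (use BC B0 in auto)
    then show "x \<in> C" unfolding a(1) by simp
  qed
  show ?case
    using fJ' span B(3) BB' gB' B(4) add mult min
    by (intro exI[of _ B'] exI[of _ J'] conjI ballI) auto
qed

text \<open>Viewed as a polynomial in \<open>x\<close>, the difference of both sides has degree less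
  than \<open>card W\<close> and vanishes at every element of \<open>W\<close>, so it is
  zero.\<close>

lemma prod_subgroup_additive:
  fixes W :: "'a::field set"
  assumes "finite W" "0 \<in> W" "\<And>u v. u \<in> W \<Longrightarrow> v \<in> W \<Longrightarrow> u + v \<in> W" "\<And>u. u \<in> W \<Longrightarrow> - u \<in> W"
  shows "(\<Prod>w\<in>W. (x + y) - w) = (\<Prod>w\<in>W. x - w) + (\<Prod>w\<in>W. y - w)"
proof -
  let ?F = "\<lambda>c. \<Prod>w\<in>W. [:c - w, 1:]"
  have deg: "Polynomial.degree (?F c) = card W" for c by (subst degree_prod_eq_sum_degree) auto
  have lc: "Polynomial.coeff (?F c) (card W) = 1" for c
    using lead_coeff_prod[of "\<lambda>w. [:c - w, 1:]" W] deg[of c] by simp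
  have ev: "poly (?F c) u = (\<Prod>w\<in>W. (u + c) - w)" for c u by (simp add: poly_prod algebra_simps)
  let ?c = "\<Prod>w\<in>W. y - w"
  define Q where "Q = ?F y - ?F 0 - [:?c:]"
  have cW: "0 < card W" using assms(1,2) card_gt_0_iff by blast
  have root: "poly Q u = 0" if u: "u \<in> W" for u
  proof -
    have "(\<Prod>w\<in>W. (u + y) - w) = ?c"
      by (rule prod.reindex_bij_witness[of _ "\<lambda>w. w + u" "\<lambda>w. w - u"])
        (use assms(3) assms(4)[OF u] u in \<open>auto simp: algebra_simps dest: assms(3)\<close>)
    moreover have "(\<Prod>w\<in>W. (u + 0) - w) = 0" using u assms(1) by (simp add: prod_zero_iff)
    ultimately show ?thesis unfolding Q_def poly_diff ev by simp
  qed
  have "Q = 0"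
  proof (rule ccontr)
    assume Q: "Q \<noteq> 0"
    have "Polynomial.coeff Q k = 0" if "card W \<le> k" for k
    proof (cases "k = card W")
      case True
      then show ?thesis unfolding Q_def using lc[of y] lc[of 0] cW by (simp add: coeff_pCons split: nat.splits)
    next
      case False
      then have "card W < k" using that by simp
      then show ?thesis unfolding Q_def using deg[of y] deg[of 0]
        by (simp add: coeff_eq_0 coeff_pCons split: nat.splits)
    qed
    then have "Polynomial.degree Q < card W" using Q by (metis leading_coeff_0_iff not_le)
    moreover have "card W \<le> card {u. poly Q u = 0}"
      by (rule card_mono[OF poly_roots_finite[OF Q]]) (use root in auto)
    ultimately show False using card_poly_roots_bound[OF Q] by simp
  qed
  then have "poly Q x = 0" by simp
  then show ?thesis unfolding Q_def poly_diff ev by (simp add: diff_eq_eq add.commute)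
qed

text \<open>A linear factor occurring twice would make the derivative vanish at its root. The
  multiset of roots is therefore the set of roots.\<close>

lemma split_simple_roots:
  fixes G :: "'a::alg_closed_field poly"
  assumes "G \<noteq> 0" and simple: "\<And>w. poly G w = 0 \<Longrightarrow> poly (pderiv G) w \<noteq> 0"
  shows "card {w. poly G w = 0} = Polynomial.degree G"
    "poly G y = Polynomial.lead_coeff G * (\<Prod>w\<in>{w. poly G w = 0}. y - w)"
proof -
  let ?W = "{w. poly G w = 0}"
  obtain A where A: "size A = Polynomial.degree G"
    "G = Polynomial.smult (Polynomial.lead_coeff G) (\<Prod>x\<in>#A. [:- x, 1:])"
    using alg_closed_imp_factorization[OF assms(1)] by auto
  have fin: "finite ?W" using poly_roots_finite[OF assms(1)] .
  have ev: "poly G y = Polynomial.lead_coeff G * (\<Prod>w\<in>#A. y - w)" for y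
    by (subst A(2)) (simp add: poly_prod_mset)
  have root: "w \<in># A \<longleftrightarrow> poly G w = 0" for w
    unfolding ev using assms(1) by (auto simp: prod_mset_zero_iff)
  have "A = mset_set ?W"
  proof (rule multiset_eqI)
    fix w
    show "count A w = count (mset_set ?W) w"
    proof (cases "w \<in># A")
      case True
      then obtain A' where A': "A = add_mset w A'" by (metis insert_DiffM)
      have G: "G = [:- w, 1:] * Polynomial.smult (Polynomial.lead_coeff G) (\<Prod>x\<in>#A'. [:- x, 1:])"
        by (subst A(2)) (simp add: A')
      have "poly (pderiv G) w = Polynomial.lead_coeff G * (\<Prod>x\<in>#A'. w - x)"
        by (subst G, simp only: pderiv_mult poly_add poly_mult)
          (simp add: pderiv_pCons poly_prod_mset)
      then have "w \<notin># A'" using simple[of w] True root by (auto simp: prod_mset_zero_iff)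
      then have "count A w = 1" using A' by (simp add: not_in_iff)
      moreover have "w \<in> ?W" using True root by simp
      ultimately show ?thesis using count_mset_set(1)[OF fin, of w] by metis
    next
      case False
      then have "count A w = 0" by (simp add: not_in_iff)
      moreover have "w \<notin> ?W" using False root by simp
      ultimately show ?thesis using count_mset_set(3)[of w ?W] by metis
    qed
  qed
  then show "card ?W = Polynomial.degree G" "poly G y = Polynomial.lead_coeff G * (\<Prod>w\<in>?W. y - w)"
    using A(1) ev[of y] by (simp_all add: prod_unfold_prod_mset)
qed

section \<open>Automorphisms of an algebraically closed field\<close>

definition field_aut :: "('a::field \<Rightarrow> 'a) \<Rightarrow> bool" where
  "field_aut \<sigma> \<longleftrightarrow> bij \<sigma> \<and> \<sigma> 1 = 1 \<and> (\<forall>x y. \<sigma> (x + y) = \<sigma> x + \<sigma> y \<and> \<sigma> (x * y) = \<sigma> x * \<sigma> y)"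

lemma field_autD:
  assumes "field_aut \<sigma>"
  shows "bij \<sigma>" "\<sigma> 1 = 1" "\<sigma> 0 = 0" "\<sigma> (x + y) = \<sigma> x + \<sigma> y" "\<sigma> (x * y) = \<sigma> x * \<sigma> y"
    "\<sigma> (- x) = - \<sigma> x" "\<sigma> (x - y) = \<sigma> x - \<sigma> y" "\<sigma> (x ^ n) = \<sigma> x ^ n" "\<sigma> x = \<sigma> y \<longleftrightarrow> x = y"
    "\<sigma> x = 0 \<longleftrightarrow> x = 0" "\<sigma> (inverse x) = inverse (\<sigma> x)"
proof -
  have add: "\<sigma> (x + y) = \<sigma> x + \<sigma> y" for x y using assms unfolding field_aut_def by auto
  have mult: "\<sigma> (x * y) = \<sigma> x * \<sigma> y" for x y using assms unfolding field_aut_def by auto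
  show "bij \<sigma>" "\<sigma> 1 = 1" using assms unfolding field_aut_def by auto
  show z: "\<sigma> 0 = 0" using add[of 0 0] by (metis add_0 add_cancel_right_right)
  show "\<sigma> (x + y) = \<sigma> x + \<sigma> y" "\<sigma> (x * y) = \<sigma> x * \<sigma> y" by (fact add, fact mult)
  show m: "\<sigma> (- x) = - \<sigma> x" for x using add[of x "- x"] z by (simp add: eq_neg_iff_add_eq_0 add.commute)
  show "\<sigma> (x - y) = \<sigma> x - \<sigma> y" using add[of x "- y"] m[of y] by simp
  show "\<sigma> (x ^ n) = \<sigma> x ^ n" by (induction n) (auto simp: \<open>\<sigma> 1 = 1\<close> mult)
  show i: "\<sigma> x = \<sigma> y \<longleftrightarrow> x = y" for x y using \<open>bij \<sigma>\<close> by (auto simp: bij_def inj_eq)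
  show "\<sigma> x = 0 \<longleftrightarrow> x = 0" using i[of x 0] z by simp
  show "\<sigma> (inverse x) = inverse (\<sigma> x)"
    using mult[of x "inverse x"] \<open>\<sigma> 1 = 1\<close> z by (cases "x = 0") (auto simp: inverse_unique)
qed

lemma field_aut_sum: "field_aut \<sigma> \<Longrightarrow> \<sigma> (\<Sum>i\<in>I. f i) = (\<Sum>i\<in>I. \<sigma> (f i))"
  by (induction I rule: infinite_finite_induct) (auto simp: field_autD)

lemma field_aut_prod: "field_aut \<sigma> \<Longrightarrow> \<sigma> (\<Prod>i\<in>I. f i) = (\<Prod>i\<in>I. \<sigma> (f i))"
  by (induction I rule: infinite_finite_induct) (auto simp: field_autD)

text \<open>A homomorphism fixing \<open>E\<close> permutes the finite root set of every polynomial over \<open>E\<close>,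
  whence it is surjective on an algebraic extension.\<close>

lemma algebraic_hom_aut:
  fixes \<sigma> :: "'a::field \<Rightarrow> 'a"
  assumes alg: "\<And>x::'a. algebraic_over E x"
    and \<sigma>: "\<And>x y. \<sigma> (x + y) = \<sigma> x + \<sigma> y" "\<And>x y. \<sigma> (x * y) = \<sigma> x * \<sigma> y" "\<And>e. e \<in> E \<Longrightarrow> \<sigma> e = e"
    and one: "\<sigma> 1 = 1"
  shows "field_aut \<sigma>"
proof -
  have z: "\<sigma> 0 = 0" using \<sigma>(1)[of 0 0] by (metis add_0 add_cancel_right_right)
  have pw: "\<sigma> (x ^ n) = \<sigma> x ^ n" for x n by (induction n) (auto simp: \<sigma> one)
  have sm: "\<sigma> (\<Sum>i\<in>I. f i) = (\<Sum>i\<in>I. \<sigma> (f i))" for I :: "nat set" and f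
    by (induction I rule: infinite_finite_induct) (auto simp: \<sigma> z)
  have m: "\<sigma> (- x) = - \<sigma> x" for x using \<sigma>(1)[of x "- x"] z by (simp add: eq_neg_iff_add_eq_0 add.commute)
  have inj: "inj \<sigma>"
  proof (rule injI, rule ccontr)
    fix x y assume xy: "\<sigma> x = \<sigma> y" "x \<noteq> y"
    have "\<sigma> (x - y) = 0" using \<sigma>(1)[of x "- y"] m xy by simp
    moreover have "\<sigma> ((x - y) * inverse (x - y)) = 1" using xy one by simp
    ultimately show False using \<sigma>(2)[of "x - y" "inverse (x - y)"] by simp
  qed
  have "surj \<sigma>"
    unfolding surj_def
  proof
    fix y
    obtain P where P: "P \<noteq> 0" "\<forall>i. Polynomial.coeff P i \<in> E" "poly P y = 0"
      using alg[of y] unfolding algebraic_over_def by auto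
    have "\<sigma> (poly P x) = poly P (\<sigma> x)" for x
      unfolding poly_altdef by (simp add: sm \<sigma>(2) pw \<sigma>(3) P(2))
    then have "poly P (\<sigma> x) = 0" if "poly P x = 0" for x using z that by metis
    then have "\<sigma> ` {x. poly P x = 0} \<subseteq> {x. poly P x = 0}" by auto
    then have "\<sigma> ` {x. poly P x = 0} = {x. poly P x = 0}"
      using poly_roots_finite[OF P(1)] inj by (intro endo_inj_surj) (auto intro: inj_on_subset)
    then have "y \<in> \<sigma> ` {x. poly P x = 0}" using P(3) by simp
    then show "\<exists>x. y = \<sigma> x" by auto
  qed
  then show ?thesis unfolding field_aut_def bij_def using inj \<sigma> one by auto
qed

text \<open>A maximal graph above \<open>G\<close> exists by Zorn. Its domain \<open>D\<close> is a
  subfield since inverses are polynomials, and if some \<open>x\<close> were missing, it could be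
  adjoined.\<close>

lemma extend_embedding:
  fixes G :: "('a::alg_closed_field \<times> 'a) set"
  assumes E: "subfld E" "\<And>x::'a. algebraic_over E x" and G: "gring G" "\<And>e. e \<in> E \<Longrightarrow> (e, e) \<in> G"
  shows "\<exists>\<sigma>. field_aut \<sigma> \<and> (\<forall>e\<in>E. \<sigma> e = e) \<and> (\<forall>(a, b)\<in>G. \<sigma> a = b)"
proof -
  define A where "A = {G'. gring G' \<and> G \<subseteq> G'}"
  have "\<exists>M\<in>A. \<forall>H\<in>A. M \<subseteq> H \<longrightarrow> H = M"
  proof (rule subset_Zorn_nonempty)
    show "A \<noteq> {}" using G unfolding A_def by auto
    fix C assume C: "C \<noteq> {}" "subset.chain A C"
    then have ch: "\<And>H H'. H \<in> C \<Longrightarrow> H' \<in> C \<Longrightarrow> H \<subseteq> H' \<or> H' \<subseteq> H" and CA: "\<And>H. H \<in> C \<Longrightarrow> gring H \<and> G \<subseteq> H"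
      unfolding subset_chain_def A_def by auto
    have two: "\<exists>H\<in>C. u \<in> H \<and> w \<in> H" if "u \<in> \<Union>C" "w \<in> \<Union>C" for u w
      using that ch by (meson UnionE subsetD)
    obtain H where H: "H \<in> C" using C by auto
    have "gring (\<Union>C)" unfolding gring_def
    proof (intro conjI allI impI)
      show "(0, 0) \<in> \<Union>C" "(1, 1) \<in> \<Union>C" using H CA[OF H] gringD(1,2) by blast+
      show "y = 0" if "(0, y) \<in> \<Union>C" for y using that CA gringD(3) by blast
      fix a b c d assume "(a, b) \<in> \<Union>C" "(c, d) \<in> \<Union>C"
      then show "(a + c, b + d) \<in> \<Union>C" "(a * c, b * d) \<in> \<Union>C"
        using two[of "(a, b)" "(c, d)"] CA gringD(4,5) by (metis UnionI)+
    next
      fix a b assume "(a, b) \<in> \<Union>C"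
      then show "(- a, - b) \<in> \<Union>C" using CA gringD(6) by blast
    qed
    then show "\<Union>C \<in> A" unfolding A_def using H CA[OF H] by auto
  qed
  then obtain M where M: "gring M" "G \<subseteq> M" and max: "\<And>H. gring H \<Longrightarrow> M \<subseteq> H \<Longrightarrow> H = M"
    unfolding A_def by auto
  have EM: "\<And>e. e \<in> E \<Longrightarrow> (e, e) \<in> M" using M G by auto
  define D where "D = fst ` M"
  define s where "s = (\<lambda>a. SOME b. (a, b) \<in> M)"
  have s: "(a, s a) \<in> M" if "a \<in> D" for a using that unfolding D_def s_def by (auto intro: someI)
  have s_eq: "s a = b" if "(a, b) \<in> M" for a b
    using that s[of a] gringD(8)[OF M(1)] unfolding D_def by (metis fst_conv image_eqI)
  have D: "subfld D"
    unfolding subfld_def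
  proof (intro conjI ballI)
    show "0 \<in> D" "1 \<in> D" unfolding D_def using gringD(1,2)[OF M(1)] by force+
    fix x y assume xy: "x \<in> D" "y \<in> D"
    show "x + y \<in> D" "x * y \<in> D" using gringD(4,5)[OF M(1) s[OF xy(1)] s[OF xy(2)]] unfolding D_def by force+
  next
    fix x assume x: "x \<in> D"
    show "- x \<in> D" using gringD(6)[OF M(1) s[OF x]] unfolding D_def by force
    show "inverse x \<in> D"
    proof (cases "x = 0")
      case True then show ?thesis using x by simp
    next
      case False
      show ?thesis using gring_inverse(2)[OF M(1) E(1) EM E(2) s[OF x] False] unfolding D_def by force
    qed
  qed
  have "x \<in> D" for x
  proof -
    have "algebraic_over D x"
      by (rule algebraic_over_mono[OF E(2)]) (use EM in \<open>force simp: D_def\<close>)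
    from minimal_poly[OF D this]
    obtain \<mu> where \<mu>: "\<forall>i. Polynomial.coeff \<mu> i \<in> D" "Polynomial.coeff \<mu> (Polynomial.degree \<mu>) = 1" "poly \<mu> x = 0"
      "Polynomial.degree \<mu> > 0"
      "\<And>R. R \<noteq> 0 \<Longrightarrow> \<forall>i. Polynomial.coeff R i \<in> D \<Longrightarrow> poly R x = 0 \<Longrightarrow> Polynomial.degree \<mu> \<le> Polynomial.degree R"
      by metis
    have s01: "s 0 = 0" "s 1 = 1" using gringD(1,2)[OF M(1)] s_eq by auto
    \<comment> \<open>The minimal polynomial of \<open>x\<close> transported along \<open>s\<close>.
      Any of its roots is an admissible image of \<open>x\<close>.\<close>
    define \<nu> where "\<nu> = map_poly s \<mu>"
    have c\<nu>: "Polynomial.coeff \<nu> i = s (Polynomial.coeff \<mu> i)" for i unfolding \<nu>_def by (simp add: coeff_map_poly s01)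
    have "Polynomial.coeff \<nu> (Polynomial.degree \<mu>) \<noteq> 0" unfolding c\<nu> using \<mu>(2) s01 by simp
    then have "Polynomial.degree \<nu> > 0" using \<mu>(4) le_degree by fastforce
    then obtain y where y: "poly \<nu> y = 0" using alg_closed_imp_poly_has_root by blast
    have pr: "\<forall>i. (Polynomial.coeff \<mu> i, Polynomial.coeff \<nu> i) \<in> M" unfolding c\<nu> using s \<mu>(1) by auto
    note adj = adjoin_gring[OF M(1) pr \<mu>(2) _ \<mu>(3) y, simplified, OF _ \<mu>(5)]
    have "gring (adjoin M x y)" "M \<subseteq> adjoin M x y" "(x, y) \<in> adjoin M x y"
      using adj coeff_eq_0 unfolding D_def by blast+
    then show ?thesis using max[of "adjoin M x y"] unfolding D_def by force
  qed
  then have sM: "(a, s a) \<in> M" for a using s by auto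
  have "field_aut s"
  proof (rule algebraic_hom_aut[OF E(2)])
    show "s (x + y) = s x + s y" "s (x * y) = s x * s y" for x y
      by (rule s_eq; rule gringD[OF M(1)]; rule sM)+
    show "s e = e" if "e \<in> E" for e using EM[OF that] s_eq by simp
    show "s 1 = 1" using gringD(2)[OF M(1)] s_eq by simp
  qed
  then show ?thesis using s_eq M(2) EM by (intro exI[of _ s]) auto
qed

text \<open>If the minimal polynomial of \<open>z\<close> had derivative zero, it would be a
  polynomial in the p-th power of the variable, that is, a relation among the p-th powers of
  \<open>1, z, z ^ 2, ...\<close>, which are independent by \<open>linindep_frobenius\<close>. So
  \<open>z\<close> is a simple root, and since \<open>z\<close> is outside \<open>E\<close> there is
  another root \<open>y\<close>; the embedding with \<open>z\<close> sent to \<open>y\<close>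
  extends.\<close>

lemma aut_moving:
  fixes z :: "'a::alg_closed_field"
  assumes p: "Factorial_Ring.prime CHAR('a)" and E: "subfld E" "\<And>x::'a. algebraic_over E x"
    and N: "finite J" "N \<subseteq> lspan E b J"
    and gen: "\<And>x. x \<in> N \<Longrightarrow> \<exists>I. I \<subseteq> N \<and> x \<in> lspan E (\<lambda>y. y ^ CHAR('a)) I"
    and z: "\<And>i::nat. z ^ i \<in> N" "z \<notin> E"
  shows "\<exists>\<sigma>. field_aut \<sigma> \<and> (\<forall>e\<in>E. \<sigma> e = e) \<and> \<sigma> z \<noteq> z"
proof -
  from minimal_poly[OF E(1) E(2)[of z]]
  obtain \<mu> where \<mu>: "\<forall>i. Polynomial.coeff \<mu> i \<in> E" "Polynomial.coeff \<mu> (Polynomial.degree \<mu>) = 1" "poly \<mu> z = 0"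
      "Polynomial.degree \<mu> > 0"
      "\<And>R. R \<noteq> 0 \<Longrightarrow> \<forall>i. Polynomial.coeff R i \<in> E \<Longrightarrow> poly R z = 0 \<Longrightarrow> Polynomial.degree \<mu> \<le> Polynomial.degree R"
    by metis
  let ?m = "Polynomial.degree \<mu>" and ?p = "CHAR('a)"
  have p1: "?p > 1" using prime_gt_1_nat[OF p] .
  have small: "R = 0" if "\<forall>i. Polynomial.coeff R i \<in> E" "poly R z = 0" "Polynomial.degree R < ?m" for R
    using \<mu>(5)[of R] that by fastforce
  have ind: "linindep E (\<lambda>i. z ^ i) {..<?m}"
    by (rule minimal_poly_linindep[OF E(1) _ \<mu>(5)]) (use \<mu>(4) in auto)
  have indp: "linindep E (\<lambda>i. (z ^ i) ^ ?p) {..<?m}"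
    by (rule linindep_frobenius[OF p E(1) N gen]) (use ind z in auto)
  have "pderiv \<mu> \<noteq> 0"
  proof
    assume "pderiv \<mu> = 0"
    then have d0: "of_nat (Suc i) * Polynomial.coeff \<mu> (Suc i) = 0" for i by (metis coeff_pderiv coeff_0)
    have nz: "?p dvd i" if "Polynomial.coeff \<mu> i \<noteq> 0" for i
    proof (cases i)
      case (Suc j)
      then have "of_nat i = (0::'a)" using d0[of j] that by simp
      then show ?thesis by (simp add: of_nat_eq_0_iff_char_dvd)
    qed auto
    then have pm: "?p dvd ?m" using \<mu>(2) by auto
    then obtain l where l: "?m = ?p * l" by auto
    have "l > 0" using \<mu>(4) l by simp
    then have lm: "l < ?m" using p1 l by simp
    have "0 = (\<Sum>i\<le>?m. Polynomial.coeff \<mu> i * z ^ i)" using \<mu>(3) by (simp add: poly_altdef)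
    also have "\<dots> = (\<Sum>i\<in>(\<lambda>i. ?p * i) ` {..l}. Polynomial.coeff \<mu> i * z ^ i)"
    proof (intro sum.mono_neutral_right ballI)
      fix i assume "i \<in> {..?m} - (\<lambda>i. ?p * i) ` {..l}"
      then have "\<not> ?p dvd i" using l p1 by (auto simp: image_iff elim!: dvdE)
      then show "Polynomial.coeff \<mu> i * z ^ i = 0" using nz by auto
    qed (use l in auto)
    also have "\<dots> = (\<Sum>i\<le>l. Polynomial.coeff \<mu> (?p * i) * (z ^ i) ^ ?p)"
      using p1 by (subst sum.reindex) (auto simp: inj_on_def power_mult[symmetric] mult.commute)
    also have "\<dots> = (\<Sum>i<?m. (if i \<le> l then Polynomial.coeff \<mu> (?p * i) else 0) * (z ^ i) ^ ?p)"
      using lm by (intro sum.mono_neutral_cong_left) auto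
    finally have "(\<Sum>i<?m. (if i \<le> l then Polynomial.coeff \<mu> (?p * i) else 0) * (z ^ i) ^ ?p) = 0" by simp
    moreover have "\<forall>i\<in>{..<?m}. (if i \<le> l then Polynomial.coeff \<mu> (?p * i) else 0) \<in> E"
      using \<mu>(1) subfldD(1)[OF E(1)] by simp
    ultimately have "\<forall>i\<in>{..<?m}. (if i \<le> l then Polynomial.coeff \<mu> (?p * i) else 0) = 0"
      using indp[unfolded linindep_def, rule_format, of "\<lambda>i. if i \<le> l then Polynomial.coeff \<mu> (?p * i) else 0"]
      by blast
    from bspec[OF this, of l] have "Polynomial.coeff \<mu> (?p * l) = 0" using lm by simp
    then show False using \<mu>(2) l by simp
  qed
  moreover have "Polynomial.degree (pderiv \<mu>) < ?m" 
  proof -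
    have "Polynomial.degree (pderiv \<mu>) \<le> ?m - 1"
      by (rule degree_le) (auto simp: coeff_pderiv coeff_eq_0)
    then show ?thesis using \<mu>(4) by linarith
  qed
  moreover have "\<forall>i. Polynomial.coeff (pderiv \<mu>) i \<in> E"
  proof -
    have "of_nat n \<in> E" for n by (induction n) (auto intro: subfldD[OF E(1)])
    then show ?thesis unfolding coeff_pderiv using \<mu>(1) subfldD(4)[OF E(1)] by blast
  qed
  ultimately have dz: "poly (pderiv \<mu>) z \<noteq> 0" using small by blast
  obtain Q where Q: "\<mu> = [:- z, 1:] * Q" using \<mu>(3) poly_eq_0_iff_dvd by (metis dvdE)
  have Qz: "poly Q z \<noteq> 0" using dz unfolding Q pderiv_mult by (simp add: pderiv_pCons)
  have m1: "?m \<noteq> 1"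
  proof
    assume m1: "?m = 1"
    have "0 = Polynomial.coeff \<mu> 0 + z" using \<mu>(2,3) m1 by (simp add: poly_altdef)
    then have "z = - Polynomial.coeff \<mu> 0" by (simp add: eq_neg_iff_add_eq_0 add.commute)
    then show False using z(2) \<mu>(1) subfldD(5)[OF E(1)] by simp
  qed
  have "Q \<noteq> 0" using Qz by auto
  then have "?m = 1 + Polynomial.degree Q" unfolding Q by (subst degree_mult_eq) auto
  then have "Polynomial.degree Q > 0" using m1 \<mu>(4) by simp
  then obtain y where y: "poly Q y = 0" using alg_closed_imp_poly_has_root by blast
  then have yz: "y \<noteq> z" "poly \<mu> y = 0" using Qz Q by auto
  let ?G = "(\<lambda>e. (e, e)) ` E"
  have G: "gring ?G" unfolding gring_def using subfldD[OF E(1)] by auto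
  have pr: "\<forall>i. (Polynomial.coeff \<mu> i, Polynomial.coeff \<mu> i) \<in> ?G" using \<mu>(1) by auto
  have f: "fst ` ?G = E" by force
  note adj = adjoin_gring[OF G pr \<mu>(2) _ \<mu>(3) yz(2), unfolded f, OF _ \<mu>(5)]
  have "gring (adjoin ?G z y)" "?G \<subseteq> adjoin ?G z y" "(z, y) \<in> adjoin ?G z y"
    using adj coeff_eq_0 by blast+
  with extend_embedding[OF E, of "adjoin ?G z y"] yz show ?thesis by fastforce
qed

section \<open>Nonarchimedean absolute values\<close>

text \<open>The multiplicative form of a valuation: with 0 as the value at 0 there are no infinite
  values, and products and powers are handled by real arithmetic.\<close>

locale nonarch =
  fixes nrm :: "'a::field \<Rightarrow> real"
  assumes nrm_eq_0 [simp]: "nrm x = 0 \<longleftrightarrow> x = 0"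
    and nrm_ge_0 [simp]: "0 \<le> nrm x"
    and nrm_mult: "nrm (x * y) = nrm x * nrm y"
    and nrm_add: "nrm (x + y) \<le> max (nrm x) (nrm y)"
begin

lemma nrm_0 [simp]: "nrm 0 = 0"
  by simp

lemma nrm_pos: "x \<noteq> 0 \<Longrightarrow> 0 < nrm x"
  using nrm_ge_0[of x] nrm_eq_0[of x] by linarith

lemma nrm_1 [simp]: "nrm 1 = 1"
proof -
  have "nrm 1 * nrm 1 = nrm 1" using nrm_mult[of 1 1] by simp
  then show ?thesis using nrm_pos[of 1] by simp
qed

lemma nrm_power: "nrm (x ^ n) = nrm x ^ n"
  by (induction n) (auto simp: nrm_mult)

lemma nrm_minus [simp]: "nrm (- x) = nrm x"
proof -
  have "nrm (- 1) ^ 2 = 1 ^ 2" using nrm_power[of "- 1" 2] by simp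
  then have "nrm (- 1) = 1" using power2_eq_imp_eq[of "nrm (-1)" 1] by simp
  then show ?thesis using nrm_mult[of "- 1" x] by simp
qed

lemma nrm_diff: "nrm (x - y) \<le> max (nrm x) (nrm y)"
  using nrm_add[of x "- y"] by simp

lemma nrm_diff_commute: "nrm (x - y) = nrm (y - x)"
  using nrm_minus[of "x - y"] by simp

lemma nrm_inverse: "nrm (inverse x) = inverse (nrm x)"
proof (cases "x = 0")
  case False
  then have "nrm x * nrm (inverse x) = 1" using nrm_mult[of x "inverse x"] by simp
  then show ?thesis by (simp add: inverse_unique)
qed auto

lemma nrm_divide: "nrm (x / y) = nrm x / nrm y"
  by (simp add: divide_inverse nrm_mult nrm_inverse)

lemma nrm_power_int: "nrm (x powi n) = nrm x powi n"
  by (simp add: power_int_def nrm_power nrm_inverse)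

lemma nrm_add_dominant: "nrm x < nrm y \<Longrightarrow> nrm (x + y) = nrm y"
  using nrm_add[of x y] nrm_diff[of "x + y" x] by auto

lemma nrm_sum_le: "0 \<le> B \<Longrightarrow> (\<And>i. i \<in> I \<Longrightarrow> nrm (f i) \<le> B) \<Longrightarrow> nrm (\<Sum>i\<in>I. f i) \<le> B"
proof (induction I rule: infinite_finite_induct)
  case (insert i I)
  then have "nrm (\<Sum>i\<in>I. f i) \<le> B" "nrm (f i) \<le> B" by auto
  then show ?case using nrm_add[of "f i" "\<Sum>i\<in>I. f i"] insert.hyps by simp
qed auto

lemma nrm_sum_less: "0 < B \<Longrightarrow> (\<And>i. i \<in> I \<Longrightarrow> nrm (f i) < B) \<Longrightarrow> nrm (\<Sum>i\<in>I. f i) < B"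
proof (induction I rule: infinite_finite_induct)
  case (insert i I)
  then have "nrm (\<Sum>i\<in>I. f i) < B" "nrm (f i) < B" by auto
  then show ?case using nrm_add[of "f i" "\<Sum>i\<in>I. f i"] insert.hyps by simp
qed auto

lemma nrm_sum_dominant:
  assumes "finite I" "k \<in> I" "\<And>i. i \<in> I \<Longrightarrow> i \<noteq> k \<Longrightarrow> nrm (f i) < nrm (f k)" "f k \<noteq> 0"
  shows "nrm (\<Sum>i\<in>I. f i) = nrm (f k)"
proof -
  have "nrm (\<Sum>i\<in>I - {k}. f i) < nrm (f k)"
    by (rule nrm_sum_less) (use assms nrm_pos in auto)
  then show ?thesis using sum.remove[OF assms(1,2), of f]
      nrm_add_dominant[of "\<Sum>i\<in>I - {k}. f i" "f k"]
    by (simp add: add.commute)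
qed

lemma nrm_prod: "nrm (\<Prod>i\<in>I. f i) = (\<Prod>i\<in>I. nrm (f i))"
  by (induction I rule: infinite_finite_induct) (auto simp: nrm_mult)

lemma nrm_le_1_add: "nrm x \<le> 1 \<Longrightarrow> nrm y \<le> 1 \<Longrightarrow> nrm (x + y) \<le> 1"
  using nrm_add[of x y] by simp

lemma nrm_less_1_add: "nrm x < 1 \<Longrightarrow> nrm y < 1 \<Longrightarrow> nrm (x + y) < 1"
  using nrm_add[of x y] by simp

lemma nrm_less_1_diff: "nrm x < 1 \<Longrightarrow> nrm y < 1 \<Longrightarrow> nrm (x - y) < 1"
  using nrm_diff[of x y] by simp

lemma nrm_le_1_mult: "nrm x \<le> 1 \<Longrightarrow> nrm y \<le> 1 \<Longrightarrow> nrm (x * y) \<le> 1"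
  by (simp add: nrm_mult mult_le_one)

lemma nrm_less_1_mult: "nrm x \<le> 1 \<Longrightarrow> nrm y < 1 \<Longrightarrow> nrm (x * y) < 1"
  using mult_right_mono[of "nrm x" 1 "nrm y"] by (simp add: nrm_mult)

end

section \<open>The algebraic closure of a local field\<close>

locale local_closure = nonarch nrm for nrm :: "'a::alg_closed_field \<Rightarrow> real" +
  fixes K :: "'a set" and p :: nat
  assumes p_eq: "p = CHAR('a)" and prime_char: "Factorial_Ring.prime CHAR('a)"
    and K: "subfld K" and alg: "algebraic_over K x"
    and discrete: "x \<in> K \<Longrightarrow> x \<noteq> 0 \<Longrightarrow> \<exists>n::int. nrm x = exp (real_of_int n)"
    and K_complete: "(\<And>n::nat. s n \<in> K) \<Longrightarrow> (\<And>e. 0 < e \<Longrightarrow> \<exists>N. \<forall>m\<ge>N. \<forall>n\<ge>N. nrm (s m - s n) < e) \<Longrightarrow>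
       \<exists>l\<in>K. \<forall>e>0. \<exists>N. \<forall>n\<ge>N. nrm (s n - l) < e"
    and residues: "\<exists>R. finite R \<and> R \<subseteq> K \<and> (\<forall>x\<in>K. nrm x \<le> 1 \<longrightarrow> (\<exists>r\<in>R. nrm (x - r) < 1))"
begin

lemma p_gt_1: "1 < p"
  unfolding p_eq using prime_gt_1_nat[OF prime_char] .

lemma frob_add: "(x + y) ^ (p ^ n) = x ^ (p ^ n) + (y::'a) ^ (p ^ n)"
  unfolding p_eq by (rule freshmans_dream'[OF prime_char refl])

lemma frob_diff: "(x - y) ^ (p ^ n) = x ^ (p ^ n) - (y::'a) ^ (p ^ n)"
  using frob_add[of "x - y" y n] by (simp add: algebra_simps)

lemma frob_inj: "x ^ (p ^ n) = (y::'a) ^ (p ^ n) \<longleftrightarrow> x = y"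
proof
  assume "x ^ (p ^ n) = y ^ (p ^ n)"
  then have "(x - y) ^ (p ^ n) = 0" by (simp add: frob_diff)
  then show "x = y" by simp
qed simp

text \<open>The algebraic closure of the prime field. Its elements serve as representatives of the
  residue field of the algebraic closure of \<open>K\<close>; in characteristic \<open>p\<close>
  these representatives form a field.\<close>

definition kb :: "'a set" where
  "kb = {z. \<exists>n>0. z ^ (p ^ n) = z}"

lemma frob_iter: "z ^ (p ^ n) = z \<Longrightarrow> (z::'a) ^ (p ^ (n * k)) = z"
proof (induction k)
  case (Suc k)
  have "z ^ (p ^ (n * Suc k)) = (z ^ (p ^ (n * k))) ^ (p ^ n)"
    by (simp add: power_mult[symmetric] power_add mult.commute)
  then show ?case using Suc by simp
qed simp

lemma kb_common:
  assumes "x \<in> kb" "y \<in> kb" obtains n where "0 < n" "x ^ (p ^ n) = x" "y ^ (p ^ n) = y"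
proof -
  obtain m n where "0 < m" "0 < n" "x ^ (p ^ m) = x" "y ^ (p ^ n) = y"
    using assms unfolding kb_def by auto
  then show thesis using frob_iter[of x m n] frob_iter[of y n m]
    by (intro that[of "m * n"]) (auto simp: mult.commute)
qed

lemma kbI: "0 < n \<Longrightarrow> z ^ (p ^ n) = z \<Longrightarrow> z \<in> kb"
  unfolding kb_def by auto

lemma subfld_kb: "subfld kb"
  unfolding subfld_def
proof (intro conjI ballI)
  show "0 \<in> kb" "1 \<in> kb" using p_gt_1 by (auto intro!: kbI[of 1])
  fix x y assume xy: "x \<in> kb" "y \<in> kb"
  obtain n where n: "0 < n" "x ^ (p ^ n) = x" "y ^ (p ^ n) = y" by (rule kb_common[OF xy])
  show "x + y \<in> kb" by (rule kbI[OF n(1)]) (simp add: frob_add n)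
  show "x * y \<in> kb" by (rule kbI[OF n(1)]) (simp add: power_mult_distrib n)
next
  fix x assume "x \<in> kb"
  then obtain n where n: "0 < n" "x ^ (p ^ n) = x" unfolding kb_def by auto
  show "inverse x \<in> kb" by (rule kbI[OF n(1)]) (simp add: power_inverse n)
  show "- x \<in> kb" by (rule kbI[OF n(1)]) (use frob_diff[of 0 x n] n p_gt_1 in simp)
qed

lemma kb_nrm:
  assumes "z \<in> kb" "z \<noteq> 0" shows "nrm z = 1"
proof -
  obtain n where n: "0 < n" "z ^ (p ^ n) = z" using assms unfolding kb_def by auto
  have q: "1 < p ^ n" using one_less_power[OF p_gt_1 n(1)] .
  then obtain k where k: "p ^ n = Suc k" "0 < k" by (cases "p ^ n") auto
  have "nrm z * nrm z ^ k = nrm z" using arg_cong[OF n(2), of nrm] unfolding k(1) by (simp add: nrm_power nrm_mult)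
  then have "nrm z ^ k = 1 ^ k" using assms(2) by simp
  then show ?thesis using k(2) power_eq_iff_eq_base[of k "nrm z" 1] by simp
qed

lemma kb_nrm_less_1: "z \<in> kb \<Longrightarrow> nrm z < 1 \<Longrightarrow> z = 0"
  using kb_nrm by fastforce

text \<open>The iterated p-th powers of \<open>z\<close> take finitely many values, and injectivity
  of Frobenius turns a coincidence among them into an equation
  \<open>z = z ^ (p ^ n)\<close>.\<close>

lemma root_of_unity_kb:
  assumes "z ^ N = 1" "0 < (N::nat)" shows "z \<in> kb"
proof -
  have md: "z ^ k = z ^ (k mod N)" for k
  proof -
    have "z ^ k = z ^ (N * (k div N) + k mod N)" by simp
    then show ?thesis using assms(1) by (simp only: power_add power_mult) simp
  qed
  have fin: "finite (range (\<lambda>k. z ^ (p ^ k)))"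
  proof (rule finite_subset)
    show "range (\<lambda>k. z ^ (p ^ k)) \<subseteq> (\<lambda>k. z ^ k) ` {..<N}"
    proof
      fix y assume "y \<in> range (\<lambda>k. z ^ (p ^ k))"
      then obtain k where y: "y = z ^ (p ^ k)" by auto
      show "y \<in> (\<lambda>k. z ^ k) ` {..<N}" unfolding y using md[of "p ^ k"] assms(2) by auto
    qed
  qed auto
  have "\<not> inj (\<lambda>k. z ^ (p ^ k))" using fin finite_imageD infinite_UNIV_nat by blast
  then obtain a b where "a \<noteq> b" "z ^ (p ^ a) = z ^ (p ^ b)" unfolding inj_def by blast
  then obtain a b where ab: "a < b" "z ^ (p ^ a) = z ^ (p ^ b)" by (metis linorder_neqE_nat)
  have "z ^ (p ^ b) = (z ^ (p ^ (b - a))) ^ (p ^ a)"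
    using ab(1) by (simp add: power_mult[symmetric] power_add[symmetric])
  then have "z = z ^ (p ^ (b - a))" using ab(2) frob_inj[of z a "z ^ (p ^ (b - a))"] by simp
  then show ?thesis using ab(1) by (intro kbI[of "b - a"]) auto
qed

text \<open>A normalized equation over \<open>K\<close> expresses \<open>x ^ d\<close> modulo small
  elements by lower powers with integral coefficients, hence also all powers of \<open>x\<close>.
  The coefficients may be taken from the finite set \<open>R\<close>, so two powers of
  \<open>x\<close> are congruent and \<open>x\<close> is close to a root of unity.\<close>

lemma residue_lift:
  assumes "nrm x \<le> 1" shows "\<exists>z\<in>kb. nrm (x - z) < 1"
proof (cases "nrm x < 1")
  case True
  then show ?thesis using subfldD(1)[OF subfld_kb] by (intro bexI[of _ 0]) auto
next
  case False
  then have x1: "nrm x = 1" using assms by simp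
  obtain P where P: "P \<noteq> 0" "\<forall>i. Polynomial.coeff P i \<in> K" "poly P x = 0"
    using alg[of x] unfolding algebraic_over_def by auto
  let ?D = "Polynomial.degree P" and ?c = "Polynomial.coeff P"
  define B where "B = Max ((\<lambda>i. nrm (?c i)) ` {..?D})"
  have Bge: "nrm (?c i) \<le> B" if "i \<le> ?D" for i unfolding B_def using that by (intro Max_ge) auto
  have "B \<in> (\<lambda>i. nrm (?c i)) ` {..?D}" unfolding B_def by (intro Max_in) auto
  then have ex: "\<exists>i. i \<le> ?D \<and> nrm (?c i) = B" by auto
  \<comment> \<open>The last index with a coefficient of maximal size: division by it makes all
    coefficients integral, the \<open>d\<close>-th one equal to 1 and the later ones small.\<close>
  define d where "d = (GREATEST i. i \<le> ?D \<and> nrm (?c i) = B)"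
  have d: "d \<le> ?D" "nrm (?c d) = B"
    using GreatestI_ex_nat[OF ex, of ?D] unfolding d_def by auto
  have dmax: "i \<le> d" if "i \<le> ?D" "nrm (?c i) = B" for i
    unfolding d_def by (rule Greatest_le_nat[of _ i ?D]) (use that in auto)
  have "0 < B" using Bge[of ?D] nrm_pos[of "?c ?D"] P(1) by simp
  then have cd: "?c d \<noteq> 0" using d(2) by auto
  define a where "a = (\<lambda>i. ?c i / ?c d)"
  have aK: "a i \<in> K" for i unfolding a_def using P(2) subfldD(8)[OF K] by auto
  have a1: "nrm (a i) \<le> 1" if "i \<le> ?D" for i
    unfolding a_def nrm_divide d(2) using Bge[OF that] \<open>0 < B\<close> by simp
  have a2: "nrm (a i) < 1" if "i \<le> ?D" "d < i" for i
    unfolding a_def nrm_divide d(2) using Bge[OF that(1)] dmax[OF that(1)] that(2) \<open>0 < B\<close> by force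
  have ad: "a d = 1" unfolding a_def using cd by simp
  have "0 = (\<Sum>i\<le>?D. ?c i * x ^ i) / ?c d" using P(3) by (simp add: poly_altdef)
  also have "\<dots> = (\<Sum>i\<le>?D. a i * x ^ i)" unfolding a_def by (simp add: sum_divide_distrib)
  also have "{..?D} = {..<d} \<union> ({d} \<union> {d<..?D})" using d(1) by auto
  also have "(\<Sum>i\<in>\<dots>. a i * x ^ i) = (\<Sum>i<d. a i * x ^ i) + (x ^ d + (\<Sum>i\<in>{d<..?D}. a i * x ^ i))"
    by (subst sum.union_disjoint; (subst sum.union_disjoint)?) (auto simp: ad)
  finally have rel: "x ^ d - (\<Sum>i<d. - a i * x ^ i) = - (\<Sum>i\<in>{d<..?D}. a i * x ^ i)"
    by (simp add: sum_negf algebra_simps eq_neg_iff_add_eq_0)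
  have small: "nrm (x ^ d - (\<Sum>i<d. - a i * x ^ i)) < 1"
    unfolding rel nrm_minus by (rule nrm_sum_less) (use a2 x1 in \<open>auto simp: nrm_mult nrm_power\<close>)
  have pw: "\<exists>b. (\<forall>i<d. b i \<in> K \<and> nrm (b i) \<le> 1) \<and> nrm (x ^ n - (\<Sum>i<d. b i * x ^ i)) < 1" for n
  proof (induction n)
    case 0
    show ?case
    proof (cases d)
      case 0
      then show ?thesis using small by simp
    next
      case (Suc d')
      have "(\<Sum>i<d. (if i = 0 then 1 else 0) * x ^ i) = (\<Sum>i<d. if i = 0 then 1 else 0)"
        by (intro sum.cong) auto
      also have "\<dots> = 1" using Suc by simp
      finally show ?thesis using subfldD(1,2)[OF K]
        by (intro exI[of _ "\<lambda>i. if i = 0 then 1 else 0"]) auto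
    qed
  next
    case (Suc n)
    then obtain b where b: "\<forall>i<d. b i \<in> K \<and> nrm (b i) \<le> 1" "nrm (x ^ n - (\<Sum>i<d. b i * x ^ i)) < 1" by auto
    show ?case
    proof (cases d)
      case 0
      then have "nrm (x ^ 0) < 1" using small by simp
      then show ?thesis by simp
    next
      case (Suc e)
      \<comment> \<open>Multiplication by \<open>x\<close> shifts the coefficients; the overflowing
        term \<open>b e * x ^ d\<close> is rewritten by the congruence for
        \<open>x ^ d\<close>.\<close>
      define b' where "b' = (\<lambda>i. (if i = 0 then 0 else b (i - 1)) + b e * (- a i))"
      have b': "\<forall>i<d. b' i \<in> K \<and> nrm (b' i) \<le> 1"
      proof (intro allI impI conjI)
        fix i assume i: "i < d"
        show "b' i \<in> K" unfolding b'_def using b(1) aK Suc i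
          by (intro subfldD[OF K]) (auto intro: subfldD[OF K])
        show "nrm (b' i) \<le> 1" unfolding b'_def
          by (rule nrm_le_1_add) (use b(1) a1[of i] Suc i d(1) in \<open>auto intro!: nrm_le_1_mult\<close>)
      qed
      have "(\<Sum>i<d. (if i = 0 then 0 else b (i - 1)) * x ^ i) = (\<Sum>i<e. b i * x ^ Suc i)"
        unfolding Suc sum.lessThan_Suc_shift by simp
      then have s1: "(\<Sum>i<d. b' i * x ^ i) = (\<Sum>i<e. b i * x ^ Suc i) + b e * (\<Sum>i<d. - a i * x ^ i)"
        unfolding b'_def by (simp only: distrib_right sum.distrib sum_distrib_left mult.assoc)
      have s2: "x * (\<Sum>i<d. b i * x ^ i) = (\<Sum>i<e. b i * x ^ Suc i) + b e * x ^ d"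
        unfolding Suc by (simp add: sum_distrib_left algebra_simps)
      have e: "x ^ Suc n - (\<Sum>i<d. b' i * x ^ i) =
          x * (x ^ n - (\<Sum>i<d. b i * x ^ i)) + b e * (x ^ d - (\<Sum>i<d. - a i * x ^ i))"
        unfolding right_diff_distrib s1 s2 by simp
      have "nrm (x ^ Suc n - (\<Sum>i<d. b' i * x ^ i)) < 1"
        unfolding e using b small Suc x1
        by (intro nrm_less_1_add nrm_less_1_mult) auto
      then show ?thesis using b' by auto
    qed
  qed
  obtain R where R: "finite R" "R \<subseteq> K" "\<forall>y\<in>K. nrm y \<le> 1 \<longrightarrow> (\<exists>r\<in>R. nrm (y - r) < 1)"
    using residues by auto
  have "\<exists>r \<in> {..<d} \<rightarrow>\<^sub>E R. nrm (x ^ n - (\<Sum>i<d. r i * x ^ i)) < 1" for n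
  proof -
    obtain b where b: "\<forall>i<d. b i \<in> K \<and> nrm (b i) \<le> 1" "nrm (x ^ n - (\<Sum>i<d. b i * x ^ i)) < 1"
      using pw by auto
    have "\<forall>i\<in>{..<d}. \<exists>r\<in>R. nrm (b i - r) < 1" using R(3) b(1) by auto
    then obtain r where r: "\<forall>i\<in>{..<d}. r i \<in> R \<and> nrm (b i - r i) < 1" by metis
    have e: "x ^ n - (\<Sum>i<d. restrict r {..<d} i * x ^ i) =
        (x ^ n - (\<Sum>i<d. b i * x ^ i)) + (\<Sum>i<d. (b i - r i) * x ^ i)"
      by (simp add: left_diff_distrib sum_subtractf)
    have "nrm (x ^ n - (\<Sum>i<d. restrict r {..<d} i * x ^ i)) < 1"
      unfolding e using r by (intro nrm_less_1_add b nrm_sum_less) (auto simp: nrm_mult nrm_power x1)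
    then show ?thesis using r by (intro bexI[of _ "restrict r {..<d}"]) auto
  qed
  then obtain r where r: "\<And>n. r n \<in> {..<d} \<rightarrow>\<^sub>E R" "\<And>n. nrm (x ^ n - (\<Sum>i<d. r n i * x ^ i)) < 1" by metis
  have "finite ({..<d} \<rightarrow>\<^sub>E R)" using R(1) by (intro finite_PiE) auto
  then have "finite (range r)" by (rule finite_subset[rotated]) (use r(1) in auto)
  then have "\<not> inj r" using finite_imageD infinite_UNIV_nat by blast
  then obtain m n where "m \<noteq> n" "r m = r n" unfolding inj_def by blast
  then obtain m n where mn: "m < n" "r m = r n" by (metis linorder_neqE_nat)
  let ?N = "n - m"
  have e: "x ^ m * (x ^ ?N - 1) = (x ^ n - (\<Sum>i<d. r n i * x ^ i)) - (x ^ m - (\<Sum>i<d. r m i * x ^ i))"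
    using mn by (simp add: right_diff_distrib power_add[symmetric])
  have "nrm (x ^ m * (x ^ ?N - 1)) < 1" unfolding e by (intro nrm_less_1_diff r)
  then have lt: "nrm (x ^ ?N - 1) < 1" by (simp add: nrm_mult nrm_power x1)
  define Q where "Q = Polynomial.monom (1::'a) ?N - 1"
  have cQ: "Polynomial.coeff Q ?N = 1" unfolding Q_def using mn by (simp add: coeff_1)
  then have "Q \<noteq> 0" by auto
  from alg_closed_imp_factorization[OF this] obtain A where
    A: "size A = Polynomial.degree Q" "Q = Polynomial.smult (Polynomial.lead_coeff Q) (\<Prod>y\<in>#A. [:- y, 1:])" by auto
  have dQ: "Polynomial.degree Q = ?N"
  proof (rule antisym)
    show "Polynomial.degree Q \<le> ?N" by (rule degree_le) (auto simp: Q_def coeff_1)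
    show "?N \<le> Polynomial.degree Q" by (rule le_degree) (simp add: cQ)
  qed
  have pQ: "poly Q y = (\<Prod>z\<in>#A. y - z)" for y
    by (subst A(2)) (simp add: dQ cQ poly_prod_mset)
  have pQ': "poly Q y = y ^ ?N - 1" for y unfolding Q_def by (simp add: poly_monom)
  \<comment> \<open>The product of the distances from \<open>x\<close> to the roots of
    \<open>Q\<close> is less than 1, so one of the factors is.\<close>
  have "\<exists>z\<in>#A. nrm (x - z) < 1"
  proof (rule ccontr)
    assume "\<not> ?thesis"
    then have "\<forall>z\<in>#A. 1 \<le> nrm (x - z)" by auto
    then have "1 \<le> nrm (\<Prod>z\<in>#A. x - z)"
    proof (induction A)
      case (add z A)
      then show ?case using mult_mono[of 1 "nrm (x - z)" 1 "nrm (\<Prod>z\<in>#A. x - z)"] by (simp add: nrm_mult)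
    qed simp
    then show False using lt pQ[of x] pQ'[of x] by simp
  qed
  then obtain z where z: "z \<in># A" "nrm (x - z) < 1" by auto
  have "poly Q z = 0" unfolding pQ using z(1) by (auto simp: prod_mset_zero_iff)
  then have "z ^ ?N = 1" unfolding pQ' by simp
  then have "z \<in> kb" using mn by (intro root_of_unity_kb) auto
  then show ?thesis using z by auto
qed

text \<open>The Teichmueller construction: raising \<open>a\<close> to the power
  \<open>p ^ n\<close> fixes \<open>z\<close> and shrinks the distance \<open>a - z\<close>, so the
  iterated powers of \<open>a\<close> converge to \<open>z\<close>, which lies in \<open>K\<close>
  by completeness.\<close>

lemma residue_lift_K:
  assumes "a \<in> K" "nrm a \<le> 1" shows "\<exists>z\<in>kb \<inter> K. nrm (a - z) < 1"
proof -
  obtain z where z: "z \<in> kb" "nrm (a - z) < 1" using residue_lift[OF assms(2)] by auto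
  obtain n where n: "0 < n" "z ^ (p ^ n) = z" using z(1) unfolding kb_def by auto
  let ?t = "nrm (a - z)"
  define s where "s = (\<lambda>k. a ^ (p ^ (n * k)))"
  have sK: "s k \<in> K" for k unfolding s_def by (rule subfldD(9)[OF K assms(1)])
  have sz: "nrm (s k - z) \<le> ?t ^ k" for k
  proof -
    have "s k - z = (a - z) ^ (p ^ (n * k))" unfolding s_def frob_diff frob_iter[OF n(2)] by simp
    moreover have "k \<le> p ^ (n * k)"
    proof -
      have "k \<le> n * k" using n(1) by simp
      also have "\<dots> \<le> p ^ (n * k)" using p_gt_1 less_exp[of "n * k"] power_mono[of 2 p "n * k"] by linarith
      finally show ?thesis .
    qed
    ultimately show ?thesis using z(2) by (simp add: nrm_power power_decreasing)
  qed
  have lim: "\<exists>N. \<forall>k\<ge>N. nrm (s k - z) < e" if e: "0 < e" for e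
  proof -
    obtain N where N: "?t ^ N < e" using real_arch_pow_inv[OF e z(2)] by auto
    have "nrm (s k - z) < e" if "N \<le> k" for k
      using sz[of k] power_decreasing[OF that, of ?t] z(2) N by simp
    then show ?thesis by auto
  qed
  have "\<exists>l\<in>K. \<forall>e>0. \<exists>N. \<forall>n\<ge>N. nrm (s n - l) < e"
  proof (rule K_complete[OF sK])
    fix e :: real assume "0 < e"
    then obtain N where N: "\<forall>k\<ge>N. nrm (s k - z) < e" using lim by blast
    have "nrm (s m - s k) < e" if "N \<le> m" "N \<le> k" for m k
      using nrm_diff[of "s m - z" "s k - z"] N that by (simp add: le_less_trans)
    then show "\<exists>N. \<forall>m\<ge>N. \<forall>n\<ge>N. nrm (s m - s n) < e" by blast
  qed
  then obtain l where l: "l \<in> K" "\<And>e. 0 < e \<Longrightarrow> \<exists>N. \<forall>n\<ge>N. nrm (s n - l) < e" by auto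
  have "l = z"
  proof (rule ccontr)
    assume "l \<noteq> z"
    then have pos: "0 < nrm (l - z)" by (intro nrm_pos) simp
    obtain N where N: "\<forall>n\<ge>N. nrm (s n - l) < nrm (l - z)" using l(2)[OF pos] by auto
    obtain N' where N': "\<forall>n\<ge>N'. nrm (s n - z) < nrm (l - z)" using lim[OF pos] by auto
    let ?n = "max N N'"
    have "nrm (l - z) \<le> max (nrm (s ?n - z)) (nrm (s ?n - l))"
      using nrm_diff[of "s ?n - z" "s ?n - l"] by simp
    moreover have "nrm (s ?n - z) < nrm (l - z)" "nrm (s ?n - l) < nrm (l - z)" using N N' by auto
    ultimately show False by simp
  qed
  then show ?thesis using l(1) z by auto
qed

text \<open>The maximal unramified extension, as the compositum of \<open>K\<close> with its constants.\<close>

definition E :: "'a set" where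
  "E = {\<Sum>z\<in>J. c z * z | J c. finite J \<and> J \<subseteq> kb \<and> (\<forall>z\<in>J. c z \<in> K)}"

lemma E_add:
  assumes "x \<in> E" "y \<in> E" shows "x + y \<in> E"
proof -
  obtain I c J d where x: "x = (\<Sum>z\<in>I. c z * z)" "finite I" "I \<subseteq> kb" "\<forall>z\<in>I. c z \<in> K"
    and y: "y = (\<Sum>z\<in>J. d z * z)" "finite J" "J \<subseteq> kb" "\<forall>z\<in>J. d z \<in> K"
    using assms unfolding E_def by auto
  define c' where "c' = (\<lambda>z. (if z \<in> I then c z else 0) + (if z \<in> J then d z else 0))"
  have "(\<Sum>z\<in>I \<union> J. (if z \<in> I then c z else 0) * z) = x"
    unfolding x(1) using x(2) y(2) by (intro sum.mono_neutral_cong_right) auto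
  moreover have "(\<Sum>z\<in>I \<union> J. (if z \<in> J then d z else 0) * z) = y"
    unfolding y(1) using x(2) y(2) by (intro sum.mono_neutral_cong_right) auto
  ultimately have "x + y = (\<Sum>z\<in>I \<union> J. c' z * z)"
    unfolding c'_def by (simp add: distrib_right sum.distrib)
  moreover have "\<forall>z\<in>I \<union> J. c' z \<in> K"
    unfolding c'_def using x(4) y(4) subfldD(1)[OF K] by (auto intro: subfldD(3)[OF K])
  ultimately show ?thesis unfolding E_def using x y by blast
qed

lemma E_prod: "a \<in> K \<Longrightarrow> z \<in> kb \<Longrightarrow> a * z \<in> E"
  unfolding E_def by (rule CollectI, rule exI[of _ "{z}"], rule exI[of _ "\<lambda>_. a"]) auto

lemma K_sub_E: "K \<subseteq> E" and kb_sub_E: "kb \<subseteq> E"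
  using E_prod[OF _ subfldD(2)[OF subfld_kb]] E_prod[OF subfldD(2)[OF K]] by auto

lemma E_sum: "finite I \<Longrightarrow> (\<And>i. i \<in> I \<Longrightarrow> f i \<in> E) \<Longrightarrow> (\<Sum>i\<in>I. f i) \<in> E"
proof (induction I rule: finite_induct)
  case empty
  then show ?case using K_sub_E subfldD(1)[OF K] by auto
qed (auto intro: E_add)

lemma E_mult:
  assumes "x \<in> E" "y \<in> E" shows "x * y \<in> E"
proof -
  obtain I c J d where x: "x = (\<Sum>z\<in>I. c z * z)" "finite I" "I \<subseteq> kb" "\<forall>z\<in>I. c z \<in> K"
    and y: "y = (\<Sum>z\<in>J. d z * z)" "finite J" "J \<subseteq> kb" "\<forall>z\<in>J. d z \<in> K"
    using assms unfolding E_def by auto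
  have "x * y = (\<Sum>z\<in>I. \<Sum>w\<in>J. (c z * d w) * (z * w))"
    unfolding x(1) y(1) by (simp add: sum_product mult_ac)
  also have "\<dots> \<in> E"
    using x y by (intro E_sum E_prod subfldD(4)[OF K] subfldD(4)[OF subfld_kb]) auto
  finally show ?thesis .
qed

lemma subfld_E: "subfld E"
  unfolding subfld_def
proof (intro conjI ballI)
  show "0 \<in> E" "1 \<in> E" using K_sub_E subfldD(1,2)[OF K] by auto
  show "x + y \<in> E" "x * y \<in> E" if "x \<in> E" "y \<in> E" for x y using that by (auto intro: E_add E_mult)
  fix x assume x: "x \<in> E"
  have "- 1 \<in> E" using K_sub_E subfldD(2,5)[OF K] by auto
  then show "- x \<in> E" using E_mult[of "- 1" x] x by simp
  show "inverse x \<in> E"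
  proof (cases "x = 0")
    case False
    show ?thesis by (rule subring_inverse[OF alg K K_sub_E x False]) (auto intro: E_add E_mult)
  qed (use x in simp)
qed

lemma algE: "algebraic_over E x"
  by (rule algebraic_over_mono[OF alg K_sub_E])

text \<open>If the residues of the normalized coefficients cancel, one of the constants can be
  eliminated, so the claim follows by induction on the number of constants.\<close>

lemma nrm_E_aux:
  assumes "finite J" "J \<subseteq> kb" "\<forall>z\<in>J. c z \<in> K" "(\<Sum>z\<in>J. c z * z) \<noteq> 0"
  shows "\<exists>a\<in>K. a \<noteq> 0 \<and> nrm (\<Sum>z\<in>J. c z * z) = nrm a"
  using assms
proof (induction "card J" arbitrary: J c rule: less_induct)
  case less
  note fin = less.prems(1) and cK = less.prems(3)
  have ne: "J \<noteq> {}" using less.prems(4) by auto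
  obtain w where w: "w \<in> J" "\<And>z. z \<in> J \<Longrightarrow> nrm (c z) \<le> nrm (c w)"
  proof -
    have "Max ((\<lambda>z. nrm (c z)) ` J) \<in> (\<lambda>z. nrm (c z)) ` J" using fin ne by (intro Max_in) auto
    then obtain w where "w \<in> J" "nrm (c w) = Max ((\<lambda>z. nrm (c z)) ` J)" by auto
    then show thesis using fin by (intro that[of w]) auto
  qed
  have cw: "c w \<noteq> 0"
  proof
    assume cw: "c w = 0"
    have "c z * z = 0" if "z \<in> J" for z using w(2)[OF that] nrm_ge_0[of "c z"] cw by (simp add: antisym)
    then show False using less.prems(4) by (simp add: sum.neutral)
  qed
  define b where "b = (\<lambda>z. c z / c w)"
  have bK: "b z \<in> K" "nrm (b z) \<le> 1" if "z \<in> J" for z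
    using that w cK subfldD(8)[OF K] nrm_pos[OF cw] unfolding b_def by (auto simp: nrm_divide)
  have "\<forall>z\<in>J. \<exists>y\<in>kb \<inter> K. nrm (b z - y) < 1 \<and> (z = w \<longrightarrow> y = 1)"
  proof
    fix z assume z: "z \<in> J"
    show "\<exists>y\<in>kb \<inter> K. nrm (b z - y) < 1 \<and> (z = w \<longrightarrow> y = 1)"
    proof (cases "z = w")
      case True
      then show ?thesis using cw subfldD(2)[OF K] subfldD(2)[OF subfld_kb] unfolding b_def
        by (intro bexI[of _ 1]) auto
    next
      case False
      then show ?thesis using residue_lift_K[OF bK[OF z]] by auto
    qed
  qed
  then obtain y where y: "\<forall>z\<in>J. y z \<in> kb \<inter> K \<and> nrm (b z - y z) < 1 \<and> (z = w \<longrightarrow> y z = 1)" by metis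
  define S where "S = (\<Sum>z\<in>J. y z * z)"
  have kb1: "nrm z \<le> 1" if "z \<in> J" for z using kb_nrm[of z] less.prems(2) that by (cases "z = 0") auto
  show ?case
  proof (cases "S = 0")
    case False
    have SE: "S \<in> kb" unfolding S_def
      using y less.prems(2) by (intro subfld_sum[OF subfld_kb] subfldD(4)[OF subfld_kb]) auto
    have "nrm (\<Sum>z\<in>J. (b z - y z) * z) < 1"
      using y kb1 by (intro nrm_sum_less) (auto simp: mult.commute[of _ "_::'a"] intro!: nrm_less_1_mult)
    then have "nrm ((\<Sum>z\<in>J. (b z - y z) * z) + S) = 1"
      using kb_nrm[OF SE False] by (simp add: nrm_add_dominant)
    moreover have "(\<Sum>z\<in>J. (b z - y z) * z) + S = (\<Sum>z\<in>J. b z * z)"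
      unfolding S_def by (simp add: left_diff_distrib sum_subtractf)
    moreover have "(\<Sum>z\<in>J. c z * z) = c w * (\<Sum>z\<in>J. b z * z)"
      unfolding b_def sum_distrib_left using cw by simp
    ultimately have "nrm (\<Sum>z\<in>J. c z * z) = nrm (c w)" by (simp add: nrm_mult)
    then show ?thesis using cw cK w(1) by auto
  next
    case True
    have e: "(\<Sum>z\<in>J. c z * z) = (\<Sum>z\<in>J - {w}. (c z - c w * y z) * z)"
    proof -
      have "(\<Sum>z\<in>J. c z * z) = (\<Sum>z\<in>J. c z * z) - c w * S" using True by simp
      also have "\<dots> = (\<Sum>z\<in>J. (c z - c w * y z) * z)"
        unfolding S_def by (simp add: left_diff_distrib sum_subtractf sum_distrib_left mult.assoc)
      also have "\<dots> = (\<Sum>z\<in>J - {w}. (c z - c w * y z) * z)"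
        using sum.remove[OF fin w(1), of "\<lambda>z. (c z - c w * y z) * z"] y w(1) by simp
      finally show ?thesis .
    qed
    have "card (J - {w}) < card J" using fin w(1) by (simp add: card_gt_0_iff ne)
    moreover have "\<forall>z\<in>J - {w}. c z - c w * y z \<in> K"
      using cK y w(1) by (auto intro!: subfldD(4,7)[OF K])
    ultimately show ?thesis unfolding e
      using less.hyps[of "J - {w}" "\<lambda>z. c z - c w * y z"] fin less.prems(2,4) e by auto
  qed
qed

lemma nrm_E: "x \<in> E \<Longrightarrow> x \<noteq> 0 \<Longrightarrow> \<exists>n::int. nrm x = exp (real_of_int n)"
  using nrm_E_aux discrete unfolding E_def by (auto; metis)

section \<open>Invariance of the absolute value under automorphisms\<close>

text \<open>Over the complete field \<open>K\<close> a basis vector has positive distance from the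
  span of the others; this bounds the last coordinate, and induction bounds the rest.\<close>

lemma coordinates_bounded:
  fixes n :: nat
  assumes "linindep K b {..<n}"
  shows "\<exists>C\<ge>0. \<forall>c. (\<forall>i<n. c i \<in> K) \<longrightarrow> (\<forall>i<n. nrm (c i) \<le> C * nrm (\<Sum>i<n. c i * b i))"
  using assms
proof (induction n)
  case 0
  show ?case by (intro exI[of _ 0]) auto
next
  case (Suc n)
  have ext: "(\<Sum>i<Suc n. (if i < n then c i else e) * b i) = (\<Sum>i<n. c i * b i) + e * b n" for c e
    by simp
  have "linindep K b {..<n}"
    unfolding linindep_def
  proof (intro allI impI ballI)
    fix c i assume c: "(\<forall>j\<in>{..<n}. c j \<in> K) \<and> (\<Sum>j<n. c j * b j) = 0" and i: "i \<in> {..<n}"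
    have "\<forall>j\<in>{..<Suc n}. (if j < n then c j else 0) = 0"
      using Suc.prems[unfolded linindep_def, rule_format, of "\<lambda>i. if i < n then c i else 0"] c ext[of c 0]
        subfldD(1)[OF K] by simp
    from bspec[OF this, of i] show "c i = 0" using i by simp
  qed
  from Suc.IH[OF this] obtain C where C: "0 \<le> C"
    "\<And>c i. (\<forall>i<n. c i \<in> K) \<Longrightarrow> i < n \<Longrightarrow> nrm (c i) \<le> C * nrm (\<Sum>i<n. c i * b i)" by auto
  \<comment> \<open>If the distance of \<open>b n\<close> from the span were zero, the coordinates
    of approximating vectors would be Cauchy by the induction hypothesis, and their limits would
    give a linear relation.\<close>
  have "\<exists>\<delta>>0. \<forall>c. (\<forall>i<n. c i \<in> K) \<longrightarrow> \<delta> \<le> nrm (b n + (\<Sum>i<n. c i * b i))"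
  proof (rule ccontr)
    assume neg: "\<not> ?thesis"
    have "\<forall>k::nat. \<exists>c. (\<forall>i<n. c i \<in> K) \<and> nrm (b n + (\<Sum>i<n. c i * b i)) < 1 / real (Suc k)"
    proof
      fix k :: nat
      have "0 < 1 / real (Suc k)" by simp
      then show "\<exists>c. (\<forall>i<n. c i \<in> K) \<and> nrm (b n + (\<Sum>i<n. c i * b i)) < 1 / real (Suc k)"
        using neg by (meson not_less)
    qed
    then obtain c where cK: "\<And>k i. i < n \<Longrightarrow> c k i \<in> K"
      and c: "\<And>k::nat. nrm (b n + (\<Sum>i<n. c k i * b i)) < 1 / real (Suc k)" by metis
    have diff: "nrm (c k i - c l i) \<le> C * (1 / real (Suc N))" if "N \<le> k" "N \<le> l" "i < n" for k l i N
    proof -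
      have le: "1 / real (Suc k) \<le> 1 / real (Suc N)" "1 / real (Suc l) \<le> 1 / real (Suc N)"
        using that by (auto simp: frac_le)
      have "(\<Sum>i<n. (c k i - c l i) * b i) = (b n + (\<Sum>i<n. c k i * b i)) - (b n + (\<Sum>i<n. c l i * b i))"
        by (simp add: left_diff_distrib sum_subtractf)
      then have "nrm (\<Sum>i<n. (c k i - c l i) * b i) \<le>
          max (nrm (b n + (\<Sum>i<n. c k i * b i))) (nrm (b n + (\<Sum>i<n. c l i * b i)))"
        by (simp only: nrm_diff)
      also have "\<dots> \<le> 1 / real (Suc N)"
        by (intro max.boundedI) (use c[of k] c[of l] le in linarith)+
      finally have "nrm (\<Sum>i<n. (c k i - c l i) * b i) \<le> 1 / real (Suc N)" .
      moreover have "nrm (c k i - c l i) \<le> C * nrm (\<Sum>i<n. (c k i - c l i) * b i)"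
        by (rule C(2)) (use cK that in \<open>auto intro: subfldD(7)[OF K]\<close>)
      ultimately show ?thesis using mult_left_mono[OF _ C(1)] by (meson order_trans)
    qed
    have "\<exists>l\<in>K. \<forall>e>0. \<exists>N. \<forall>k\<ge>N. nrm (c k i - l) < e" if i: "i < n" for i
    proof (rule K_complete)
      show "c k i \<in> K" for k using cK i .
      fix e :: real assume e: "0 < e"
      obtain N where N: "C / e < real N" using reals_Archimedean2 by blast
      then have "C < e * real N" using e by (simp add: field_simps)
      also have "\<dots> \<le> e * real (Suc N)" using e by simp
      finally have "C < e * real (Suc N)" .
      then have "C * (1 / real (Suc N)) < e" by (simp add: field_simps)
      then show "\<exists>N. \<forall>m\<ge>N. \<forall>k\<ge>N. nrm (c m i - c k i) < e" using diff i by (meson le_less_trans)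
    qed
    then have "\<forall>i. \<exists>l. i < n \<longrightarrow> l \<in> K \<and> (\<forall>e>0. \<exists>N. \<forall>k\<ge>N. nrm (c k i - l) < e)" by blast
    then obtain l where l: "\<And>i. i < n \<Longrightarrow> l i \<in> K"
      "\<And>i e. i < n \<Longrightarrow> 0 < e \<Longrightarrow> \<exists>N. \<forall>k\<ge>N. nrm (c k i - l i) < e" by metis
    have "b n + (\<Sum>i<n. l i * b i) = 0"
    proof (rule ccontr)
      assume nz: "b n + (\<Sum>i<n. l i * b i) \<noteq> 0"
      define e where "e = nrm (b n + (\<Sum>i<n. l i * b i))"
      have e: "0 < e" unfolding e_def by (rule nrm_pos[OF nz])
      have "\<exists>N. \<forall>k\<ge>N. nrm ((c k i - l i) * b i) < e" if i: "i < n" for i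
      proof -
        have pos: "0 < nrm (b i) + 1" using nrm_ge_0[of "b i"] by linarith
        obtain N where N: "\<forall>k\<ge>N. nrm (c k i - l i) < e / (nrm (b i) + 1)"
          using l(2)[OF i, of "e / (nrm (b i) + 1)"] e pos by auto
        have "nrm ((c k i - l i) * b i) < e" if "N \<le> k" for k
        proof -
          have "nrm (c k i - l i) * nrm (b i) \<le> nrm (c k i - l i) * (nrm (b i) + 1)"
            by (intro mult_left_mono) auto
          also have "\<dots> < e" using N that pos by (simp add: less_divide_eq)
          finally show ?thesis by (simp add: nrm_mult)
        qed
        then show ?thesis by auto
      qed
      then obtain N where N: "\<And>i k. i < n \<Longrightarrow> N i \<le> k \<Longrightarrow> nrm ((c k i - l i) * b i) < e" by metis
      obtain M where M: "1 / e < real M" using reals_Archimedean2 by blast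
      define k where "k = M + (\<Sum>i<n. N i)"
      have Nk: "N i \<le> k" if "i < n" for i
        unfolding k_def using member_le_sum[of i "{..<n}" N] that by simp
      have "nrm (\<Sum>i<n. (c k i - l i) * b i) < e" using N Nk e by (intro nrm_sum_less) auto
      moreover have "nrm (b n + (\<Sum>i<n. c k i * b i)) < e"
      proof -
        have "1 / e < real (Suc k)" using M unfolding k_def by linarith
        then have "1 / real (Suc k) < e" using e by (simp add: field_simps)
        then show ?thesis using c[of k] by linarith
      qed
      ultimately have "nrm ((b n + (\<Sum>i<n. c k i * b i)) - (\<Sum>i<n. (c k i - l i) * b i)) < e"
        by (intro le_less_trans[OF nrm_diff] max_less_iff_conj[THEN iffD2]) auto
      then show False unfolding e_def by (simp add: left_diff_distrib sum_subtractf)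
    qed
    then have "(\<Sum>i<Suc n. (if i < n then l i else 1) * b i) = 0" using ext[of l 1] by (simp add: add.commute)
    moreover have "\<forall>j\<in>{..<Suc n}. (if j < n then l j else 1) \<in> K"
      using l(1) subfldD(2)[OF K] by simp
    ultimately have "\<forall>j\<in>{..<Suc n}. (if j < n then l j else 1) = 0"
      by (rule Suc.prems[unfolded linindep_def, THEN spec, THEN mp, OF conjI, rotated])
    from bspec[OF this, of n] show False by simp
  qed
  then obtain \<delta> where \<delta>: "0 < \<delta>" "\<And>c. (\<forall>i<n. c i \<in> K) \<Longrightarrow> \<delta> \<le> nrm (b n + (\<Sum>i<n. c i * b i))" by auto
  \<comment> \<open>The summand \<open>1 / \<delta>\<close> bounds the coordinate at
    \<open>b n\<close>. The other summand bounds the remaining coordinates, obtained from the vector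
    after its last component is subtracted.\<close>
  define C' where "C' = C * (1 + nrm (b n) / \<delta>) + 1 / \<delta>"
  have C'0: "0 \<le> C'" "C * (1 + nrm (b n) / \<delta>) \<le> C'" "1 / \<delta> \<le> C'"
    unfolding C'_def using C(1) \<delta>(1) by (auto intro!: add_nonneg_nonneg mult_nonneg_nonneg)
  have "nrm (c i) \<le> C' * nrm (\<Sum>i<Suc n. c i * b i)" if cK: "\<forall>i<Suc n. c i \<in> K" and i: "i < Suc n" for c i
  proof -
    let ?t = "\<Sum>i<Suc n. c i * b i"
    have cn: "nrm (c n) \<le> 1 / \<delta> * nrm ?t"
    proof (cases "c n = 0")
      case False
      have "\<delta> \<le> nrm (b n + (\<Sum>i<n. (c i / c n) * b i))"
        by (rule \<delta>(2)) (use cK in \<open>auto intro: subfldD(8)[OF K]\<close>)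
      moreover have "?t = c n * (b n + (\<Sum>i<n. (c i / c n) * b i))"
        using False by (simp add: distrib_left sum_distrib_left add.commute)
      ultimately have "nrm (c n) * \<delta> \<le> nrm ?t" by (simp only: nrm_mult mult_left_mono nrm_ge_0)
      then show ?thesis using \<delta>(1) by (simp add: field_simps)
    qed (use \<delta> in simp)
    show ?thesis
    proof (cases "i = n")
      case True
      then show ?thesis using cn mult_right_mono[OF C'0(3), of "nrm ?t"] by simp
    next
      case False
      then have "i < n" using i by simp
      have "(\<Sum>i<n. c i * b i) = ?t - c n * b n" by simp
      then have "nrm (\<Sum>i<n. c i * b i) \<le> max (nrm ?t) (nrm (c n) * nrm (b n))"
        using nrm_diff[of ?t "c n * b n"] by (simp only: nrm_mult)
      also have "\<dots> \<le> nrm ?t + nrm (c n) * nrm (b n)" by simp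
      also have "\<dots> \<le> nrm ?t + (1 / \<delta> * nrm ?t) * nrm (b n)"
        by (intro add_left_mono mult_right_mono cn) simp
      also have "\<dots> = (1 + nrm (b n) / \<delta>) * nrm ?t" by (simp add: algebra_simps)
      finally have "C * nrm (\<Sum>i<n. c i * b i) \<le> C * ((1 + nrm (b n) / \<delta>) * nrm ?t)"
        by (rule mult_left_mono[OF _ C(1)])
      moreover have "nrm (c i) \<le> C * nrm (\<Sum>i<n. c i * b i)" by (rule C(2)) (use cK \<open>i < n\<close> in auto)
      moreover have "C * (1 + nrm (b n) / \<delta>) * nrm ?t \<le> C' * nrm ?t" by (intro mult_right_mono C'0) simp
      ultimately show ?thesis by (simp add: mult.assoc)
    qed
  qed
  then show ?case using C'0(1) by blast
qed

text \<open>All powers \<open>x ^ m\<close> have coordinates in one fixed basis, bounded by a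
  constant times \<open>nrm x ^ m\<close>. Hence
  \<open>nrm (\<sigma> x) ^ m \<le> D * nrm x ^ m\<close> with \<open>D\<close> independent of
  \<open>m\<close>, and \<open>m\<close> tends to infinity.\<close>

lemma nrm_aut_le:
  assumes \<sigma>: "field_aut \<sigma>" "\<And>a. a \<in> K \<Longrightarrow> \<sigma> a = a"
  shows "nrm (\<sigma> x) \<le> nrm x"
proof (cases "x = 0")
  case True
  then show ?thesis using field_autD(3)[OF \<sigma>(1)] by simp
next
  case False
  from minimal_poly[OF K alg[of x]]
  obtain \<mu> where \<mu>: "\<forall>i. Polynomial.coeff \<mu> i \<in> K" "Polynomial.coeff \<mu> (Polynomial.degree \<mu>) = 1" "poly \<mu> x = 0"
      "Polynomial.degree \<mu> > 0"
      "\<And>R. R \<noteq> 0 \<Longrightarrow> \<forall>i. Polynomial.coeff R i \<in> K \<Longrightarrow> poly R x = 0 \<Longrightarrow> Polynomial.degree \<mu> \<le> Polynomial.degree R"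
    by metis
  let ?n = "Polynomial.degree \<mu>"
  have "linindep K (\<lambda>i. x ^ i) {..<?n}" by (rule minimal_poly_linindep[OF K \<mu>(4,5)])
  from coordinates_bounded[OF this] obtain C where C: "0 \<le> C"
    "\<And>c i. (\<forall>i<?n. c i \<in> K) \<Longrightarrow> i < ?n \<Longrightarrow> nrm (c i) \<le> C * nrm (\<Sum>i<?n. c i * x ^ i)" by auto
  define D where "D = C * (\<Sum>i<?n. nrm (\<sigma> x) ^ i)"
  have D0: "0 \<le> D" unfolding D_def using C(1) by (intro mult_nonneg_nonneg sum_nonneg) auto
  have bound: "nrm (\<sigma> x) ^ m \<le> D * nrm x ^ m" for m
  proof -
    obtain c where c: "\<forall>i<?n. c i \<in> K" "x ^ m = (\<Sum>i<?n. c i * x ^ i)"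
      using powers_in_span[OF K \<mu>(1-3), of m] unfolding lspan_def by auto
    have "\<sigma> x ^ m = (\<Sum>i<?n. c i * \<sigma> x ^ i)"
      using arg_cong[OF c(2), of \<sigma>] c(1) \<sigma>(2) by (simp add: field_aut_sum[OF \<sigma>(1)] field_autD[OF \<sigma>(1)])
    moreover have "nrm (\<Sum>i<?n. c i * \<sigma> x ^ i) \<le> D * nrm x ^ m"
    proof (rule nrm_sum_le)
      fix i assume i: "i \<in> {..<?n}"
      have "nrm (c i) \<le> C * nrm x ^ m" using C(2)[OF c(1), of i] i c(2) by (simp add: nrm_power[symmetric])
      then have "nrm (c i) * nrm (\<sigma> x) ^ i \<le> (C * nrm x ^ m) * (\<Sum>i<?n. nrm (\<sigma> x) ^ i)"
        using C(1) i member_le_sum[of i "{..<?n}" "\<lambda>i. nrm (\<sigma> x) ^ i"] by (intro mult_mono) auto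
      then show "nrm (c i * \<sigma> x ^ i) \<le> D * nrm x ^ m" unfolding D_def by (simp add: nrm_mult nrm_power mult_ac)
    qed (use D0 in simp)
    ultimately show ?thesis by (simp add: nrm_power[symmetric])
  qed
  show ?thesis
  proof (rule ccontr)
    assume "\<not> ?thesis"
    then have "1 < nrm (\<sigma> x) / nrm x" using nrm_pos[OF False] by simp
    then obtain m where "D < (nrm (\<sigma> x) / nrm x) ^ m" using real_arch_pow by blast
    then have "D * nrm x ^ m < nrm (\<sigma> x) ^ m" using nrm_pos[OF False] by (simp add: power_divide field_simps)
    then show False using bound[of m] by simp
  qed
qed

text \<open>The inertia group with \<open>K\<close> in place of its perfection; both versions agree
  because an automorphism fixing \<open>K\<close> fixes all p-power roots of its elements, as
  \<open>inertia_eq\<close> shows.\<close>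

definition Iner :: "('a \<Rightarrow> 'a) set" where
  "Iner = {\<sigma>. field_aut \<sigma> \<and> (\<forall>x\<in>K. \<sigma> x = x) \<and> (\<forall>x. nrm x \<le> 1 \<longrightarrow> nrm (\<sigma> x - x) < 1)}"

lemma InerD:
  assumes "\<sigma> \<in> Iner"
  shows "field_aut \<sigma>" "\<And>x. x \<in> E \<Longrightarrow> \<sigma> x = x" "\<And>x. nrm x \<le> 1 \<Longrightarrow> nrm (\<sigma> x - x) < 1"
    "\<And>x. nrm (\<sigma> x) \<le> nrm x"
proof -
  show aut: "field_aut \<sigma>" and res: "\<And>x. nrm x \<le> 1 \<Longrightarrow> nrm (\<sigma> x - x) < 1"
    using assms unfolding Iner_def by auto
  have fixK: "\<And>x. x \<in> K \<Longrightarrow> \<sigma> x = x" using assms unfolding Iner_def by auto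
  show "\<And>x. nrm (\<sigma> x) \<le> nrm x" by (rule nrm_aut_le[OF aut fixK])
  \<comment> \<open>\<open>\<sigma> z - z\<close> is again a constant and has absolute value less
    than 1, so it is zero.\<close>
  have fixkb: "\<sigma> z = z" if z: "z \<in> kb" for z
  proof -
    obtain n where n: "0 < n" "z ^ (p ^ n) = z" using z unfolding kb_def by auto
    have "\<sigma> z \<in> kb" by (rule kbI[OF n(1)]) (metis field_autD(8)[OF aut] n(2))
    then have d: "\<sigma> z - z \<in> kb" using z by (intro subfldD(7)[OF subfld_kb])
    have "nrm z \<le> 1" using kb_nrm[OF z] by (cases "z = 0") auto
    then show ?thesis using kb_nrm_less_1[OF d res] by simp
  qed
  show "\<sigma> x = x" if x: "x \<in> E" for x
  proof -
    obtain I c where x: "x = (\<Sum>z\<in>I. c z * z)" "I \<subseteq> kb" "\<forall>z\<in>I. c z \<in> K"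
      using x unfolding E_def by auto
    show ?thesis unfolding x(1) field_aut_sum[OF aut]
      using x fixkb fixK by (intro sum.cong) (auto simp: field_autD(5)[OF aut])
  qed
qed

text \<open>Every integral element is a constant of \<open>E\<close> plus a small element, and
  automorphisms do not enlarge small elements. Thus inertia is the group of automorphisms over
  \<open>E\<close>.\<close>

lemma InerI:
  assumes "field_aut \<sigma>" "\<And>x. x \<in> E \<Longrightarrow> \<sigma> x = x"
  shows "\<sigma> \<in> Iner"
  unfolding Iner_def
proof (intro CollectI conjI ballI allI impI)
  show "field_aut \<sigma>" by fact
  show fixK: "\<sigma> x = x" if "x \<in> K" for x using that assms(2) K_sub_E by auto
  fix x assume "nrm x \<le> 1"
  then obtain z where z: "z \<in> kb" "nrm (x - z) < 1" using residue_lift by auto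
  have "\<sigma> x - x = \<sigma> (x - z) - (x - z)"
    using assms(2)[of z] kb_sub_E z(1) by (auto simp: field_autD[OF assms(1)])
  moreover have "nrm (\<sigma> (x - z)) < 1" using nrm_aut_le[OF assms(1) fixK, of "x - z"] z(2) by simp
  ultimately show "nrm (\<sigma> x - x) < 1" using z(2) nrm_less_1_diff by metis
qed

end

section \<open>Kummer theory at a finite level\<close>

context local_closure
begin

text \<open>Reduction modulo the maximal ideal with values in the field \<open>kb\<close>, where
  reductions can be added and raised to powers.\<close>

definition res :: "'a \<Rightarrow> 'a" where
  "res y = (SOME z. z \<in> kb \<and> nrm (y - z) < 1)"

lemma res: "nrm y \<le> 1 \<Longrightarrow> res y \<in> kb" "nrm y \<le> 1 \<Longrightarrow> nrm (y - res y) < 1"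
  using residue_lift[of y] someI_ex[of "\<lambda>z. z \<in> kb \<and> nrm (y - z) < 1"] unfolding res_def by auto

lemma res_unique: "z \<in> kb \<Longrightarrow> nrm (y - z) < 1 \<Longrightarrow> res y = z"
proof -
  assume z: "z \<in> kb" "nrm (y - z) < 1"
  have "nrm z \<le> 1" using kb_nrm[OF z(1)] by (cases "z = 0") auto
  then have y: "nrm y \<le> 1" using nrm_add[of "y - z" z] z(2) by simp
  have "nrm ((y - z) - (y - res y)) < 1" by (rule nrm_less_1_diff[OF z(2) res(2)[OF y]])
  then have "nrm (res y - z) < 1" by simp
  moreover have "res y - z \<in> kb" by (rule subfldD(7)[OF subfld_kb res(1)[OF y] z(1)])
  ultimately show ?thesis using kb_nrm_less_1 by fastforce
qed

lemma Iner_comp: "\<sigma> \<in> Iner \<Longrightarrow> \<tau> \<in> Iner \<Longrightarrow> \<sigma> \<circ> \<tau> \<in> Iner"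
proof (rule InerI)
  assume \<sigma>: "\<sigma> \<in> Iner" and \<tau>: "\<tau> \<in> Iner"
  show "field_aut (\<sigma> \<circ> \<tau>)"
    using InerD(1)[OF \<sigma>] InerD(1)[OF \<tau>] by (auto simp: field_aut_def bij_comp)
  show "(\<sigma> \<circ> \<tau>) x = x" if "x \<in> E" for x
    using InerD(2)[OF \<sigma> that] InerD(2)[OF \<tau> that] by simp
qed

lemma id_Iner: "id \<in> Iner"
  by (rule InerI) (auto simp: field_aut_def)

lemma nmul_of_nat: "nmul k (x::'a) = of_nat k * x"
  by (induction k) (auto simp: algebra_simps)

lemma nmul_fun: "nmul k (h :: 'c \<Rightarrow> 'a) i = nmul k (h i)"
  by (induction k) auto

text \<open>The hypothesis puts each generator into the \<open>E\<close>-span of 1 and of p-th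
  powers of its own powers. The generated ring is then spanned by its p-th powers, so that
  \<open>aut_moving\<close> produces an element of inertia moving any given element outside
  \<open>E\<close>.\<close>

lemma generated_fixed_in_E:
  assumes "finite G" "\<And>t. t \<in> G \<Longrightarrow> \<exists>n e c. e \<in> E \<and> (\<forall>k. c k \<in> E) \<and> t = e + (\<Sum>k<(n::nat). c k * t ^ (p ^ Suc k))"
  shows "\<exists>B. E \<subseteq> B \<and> G \<subseteq> B \<and> (\<forall>x\<in>B. \<forall>y\<in>B. x + y \<in> B \<and> x * y \<in> B) \<and>
    (\<forall>z\<in>B. (\<forall>\<sigma>\<in>Iner. \<sigma> z = z) \<longrightarrow> z \<in> E)"
proof -
  from finite_algebra[OF subfld_E assms(1) algE]
  obtain B J where B: "finite J" "B \<subseteq> lspan E (\<lambda>x. x) J" "E \<subseteq> B" "G \<subseteq> B"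
    "\<And>x y. x \<in> B \<Longrightarrow> y \<in> B \<Longrightarrow> x + y \<in> B" "\<And>x y. x \<in> B \<Longrightarrow> y \<in> B \<Longrightarrow> x * y \<in> B"
    "\<And>C. E \<subseteq> C \<Longrightarrow> G \<subseteq> C \<Longrightarrow> (\<forall>x\<in>C. \<forall>y\<in>C. x + y \<in> C \<and> x * y \<in> C) \<Longrightarrow> B \<subseteq> C"
    by metis
  note EE = subfldD[OF subfld_E]
  have B1: "1 \<in> B" using B(3) EE(2) by auto
  have Bpow: "x ^ n \<in> B" if "x \<in> B" for x and n :: nat
    by (induction n) (use that B1 B(6) in auto)
  \<comment> \<open>The \<open>E\<close>-span of the p-th powers of \<open>B\<close>. It is closed
    under sums and products and contains \<open>E\<close> and \<open>G\<close>, hence all of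
    \<open>B\<close> by minimality.\<close>
  define C where "C = (\<Union>I\<in>{I. finite I \<and> I \<subseteq> B}. lspan E (\<lambda>y. y ^ p) I)"
  have C_add: "x + y \<in> C" if "x \<in> C" "y \<in> C" for x y
  proof -
    obtain I I' where I: "finite I" "I \<subseteq> B" "x \<in> lspan E (\<lambda>y. y ^ p) I"
      "finite I'" "I' \<subseteq> B" "y \<in> lspan E (\<lambda>y. y ^ p) I'" using \<open>x \<in> C\<close> \<open>y \<in> C\<close> unfolding C_def by auto
    have "x \<in> lspan E (\<lambda>y. y ^ p) (I \<union> I')" "y \<in> lspan E (\<lambda>y. y ^ p) (I \<union> I')"
      using lspan_mono[OF subfld_E, of "I \<union> I'" I] lspan_mono[OF subfld_E, of "I \<union> I'" I'] I by blast+
    then have "x + y \<in> lspan E (\<lambda>y. y ^ p) (I \<union> I')" by (rule lspan_add[OF subfld_E])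
    then show ?thesis unfolding C_def using I by blast
  qed
  have C_term: "e * y ^ p \<in> C" if "e \<in> E" "y \<in> B" for e y
  proof -
    have "e * y ^ p \<in> lspan E (\<lambda>y. y ^ p) {y}"
      unfolding lspan_def using that by (intro CollectI exI[of _ "\<lambda>_. e"]) auto
    then show ?thesis unfolding C_def using that(2) by blast
  qed
  have EC: "e \<in> C" if "e \<in> E" for e using C_term[OF that B1] by simp
  have C_sum: "(\<Sum>i\<in>I. f i) \<in> C" if "\<And>i. i \<in> I \<Longrightarrow> f i \<in> C" for I :: "'i set" and f
    using that
  proof (induction I rule: infinite_finite_induct)
    case (insert i I)
    have "(\<Sum>i\<in>I. f i) \<in> C" by (rule insert.IH) (use insert.prems in simp)
    then show ?case using insert.hyps C_add[of "f i"] insert.prems[of i] by simp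
  qed (use EC[OF EE(1)] in simp_all)
  have C_mult: "x * y \<in> C" if "x \<in> C" "y \<in> C" for x y
  proof -
    obtain I where I: "finite I" "I \<subseteq> B" "x \<in> lspan E (\<lambda>y. y ^ p) I" using \<open>x \<in> C\<close> unfolding C_def by auto
    obtain I' where I': "finite I'" "I' \<subseteq> B" "y \<in> lspan E (\<lambda>y. y ^ p) I'" using \<open>y \<in> C\<close> unfolding C_def by auto
    obtain c where c: "x = (\<Sum>u\<in>I. c u * u ^ p)" "\<forall>u\<in>I. c u \<in> E" using I(3) unfolding lspan_def by auto
    obtain d where d: "y = (\<Sum>u\<in>I'. d u * u ^ p)" "\<forall>u\<in>I'. d u \<in> E" using I'(3) unfolding lspan_def by auto
    have "x * y = (\<Sum>u\<in>I. \<Sum>w\<in>I'. (c u * d w) * (u * w) ^ p)"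
      unfolding c(1) d(1) sum_product by (intro sum.cong refl) (simp add: power_mult_distrib mult_ac)
    also have "\<dots> \<in> C"
    proof (intro C_sum)
      fix u w assume "u \<in> I" "w \<in> I'"
      then show "(c u * d w) * (u * w) ^ p \<in> C"
        using c(2) d(2) I(2) I'(2) by (intro C_term EE(4) B(6)) auto
    qed
    finally show ?thesis .
  qed
  have "G \<subseteq> C"
  proof
    fix t assume t: "t \<in> G"
    from assms(2)[OF t] obtain n e c where e: "e \<in> E" "\<And>k. c k \<in> E" "t = e + (\<Sum>k<(n::nat). c k * t ^ (p ^ Suc k))" by auto
    have tB: "t \<in> B" using t B(4) by auto
    have "c k * t ^ (p ^ Suc k) \<in> C" for k
    proof -
      have "t ^ (p ^ Suc k) = (t ^ (p ^ k)) ^ p" by (simp add: power_mult[symmetric] mult.commute)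
      then show ?thesis using C_term[OF e(2) Bpow[OF tB]] by simp
    qed
    then have "e + (\<Sum>k<n. c k * t ^ (p ^ Suc k)) \<in> C" by (rule C_add[OF EC[OF e(1)] C_sum])
    then show "t \<in> C" using e(3) by simp
  qed
  then have "B \<subseteq> C" by (intro B(7)) (use EC C_add C_mult in auto)
  then have gen: "\<exists>I. I \<subseteq> B \<and> x \<in> lspan E (\<lambda>y. y ^ CHAR('a)) I" if "x \<in> B" for x
    using that unfolding C_def p_eq by auto
  have fixed: "z \<in> E" if z: "z \<in> B" "\<And>\<sigma>. \<sigma> \<in> Iner \<Longrightarrow> \<sigma> z = z" for z
  proof (rule ccontr)
    assume "z \<notin> E"
    from aut_moving[OF prime_char subfld_E algE B(1,2) gen Bpow[OF z(1)] this]
    obtain \<sigma> where \<sigma>: "field_aut \<sigma>" "\<forall>e\<in>E. \<sigma> e = e" "\<sigma> z \<noteq> z" by auto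
    have "\<sigma> \<in> Iner" by (rule InerI) (use \<sigma> in auto)
    then show False using z(2) \<sigma>(3) by simp
  qed
  show ?thesis using B(3-6) fixed by (intro exI[of _ B]) simp
qed

definition addpoly :: "(nat \<Rightarrow> 'a) \<Rightarrow> nat \<Rightarrow> 'a \<Rightarrow> 'a" where
  "addpoly b n y = (\<Sum>k\<le>n. b k * y ^ (p ^ k))"

lemma addpoly_add: "addpoly b n (x + y) = addpoly b n x + addpoly b n y"
  unfolding addpoly_def by (simp add: frob_add distrib_left sum.distrib)

lemma addpoly_0 [simp]: "addpoly b n 0 = 0"
  unfolding addpoly_def using p_gt_1 by (simp add: power_0_left)

lemma addpoly_minus: "addpoly b n (- x) = - addpoly b n x"
  using addpoly_add[of b n x "- x"] by (simp add: eq_neg_iff_add_eq_0 add.commute)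

lemma addpoly_diff: "addpoly b n (x - y) = addpoly b n x - addpoly b n y"
  using addpoly_add[of b n x "- y"] addpoly_minus[of b n y] by simp

lemma addpoly_aut:
  "field_aut \<sigma> \<Longrightarrow> (\<And>k. k \<le> n \<Longrightarrow> \<sigma> (b k) = b k) \<Longrightarrow> \<sigma> (addpoly b n x) = addpoly b n (\<sigma> x)"
  unfolding addpoly_def by (simp add: field_aut_sum field_autD)

lemma p_pow_inj: "p ^ i = p ^ j \<longleftrightarrow> i = j"
  using p_gt_1 by simp

lemma nrm_addpoly_le_1:
  assumes "\<And>k. k \<le> n \<Longrightarrow> nrm (b k) \<le> 1" "nrm y \<le> 1"
  shows "nrm (addpoly b n y) \<le> 1"
  unfolding addpoly_def
  by (rule nrm_sum_le) (use assms in \<open>auto intro!: nrm_le_1_mult simp: nrm_power power_le_one\<close>)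

lemma nrm_addpoly_gt_1:
  assumes "\<And>k. k \<le> n \<Longrightarrow> nrm (b k) \<le> 1" "nrm (b n) = 1" "1 < nrm y"
  shows "nrm (addpoly b n y) = nrm y ^ (p ^ n)"
proof -
  have "nrm (addpoly b n y) = nrm (b n * y ^ (p ^ n))"
    unfolding addpoly_def
  proof (rule nrm_sum_dominant)
    fix k assume k: "k \<in> {..n}" "k \<noteq> n"
    have "nrm (b k) * nrm y ^ (p ^ k) \<le> 1 * nrm y ^ (p ^ k)"
      using assms(1)[of k] k by (intro mult_right_mono) auto
    also have "\<dots> < nrm y ^ (p ^ n)"
      using k p_gt_1 assms(3) by (simp add: power_strict_increasing)
    finally show "nrm (b k * y ^ p ^ k) < nrm (b n * y ^ p ^ n)"
      using assms(2) by (simp add: nrm_mult nrm_power)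
  qed (use assms in auto)
  then show ?thesis using assms(2) by (simp add: nrm_mult nrm_power)
qed

lemma nrm_addpoly_iff:
  assumes "\<And>k. k \<le> n \<Longrightarrow> nrm (b k) \<le> 1" "nrm (b n) = 1"
  shows "nrm (addpoly b n y) \<le> 1 \<longleftrightarrow> nrm y \<le> 1"
proof
  assume "nrm (addpoly b n y) \<le> 1"
  show "nrm y \<le> 1"
  proof (rule ccontr)
    assume "\<not> nrm y \<le> 1"
    then have y: "1 < nrm y" by simp
    then have "1 < nrm y ^ (p ^ n)" using p_gt_1 by (intro one_less_power) auto
    then show False using nrm_addpoly_gt_1[of n b y] assms y \<open>nrm (addpoly b n y) \<le> 1\<close> by simp
  qed
next
  assume "nrm y \<le> 1"
  then show "nrm (addpoly b n y) \<le> 1" by (intro nrm_addpoly_le_1) (use assms(1) in auto)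
qed

lemma pderiv_sum_fun: "pderiv (\<Sum>k\<in>A. F k) = (\<Sum>k\<in>A. pderiv (F k :: 'a poly))"
  by (induction A rule: infinite_finite_induct) (auto simp: pderiv_add)

text \<open>All terms except the linear one have derivative zero in characteristic \<open>p\<close>,
  so the derivative is the constant \<open>b 0\<close> and every root is simple.\<close>

lemma addpoly_roots:
  assumes "b 0 \<noteq> 0" "b n \<noteq> 0"
  shows "finite {w. addpoly b n w = 0}" "card {w. addpoly b n w = 0} = p ^ n"
    "addpoly b n y = b n * (\<Prod>w\<in>{w. addpoly b n w = 0}. y - w)"
proof -
  define G where "G = (\<Sum>k\<le>n. Polynomial.monom (b k) (p ^ k))"
  have ev: "poly G y = addpoly b n y" for y unfolding G_def addpoly_def by (simp add: poly_sum poly_monom)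
  have coeff: "Polynomial.coeff G i = (\<Sum>k\<le>n. if p ^ k = i then b k else 0)" for i
    unfolding G_def by (simp add: coeff_sum)
  have cn: "Polynomial.coeff G (p ^ n) = b n" unfolding coeff by (simp add: p_pow_inj)
  then have G0: "G \<noteq> 0" using assms(2) by auto
  have deg: "Polynomial.degree G = p ^ n"
  proof (rule antisym)
    show "Polynomial.degree G \<le> p ^ n"
    proof (rule degree_le, intro allI impI)
      fix i assume i: "p ^ n < i"
      have "p ^ k \<noteq> i" if "k \<le> n" for k
      proof -
        have "p ^ k \<le> p ^ n" by (rule power_increasing) (use that p_gt_1 in auto)
        then show ?thesis using i by linarith
      qed
      then show "Polynomial.coeff G i = 0" unfolding coeff by (intro sum.neutral) auto
    qed
    show "p ^ n \<le> Polynomial.degree G" by (rule le_degree) (use cn assms(2) in simp)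
  qed
  have char0: "of_nat (p ^ Suc k) = (0::'a)" for k
    using of_nat_CHAR[where 'a = 'a] by (simp add: p_eq)
  have pd: "pderiv (Polynomial.monom (b k) (p ^ k)) = (if k = 0 then [:b 0:] else 0)" for k
  proof (cases k)
    case 0
    then show ?thesis by (simp add: pderiv_monom monom_0)
  next
    case (Suc m)
    then show ?thesis unfolding pderiv_monom using char0[of m] by simp
  qed
  have "pderiv G = (\<Sum>k\<le>n. if k = 0 then [:b 0:] else 0)"
    unfolding G_def pderiv_sum_fun pd ..
  then have "pderiv G = [:b 0:]" by simp
  then have simple: "poly (pderiv G) w \<noteq> 0" for w using assms(1) by simp
  show "finite {w. addpoly b n w = 0}" using poly_roots_finite[OF G0] unfolding ev .
  show "card {w. addpoly b n w = 0} = p ^ n"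
    using split_simple_roots(1)[OF G0 simple] by (simp only: ev deg)
  show "addpoly b n y = b n * (\<Prod>w\<in>{w. addpoly b n w = 0}. y - w)"
    using split_simple_roots(2)[OF G0 simple, of y] by (simp only: ev deg cn)
qed

text \<open>The image \<open>H\<close> of inertia carries the additive functions \<open>h \<mapsto> h\<^sub>i\<^bsup>p\<^sup>k\<^esup>\<close>. A relation
  between them over \<open>E\<close> is an inertia invariant combination of the \<open>y\<^sub>i\<^bsup>p\<^sup>k\<^esup>\<close>, whose
  valuation lies strictly between \<open>-1\<close> and \<open>0\<close>, whereas \<open>E\<close> has integral valuations. The
  roots of \<open>f\<close> are those roots of the given polynomial that vanish in the residue field, so
  that passing from \<open>x\<^sub>i\<close> to \<open>y\<^sub>i = f x\<^sub>i\<close> removes the ramification of the torsion points.\<close>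

lemma level_bound:
  fixes b \<xi> x :: "nat \<Rightarrow> 'a"
  assumes b: "\<And>k. k \<le> n \<Longrightarrow> b k \<in> K" "\<And>k. k \<le> n \<Longrightarrow> nrm (b k) \<le> 1" "b 0 \<noteq> 0" "nrm (b n) = 1"
    and \<xi>: "\<And>i. i < r \<Longrightarrow> \<xi> i \<in> K" "\<And>i. i < r \<Longrightarrow> 1 < nrm (\<xi> i)"
    and dist: "\<And>i j k l. i < r \<Longrightarrow> j < r \<Longrightarrow> nrm (\<xi> i) ^ (p ^ k) = nrm (\<xi> j) ^ (p ^ l) \<Longrightarrow> i = j"
    and N: "\<And>i. i < r \<Longrightarrow> nrm (\<xi> i) < exp (real (p ^ N))"
    and x: "\<And>i. i < r \<Longrightarrow> addpoly b n (x i) = \<xi> i"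
  shows "card {w \<in> kb. nrm (addpoly b n w) < 1} ^ r \<le>
    p ^ (r * N) * card ((\<lambda>\<sigma>. \<lambda>i\<in>{..<r}. res (\<sigma> (x i) - x i)) ` Iner)"
proof -

  \<comment> \<open>Torsion points and the additive polynomial vanishing on those with zero
    reduction\<close>
  define W where "W = {w. addpoly b n w = 0}"
  define W0 where "W0 = {w \<in> W. nrm w < 1}"
  have bn0: "b n \<noteq> 0" using b(4) by auto
  note roots = addpoly_roots[of b n, OF b(3) bn0, folded W_def]
  note EE = subfldD[OF subfld_E]
  have bE: "b k \<in> E" if "k \<le> n" for k using b(1)[OF that] K_sub_E by auto
  have \<xi>E: "\<xi> i \<in> E" if "i < r" for i using \<xi>(1)[OF that] K_sub_E by auto
  have gaut: "\<sigma> (addpoly b n y) = addpoly b n (\<sigma> y)" if "\<sigma> \<in> Iner" for \<sigma> y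
    using addpoly_aut[OF InerD(1)[OF that]] InerD(2)[OF that] bE by simp
  have W_add: "u + v \<in> W" "u - v \<in> W" "- u \<in> W" "0 \<in> W" if "u \<in> W" "v \<in> W" for u v
    using that unfolding W_def by (auto simp: addpoly_add addpoly_diff addpoly_minus)
  have zW: "0 \<in> W" unfolding W_def by simp
  have W1: "nrm w \<le> 1" if "w \<in> W" for w
    using nrm_addpoly_iff[of n b w] b(2,4) that unfolding W_def by simp
  have finW: "finite W" "finite W0" using roots(1) unfolding W0_def by auto
  have W0_add: "0 \<in> W0" "u + v \<in> W0" "- u \<in> W0" "u - v \<in> W0" if "u \<in> W0" "v \<in> W0" for u v
    using that W_add[of u v] unfolding W0_def by (auto intro: nrm_less_1_add nrm_less_1_diff)
  have zW0: "0 \<in> W0" using zW unfolding W0_def by simp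
  \<comment> \<open>Additive because its roots form a group, and compatible with inertia because
    inertia permutes \<open>W0\<close>.\<close>
  define f where "f = (\<lambda>y. \<Prod>w\<in>W0. y - w)"
  have f_add: "f (y + z) = f y + f z" for y z
    unfolding f_def by (rule prod_subgroup_additive[OF finW(2) zW0]) (use W0_add in auto)
  have f0: "f 0 = 0" using f_add[of 0 0] by (metis add_0 add_cancel_right_right)
  have f_minus: "f (- y) = - f y" for y using f_add[of y "- y"] f0 by (simp add: eq_neg_iff_add_eq_0 add.commute)
  have f_diff: "f (y - z) = f y - f z" for y z using f_add[of y "- z"] f_minus by simp
  have f_zero: "f y = 0 \<longleftrightarrow> y \<in> W0" for y unfolding f_def using finW(2) by auto
  have \<sigma>W: "\<sigma> w \<in> W" if "\<sigma> \<in> Iner" "w \<in> W" for \<sigma> w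
    using gaut[OF that(1), of w] that(2) field_autD(3)[OF InerD(1)[OF that(1)]] unfolding W_def by auto
  have \<sigma>W0: "\<sigma> ` W0 = W0" if \<sigma>: "\<sigma> \<in> Iner" for \<sigma>
  proof (rule endo_inj_surj[OF finW(2)])
    show "\<sigma> ` W0 \<subseteq> W0" unfolding W0_def using \<sigma>W[OF \<sigma>] InerD(4)[OF \<sigma>] by (auto intro: le_less_trans)
    show "inj_on \<sigma> W0" using field_autD(9)[OF InerD(1)[OF \<sigma>]] by (auto simp: inj_on_def)
  qed
  have f_aut: "\<sigma> (f y) = f (\<sigma> y)" if \<sigma>: "\<sigma> \<in> Iner" for \<sigma> y
  proof -
    have inj: "inj_on \<sigma> W0" using field_autD(9)[OF InerD(1)[OF \<sigma>]] by (auto simp: inj_on_def)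
    have "\<sigma> (f y) = (\<Prod>w\<in>W0. \<sigma> y - \<sigma> w)"
      unfolding f_def by (simp add: field_aut_prod[OF InerD(1)[OF \<sigma>]] field_autD(7)[OF InerD(1)[OF \<sigma>]])
    also have "\<dots> = (\<Prod>w\<in>\<sigma> ` W0. \<sigma> y - w)" by (simp add: prod.reindex[OF inj])
    finally show ?thesis unfolding \<sigma>W0[OF \<sigma>] f_def .
  qed
  \<comment> \<open>A copy of \<open>W / W0\<close>. Its order \<open>p ^ n'\<close> determines how
    many Frobenius powers are available.\<close>
  define V where "V = f ` W"
  have finV: "finite V" unfolding V_def using finW by simp
  have V_add: "u + v \<in> V" if "u \<in> V" "v \<in> V" for u v
    using that W_add unfolding V_def by (auto simp: f_add[symmetric])
  have zV: "0 \<in> V" unfolding V_def using zW f0 by force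
  have charp: "nmul p h = 0" for h :: 'a unfolding nmul_of_nat using of_nat_CHAR[where 'a = 'a] by (simp add: p_eq)
  have prime_p: "Factorial_Ring.prime p" unfolding p_eq by (rule prime_char)
  obtain n' where n': "card V = p ^ n'"
    using elementary_abelian_generators[of p V, OF prime_p finV zV V_add charp] by auto
  have fibre: "card {w \<in> W. f w = v} = card W0" if v: "v \<in> V" for v
  proof -
    obtain u where u: "u \<in> W" "v = f u" using v unfolding V_def by auto
    have "{w \<in> W. f w = v} = (\<lambda>w. u + w) ` W0"
    proof (intro equalityI subsetI)
      fix w assume "w \<in> {w \<in> W. f w = v}"
      then have "w - u \<in> W0" using u f_diff[of w u] f_zero by simp
      then show "w \<in> (\<lambda>w. u + w) ` W0" by (intro image_eqI[of _ _ "w - u"]) auto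
    next
      fix w assume "w \<in> (\<lambda>w. u + w) ` W0"
      then obtain w0 where w0: "w = u + w0" "w0 \<in> W0" by auto
      then show "w \<in> {w \<in> W. f w = v}" using u W_add[of u w0] f_add[of u w0] f_zero[of w0] unfolding W0_def by auto
    qed
    then show ?thesis by (simp add: card_image)
  qed
  have cardW: "p ^ n = card V * card W0"
  proof -
    have "W = (\<Union>v\<in>V. {w \<in> W. f w = v})" unfolding V_def by auto
    then have "card W = (\<Sum>v\<in>V. card {w \<in> W. f w = v})"
      using finV finW by (subst card_UN_disjoint[symmetric]) auto
    then show ?thesis using roots(2) fibre by simp
  qed

  \<comment> \<open>Absolute values of the modified Kummer generators\<close>
  define y where "y = (\<lambda>i. f (x i))"
  have x1: "1 < nrm (x i)" if "i < r" for i
    using nrm_addpoly_iff[of n b "x i"] b(2,4) x[OF that] \<xi>(2)[OF that] by simp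
  have xn: "nrm (x i) ^ (p ^ n) = nrm (\<xi> i)" if "i < r" for i
    using nrm_addpoly_gt_1[of n b "x i"] b(2,4) x1[OF that] x[OF that] by simp
  have yx: "nrm (y i) = nrm (x i) ^ card W0" if "i < r" for i
  proof -
    have "nrm (x i - w) = nrm (x i)" if "w \<in> W0" for w
      using nrm_add_dominant[of "- w" "x i"] x1[OF \<open>i < r\<close>] that unfolding W0_def by simp
    then show ?thesis unfolding y_def f_def nrm_prod by simp
  qed
  have yn: "nrm (y i) ^ (p ^ n') = nrm (\<xi> i)" if "i < r" for i
    unfolding yx[OF that] xn[OF that, symmetric] power_mult[symmetric] cardW n' by (simp add: mult.commute)
  have y1: "1 < nrm (y i)" if "i < r" for i
    unfolding yx[OF that] using x1[OF that] finW(2) zW0 by (intro one_less_power) (auto simp: card_gt_0_iff)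
  \<comment> \<open>Together with \<open>y1\<close> this places the powers strictly between two
    consecutive absolute values of \<open>E\<close>. The proof raises to the power
    \<open>p ^ (n' - k)\<close>, which leads to
    \<open>nrm (\<xi> i) < exp (real (p ^ N))\<close>.\<close>
  have ypk: "nrm (y i) ^ (p ^ k) < exp 1" if "i < r" "k < n' - N" for i k
  proof (rule power_less_imp_less_base)
    have "k + (n' - k) = n'" using that by simp
    then have e: "p ^ k * p ^ (n' - k) = p ^ n'" by (simp add: power_add[symmetric])
    have "(nrm (y i) ^ (p ^ k)) ^ (p ^ (n' - k)) = nrm (\<xi> i)"
      using yn[OF that(1)] by (simp add: power_mult[symmetric] e)
    also have "\<dots> < exp (real (p ^ N))" by (rule N[OF that(1)])
    also have "\<dots> \<le> exp (real (p ^ (n' - k)))"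
      using that p_gt_1 by (simp add: power_increasing del: of_nat_power)
    also have "\<dots> = exp 1 ^ (p ^ (n' - k))" by (simp add: exp_of_nat_mult[symmetric])
    finally show "(nrm (y i) ^ (p ^ k)) ^ (p ^ (n' - k)) < exp 1 ^ (p ^ (n' - k))" .
  qed simp
  have ydist: "i = j \<and> k = l" if "i < r" "j < r" "nrm (y i) ^ (p ^ k) = nrm (y j) ^ (p ^ l)" for i j k l
  proof -
    have "nrm (\<xi> i) ^ (p ^ k) = (nrm (y i) ^ (p ^ k)) ^ (p ^ n')"
      unfolding yn[OF that(1), symmetric] by (simp add: power_mult[symmetric] mult.commute)
    also have "\<dots> = nrm (\<xi> j) ^ (p ^ l)"
      unfolding that(3) yn[OF that(2), symmetric] by (simp add: power_mult[symmetric] mult.commute)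
    finally have ij: "i = j" by (rule dist[OF that(1,2)])
    then have "p ^ k = p ^ l" using that(3) y1[OF that(2)] by (simp add: power_inject_exp)
    then show ?thesis using ij p_pow_inj by simp
  qed

  \<comment> \<open>Elements fixed by inertia\<close>
  define G where "G = W \<union> x ` {..<r}"
  have finG: "finite G" unfolding G_def using finW by simp
  \<comment> \<open>The equation for \<open>addpoly b n t\<close>, a value in \<open>E\<close>, is
    solved for its linear term, as \<open>b 0\<close> is non-zero; all other exponents are divisible
    by \<open>p\<close>.\<close>
  have Ggen: "\<exists>m e c. e \<in> E \<and> (\<forall>k. c k \<in> E) \<and> t = e + (\<Sum>k<(m::nat). c k * t ^ (p ^ Suc k))" if t: "t \<in> G" for t
  proof -
    have gt: "addpoly b n t \<in> E" using t x \<xi>E EE(1) unfolding G_def W_def by auto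
    have "addpoly b n t = b 0 * t + (\<Sum>k<n. b (Suc k) * t ^ (p ^ Suc k))"
      unfolding addpoly_def by (simp only: lessThan_Suc_atMost[symmetric] sum.lessThan_Suc_shift) simp
    then have "b 0 * t = addpoly b n t - (\<Sum>k<n. b (Suc k) * t ^ (p ^ Suc k))" by simp
    then have "t = (addpoly b n t - (\<Sum>k<n. b (Suc k) * t ^ (p ^ Suc k))) / b 0"
      using b(3) by (simp add: eq_divide_eq mult.commute)
    also have "\<dots> = addpoly b n t / b 0 + (\<Sum>k<n. (if Suc k \<le> n then - b (Suc k) / b 0 else 0) * t ^ (p ^ Suc k))"
      by (simp add: diff_divide_distrib sum_divide_distrib sum_negf)
    finally have "t = addpoly b n t / b 0 + (\<Sum>k<n. (if Suc k \<le> n then - b (Suc k) / b 0 else 0) * t ^ (p ^ Suc k))" .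
    note h1 = this
    have h2: "addpoly b n t / b 0 \<in> E" using gt bE[of 0] by (intro EE(8)) auto
    have h3: "(if Suc k \<le> n then - b (Suc k) / b 0 else 0) \<in> E" for k
      using bE[of 0] bE[of "Suc k"] EE(1) by (auto intro!: EE(8) EE(5))
    show ?thesis
      by (intro exI[of _ n] exI[of _ "addpoly b n t / b 0"]
        exI[of _ "\<lambda>k. if Suc k \<le> n then - b (Suc k) / b 0 else 0"] conjI allI h1 h2 h3)
  qed
  have "\<exists>B. E \<subseteq> B \<and> G \<subseteq> B \<and> (\<forall>x\<in>B. \<forall>y\<in>B. x + y \<in> B \<and> x * y \<in> B) \<and>
    (\<forall>z\<in>B. (\<forall>\<sigma>\<in>Iner. \<sigma> z = z) \<longrightarrow> z \<in> E)"
    by (rule generated_fixed_in_E[OF finG Ggen])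
  then obtain B where B': "E \<subseteq> B" "G \<subseteq> B" "\<forall>x\<in>B. \<forall>y\<in>B. x + y \<in> B \<and> x * y \<in> B"
    "\<forall>z\<in>B. (\<forall>\<sigma>\<in>Iner. \<sigma> z = z) \<longrightarrow> z \<in> E"
    by (elim exE conjE)
  have B: "E \<subseteq> B" "G \<subseteq> B" "\<And>x y. x \<in> B \<Longrightarrow> y \<in> B \<Longrightarrow> x + y \<in> B"
    "\<And>x y. x \<in> B \<Longrightarrow> y \<in> B \<Longrightarrow> x * y \<in> B"
    "\<And>z. z \<in> B \<Longrightarrow> (\<And>\<sigma>. \<sigma> \<in> Iner \<Longrightarrow> \<sigma> z = z) \<Longrightarrow> z \<in> E"
    using B' by simp_all
  have mB: "- z \<in> B" if "z \<in> B" for z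
  proof -
    have "- 1 \<in> B" using B(1) EE(2,5) by auto
    then show ?thesis using B(4)[of "- 1" z] that by simp
  qed
  have powB: "z ^ k \<in> B" if "z \<in> B" for z and k :: nat
    by (induction k) (use that B(1) EE(2) B(4) in auto)
  have sumB: "(\<Sum>i\<in>I. h i) \<in> B" if "\<And>i. i \<in> I \<Longrightarrow> h i \<in> B" for I :: "(nat \<times> nat) set" and h
    using that
  proof (induction I rule: infinite_finite_induct)
    case (insert i I)
    have "(\<Sum>i\<in>I. h i) \<in> B" by (rule insert.IH) (use insert.prems in simp)
    then show ?case using insert.hyps B(3)[of "h i"] insert.prems[of i] by simp
  qed (use B(1) EE(1) in auto)
  have fB: "f z \<in> B" if z: "z \<in> B" for z
  proof -
    have d: "z - w \<in> B" if "w \<in> W0" for w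
    proof -
      have "w \<in> B" using that B(2) unfolding G_def W0_def by auto
      then show ?thesis using B(3)[OF z mB[of w]] by simp
    qed
    have "finite U \<Longrightarrow> U \<subseteq> W0 \<Longrightarrow> (\<Prod>w\<in>U. z - w) \<in> B" for U
      by (induction U rule: finite_induct) (use d B(1,4) EE(2) in auto)
    then show ?thesis unfolding f_def using finW(2) by simp
  qed
  have VE: "v \<in> E" if v: "v \<in> V" for v
  proof -
    obtain w where w: "w \<in> W" "v = f w" using v unfolding V_def by auto
    have vB: "v \<in> B" unfolding w(2) by (rule fB) (use w(1) B(2) in \<open>auto simp: G_def\<close>)
    show ?thesis
    proof (rule B(5)[OF vB])
      fix \<sigma> assume \<sigma>: "\<sigma> \<in> Iner"
      \<comment> \<open>Inertia moves an integral element by less than 1, so the difference is a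
        torsion point with zero reduction, and \<open>f\<close> removes it.\<close>
      have "\<sigma> w - w \<in> W0" unfolding W0_def
        using InerD(3)[OF \<sigma> W1[OF w(1)]] W_add(2)[OF \<sigma>W[OF \<sigma> w(1)] w(1)] by simp
      then have "f (\<sigma> w) - f w = 0" unfolding f_diff[symmetric] f_zero .
      then show "\<sigma> v = v" unfolding w(2) f_aut[OF \<sigma>] by simp
    qed
  qed
  have xW: "\<sigma> (x i) - x i \<in> W" if "\<sigma> \<in> Iner" "i < r" for \<sigma> i
    using gaut[OF that(1), of "x i"] x[OF that(2)] InerD(2)[OF that(1) \<xi>E[OF that(2)]]
    unfolding W_def by (simp add: addpoly_diff)
  have yf: "\<sigma> (y i) - y i = f (\<sigma> (x i) - x i)" if "\<sigma> \<in> Iner" for \<sigma> i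
    unfolding y_def f_aut[OF that] f_diff ..
  have yV: "\<sigma> (y i) - y i \<in> V" if "\<sigma> \<in> Iner" "i < r" for \<sigma> i
    unfolding yf[OF that(1)] V_def using xW[OF that] by auto

  \<comment> \<open>The image group of inertia and its additive functions\<close>
  define h where "h = (\<lambda>\<sigma> i. if i < r then \<sigma> (y i) - y i else 0)"
  define H where "H = h ` Iner"
  have h_comp: "h (\<sigma> \<circ> \<tau>) = h \<sigma> + h \<tau>" if "\<sigma> \<in> Iner" "\<tau> \<in> Iner" for \<sigma> \<tau>
  proof
    fix i
    have "\<sigma> (\<tau> (y i)) = \<sigma> (y i) + (\<tau> (y i) - y i)" if "i < r"
    proof -
      \<comment> \<open>The differences lie in \<open>V\<close>, hence in \<open>E\<close>, and are
        fixed by inertia. This turns the cocycle into a homomorphism.\<close>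
      have "\<sigma> (\<tau> (y i) - y i) = \<tau> (y i) - y i"
        by (rule InerD(2)[OF \<open>\<sigma> \<in> Iner\<close>]) (rule VE[OF yV[OF \<open>\<tau> \<in> Iner\<close> that]])
      then show ?thesis by (simp add: field_autD(7)[OF InerD(1)[OF \<open>\<sigma> \<in> Iner\<close>]] diff_eq_eq add.commute)
    qed
    then show "h (\<sigma> \<circ> \<tau>) i = (h \<sigma> + h \<tau>) i" unfolding h_def by simp
  qed
  have finH: "finite H"
  proof (rule finite_subset)
    show "H \<subseteq> (\<lambda>u i. if i < r then u i else 0) ` ({..<r} \<rightarrow>\<^sub>E V)"
    proof
      fix u assume "u \<in> H"
      then obtain \<sigma> where \<sigma>: "\<sigma> \<in> Iner" "u = h \<sigma>" unfolding H_def by auto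
      show "u \<in> (\<lambda>u i. if i < r then u i else 0) ` ({..<r} \<rightarrow>\<^sub>E V)"
        by (rule image_eqI[of _ _ "restrict u {..<r}"]) (use \<sigma> yV in \<open>auto simp: h_def\<close>)
    qed
  qed (use finV in \<open>auto intro: finite_PiE\<close>)
  have zH: "0 \<in> H" unfolding H_def
    by (rule image_eqI[OF _ id_Iner]) (auto simp: h_def)
  have H_add: "u + v \<in> H" if uv: "u \<in> H" "v \<in> H" for u v
  proof -
    obtain \<sigma> \<tau> where \<sigma>: "\<sigma> \<in> Iner" "\<tau> \<in> Iner" "u = h \<sigma>" "v = h \<tau>" using uv unfolding H_def by auto
    have "u + v = h (\<sigma> \<circ> \<tau>)" using h_comp[OF \<sigma>(1,2)] \<sigma>(3,4) by simp
    then show ?thesis unfolding H_def using Iner_comp[OF \<sigma>(1,2)] by blast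
  qed
  have H_p: "nmul p u = 0" for u :: "nat \<Rightarrow> 'a"
    by (rule ext) (simp add: nmul_fun charp)
  define J where "J = {..<r} \<times> {..<n' - N}"
  define \<phi> where "\<phi> = (\<lambda>(i, k) (u :: nat \<Rightarrow> 'a). u i ^ (p ^ k))"
  have "p ^ card J \<le> card H"
  proof (rule card_ge_independent_additive[of p H E J \<phi>])
    show "finite J" unfolding J_def by simp
    show "\<phi> j u \<in> E" if "j \<in> J" "u \<in> H" for j u
    proof -
      obtain i k where j: "j = (i, k)" "i < r" using \<open>j \<in> J\<close> unfolding J_def by auto
      obtain \<sigma> where \<sigma>: "\<sigma> \<in> Iner" "u = h \<sigma>" using \<open>u \<in> H\<close> unfolding H_def by auto
      show ?thesis unfolding j(1) \<phi>_def \<sigma>(2) h_def using j(2) VE[OF yV[OF \<sigma>(1) j(2)]] by (auto intro: EE(9))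
    qed
    show "\<phi> j (u + v) = \<phi> j u + \<phi> j v" for j u v
      unfolding \<phi>_def by (cases j) (simp add: frob_add)
    fix c assume c: "\<And>j. j \<in> J \<Longrightarrow> c j \<in> E" "\<And>u. u \<in> H \<Longrightarrow> (\<Sum>j\<in>J. \<phi> j u * c j) = 0"
    show "\<forall>j\<in>J. c j = 0"
    proof (rule ccontr)
      assume neg: "\<not> ?thesis"
      have finJ: "finite J" unfolding J_def by simp
      have neJ: "J \<noteq> {}" using neg by auto
      obtain q where q: "q \<in> J" "\<And>j. j \<in> J \<Longrightarrow> nrm (c j) \<le> nrm (c q)"
      proof -
        have "Max ((\<lambda>z. nrm (c z)) ` J) \<in> (\<lambda>z. nrm (c z)) ` J" using finJ neJ by (intro Max_in) auto
        then obtain w where "w \<in> J" "nrm (c w) = Max ((\<lambda>z. nrm (c z)) ` J)" by auto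
        then show thesis using finJ by (intro that[of w]) auto
      qed
      have cq: "c q \<noteq> 0"
      proof
        assume "c q = 0"
        have "c j = 0" if "j \<in> J" for j using q(2)[OF that] nrm_ge_0[of "c j"] \<open>c q = 0\<close> by (simp add: antisym)
        then show False using neg by auto
      qed
      \<comment> \<open>Normalization by a coefficient of largest absolute value: all
        \<open>d j\<close> are integral, and \<open>d q = 1\<close>.\<close>
      define d where "d = (\<lambda>j. c j / c q)"
      have dE: "d j \<in> E" if "j \<in> J" for j unfolding d_def using c(1) q(1) that by (intro EE(8))
      have d1: "nrm (d j) \<le> 1" if "j \<in> J" for j
        unfolding d_def nrm_divide using q(2)[OF that] nrm_pos[OF cq] by simp
      define s where "s = (\<lambda>j. d j * y (fst j) ^ (p ^ snd j))"
      define z where "z = (\<Sum>j\<in>J. s j)"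
      have yB: "y i \<in> B" if "i < r" for i unfolding y_def by (rule fB) (use that B(2) in \<open>auto simp: G_def\<close>)
      have zB: "z \<in> B" unfolding z_def
      proof (rule sumB)
        fix j assume j: "j \<in> J"
        then have "fst j < r" unfolding J_def by auto
        then show "s j \<in> B" unfolding s_def using dE[OF j] B(1) by (intro B(4) powB yB) auto
      qed
      have "z \<in> E"
      proof (rule B(5)[OF zB])
        fix \<sigma> assume \<sigma>: "\<sigma> \<in> Iner"
        note aut = InerD(1)[OF \<sigma>]
        have "\<sigma> z - z = (\<Sum>j\<in>J. \<sigma> (s j) - s j)" unfolding z_def by (simp add: field_aut_sum[OF aut] sum_subtractf)
        also have "\<dots> = (\<Sum>j\<in>J. \<phi> j (h \<sigma>) * c j / c q)"
        proof (rule sum.cong[OF refl])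
          fix j assume j: "j \<in> J"
          obtain i k where jk: "j = (i, k)" "i < r" using j unfolding J_def by auto
          have "\<sigma> (s j) - s j = d j * (\<sigma> (y i) ^ (p ^ k) - y i ^ (p ^ k))"
            unfolding s_def using InerD(2)[OF \<sigma> dE[OF j]] jk
            by (simp add: field_autD[OF aut] right_diff_distrib)
          also have "\<dots> = d j * (\<sigma> (y i) - y i) ^ (p ^ k)" by (simp add: frob_diff)
          finally show "\<sigma> (s j) - s j = \<phi> j (h \<sigma>) * c j / c q"
            unfolding d_def \<phi>_def h_def using jk by simp
        qed
        also have "\<dots> = (\<Sum>j\<in>J. \<phi> j (h \<sigma>) * c j) / c q" by (simp add: sum_divide_distrib)
        also have "\<dots> = 0" using c(2)[of "h \<sigma>"] \<sigma> unfolding H_def by simp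
        finally show "\<sigma> z = z" by simp
      qed
      \<comment> \<open>The terms with unit coefficient. Among them the largest size
        \<open>m t\<close> is attained only once, by \<open>ydist\<close>. The other terms have
        coefficient at most \<open>exp (- 1)\<close> and so size below 1. Therefore
        \<open>nrm z = m t\<close>, strictly between 1 and \<open>exp 1\<close>, which is impossible
        in \<open>E\<close>.\<close>
      define U where "U = {j \<in> J. nrm (d j) = 1}"
      define m where "m = (\<lambda>j. nrm (y (fst j)) ^ (p ^ snd j))"
      have qU: "q \<in> U" unfolding U_def d_def using q(1) cq by simp
      have finU: "finite U" unfolding U_def using finJ by simp
      obtain t where t: "t \<in> U" "\<And>j. j \<in> U \<Longrightarrow> m j \<le> m t"
      proof -
        have "Max (m ` U) \<in> m ` U" using finU qU by (intro Max_in) auto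
        then obtain w where "w \<in> U" "m w = Max (m ` U)" by auto
        then show thesis using finU by (intro that[of w]) auto
      qed
      have m_bounds: "1 < m j" "m j < exp 1" if "j \<in> J" for j
        using that y1[of "fst j"] ypk[of "fst j" "snd j"] p_gt_1 unfolding m_def J_def
        by (auto intro!: one_less_power)
      have tJ: "t \<in> J" "nrm (d t) = 1" using t(1) unfolding U_def by auto
      have nst: "nrm (s j) = nrm (d j) * m j" for j unfolding s_def m_def by (simp add: nrm_mult nrm_power)
      have "nrm z = nrm (s t)" unfolding z_def
      proof (rule nrm_sum_dominant[OF finJ tJ(1)])
        fix j assume j: "j \<in> J" "j \<noteq> t"
        show "nrm (s j) < nrm (s t)"
        proof (cases "j \<in> U")
          case True
          have "m j \<noteq> m t"
          proof
            assume "m j = m t"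
            then have "fst j = fst t \<and> snd j = snd t"
              unfolding m_def by (intro ydist) (use j tJ in \<open>auto simp: J_def\<close>)
            then show False using j(2) by (simp add: prod_eq_iff)
          qed
          then have "m j < m t" using t(2)[OF True] by simp
          then show ?thesis unfolding nst tJ(2) using True unfolding U_def by simp
        next
          case False
          then have lt: "nrm (d j) < 1" using d1[OF j(1)] j(1) unfolding U_def by force
          have le: "nrm (d j) \<le> exp (- 1)"
          proof (cases "d j = 0")
            case False
            obtain k :: int where k: "nrm (d j) = exp (real_of_int k)" using nrm_E[OF dE[OF j(1)] False] by auto
            then have "k \<le> - 1" using lt by simp
            then have "real_of_int k \<le> - 1" by (simp add: of_int_le_iff[of k "- 1", simplified])
            then show ?thesis unfolding k by simp
          qed simp
          have "nrm (s j) \<le> exp (- 1) * m j" unfolding nst by (rule mult_right_mono[OF le]) (use m_bounds[OF j(1)] in simp)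
          also have "\<dots> < exp (- 1) * exp 1" by (rule mult_strict_left_mono) (use m_bounds[OF j(1)] in auto)
          also have "\<dots> = 1" by (simp add: exp_add[symmetric])
          also have "1 < nrm (s t)" unfolding nst tJ(2) using m_bounds[OF tJ(1)] by simp
          finally show ?thesis .
        qed
      next
        show "s t \<noteq> 0" using nst[of t] tJ m_bounds[OF tJ(1)] by auto
      qed
      then have nz: "nrm z = m t" using nst tJ(2) by simp
      then have "z \<noteq> 0" using m_bounds[OF tJ(1)] by auto
      then obtain k :: int where k: "nrm z = exp (real_of_int k)" using nrm_E[OF \<open>z \<in> E\<close>] by auto
      have "exp 0 < exp (real_of_int k)" "exp (real_of_int k) < exp 1" using m_bounds[OF tJ(1)] nz k by auto
      then have "0 < real_of_int k" "real_of_int k < 1" by (simp_all only: exp_less_cancel_iff)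
      then have "0 < k" "k < 1" by simp_all
      then show False by simp
    qed
  qed (use prime_p finH zH H_add H_p subfld_E in auto)
  then have Hge: "p ^ (r * (n' - N)) \<le> card H" unfolding J_def by (simp add: card_cartesian_product)

  \<comment> \<open>Comparison with residues\<close>
  define Rs where "Rs = (\<lambda>\<sigma>. \<lambda>i\<in>{..<r}. res (\<sigma> (x i) - x i)) ` Iner"
  have res_eq: "f u = f v" if "u \<in> W" "v \<in> W" "res u = res v" for u v
  proof -
    have "nrm ((u - res u) - (v - res v)) < 1"
      by (rule nrm_less_1_diff[OF res(2)[OF W1[OF that(1)]] res(2)[OF W1[OF that(2)]]])
    then have "u - v \<in> W0" unfolding W0_def using that W_add(2) by simp
    then show ?thesis using f_zero[of "u - v"] by (simp add: f_diff)
  qed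
  have finR: "finite Rs"
  proof (rule finite_subset)
    show "Rs \<subseteq> {..<r} \<rightarrow>\<^sub>E res ` W"
    proof
      fix u assume "u \<in> Rs"
      then obtain \<sigma> where \<sigma>: "\<sigma> \<in> Iner" "u = (\<lambda>i\<in>{..<r}. res (\<sigma> (x i) - x i))" unfolding Rs_def by auto
      show "u \<in> {..<r} \<rightarrow>\<^sub>E res ` W" unfolding \<sigma>(2) restrict_PiE_iff using xW[OF \<sigma>(1)] by simp
    qed
  qed (use finW in \<open>auto intro: finite_PiE\<close>)
  \<comment> \<open>Elements of \<open>W\<close> with equal residues differ by an element of
    \<open>W0\<close>, so the residues of the differences at \<open>x i\<close> determine those at
    \<open>y i\<close>.\<close>
  have "card H \<le> card Rs"
  proof -
    define S where "S = (\<lambda>\<sigma>. \<lambda>i\<in>{..<r}. res (\<sigma> (x i) - x i))"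
    have "h \<sigma> = h \<tau>" if st: "\<sigma> \<in> Iner" "\<tau> \<in> Iner" "S \<sigma> = S \<tau>" for \<sigma> \<tau>
    proof
      fix i
      show "h \<sigma> i = h \<tau> i"
      proof (cases "i < r")
        case True
        have "res (\<sigma> (x i) - x i) = res (\<tau> (x i) - x i)" using fun_cong[OF st(3), of i] True unfolding S_def by simp
        then have "f (\<sigma> (x i) - x i) = f (\<tau> (x i) - x i)" by (intro res_eq xW st True)
        then show ?thesis unfolding h_def using True yf[OF st(1)] yf[OF st(2)] by simp
      qed (simp add: h_def)
    qed
    then have "h \<sigma> = (\<lambda>u. h (SOME \<tau>. \<tau> \<in> Iner \<and> S \<tau> = u)) (S \<sigma>)" if "\<sigma> \<in> Iner" for \<sigma>
      using someI[of "\<lambda>\<tau>. \<tau> \<in> Iner \<and> S \<tau> = S \<sigma>" \<sigma>] that by (metis (mono_tags, lifting))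
    then have "H \<subseteq> (\<lambda>u. h (SOME \<tau>. \<tau> \<in> Iner \<and> S \<tau> = u)) ` Rs" unfolding H_def Rs_def S_def[symmetric] by blast
    then show ?thesis by (rule surj_card_le[OF finR])
  qed
  then have Rge: "p ^ (r * (n' - N)) \<le> card Rs" using Hge by simp
  \<comment> \<open>The torsion of the reduction. By the factorization over \<open>W\<close>, each
    of its elements is close to a root; applying \<open>f\<close> to that root embeds
    \<open>Z\<close> into \<open>V\<close>.\<close>
  define Z where "Z = {w \<in> kb. nrm (addpoly b n w) < 1}"
  have Zw: "\<exists>w\<in>W. nrm (z - w) < 1" if "z \<in> Z" for z
  proof (rule ccontr)
    assume "\<not> ?thesis"
    then have "\<forall>w\<in>W. 1 \<le> nrm (z - w)" by auto
    then have "1 \<le> (\<Prod>w\<in>W. nrm (z - w))" by (intro prod_ge_1) auto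
    then have "1 \<le> nrm (addpoly b n z)" unfolding roots(3)[of z] by (simp add: nrm_mult nrm_prod b(4))
    then show False using that unfolding Z_def by simp
  qed
  then obtain w where w: "\<And>z. z \<in> Z \<Longrightarrow> w z \<in> W" "\<And>z. z \<in> Z \<Longrightarrow> nrm (z - w z) < 1" by metis
  have "inj_on (\<lambda>z. f (w z)) Z"
  proof (rule inj_onI)
    fix z z' assume z: "z \<in> Z" "z' \<in> Z" "f (w z) = f (w z')"
    have "w z - w z' \<in> W0" using z(3) f_zero[of "w z - w z'"] by (simp add: f_diff)
    then have "nrm (w z - w z') < 1" unfolding W0_def by simp
    then have "nrm (((z - w z) - (z' - w z')) + (w z - w z')) < 1"
      by (rule nrm_less_1_add[OF nrm_less_1_diff[OF w(2)[OF z(1)] w(2)[OF z(2)]]])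
    then have "nrm (z - z') < 1" by simp
    moreover have "z - z' \<in> kb" using z unfolding Z_def by (auto intro: subfldD(7)[OF subfld_kb])
    ultimately show "z = z'" using kb_nrm_less_1 by fastforce
  qed
  moreover have "(\<lambda>z. f (w z)) ` Z \<subseteq> V" unfolding V_def using w(1) by auto
  ultimately have "card Z \<le> p ^ n'" using card_inj_on_le[OF _ _ finV] n' by simp
  then have "card Z ^ r \<le> (p ^ n') ^ r" by (rule power_mono) simp
  also have "\<dots> \<le> (p ^ (N + (n' - N))) ^ r" by (rule power_mono, rule power_increasing) (use p_gt_1 in auto)
  also have "\<dots> = p ^ (r * N) * p ^ (r * (n' - N))"
    by (simp add: power_add power_mult_distrib power_mult[symmetric] mult.commute)
  also have "\<dots> \<le> p ^ (r * N) * card Rs" using Rge by simp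
  finally show ?thesis unfolding Z_def Rs_def .
qed

end

section \<open>From valuations to absolute values\<close>

text \<open>With base \<open>exp 1\<close>, a normalized valuation takes the values
  \<open>exp n\<close> for integers \<open>n\<close> at non-zero elements.\<close>

definition absv :: "('a::field \<Rightarrow> ereal) \<Rightarrow> 'a \<Rightarrow> real" where
  "absv v x = (if x = 0 then 0 else exp (- real_of_ereal (v x)))"

lemma valuationD:
  assumes "valuation v"
  shows "v 0 = \<infinity>" "x \<noteq> 0 \<Longrightarrow> \<exists>r. v x = ereal r" "v (x * y) = v x + v y" "min (v x) (v y) \<le> v (x + y)"
proof -
  show "v 0 = \<infinity>" "v (x * y) = v x + v y" "min (v x) (v y) \<le> v (x + y)"
    using assms unfolding valuation_def by auto
  show "\<exists>r. v x = ereal r" if "x \<noteq> 0"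
    using assms that unfolding valuation_def by (cases "v x") auto
qed

lemma absv_exp: "valuation v \<Longrightarrow> v x = ereal r \<Longrightarrow> absv v x = exp (- r)"
  unfolding absv_def using valuationD(1)[of v] by auto

lemma absv_le_exp_iff: "valuation v \<Longrightarrow> absv v x \<le> exp (- r) \<longleftrightarrow> ereal r \<le> v x"
proof (cases "x = 0")
  case False
  assume v: "valuation v"
  obtain s where "v x = ereal s" using valuationD(2)[OF v False] by auto
  then show ?thesis using absv_exp[OF v] by simp
qed (simp add: absv_def valuationD(1))

lemma absv_less_exp_iff: "valuation v \<Longrightarrow> absv v x < exp (- r) \<longleftrightarrow> ereal r < v x"
proof (cases "x = 0")
  case False
  assume v: "valuation v"
  obtain s where "v x = ereal s" using valuationD(2)[OF v False] by auto
  then show ?thesis using absv_exp[OF v] by simp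
qed (simp add: absv_def valuationD(1))

lemma absv_le_1_iff: "valuation v \<Longrightarrow> absv v x \<le> 1 \<longleftrightarrow> 0 \<le> v x"
  using absv_le_exp_iff[of v x 0] by (simp add: zero_ereal_def)

lemma absv_less_1_iff: "valuation v \<Longrightarrow> absv v x < 1 \<longleftrightarrow> 0 < v x"
  using absv_less_exp_iff[of v x 0] by (simp add: zero_ereal_def)

lemma nonarch_absv:
  assumes v: "valuation v" shows "nonarch (absv v)"
proof
  fix x y
  show "absv v x = 0 \<longleftrightarrow> x = 0" "0 \<le> absv v x" by (auto simp: absv_def)
  show "absv v (x * y) = absv v x * absv v y"
  proof (cases "x = 0 \<or> y = 0")
    case False
    then obtain r s where rs: "v x = ereal r" "v y = ereal s" using valuationD(2)[OF v] by metis
    then have "v (x * y) = ereal (r + s)" using valuationD(3)[OF v] by simp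
    then show ?thesis using rs absv_exp[OF v] by (simp add: exp_add[symmetric])
  qed (auto simp: absv_def)
  show "absv v (x + y) \<le> max (absv v x) (absv v y)"
  proof (cases "x = 0 \<or> y = 0 \<or> x + y = 0")
    case False
    then obtain r s t where rs: "v x = ereal r" "v y = ereal s" "v (x + y) = ereal t"
      using valuationD(2)[OF v] by metis
    then have "min r s \<le> t" using valuationD(4)[OF v, of x y] by (simp add: min_def split: if_splits)
    then show ?thesis using rs absv_exp[OF v] by (auto simp: min_def max_def split: if_splits)
  qed (auto simp: absv_def max_def)
qed

lemma subfld_range_to_ac: "subfld (range (to_ac :: 'k::field \<Rightarrow> 'k alg_closure))"
  unfolding subfld_def
proof (intro conjI ballI)
  show "0 \<in> range to_ac" by (rule range_eqI[of _ _ 0]) simp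
  show "1 \<in> range to_ac" by (rule range_eqI[of _ _ 1]) simp
  fix x y :: "'k alg_closure" assume "x \<in> range to_ac" "y \<in> range to_ac"
  then obtain a b where ab: "x = to_ac a" "y = to_ac b" by auto
  show "x + y \<in> range to_ac" unfolding ab by (rule range_eqI[of _ _ "a + b"]) simp
  show "x * y \<in> range to_ac" unfolding ab by (rule range_eqI[of _ _ "a * b"]) simp
next
  fix x :: "'k alg_closure" assume "x \<in> range to_ac"
  then obtain a where a: "x = to_ac a" by auto
  show "- x \<in> range to_ac" unfolding a by (rule range_eqI[of _ _ "- a"]) simp
  show "inverse x \<in> range to_ac" unfolding a by (rule range_eqI[of _ _ "inverse a"]) simp
qed

lemma algebraic_over_range_to_ac: "algebraic_over (range to_ac) (x :: 'k::field alg_closure)"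
proof -
  obtain P :: "'k poly" where P: "P \<noteq> 0" "poly (map_poly to_ac P) x = 0" by (rule alg_closure_algebraic)
  have c: "Polynomial.coeff (map_poly to_ac P) i = to_ac (Polynomial.coeff P i)" for i
    by (simp add: coeff_map_poly)
  have "map_poly to_ac P \<noteq> 0" using P(1) by (metis c leading_coeff_0_iff coeff_0 to_ac_eq_0_iff)
  then show ?thesis unfolding algebraic_over_def using P(2) c by auto
qed

lemma local_closure_absv:
  fixes v :: "'k::field alg_closure \<Rightarrow> ereal"
  assumes p: "Factorial_Ring.prime CHAR('k)" and v: "valuation v" and lf: "local_field (base_val v)"
  shows "local_closure (absv v) (range to_ac) CHAR('k)"
proof -
  interpret nonarch "absv v" by (rule nonarch_absv[OF v])
  have u: "valuation (base_val v)" and nv: "base_val v ` (UNIV - {0}) = range (\<lambda>n::int. ereal (real_of_int n))"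
    and cv: "complete_valuation (base_val v)"
    and fin: "finite (quotient_set (val_ring (base_val v) UNIV) (max_ideal (base_val v) UNIV))"
    using lf unfolding local_field_def normalized_valuation_def by auto
  have bv: "base_val v x = v (to_ac x)" for x by (simp add: base_val_def)
  show ?thesis
  proof
    show "CHAR('k) = CHAR('k alg_closure)" by simp
    show "Factorial_Ring.prime CHAR('k alg_closure)" using p by simp
    show "subfld (range (to_ac :: 'k \<Rightarrow> 'k alg_closure))" by (rule subfld_range_to_ac)
    show "algebraic_over (range to_ac) (x :: 'k alg_closure)" for x by (rule algebraic_over_range_to_ac)
    show "\<exists>n::int. absv v x = exp (real_of_int n)" if x: "x \<in> range to_ac" "x \<noteq> 0" for x
    proof -
      obtain a where a: "x = to_ac a" "a \<noteq> 0" using x by auto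
      then have "base_val v a \<in> range (\<lambda>n::int. ereal (real_of_int n))" using nv by blast
      then obtain n :: int where "v x = ereal (real_of_int n)" using a bv by auto
      then have "absv v x = exp (real_of_int (- n))" using absv_exp[OF v] by simp
      then show ?thesis by blast
    qed
    show "\<exists>l\<in>range to_ac. \<forall>e>0. \<exists>N. \<forall>n\<ge>N. absv v (s n - l) < e"
      if s: "\<And>n. s n \<in> range to_ac" and c: "\<And>e. 0 < e \<Longrightarrow> \<exists>N. \<forall>m\<ge>N. \<forall>n\<ge>N. absv v (s m - s n) < e" for s :: "nat \<Rightarrow> 'k alg_closure"
    proof -
      have "\<forall>n. \<exists>a. s n = to_ac a" using s by blast
      then obtain a where a: "\<And>n. s n = to_ac (a n)" by metis
      have "\<exists>N. \<forall>m\<ge>N. \<forall>n\<ge>N. ereal C \<le> base_val v (a m - a n)" for C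
      proof -
        obtain N where N: "\<forall>m\<ge>N. \<forall>n\<ge>N. absv v (s m - s n) < exp (- C)" using c[of "exp (- C)"] by auto
        have "ereal C \<le> base_val v (a m - a n)" if "N \<le> m" "N \<le> n" for m n
        proof -
          have "absv v (s m - s n) \<le> exp (- C)" using N that by (simp add: less_imp_le)
          then show ?thesis unfolding bv absv_le_exp_iff[OF v] a by simp
        qed
        then show ?thesis by blast
      qed
      then obtain l where l: "\<And>C. \<exists>N. \<forall>n\<ge>N. ereal C \<le> base_val v (a n - l)"
        using cv[unfolded complete_valuation_def, rule_format, of a] by auto
      have "\<exists>N. \<forall>n\<ge>N. absv v (s n - to_ac l) < e" if e: "0 < e" for e
      proof -
        obtain N where N: "\<forall>n\<ge>N. ereal (1 - ln e) \<le> base_val v (a n - l)" using l by blast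
        have "absv v (s n - to_ac l) < e" if "N \<le> n" for n
        proof -
          have "ereal (1 - ln e) \<le> v (s n - to_ac l)" using N that unfolding bv a by simp
          then have "absv v (s n - to_ac l) \<le> exp (- (1 - ln e))" unfolding absv_le_exp_iff[OF v] .
          also have "\<dots> < exp (ln e)" by simp
          also have "\<dots> = e" using e by simp
          finally show ?thesis .
        qed
        then show ?thesis by blast
      qed
      then show ?thesis by blast
    qed
    show "\<exists>R. finite R \<and> R \<subseteq> range to_ac \<and>
        (\<forall>x\<in>range to_ac. absv v x \<le> 1 \<longrightarrow> (\<exists>r\<in>R. absv v (x - r) < 1))"
    proof -
      let ?Q = "quotient_set (val_ring (base_val v) UNIV) (max_ideal (base_val v) UNIV)"
      let ?R = "(\<lambda>c. to_ac (SOME a. a \<in> c)) ` ?Q"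
      have "\<exists>r\<in>?R. absv v (x - r) < 1" if x: "x \<in> range to_ac" "absv v x \<le> 1" for x
      proof -
        obtain a where a: "x = to_ac a" using x by auto
        let ?c = "a +o max_ideal (base_val v) UNIV"
        have "?c \<in> ?Q" unfolding quotient_set_def val_ring_def
          using x(2) unfolding a absv_le_1_iff[OF v] bv by auto
        moreover have "absv v (x - to_ac (SOME a. a \<in> ?c)) < 1"
        proof -
          have "a \<in> ?c" unfolding elt_set_plus_def max_ideal_def using valuationD(1)[OF u]
            by (intro CollectI bexI[of _ 0]) auto
          then have "(SOME a. a \<in> ?c) \<in> ?c" by (rule someI)
          then obtain m where m: "(SOME a. a \<in> ?c) = a + m" "0 < base_val v m"
            unfolding elt_set_plus_def max_ideal_def by auto
          have "x - to_ac (SOME a. a \<in> ?c) = - to_ac m" unfolding m(1) a by simp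
          then show ?thesis using m(2) unfolding bv absv_less_1_iff[OF v, symmetric] by simp
        qed
        ultimately show ?thesis by blast
      qed
      then show ?thesis using fin by (intro exI[of _ ?R]) auto
    qed
  qed
qed

section \<open>Cosets\<close>

definition add_subgroup :: "'a::ab_group_add set \<Rightarrow> bool" where
  "add_subgroup S \<longleftrightarrow> 0 \<in> S \<and> (\<forall>x\<in>S. \<forall>y\<in>S. x - y \<in> S)"

lemma add_subgroupD:
  assumes "add_subgroup S"
  shows "0 \<in> S" "\<And>x y. x \<in> S \<Longrightarrow> y \<in> S \<Longrightarrow> x - y \<in> S" "\<And>x. x \<in> S \<Longrightarrow> - x \<in> S"
    "\<And>x y. x \<in> S \<Longrightarrow> y \<in> S \<Longrightarrow> x + y \<in> S"
proof -
  show *: "0 \<in> S" "\<And>x y. x \<in> S \<Longrightarrow> y \<in> S \<Longrightarrow> x - y \<in> S" using assms unfolding add_subgroup_def by auto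
  show m: "- x \<in> S" if "x \<in> S" for x using *(2)[OF *(1) that] by simp
  show "x + y \<in> S" if "x \<in> S" "y \<in> S" for x y using *(2)[OF that(1) m[OF that(2)]] by simp
qed

lemma coset_mem: "(y::'a::ab_group_add) \<in> x +o S \<longleftrightarrow> y - x \<in> S"
  unfolding elt_set_plus_def by (auto intro: bexI[of _ "y - x"])

lemma coset_eq:
  assumes "add_subgroup S" shows "x +o S = y +o S \<longleftrightarrow> x - y \<in> S"
proof
  assume "x +o S = y +o S"
  moreover have "x \<in> x +o S" using add_subgroupD(1)[OF assms] by (simp add: coset_mem)
  ultimately show "x - y \<in> S" by (simp add: coset_mem)
next
  assume xy: "x - y \<in> S"
  have "z - x \<in> S \<longleftrightarrow> z - y \<in> S" for z
    using add_subgroupD(4)[OF assms _ xy, of "z - x"] add_subgroupD(2)[OF assms _ xy, of "z - y"] by auto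
  then show "x +o S = y +o S" by (auto simp: coset_mem)
qed

lemma coset_rep:
  assumes "add_subgroup S" "U \<in> quotient_set H S"
  obtains x where "x \<in> H" "U = x +o S" "x \<in> U"
proof -
  obtain x where "x \<in> H" "U = x +o S" using assms(2) unfolding quotient_set_def by auto
  then show thesis using that[of x] add_subgroupD(1)[OF assms(1)] by (simp add: coset_mem)
qed

lemma coset_of_mem:
  assumes "add_subgroup S" "U \<in> quotient_set H S" "x \<in> U"
  shows "U = x +o S"
proof -
  obtain y where y: "U = y +o S" using assms(2) unfolding quotient_set_def by auto
  then have "x - y \<in> S" using assms(3) by (simp add: coset_mem)
  then have "y - x \<in> S" using add_subgroupD(3)[OF assms(1), of "x - y"] by simp
  then show ?thesis unfolding y by (simp add: coset_eq[OF assms(1)])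
qed

lemma coset_plus:
  assumes "add_subgroup S" shows "(x +o S) + (y +o S) = (x + y) +o S"
proof (intro equalityI subsetI)
  fix z assume "z \<in> (x +o S) + (y +o S)"
  then obtain s t where st: "z = (x + s) + (y + t)" "s \<in> S" "t \<in> S"
    unfolding set_plus_def elt_set_plus_def by auto
  have "z - (x + y) = s + t" unfolding st(1) by (simp add: algebra_simps)
  then show "z \<in> (x + y) +o S" using add_subgroupD(4)[OF assms st(2,3)] by (simp add: coset_mem)
next
  fix z assume "z \<in> (x + y) +o S"
  then have s: "z - (x + y) \<in> S" by (simp add: coset_mem)
  have "z = (x + (z - (x + y))) + (y + 0)" by simp
  then show "z \<in> (x +o S) + (y +o S)"
    using s add_subgroupD(1)[OF assms] unfolding set_plus_def elt_set_plus_def by blast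
qed

text \<open>All cosets in the union coincide because \<open>act\<close> maps \<open>S\<close> into
  itself; this evaluates the scalar multiplication of \<open>quotient_module\<close>.\<close>

lemma coset_smult:
  assumes "add_subgroup S" "\<And>x y. act (x - y) = act x - (act y :: 'b::ab_group_add)" "\<And>s. s \<in> S \<Longrightarrow> act s \<in> S"
  shows "(\<Union>y\<in>x +o S. act y +o S) = act x +o S"
proof -
  have "act y +o S = act x +o S" if "y \<in> x +o S" for y
    unfolding coset_eq[OF assms(1)] assms(2)[symmetric] using that by (intro assms(3)) (simp add: coset_mem)
  moreover have "x \<in> x +o S" using add_subgroupD(1)[OF assms(1)] by (simp add: coset_mem)
  ultimately show ?thesis by blast
qed

section \<open>Evaluation of twisted polynomials\<close>

lemma tw_eval_upto:
  fixes f :: "'k::field poly"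
  assumes "Polynomial.degree f \<le> n"
  shows "tw_eval f x = (\<Sum>i\<le>n. to_ac (Polynomial.coeff f i) * x ^ (CHAR('k) ^ i))"
  unfolding tw_eval_def using assms by (intro sum.mono_neutral_left) (auto simp: coeff_eq_0)

lemma tw_eval_add: "tw_eval (f + g) x = tw_eval f x + tw_eval g x"
proof -
  let ?n = "max (Polynomial.degree f) (Polynomial.degree g)"
  have "tw_eval (f + g) x = (\<Sum>i\<le>?n. to_ac (Polynomial.coeff (f + g) i) * x ^ (CHAR('a) ^ i))"
    by (rule tw_eval_upto) (rule degree_add_le_max)
  moreover have "tw_eval f x = (\<Sum>i\<le>?n. to_ac (Polynomial.coeff f i) * x ^ (CHAR('a) ^ i))"
    "tw_eval g x = (\<Sum>i\<le>?n. to_ac (Polynomial.coeff g i) * x ^ (CHAR('a) ^ i))"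
    by (rule tw_eval_upto; simp)+
  ultimately show ?thesis by (simp add: distrib_right sum.distrib)
qed

lemma tw_eval_0 [simp]: "tw_eval 0 x = 0"
  by (simp add: tw_eval_def)

lemma tw_eval_1 [simp]: "tw_eval 1 x = x"
  by (simp add: tw_eval_def)

lemma tw_eval_sum: "tw_eval (\<Sum>i\<in>I. f i) x = (\<Sum>i\<in>I. tw_eval (f i) x)"
  by (induction I rule: infinite_finite_induct) (auto simp: tw_eval_add)

lemma tw_eval_monom: "tw_eval (Polynomial.monom (c::'k::field) k) x = to_ac c * x ^ (CHAR('k) ^ k)"
proof -
  have "tw_eval (Polynomial.monom c k) x = (\<Sum>i\<le>k. to_ac (Polynomial.coeff (Polynomial.monom c k) i) * x ^ (CHAR('k) ^ i))"
    by (rule tw_eval_upto) (rule degree_monom_le)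
  also have "\<dots> = (\<Sum>i\<le>k. if i = k then to_ac c * x ^ (CHAR('k) ^ i) else 0)"
    by (intro sum.cong) auto
  finally show ?thesis by simp
qed

text \<open>Frobenius is additive, so the inner sum may be raised to the power \<open>p ^ i\<close>
  term by term; this produces the exponents in the twisted product.\<close>

lemma tw_eval_mult:
  fixes f g :: "'k::field poly"
  assumes p: "Factorial_Ring.prime CHAR('k)"
  shows "tw_eval (f \<otimes>\<^bsub>twisted_poly_ring R\<^esub> g) x = tw_eval f (tw_eval g x)"
proof -
  let ?p = "CHAR('k)"
  have p': "Factorial_Ring.prime CHAR('k alg_closure)" using p by simp
  have "tw_eval f (tw_eval g x) = (\<Sum>i\<le>Polynomial.degree f. \<Sum>j\<le>Polynomial.degree g.
      to_ac (Polynomial.coeff f i * Polynomial.coeff g j ^ (?p ^ i)) * x ^ (?p ^ (i + j)))"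
    unfolding tw_eval_def[of f]
  proof (rule sum.cong[OF refl])
    fix i
    have "tw_eval g x ^ (?p ^ i) = (\<Sum>j\<le>Polynomial.degree g. (to_ac (Polynomial.coeff g j) * x ^ (?p ^ j)) ^ (?p ^ i))"
      unfolding tw_eval_def by (rule freshmans_dream_sum'[OF p']) simp
    also have "\<dots> = (\<Sum>j\<le>Polynomial.degree g. to_ac (Polynomial.coeff g j ^ (?p ^ i)) * x ^ (?p ^ (i + j)))"
      by (intro sum.cong refl) (simp add: power_mult_distrib power_mult[symmetric] power_add mult.commute)
    finally show "to_ac (Polynomial.coeff f i) * tw_eval g x ^ ?p ^ i = (\<Sum>j\<le>Polynomial.degree g.
        to_ac (Polynomial.coeff f i * Polynomial.coeff g j ^ (?p ^ i)) * x ^ (?p ^ (i + j)))"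
      by (simp add: sum_distrib_left mult.assoc)
  qed
  then show ?thesis unfolding twisted_poly_ring_def
    by (simp add: tw_eval_sum tw_eval_monom)
qed

lemma regular_outside_iff:
  "a \<in> regular_outside vinf \<longleftrightarrow> (\<forall>w. normalized_valuation w \<and> w \<noteq> vinf \<longrightarrow> absv w a \<le> 1)"
  unfolding regular_outside_def normalized_valuation_def using absv_le_1_iff by auto

lemma regular_outside_closed:
  fixes vinf :: "'f::field \<Rightarrow> ereal"
  shows "0 \<in> regular_outside vinf" "1 \<in> regular_outside vinf"
    "a \<in> regular_outside vinf \<Longrightarrow> b \<in> regular_outside vinf \<Longrightarrow> a + b \<in> regular_outside vinf"
    "a \<in> regular_outside vinf \<Longrightarrow> b \<in> regular_outside vinf \<Longrightarrow> a * b \<in> regular_outside vinf"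
    "a \<in> regular_outside vinf \<Longrightarrow> - a \<in> regular_outside vinf"
    "a \<in> regular_outside vinf \<Longrightarrow> b \<in> regular_outside vinf \<Longrightarrow> a - b \<in> regular_outside vinf"
proof -
  have na: "nonarch (absv w)" if "normalized_valuation w" for w :: "'f \<Rightarrow> ereal"
    using that nonarch_absv unfolding normalized_valuation_def by auto
  show "0 \<in> regular_outside vinf" "1 \<in> regular_outside vinf"
    unfolding regular_outside_iff using nonarch.nrm_1[OF na] nonarch.nrm_0[OF na] by auto
  show "a + b \<in> regular_outside vinf" if "a \<in> regular_outside vinf" "b \<in> regular_outside vinf" for a b
    using that nonarch.nrm_le_1_add[OF na] unfolding regular_outside_iff by blast
  show "a * b \<in> regular_outside vinf" if "a \<in> regular_outside vinf" "b \<in> regular_outside vinf" for a b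
    using that nonarch.nrm_le_1_mult[OF na] unfolding regular_outside_iff by blast
  show m: "- a \<in> regular_outside vinf" if "a \<in> regular_outside vinf" for a
    using that nonarch.nrm_minus[OF na] unfolding regular_outside_iff by simp
  show "a - b \<in> regular_outside vinf" if "a \<in> regular_outside vinf" "b \<in> regular_outside vinf" for a b
    using that nonarch.nrm_le_1_add[OF na, of _ a "- b"] nonarch.nrm_minus[OF na] unfolding regular_outside_iff by simp
qed

text \<open>The assumption \<open>frac\<close> says that \<open>F\<close> is the fraction field of
  \<open>A\<close>. It is kept apart here, as it concerns only the function field;
  \<open>regular_outside_fraction\<close> establishes it.\<close>

locale drinfeld =
  fixes v :: "'k::field alg_closure \<Rightarrow> ereal" and vinf :: "'f::field \<Rightarrow> ereal" and \<psi> :: "'f \<Rightarrow> 'k poly"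
  assumes prime_k: "Factorial_Ring.prime CHAR('k)" and val: "valuation v" and lf: "local_field (base_val v)"
    and good: "good_drinfeld_module vinf (base_val v) \<psi>"
    and frac: "\<exists>a\<in>regular_outside vinf - {0}. a * f \<in> regular_outside vinf"

sublocale drinfeld \<subseteq> local_closure "absv v" "range to_ac" "CHAR('k)"
  by (rule local_closure_absv[OF prime_k val lf])

context drinfeld
begin

section \<open>The action of \<open>A\<close> on the algebraic closure\<close>

abbreviation A :: "'f set" where "A \<equiv> regular_outside vinf"
abbreviation act :: "'f \<Rightarrow> 'k alg_closure \<Rightarrow> 'k alg_closure" where "act a \<equiv> tw_eval (\<psi> a)"
abbreviation perf :: "'k alg_closure set" where "perf \<equiv> perfection"
abbreviation mm :: "'k alg_closure set" where "mm \<equiv> max_ideal v UNIV"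
abbreviation Operf :: "'k alg_closure set" where "Operf \<equiv> val_ring v perfection"

lemmas A_closed = regular_outside_closed[where vinf = vinf]

lemma A_sub: "add_subgroup A"
  unfolding add_subgroup_def using A_closed by auto

lemma mm_iff: "x \<in> mm \<longleftrightarrow> absv v x < 1"
  unfolding max_ideal_def using absv_less_1_iff[OF val] by simp

lemma mm_sub: "add_subgroup mm"
  unfolding add_subgroup_def by (auto simp: mm_iff intro: nrm_less_1_diff)

lemma perf_subfld: "subfld perf"
proof -
  let ?p = "CHAR('k)"
  have up: "x ^ (?p ^ (n + m)) \<in> range to_ac" if "x ^ (?p ^ n) \<in> range to_ac" for x :: "'k alg_closure" and n m
    unfolding power_add power_mult by (rule subfldD(9)[OF K that])
  have cm: "\<exists>n. x ^ (?p ^ n) \<in> range to_ac \<and> y ^ (?p ^ n) \<in> range to_ac" if xy: "x \<in> perf" "y \<in> perf" for x y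
  proof -
    obtain m n where mn: "x ^ (?p ^ m) \<in> range to_ac" "y ^ (?p ^ n) \<in> range to_ac" using xy unfolding perfection_def by auto
    then show ?thesis using up[OF mn(1), of n] up[OF mn(2), of m] by (intro exI[of _ "m + n"]) (simp add: add.commute)
  qed
  show ?thesis unfolding subfld_def
  proof (intro conjI ballI)
    show "0 \<in> perf" "1 \<in> perf" unfolding perfection_def
      using subfldD(1,2)[OF K] by (auto intro!: exI[of _ 0])
    fix x y assume "x \<in> perf" "y \<in> perf"
    then obtain n where n: "x ^ (?p ^ n) \<in> range to_ac" "y ^ (?p ^ n) \<in> range to_ac" using cm by blast
    show "x + y \<in> perf" unfolding perfection_def using subfldD(3)[OF K n] by (auto simp: frob_add intro!: exI[of _ n])
    show "x * y \<in> perf" unfolding perfection_def using subfldD(4)[OF K n] by (auto simp: power_mult_distrib intro!: exI[of _ n])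
  next
    fix x assume "x \<in> perf"
    then obtain n where n: "x ^ (?p ^ n) \<in> range to_ac" unfolding perfection_def by auto
    have "(- x) ^ (?p ^ n) = - (x ^ (?p ^ n))" using frob_diff[of 0 x n] p_gt_1 by (simp add: power_0_left)
    then show "- x \<in> perf" unfolding perfection_def using subfldD(5)[OF K n] by (intro CollectI exI[of _ n]) simp
    show "inverse x \<in> perf" unfolding perfection_def using subfldD(6)[OF K n] by (auto simp: power_inverse intro!: exI[of _ n])
  qed
qed

lemma Operf_iff: "x \<in> Operf \<longleftrightarrow> x \<in> perf \<and> absv v x \<le> 1"
  unfolding val_ring_def using absv_le_1_iff[OF val] by simp

lemma Operf_sub: "add_subgroup Operf"
  unfolding add_subgroup_def
proof (intro conjI ballI)
  show "0 \<in> Operf" unfolding Operf_iff using subfldD(1)[OF perf_subfld] by simp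
  fix x y assume "x \<in> Operf" "y \<in> Operf"
  then have "x \<in> perf" "y \<in> perf" "absv v x \<le> 1" "absv v y \<le> 1" by (simp_all add: Operf_iff)
  then show "x - y \<in> Operf"
    unfolding Operf_iff using subfldD(7)[OF perf_subfld] nrm_le_1_add[of x "- y"] by simp
qed

lemma K_sub_perf: "range to_ac \<subseteq> perf"
  unfolding perfection_def by (auto intro!: exI[of _ 0])

lemma psi_carrier: "a \<in> A \<Longrightarrow> base_val v (Polynomial.coeff (\<psi> a) k) \<ge> 0"
  using good unfolding good_drinfeld_module_def ring_hom_def ring_A_def twisted_poly_ring_def val_ring_def
  by (auto simp: ring_of_type_algebra_def)

definition cf :: "'f \<Rightarrow> nat \<Rightarrow> 'k alg_closure" where
  "cf a k = to_ac (Polynomial.coeff (\<psi> a) k)"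

abbreviation dg :: "'f \<Rightarrow> nat" where "dg a \<equiv> Polynomial.degree (\<psi> a)"

lemma act_addpoly: "act a x = addpoly (cf a) (dg a) x"
  unfolding tw_eval_def addpoly_def cf_def ..

lemma cf_K: "cf a k \<in> range to_ac"
  unfolding cf_def by simp

lemma cf_le_1: "a \<in> A \<Longrightarrow> absv v (cf a k) \<le> 1"
  using psi_carrier[of a k] unfolding cf_def base_val_def absv_le_1_iff[OF val] .

lemma cf_lead:
  assumes "a \<in> A" "a \<noteq> 0" shows "absv v (cf a (dg a)) = 1"
proof -
  have "Polynomial.lead_coeff (\<psi> a) \<in> Units (ring_of_type_algebra \<lparr>carrier := val_ring (base_val v) UNIV\<rparr>)"
    using good assms unfolding good_drinfeld_module_def by auto
  then obtain y where y: "y \<in> val_ring (base_val v) UNIV" "y * Polynomial.lead_coeff (\<psi> a) = 1"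
    unfolding Units_def by (auto simp: ring_of_type_algebra_def)
  have "absv v (to_ac y) \<le> 1" using y(1) unfolding val_ring_def base_val_def absv_le_1_iff[OF val] by simp
  moreover have "absv v (to_ac y) * absv v (cf a (dg a)) = 1"
    using y(2) unfolding cf_def nrm_mult[symmetric] by (metis nrm_1 to_ac_1 to_ac_mult)
  moreover have "absv v (cf a (dg a)) \<le> 1" using cf_le_1[OF assms(1)] .
  ultimately show ?thesis
    using mult_right_mono[of "absv v (to_ac y)" 1 "absv v (cf a (dg a))"] by simp
qed

lemma act_arg:
  "act a (x + y) = act a x + act a y" "act a (x - y) = act a x - act a y" "act a 0 = 0" "act a (- x) = - act a x"
  unfolding act_addpoly by (simp_all add: addpoly_add addpoly_diff addpoly_minus)

lemma act_add: "a \<in> A \<Longrightarrow> b \<in> A \<Longrightarrow> act (a + b) x = act a x + act b x"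
proof -
  assume "a \<in> A" "b \<in> A"
  then have "\<psi> (a + b) = \<psi> a + \<psi> b"
    using good unfolding good_drinfeld_module_def ring_hom_def ring_A_def twisted_poly_ring_def
    by (auto simp: ring_of_type_algebra_def)
  then show ?thesis by (simp add: tw_eval_add)
qed

lemma act_mult: "a \<in> A \<Longrightarrow> b \<in> A \<Longrightarrow> act (a * b) x = act a (act b x)"
proof -
  assume "a \<in> A" "b \<in> A"
  then have "\<psi> (a * b) = \<psi> a \<otimes>\<^bsub>twisted_poly_ring (val_ring (base_val v) UNIV)\<^esub> \<psi> b"
    using good unfolding good_drinfeld_module_def ring_hom_def ring_A_def
    by (auto simp: ring_of_type_algebra_def)
  then show ?thesis by (simp add: tw_eval_mult[OF prime_k])
qed

lemma act_1 [simp]: "act 1 x = x"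
proof -
  have "\<psi> 1 = 1"
    using good unfolding good_drinfeld_module_def ring_hom_def ring_A_def twisted_poly_ring_def
    by (auto simp: ring_of_type_algebra_def)
  then show ?thesis by simp
qed

lemma act_zero [simp]: "act 0 x = 0"
  using act_add[OF A_closed(1,1), of x] by (metis add_0 add_cancel_right_right)

lemma act_minus: "a \<in> A \<Longrightarrow> act (- a) x = - act a x"
  using act_add[of a "- a" x] A_closed(5)[of a] by (simp add: eq_neg_iff_add_eq_0 add.commute)

lemma act_diff: "a \<in> A \<Longrightarrow> b \<in> A \<Longrightarrow> act (a - b) x = act a x - act b x"
  using act_add[of a "- b" x] act_minus[of b] A_closed(5)[of b] by simp

text \<open>This is where good reduction enters: coefficients are integral and the leading one is a
  unit. In particular, two division points of the same element differ by an integral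
  element.\<close>

lemma act_le_1_iff: "a \<in> A \<Longrightarrow> a \<noteq> 0 \<Longrightarrow> absv v (act a x) \<le> 1 \<longleftrightarrow> absv v x \<le> 1"
  unfolding act_addpoly using cf_le_1 cf_lead by (intro nrm_addpoly_iff) auto

lemma act_nrm: "a \<in> A \<Longrightarrow> a \<noteq> 0 \<Longrightarrow> 1 < absv v x \<Longrightarrow> absv v (act a x) = absv v x ^ (CHAR('k) ^ dg a)"
  unfolding act_addpoly using cf_le_1 cf_lead by (intro nrm_addpoly_gt_1) auto

lemma act_le_1: "a \<in> A \<Longrightarrow> absv v x \<le> 1 \<Longrightarrow> absv v (act a x) \<le> 1"
  using act_le_1_iff[of a x] by (cases "a = 0") auto

lemma act_less_1:
  assumes "a \<in> A" "absv v x < 1" shows "absv v (act a x) < 1"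
  unfolding act_addpoly addpoly_def
proof (rule nrm_sum_less)
  fix k
  have "absv v x ^ (CHAR('k) ^ k) \<le> absv v x ^ 1"
    by (rule power_decreasing) (use assms(2) p_gt_1 in auto)
  then have "absv v x ^ (CHAR('k) ^ k) < 1" using assms(2) by simp
  then show "absv v (cf a k * x ^ (CHAR('k) ^ k)) < 1"
    by (intro nrm_less_1_mult cf_le_1[OF assms(1)]) (simp add: nrm_power)
qed simp

lemma act_surj:
  assumes "a \<in> A" "a \<noteq> 0" obtains x where "act a x = y"
proof -
  define G where "G = (\<Sum>k\<le>dg a. Polynomial.monom (cf a k) (CHAR('k) ^ k)) - [:y:]"
  have ev: "poly G x = act a x - y" for x unfolding G_def act_addpoly addpoly_def by (simp add: poly_sum poly_monom)
  have pos: "0 < CHAR('k) ^ dg a" using p_gt_1 by simp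
  \<comment> \<open>A positive exponent keeps the top coefficient apart from the constant
    \<open>y\<close>, also in the case \<open>dg a = 0\<close>.\<close>
  then obtain m where m: "CHAR('k) ^ dg a = Suc m" by (cases "CHAR('k) ^ dg a") auto
  have "Polynomial.coeff G (CHAR('k) ^ dg a) = (\<Sum>k\<le>dg a. if CHAR('k) ^ k = CHAR('k) ^ dg a then cf a k else 0)"
    unfolding G_def by (simp add: coeff_sum m coeff_pCons)
  also have "\<dots> = cf a (dg a)" unfolding p_pow_inj by simp
  finally have "Polynomial.coeff G (CHAR('k) ^ dg a) \<noteq> 0" using cf_lead[OF assms] by auto
  then have "0 < Polynomial.degree G" using pos le_degree[of G "CHAR('k) ^ dg a"] by linarith
  then obtain x where "poly G x = 0" using alg_closed_imp_poly_has_root by blast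
  then show thesis using that[of x] ev by simp
qed

lemma perf_act: "x \<in> perf \<Longrightarrow> act a x \<in> perf"
  unfolding act_addpoly addpoly_def
  by (intro subfld_sum[OF perf_subfld] subfldD(4,9)[OF perf_subfld]) (use cf_K K_sub_perf in auto)

lemma Iner_perf: "\<sigma> \<in> Iner \<Longrightarrow> x \<in> perf \<Longrightarrow> \<sigma> x = x"
proof -
  assume \<sigma>: "\<sigma> \<in> Iner" and "x \<in> perf"
  then obtain n where n: "x ^ (CHAR('k) ^ n) \<in> range to_ac" unfolding perfection_def by auto
  have "\<sigma> (x ^ (CHAR('k) ^ n)) = x ^ (CHAR('k) ^ n)"
    by (rule InerD(2)[OF \<sigma> subsetD[OF K_sub_E n]])
  then have "\<sigma> x ^ (CHAR('k) ^ n) = x ^ (CHAR('k) ^ n)"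
    by (simp only: field_autD(8)[OF InerD(1)[OF \<sigma>]])
  then show ?thesis by (simp add: frob_inj)
qed

lemma inertia_eq: "inertia v = Iner"
proof (intro equalityI subsetI)
  fix \<gamma> assume \<gamma>: "\<gamma> \<in> inertia v"
  have "field_aut \<gamma>" using \<gamma> unfolding inertia_def gal_def ring_iso_def ring_hom_def field_aut_def
    by (auto simp: ring_of_type_algebra_def)
  then show "\<gamma> \<in> Iner" using \<gamma> K_sub_perf absv_le_1_iff[OF val] absv_less_1_iff[OF val]
    unfolding Iner_def inertia_def gal_def val_ring_def max_ideal_def by auto
next
  fix \<gamma> assume \<gamma>: "\<gamma> \<in> Iner"
  have "\<gamma> \<in> gal" using InerD(1)[OF \<gamma>] Iner_perf[OF \<gamma>] unfolding gal_def ring_iso_def ring_hom_def field_aut_def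
    by (auto simp: ring_of_type_algebra_def)
  then show "\<gamma> \<in> inertia v" using InerD(3)[OF \<gamma>] absv_le_1_iff[OF val] absv_less_1_iff[OF val]
    unfolding inertia_def val_ring_def max_ideal_def by auto
qed

lemma Iner_act: "\<sigma> \<in> Iner \<Longrightarrow> \<sigma> (act a x) = act a (\<sigma> x)"
  unfolding act_addpoly by (rule addpoly_aut) (auto intro: InerD(1) InerD(2) subsetD[OF K_sub_E cf_K])

section \<open>The local Kummer pairing\<close>

abbreviation dl :: "('k alg_closure \<Rightarrow> 'k alg_closure) \<Rightarrow> 'k alg_closure \<Rightarrow> 'k alg_closure" where
  "dl \<sigma> x \<equiv> \<sigma> x - x"

lemma dl_act: "\<sigma> \<in> Iner \<Longrightarrow> dl \<sigma> (act a x) = act a (dl \<sigma> x)"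
  by (simp add: Iner_act act_arg)

lemma dl_add: "\<sigma> \<in> Iner \<Longrightarrow> dl \<sigma> (x + y) = dl \<sigma> x + dl \<sigma> y"
  by (simp add: field_autD(4)[OF InerD(1)])

lemma dl_diff: "\<sigma> \<in> Iner \<Longrightarrow> dl \<sigma> (x - y) = dl \<sigma> x - dl \<sigma> y"
  by (simp add: field_autD(7)[OF InerD(1)])

text \<open>By good reduction \<open>x - y\<close> is integral, and inertia moves integral elements
  by less than 1. This makes the pairing depend only on classes modulo integral elements.\<close>

lemma dl_close:
  assumes "\<sigma> \<in> Iner" "a \<in> A" "a \<noteq> 0" "absv v (act a x - act a y) \<le> 1"
  shows "absv v (dl \<sigma> x - dl \<sigma> y) < 1"
proof -
  have "absv v (x - y) \<le> 1" using assms(4) act_le_1_iff[OF assms(2,3), of "x - y"] by (simp only: act_arg(2))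
  then show ?thesis unfolding dl_diff[OF assms(1), symmetric] by (rule InerD(3)[OF assms(1)])
qed

lemma dl_le_1:
  assumes "\<sigma> \<in> Iner" "a \<in> A" "a \<noteq> 0" "act a x \<in> perf"
  shows "absv v (dl \<sigma> x) \<le> 1" "act a (dl \<sigma> x) = 0"
proof -
  show z: "act a (dl \<sigma> x) = 0" using dl_act[OF assms(1), of a x] Iner_perf[OF assms(1,4)] by simp
  show "absv v (dl \<sigma> x) \<le> 1" using act_le_1_iff[OF assms(2,3), of "dl \<sigma> x"] z by simp
qed

text \<open>The defect of additivity is \<open>dl \<sigma> (dl \<tau> x)\<close>, and
  \<open>dl \<tau> x\<close> is integral.\<close>

lemma dl_comp:
  assumes "\<sigma> \<in> Iner" "\<tau> \<in> Iner" "a \<in> A" "a \<noteq> 0" "act a x \<in> perf"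
  shows "absv v (dl (\<sigma> \<circ> \<tau>) x - (dl \<sigma> x + dl \<tau> x)) < 1"
proof -
  have "dl (\<sigma> \<circ> \<tau>) x - (dl \<sigma> x + dl \<tau> x) = dl \<sigma> (dl \<tau> x)"
    by (simp add: field_autD(7)[OF InerD(1)[OF assms(1)]])
  then show ?thesis by (simp only: InerD(3)[OF assms(1) dl_le_1(1)[OF assms(2-5)]])
qed

text \<open>Both expressions are compared with the values at one common division point
  \<open>y\<close> for \<open>a * a'\<close>.\<close>

lemma pairing_wd:
  assumes \<sigma>: "\<sigma> \<in> Iner" and a: "a \<in> A" "a \<noteq> 0" "a' \<in> A" "a' \<noteq> 0" and b: "b \<in> A" "b' \<in> A"
    and bb: "b / a - b' / a' \<in> A" and x: "act a x = \<xi>" "act a' x' = \<xi>'" and \<xi>: "\<xi> \<in> perf" "absv v (\<xi> - \<xi>') \<le> 1"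
  shows "absv v (act b (dl \<sigma> x) - act b' (dl \<sigma> x')) < 1"
proof -
  have aa: "a * a' \<in> A" "a * a' \<noteq> 0" using a A_closed(4) by auto
  obtain y where y: "act (a * a') y = \<xi>" using act_surj[OF aa] by auto
  have y1: "act a (act a' y) = \<xi>" using act_mult[OF a(1,3)] y by simp
  have y2: "act a' (act a y) = \<xi>" using act_mult[OF a(3,1), of y] y by (simp add: mult.commute)
  have d1: "absv v (dl \<sigma> x - dl \<sigma> (act a' y)) < 1"
    by (rule dl_close[OF \<sigma> a(1,2)]) (simp add: x y1)
  have d2: "absv v (dl \<sigma> x' - dl \<sigma> (act a y)) < 1"
    by (rule dl_close[OF \<sigma> a(3,4)]) (use \<xi>(2) in \<open>simp add: x y2 nrm_diff_commute[of \<xi>]\<close>)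
  have e1: "absv v (act b (dl \<sigma> x) - act (b * a') (dl \<sigma> y)) < 1"
    using act_less_1[OF b(1) d1] by (simp only: act_arg(2) dl_act[OF \<sigma>] act_mult[OF b(1) a(3)])
  have e2: "absv v (act b' (dl \<sigma> x') - act (b' * a) (dl \<sigma> y)) < 1"
    using act_less_1[OF b(2) d2] by (simp only: act_arg(2) dl_act[OF \<sigma>] act_mult[OF b(2) a(1)])
  \<comment> \<open>The discrepancy is the action of \<open>b / a - b' / a'\<close> on
    \<open>dl \<sigma> \<xi>\<close>, which is zero since inertia fixes the perfection.\<close>
  have c: "b * a' - b' * a = (b / a - b' / a') * (a * a')" using a by (simp add: field_simps)
  have "act (b * a') (dl \<sigma> y) - act (b' * a) (dl \<sigma> y) = act (b * a' - b' * a) (dl \<sigma> y)"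
    using A_closed(4) a b by (simp add: act_diff)
  also have "\<dots> = act (b / a - b' / a') (dl \<sigma> (act (a * a') y))"
    unfolding c act_mult[OF bb aa(1)] dl_act[OF \<sigma>] ..
  also have "\<dots> = 0" using Iner_perf[OF \<sigma> \<xi>(1)] unfolding y by (simp add: act_arg)
  finally have e3: "act (b * a') (dl \<sigma> y) = act (b' * a) (dl \<sigma> y)" by simp
  have "absv v ((act b (dl \<sigma> x) - act (b * a') (dl \<sigma> y)) - (act b' (dl \<sigma> x') - act (b' * a) (dl \<sigma> y))) < 1"
    by (rule nrm_less_1_diff[OF e1 e2])
  then show ?thesis using e3 by simp
qed

lemma F_carrier: "carrier (F_mod_A vinf) = quotient_set UNIV A"
  unfolding F_mod_A_def quotient_module_def by simp

lemma F_rep: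
  assumes "U \<in> quotient_set UNIV A"
  obtains a b where "a \<in> A" "a \<noteq> 0" "b \<in> A" "U = b / a +o A"
proof -
  obtain f where f: "U = f +o A" using assms unfolding quotient_set_def by auto
  obtain a where a: "a \<in> A" "a \<noteq> 0" "a * f \<in> A" using frac[of f] by auto
  show thesis by (rule that[of a "a * f"]) (use a f in auto)
qed

lemma kummer_eq:
  assumes \<sigma>: "\<sigma> \<in> Iner" and a: "a \<in> A" "a \<noteq> 0" "b \<in> A" and x: "act a x = \<xi>" "\<xi> \<in> perf"
  shows "kummer vinf v \<psi> \<xi> \<sigma> (b / a +o A) = act b (dl \<sigma> x) +o mm"
proof -
  have U: "b / a +o A \<in> carrier (F_mod_A vinf)" unfolding F_carrier quotient_set_def by auto
  have "(THE V. \<exists>a' b' \<xi>\<^sub>a. a' \<in> A - {0} \<and> b' \<in> A \<and> b / a +o A = b' / a' +o A \<and> act a' \<xi>\<^sub>a = \<xi> \<and>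
      V = act b' (\<sigma> \<xi>\<^sub>a - \<xi>\<^sub>a) +o mm) = act b (dl \<sigma> x) +o mm"
  proof (rule the_equality)
    show "\<exists>a' b' \<xi>\<^sub>a. a' \<in> A - {0} \<and> b' \<in> A \<and> b / a +o A = b' / a' +o A \<and> act a' \<xi>\<^sub>a = \<xi> \<and>
      act b (dl \<sigma> x) +o mm = act b' (\<sigma> \<xi>\<^sub>a - \<xi>\<^sub>a) +o mm"
      using a x by (intro exI[of _ a] exI[of _ b] exI[of _ x]) simp
    fix V assume "\<exists>a' b' \<xi>\<^sub>a. a' \<in> A - {0} \<and> b' \<in> A \<and> b / a +o A = b' / a' +o A \<and> act a' \<xi>\<^sub>a = \<xi> \<and>
      V = act b' (\<sigma> \<xi>\<^sub>a - \<xi>\<^sub>a) +o mm"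
    then obtain a' b' x' where *: "a' \<in> A" "a' \<noteq> 0" "b' \<in> A" "b / a +o A = b' / a' +o A" "act a' x' = \<xi>"
      "V = act b' (dl \<sigma> x') +o mm" by auto
    have "b' / a' - b / a \<in> A" using *(4) coset_eq[OF A_sub] by metis
    then show "V = act b (dl \<sigma> x) +o mm"
      unfolding *(6) coset_eq[OF mm_sub] mm_iff
      by (intro pairing_wd[OF \<sigma> *(1,2) a(1,2) *(3) a(3) _ *(5) x(1,2)]) simp_all
  qed
  then show ?thesis unfolding kummer_def using U by simp
qed

lemma kummer_ext: "U \<notin> quotient_set UNIV A \<Longrightarrow> kummer vinf v \<psi> \<xi> \<sigma> U = undefined"
  unfolding kummer_def F_carrier by simp

lemma kummer_cong:
  assumes \<sigma>: "\<sigma> \<in> Iner" "\<tau> \<in> Iner" and \<xi>: "\<xi> \<in> perf" "\<xi>' \<in> perf" "absv v (\<xi> - \<xi>') \<le> 1"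
    and close: "\<And>a x. a \<in> A \<Longrightarrow> a \<noteq> 0 \<Longrightarrow> act a x \<in> perf \<Longrightarrow> absv v (\<sigma> x - \<tau> x) < 1"
  shows "kummer vinf v \<psi> \<xi> \<sigma> = kummer vinf v \<psi> \<xi>' \<tau>"
proof
  fix U
  show "kummer vinf v \<psi> \<xi> \<sigma> U = kummer vinf v \<psi> \<xi>' \<tau> U"
  proof (cases "U \<in> quotient_set UNIV A")
    case True
    obtain a b where ab: "a \<in> A" "a \<noteq> 0" "b \<in> A" "U = b / a +o A" by (rule F_rep[OF True])
    obtain x where x: "act a x = \<xi>" using act_surj[OF ab(1,2)] by auto
    obtain x' where x': "act a x' = \<xi>'" using act_surj[OF ab(1,2)] by auto
    have z: "b / a - b / a \<in> A" using A_closed(1) by simp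
    have 1: "absv v (act b (dl \<sigma> x) - act b (dl \<sigma> x')) < 1"
      by (rule pairing_wd[OF \<sigma>(1) ab(1,2,1,2,3,3) z x x' \<xi>(1,3)])
    have "absv v (dl \<sigma> x' - dl \<tau> x') < 1" using close[OF ab(1,2), of x'] x' \<xi>(2) by simp
    then have 2: "absv v (act b (dl \<sigma> x') - act b (dl \<tau> x')) < 1"
      using act_less_1[OF ab(3)] by (simp only: act_arg(2)[symmetric])
    have "absv v ((act b (dl \<sigma> x) - act b (dl \<sigma> x')) + (act b (dl \<sigma> x') - act b (dl \<tau> x'))) < 1"
      by (rule nrm_less_1_add[OF 1 2])
    then show ?thesis unfolding ab(4) kummer_eq[OF \<sigma>(1) ab(1-3) x \<xi>(1)] kummer_eq[OF \<sigma>(2) ab(1-3) x' \<xi>(2)]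
      coset_eq[OF mm_sub] mm_iff by simp
  qed (simp add: kummer_ext)
qed

end

section \<open>The group J\<close>

lemma eval_eq_poly:
  "ring.eval (ring_of_type_algebra :: 'a::field ring) xs x = poly (Poly (rev xs)) x"
proof -
  interpret field "ring_of_type_algebra :: 'a ring" by (rule field_from_type_algebra)
  have pw: "y [^]\<^bsub>ring_of_type_algebra\<^esub> n = (y::'a) ^ n" for y and n :: nat
    by (induction n) (simp_all add: ring_of_type_algebra_def mult.commute)
  show ?thesis
    by (induction xs) (simp_all add: pw Poly_append poly_monom, simp_all add: ring_of_type_algebra_def add.commute)
qed

lemma subfield_of_subfld:
  assumes "subfld (D :: 'a::field set)" shows "subfield D ring_of_type_algebra"
proof -
  interpret field "ring_of_type_algebra :: 'a ring" by (rule field_from_type_algebra)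
  have R: "carrier (ring_of_type_algebra :: 'a ring) = UNIV" "\<zero>\<^bsub>ring_of_type_algebra\<^esub> = (0::'a)"
    "\<one>\<^bsub>ring_of_type_algebra\<^esub> = (1::'a)" "\<And>x y. x \<otimes>\<^bsub>ring_of_type_algebra\<^esub> y = (x::'a) * y"
    "\<And>x y. x \<oplus>\<^bsub>ring_of_type_algebra\<^esub> y = (x::'a) + y"
    by (simp_all add: ring_of_type_algebra_def)
  have neg: "\<ominus>\<^bsub>ring_of_type_algebra\<^esub> x = - (x::'a)" for x
    by (rule minus_equality) (simp_all add: R)
  have inv: "inv\<^bsub>ring_of_type_algebra\<^esub> x = inverse (x::'a)" if "x \<noteq> 0" for x
    by (rule comm_inv_char) (use that in \<open>simp_all add: R\<close>)
  show ?thesis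
  proof (rule subfieldI')
    show "subring D ring_of_type_algebra"
      by (rule subringI) (use subfldD[OF assms] in \<open>simp_all add: R neg\<close>)
    show "inv\<^bsub>ring_of_type_algebra\<^esub> k \<in> D" if "k \<in> D - {\<zero>\<^bsub>ring_of_type_algebra\<^esub>}" for k
      using that subfldD(6)[OF assms, of k] inv[of k] by (simp add: R)
  qed
qed

text \<open>Supplies the finite-dimensional intermediate fields that occur in the definition of
  \<open>krull_topology\<close>.\<close>

lemma finite_subextension:
  fixes D :: "'a::field set"
  assumes D: "subfld D" and x: "algebraic_over D x"
  obtains L where "subfield L ring_of_type_algebra" "D \<subseteq> L" "x \<in> L"
    "ring.finite_dimension ring_of_type_algebra D L"
proof -
  interpret field "ring_of_type_algebra :: 'a ring" by (rule field_from_type_algebra)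
  have R: "carrier (ring_of_type_algebra :: 'a ring) = UNIV" "\<zero>\<^bsub>ring_of_type_algebra\<^esub> = (0::'a)"
    by (simp_all add: ring_of_type_algebra_def)
  have sD: "subfield D ring_of_type_algebra" by (rule subfield_of_subfld[OF D])
  obtain P where P: "P \<noteq> 0" "\<forall>i. Polynomial.coeff P i \<in> D" "poly P x = 0" using x unfolding algebraic_over_def by auto
  have "(algebraic over D) x"
  proof (rule algebraicI[of "rev (coeffs P)"])
    have "set (coeffs P) \<subseteq> D" using P(2) by (auto simp: coeffs_def split: if_splits)
    then show "rev (coeffs P) \<in> carrier (D[X]\<^bsub>ring_of_type_algebra\<^esub>)"
      unfolding univ_poly_def polynomial_def using P(1) by (simp add: hd_rev last_coeffs_eq_coeff_degree R)
    show "rev (coeffs P) \<noteq> []" using P(1) by simp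
    show "ring.eval ring_of_type_algebra (rev (coeffs P)) x = \<zero>\<^bsub>ring_of_type_algebra\<^esub>"
      unfolding eval_eq_poly R using P(3) by simp
  qed
  then show thesis
    using that[of "simple_extension D x"] simple_extension_is_subfield[OF sD, of x]
      finite_dimension_simple_extension[OF sD, of x] simple_extension_mem[OF subfieldE(1)[OF sD], of x]
      simple_extension_incl[of D x] R subfieldE(3)[OF sD] by auto
qed

context drinfeld
begin

lemma Iner_inv:
  assumes "\<sigma> \<in> Iner" shows "inv_into UNIV \<sigma> \<in> Iner"
proof (rule InerI)
  note aut = InerD(1)[OF assms]
  have b: "\<sigma> (inv_into UNIV \<sigma> x) = x" for x using field_autD(1)[OF aut] by (simp add: bij_is_surj surj_f_inv_f)
  have e: "inv_into UNIV \<sigma> y = x" if "\<sigma> x = y" for x y using that field_autD(9)[OF aut] b by metis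
  show "field_aut (inv_into UNIV \<sigma>)" unfolding field_aut_def
  proof (intro conjI allI)
    show "bij (inv_into UNIV \<sigma>)" using field_autD(1)[OF aut] by (rule bij_imp_bij_inv)
    show "inv_into UNIV \<sigma> 1 = 1" by (rule e) (rule field_autD(2)[OF aut])
    show "inv_into UNIV \<sigma> (x + y) = inv_into UNIV \<sigma> x + inv_into UNIV \<sigma> y"
      "inv_into UNIV \<sigma> (x * y) = inv_into UNIV \<sigma> x * inv_into UNIV \<sigma> y" for x y
      by (rule e, simp add: field_autD(4,5)[OF aut] b)+
  qed
  show "inv_into UNIV \<sigma> x = x" if "x \<in> E" for x by (rule e) (rule InerD(2)[OF assms that])
qed

abbreviation Gr :: "('k alg_closure \<Rightarrow> 'k alg_closure) monoid" where "Gr \<equiv> inertia_group v"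

lemma Gr_simps: "carrier Gr = Iner" "\<sigma> \<otimes>\<^bsub>Gr\<^esub> \<tau> = \<sigma> \<circ> \<tau>" "\<one>\<^bsub>Gr\<^esub> = id"
  by (simp_all add: inertia_group_def inertia_eq)

lemma Gr_group: "group Gr"
proof (rule groupI, unfold Gr_simps)
  show "\<exists>y\<in>Iner. y \<circ> x = id" if "x \<in> Iner" for x
    using Iner_inv[OF that] field_autD(1)[OF InerD(1)[OF that]] by (intro bexI[of _ "inv_into UNIV x"]) (auto simp: bij_def)
qed (auto simp: Iner_comp id_Iner comp_assoc)

text \<open>\<open>\<sigma>\<close> acts as \<open>f\<close> prescribes, modulo the maximal ideal,
  on all division points of elements of the perfection. Composition of automorphisms corresponds to
  addition of such functions, which is what lets the pairing descend to
  \<open>J_group\<close>.\<close>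

definition sim :: "('k alg_closure \<Rightarrow> 'k alg_closure) \<Rightarrow> ('k alg_closure \<Rightarrow> 'k alg_closure) \<Rightarrow> bool" where
  "sim \<sigma> f \<longleftrightarrow> (\<forall>a x. a \<in> A \<longrightarrow> a \<noteq> 0 \<longrightarrow> act a x \<in> perf \<longrightarrow> absv v (dl \<sigma> x - f x) < 1)"

lemma sim_comp:
  assumes "\<sigma> \<in> Iner" "\<tau> \<in> Iner" "sim \<sigma> f" "sim \<tau> g" "\<And>x. h x = f x + g x"
  shows "sim (\<sigma> \<circ> \<tau>) h"
  unfolding sim_def
proof (intro allI impI)
  fix a x assume a: "a \<in> A" "a \<noteq> 0" "act a x \<in> perf"
  have 1: "absv v (dl \<sigma> x - f x) < 1" "absv v (dl \<tau> x - g x) < 1" using assms(3,4) a unfolding sim_def by blast+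
  have "dl (\<sigma> \<circ> \<tau>) x - h x = (dl (\<sigma> \<circ> \<tau>) x - (dl \<sigma> x + dl \<tau> x)) + ((dl \<sigma> x - f x) + (dl \<tau> x - g x))"
    unfolding assms(5) by (simp only: algebra_simps)
  then show "absv v (dl (\<sigma> \<circ> \<tau>) x - h x) < 1"
    by (simp only: nrm_less_1_add[OF dl_comp[OF assms(1,2) a] nrm_less_1_add[OF 1]])
qed

lemma sim_self: "sim \<sigma> (dl \<sigma>)"
  unfolding sim_def by simp

lemma sim_id: "sim id (\<lambda>_. 0)"
  unfolding sim_def by simp

lemma sim_inv:
  assumes "\<sigma> \<in> Iner" "\<tau> \<in> Iner" "\<sigma> \<circ> \<tau> = id" "sim \<sigma> f" "\<And>x. g x = - f x"
  shows "sim \<tau> g"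
  unfolding sim_def
proof (intro allI impI)
  fix a x assume a: "a \<in> A" "a \<noteq> 0" "act a x \<in> perf"
  have 1: "absv v (dl \<sigma> x - f x) < 1" using assms(4) a unfolding sim_def by blast
  have "absv v (dl (\<sigma> \<circ> \<tau>) x - (dl \<sigma> x + dl \<tau> x)) < 1" by (rule dl_comp[OF assms(1,2) a])
  then have 2: "absv v (dl \<sigma> x + dl \<tau> x) < 1" unfolding assms(3) using nrm_minus[of "dl \<sigma> x + dl \<tau> x"] by simp
  have "dl \<tau> x - g x = (dl \<sigma> x + dl \<tau> x) - (dl \<sigma> x - f x)" unfolding assms(5) by (simp only: algebra_simps) simp
  then show "absv v (dl \<tau> x - g x) < 1" by (simp only: nrm_less_1_diff[OF 2 1])
qed

abbreviation Ker :: "('k alg_closure \<Rightarrow> 'k alg_closure) set" where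
  "Ker \<equiv> {\<sigma> \<in> Iner. sim \<sigma> (\<lambda>_. 0)}"

abbreviation Der :: "('k alg_closure \<Rightarrow> 'k alg_closure) set" where
  "Der \<equiv> subtopology krull_topology (inertia v) closure_of derived Gr (inertia v)"

lemma inv_Gr:
  assumes "\<sigma> \<in> Iner" shows "inv\<^bsub>Gr\<^esub> \<sigma> \<in> Iner" "\<sigma> \<circ> inv\<^bsub>Gr\<^esub> \<sigma> = id"
  using group.inv_closed[OF Gr_group, of \<sigma>] group.r_inv[OF Gr_group, of \<sigma>] assms by (simp_all add: Gr_simps)

text \<open>Modulo small elements \<open>dl\<close> is additive in the automorphism, with values in
  an abelian group, so a commutator contributes zero.\<close>

lemma commutator_Ker:
  assumes "h \<in> derived_set Gr Iner" shows "h \<in> Ker"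
proof -
  obtain s t where st: "s \<in> Iner" "t \<in> Iner" "h = ((s \<circ> t) \<circ> inv\<^bsub>Gr\<^esub> s) \<circ> inv\<^bsub>Gr\<^esub> t"
    using assms by (auto simp: Gr_simps)
  note s' = inv_Gr[OF st(1)] and t' = inv_Gr[OF st(2)]
  have 1: "sim (inv\<^bsub>Gr\<^esub> s) (\<lambda>x. - dl s x)" by (rule sim_inv[OF st(1) s'(1,2) sim_self]) simp
  have 2: "sim (inv\<^bsub>Gr\<^esub> t) (\<lambda>x. - dl t x)" by (rule sim_inv[OF st(2) t'(1,2) sim_self]) simp
  have 3: "sim (s \<circ> t) (\<lambda>x. dl s x + dl t x)" by (rule sim_comp[OF st(1,2) sim_self sim_self]) simp
  have 4: "sim ((s \<circ> t) \<circ> inv\<^bsub>Gr\<^esub> s) (\<lambda>x. dl t x)"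
    by (rule sim_comp[OF Iner_comp[OF st(1,2)] s'(1) 3 1]) simp
  have "sim h (\<lambda>x. 0)" unfolding st(3)
    by (rule sim_comp[OF Iner_comp[OF Iner_comp[OF st(1,2)] s'(1)] t'(1) 4 2]) simp
  moreover have "h \<in> Iner" unfolding st(3) by (rule Iner_comp[OF Iner_comp[OF Iner_comp[OF st(1,2)] s'(1)] t'(1)])
  ultimately show ?thesis by simp
qed

lemma derived_Ker: "derived Gr (inertia v) \<subseteq> Ker"
proof
  fix \<sigma> assume "\<sigma> \<in> derived Gr (inertia v)"
  then have "\<sigma> \<in> generate Gr (derived_set Gr Iner)" unfolding derived_def inertia_eq .
  then show "\<sigma> \<in> Ker"
  proof (induction rule: generate.induct)
    case one
    show ?case unfolding Gr_simps(3) using id_Iner sim_id by blast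
  next
    case (incl h)
    then show ?case by (rule commutator_Ker)
  next
    case (inv h)
    then have "h \<in> Ker" by (rule commutator_Ker)
    then have h: "h \<in> Iner" "sim h (\<lambda>_. 0)" by simp_all
    have "sim (inv\<^bsub>Gr\<^esub> h) (\<lambda>_. 0)" by (rule sim_inv[OF h(1) inv_Gr[OF h(1)] h(2)]) simp
    then show ?case using inv_Gr(1)[OF h(1)] by simp
  next
    case (eng h1 h2)
    then have h: "h1 \<in> Iner" "h2 \<in> Iner" "sim h1 (\<lambda>_. 0)" "sim h2 (\<lambda>_. 0)" by simp_all
    have "sim (h1 \<circ> h2) (\<lambda>_. 0)" by (rule sim_comp[OF h]) simp
    then show ?case unfolding Gr_simps(2) by (intro CollectI conjI Iner_comp[OF h(1,2)])
  qed
qed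

lemma krull_nbhd:
  assumes \<sigma>: "\<sigma> \<in> Iner"
  shows "\<exists>T. openin (subtopology krull_topology (inertia v)) T \<and> \<sigma> \<in> T \<and>
    T \<subseteq> Iner \<and> (\<forall>\<tau>\<in>T. \<tau> x = \<sigma> x)"
proof -
  have "algebraic_over perf x" by (rule algebraic_over_mono[OF alg K_sub_perf])
  then obtain L where L: "subfield L ring_of_type_algebra" "perf \<subseteq> L" "x \<in> L"
    "ring.finite_dimension ring_of_type_algebra perf L"
    by (rule finite_subextension[OF perf_subfld])
  have gal: "\<sigma> \<in> gal" using \<sigma> inertia_eq unfolding inertia_def by auto
  let ?S = "{\<tau> \<in> gal. \<forall>x\<in>L. \<tau> x = \<sigma> x}"
  have "openin krull_topology ?S" unfolding krull_topology_def
    by (rule topology_generated_by_Basis) (use L gal in blast)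
  then have "openin (subtopology krull_topology (inertia v)) (?S \<inter> inertia v)"
    by (rule openin_subtopology_Int)
  moreover have "?S \<inter> inertia v \<subseteq> Iner" "\<sigma> \<in> ?S \<inter> inertia v" "\<forall>\<tau>\<in>?S \<inter> inertia v. \<tau> x = \<sigma> x"
    using \<sigma> gal L(3) inertia_eq by auto
  ultimately show ?thesis by blast
qed

text \<open>The condition defining \<open>Ker\<close> at a division point \<open>x\<close> involves
  only the value at \<open>x\<close>, and a Krull neighbourhood can be chosen in which this value is
  constant. Hence the condition survives the closure.\<close>

lemma Der_Ker: "Der \<subseteq> Ker"
proof
  fix \<sigma> assume D: "\<sigma> \<in> Der"
  then have "\<sigma> \<in> topspace (subtopology krull_topology (inertia v))" by (simp add: in_closure_of)
  then have \<sigma>: "\<sigma> \<in> Iner" using inertia_eq by simp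
  have "sim \<sigma> (\<lambda>_. 0)" unfolding sim_def
  proof (intro allI impI)
    fix a x assume a: "a \<in> A" "a \<noteq> 0" "act a x \<in> perf"
    obtain T where T: "openin (subtopology krull_topology (inertia v)) T" "\<sigma> \<in> T"
      "\<forall>\<tau>\<in>T. \<tau> x = \<sigma> x" using krull_nbhd[OF \<sigma>, of x] by (elim exE conjE)
    have "\<forall>T. \<sigma> \<in> T \<and> openin (subtopology krull_topology (inertia v)) T \<longrightarrow>
        (\<exists>\<tau>. \<tau> \<in> derived Gr (inertia v) \<and> \<tau> \<in> T)"
      by (rule conjunct2[OF D[unfolded in_closure_of]])
    then obtain \<tau> where \<tau>: "\<tau> \<in> derived Gr (inertia v)" "\<tau> \<in> T" using T(1,2) by metis
    then have "sim \<tau> (\<lambda>_. 0)" using derived_Ker by blast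
    then have "absv v (dl \<tau> x - 0) < 1" using a unfolding sim_def by blast
    then show "absv v (dl \<sigma> x - 0) < 1" using bspec[OF T(3) \<tau>(2)] by simp
  qed
  then show "\<sigma> \<in> Ker" using \<sigma> by simp
qed

lemma id_Der: "id \<in> Der"
proof -
  obtain T where T: "openin (subtopology krull_topology (inertia v)) T" "id \<in> T"
    using krull_nbhd[OF id_Iner, of 0] by (elim exE conjE)
  have "id \<in> topspace (subtopology krull_topology (inertia v))" using openin_subset[OF T(1)] T(2) by (rule subsetD)
  moreover have "id \<in> derived Gr (inertia v)" unfolding derived_def using generate.one[of Gr] by (simp add: Gr_simps)
  ultimately show ?thesis by (intro subsetD[OF closure_of_subset_Int] IntI)
qed

abbreviation Gab :: "('k alg_closure \<Rightarrow> 'k alg_closure) set monoid" where "Gab \<equiv> inertia_ab v"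

lemma carrier_Gab: "carrier Gab = {{d \<circ> \<gamma> | d. d \<in> Der} | \<gamma>. \<gamma> \<in> Iner}"
  unfolding inertia_ab_def carrier_FactGroup by (auto simp: r_coset_def Gr_simps)

lemma Gab_mult: "P \<otimes>\<^bsub>Gab\<^esub> Q = {\<sigma> \<circ> \<tau> | \<sigma> \<tau>. \<sigma> \<in> P \<and> \<tau> \<in> Q}"
  unfolding inertia_ab_def by (auto simp: set_mult_def Gr_simps)

lemma Gab_one: "\<one>\<^bsub>Gab\<^esub> = Der"
  unfolding inertia_ab_def by simp

lemma Gab_pow: "P [^]\<^bsub>Gab\<^esub> (0::nat) = Der" "P [^]\<^bsub>Gab\<^esub> Suc n = P [^]\<^bsub>Gab\<^esub> n \<otimes>\<^bsub>Gab\<^esub> P"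
  by (simp_all add: nat_pow_def Gab_one)

lemma Gab_elem:
  assumes "\<gamma> \<in> Iner" "\<sigma> \<in> {d \<circ> \<gamma> | d. d \<in> Der}"
  shows "\<sigma> \<in> Iner" "sim \<sigma> (dl \<gamma>)"
proof -
  obtain d where d: "d \<in> Iner" "sim d (\<lambda>_. 0)" "\<sigma> = d \<circ> \<gamma>" using assms(2) Der_Ker by auto
  show "\<sigma> \<in> Iner" unfolding d(3) by (rule Iner_comp[OF d(1) assms(1)])
  show "sim \<sigma> (dl \<gamma>)" unfolding d(3) by (rule sim_comp[OF d(1) assms(1) d(2) sim_self]) simp
qed

text \<open>An \<open>n\<close>-th power multiplies the differences by \<open>n\<close>, so p-th
  powers act trivially in characteristic \<open>p\<close>.\<close>

lemma Gab_pow_elem: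
  assumes "\<gamma> \<in> Iner" "\<sigma> \<in> {d \<circ> \<gamma> | d. d \<in> Der} [^]\<^bsub>Gab\<^esub> (n::nat)"
  shows "\<sigma> \<in> Iner \<and> sim \<sigma> (\<lambda>x. of_nat n * dl \<gamma> x)"
  using assms(2)
proof (induction n arbitrary: \<sigma>)
  case 0
  then have "\<sigma> \<in> Ker" using subsetD[OF Der_Ker, of \<sigma>] by (simp add: Gab_one)
  then show ?case by simp
next
  case (Suc n)
  then obtain s t where st: "s \<in> {d \<circ> \<gamma> | d. d \<in> Der} [^]\<^bsub>Gab\<^esub> n" "t \<in> {d \<circ> \<gamma> | d. d \<in> Der}" "\<sigma> = s \<circ> t"
    unfolding Gab_pow(2) Gab_mult by blast
  note s = Suc.IH[OF st(1)] and t = Gab_elem[OF assms(1) st(2)]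
  have "sim (s \<circ> t) (\<lambda>x. of_nat (Suc n) * dl \<gamma> x)"
    by (rule sim_comp[OF conjunct1[OF s] t(1) conjunct2[OF s] t(2)]) (simp add: algebra_simps)
  then show ?case unfolding st(3) by (rule conjI[OF Iner_comp[OF conjunct1[OF s] t(1)]])
qed

lemma carrier_J:
  "carrier (J_group v) = {{(P [^]\<^bsub>Gab\<^esub> CHAR('k)) \<otimes>\<^bsub>Gab\<^esub> Q | P. P \<in> carrier Gab} | Q. Q \<in> carrier Gab}"
  unfolding J_group_def carrier_FactGroup by (auto simp: r_coset_def)

lemma one_Gab: "{d \<circ> id | d. d \<in> Der} \<in> carrier Gab"
  unfolding carrier_Gab using id_Iner by blast

lemma J_rep_mem:
  assumes "\<gamma> \<in> Iner"
  shows "\<gamma> \<in> ({d \<circ> id | d. d \<in> Der} [^]\<^bsub>Gab\<^esub> (n::nat)) \<otimes>\<^bsub>Gab\<^esub> {d \<circ> \<gamma> | d. d \<in> Der}"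
proof -
  let ?D = "{d \<circ> id | d. d \<in> Der}"
  have "id \<in> ?D [^]\<^bsub>Gab\<^esub> n"
  proof (induction n)
    case 0
    show ?case unfolding Gab_pow(1) by (rule id_Der)
  next
    case (Suc n)
    have D: "id \<in> ?D" by (rule CollectI, rule exI[of _ id], rule conjI[OF comp_id[symmetric] id_Der])
    show ?case unfolding Gab_pow(2) Gab_mult
      by (rule CollectI, rule exI[of _ id], rule exI[of _ id], rule conjI[OF comp_id[symmetric] conjI[OF Suc D]])
  qed
  then have 1: "id \<in> ?D [^]\<^bsub>Gab\<^esub> n" .
  have 2: "\<gamma> \<in> {d \<circ> \<gamma> | d. d \<in> Der}"
    by (rule CollectI, rule exI[of _ id], rule conjI[OF id_comp[symmetric] id_Der])
  show ?thesis unfolding Gab_mult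
    by (rule CollectI, rule exI[of _ id], rule exI[of _ \<gamma>], rule conjI[OF id_comp[symmetric] conjI[OF 1 2]])
qed

text \<open>Neither the closed commutator subgroup nor the p-th powers change the differences modulo
  small elements, so all automorphisms representing \<open>c\<close> act like one of them.\<close>

lemma J_elem:
  assumes "c \<in> carrier (J_group v)"
  obtains \<gamma> where "\<gamma> \<in> Iner" "\<gamma> \<in> \<Union>c" "\<And>\<sigma>. \<sigma> \<in> \<Union>c \<Longrightarrow> \<sigma> \<in> Iner \<and> sim \<sigma> (dl \<gamma>)"
proof -
  obtain Q where Q: "Q \<in> carrier Gab" "c = {(P [^]\<^bsub>Gab\<^esub> CHAR('k)) \<otimes>\<^bsub>Gab\<^esub> Q | P. P \<in> carrier Gab}"
    using assms unfolding carrier_J by auto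
  obtain \<gamma> where \<gamma>: "\<gamma> \<in> Iner" "Q = {d \<circ> \<gamma> | d. d \<in> Der}" using Q(1) unfolding carrier_Gab by auto
  have 1: "\<sigma> \<in> Iner \<and> sim \<sigma> (dl \<gamma>)" if \<sigma>: "\<sigma> \<in> \<Union>c" for \<sigma>
  proof -
    obtain P where P: "P \<in> carrier Gab" "\<sigma> \<in> (P [^]\<^bsub>Gab\<^esub> CHAR('k)) \<otimes>\<^bsub>Gab\<^esub> Q" using \<sigma> unfolding Q(2) by auto
    then obtain s t where st: "s \<in> P [^]\<^bsub>Gab\<^esub> CHAR('k)" "t \<in> Q" "\<sigma> = s \<circ> t" unfolding Gab_mult by blast
    obtain \<beta> where \<beta>: "\<beta> \<in> Iner" "P = {d \<circ> \<beta> | d. d \<in> Der}" using P(1) unfolding carrier_Gab by auto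
    have "s \<in> Iner \<and> sim s (\<lambda>x. of_nat CHAR('k) * dl \<beta> x)"
      by (rule Gab_pow_elem[OF \<beta>(1)]) (use st(1) \<beta>(2) in simp)
    moreover have "of_nat CHAR('k) = (0 :: 'k alg_closure)" using of_nat_CHAR[where 'a = "'k alg_closure"] by simp
    ultimately have s: "s \<in> Iner" "sim s (\<lambda>x. 0)" by simp_all
    note t = Gab_elem[OF \<gamma>(1) st(2)[unfolded \<gamma>(2)]]
    have "sim (s \<circ> t) (dl \<gamma>)" by (rule sim_comp[OF s(1) t(1) s(2) t(2)]) simp
    then show ?thesis unfolding st(3) by (rule conjI[OF Iner_comp[OF s(1) t(1)]])
  qed
  have "\<gamma> \<in> \<Union>c"
    unfolding Q(2) \<gamma>(2)
    by (rule UnionI[OF _ J_rep_mem[OF \<gamma>(1)]], rule CollectI, rule exI, rule conjI[OF refl one_Gab])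
  then show thesis using that[OF \<gamma>(1) _ 1] by blast
qed

lemma J_surj:
  assumes "\<gamma> \<in> Iner" shows "\<exists>c\<in>carrier (J_group v). \<gamma> \<in> \<Union>c"
proof -
  let ?Q = "{d \<circ> \<gamma> | d. d \<in> Der}"
  let ?c = "{(P [^]\<^bsub>Gab\<^esub> CHAR('k)) \<otimes>\<^bsub>Gab\<^esub> ?Q | P. P \<in> carrier Gab}"
  have Q: "?Q \<in> carrier Gab" unfolding carrier_Gab using assms by blast
  have "\<gamma> \<in> \<Union>?c" 
    by (rule UnionI[OF _ J_rep_mem[OF assms]], rule CollectI, rule exI, rule conjI[OF refl one_Gab])
  moreover have "?c \<in> carrier (J_group v)" unfolding carrier_J
    by (rule CollectI, rule exI, rule conjI[OF refl Q])
  ultimately show ?thesis by (rule bexI)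
qed

text \<open>All choices of \<open>\<xi>\<close> and \<open>\<gamma>\<close> give the same Kummer
  map, so the definite description in \<open>rho\<close> may be evaluated at any of them.\<close>

lemma rho_eq:
  assumes c: "c \<in> carrier (J_group v)" and \<gamma>: "\<gamma> \<in> \<Union>c" and M: "M \<subseteq> quotient_set perf Operf" "m \<in> M" and \<xi>: "\<xi> \<in> m"
  shows "rho vinf v \<psi> M c m = kummer vinf v \<psi> \<xi> \<gamma>"
proof -
  obtain \<gamma>0 where \<gamma>0: "\<gamma>0 \<in> Iner" "\<And>\<sigma>. \<sigma> \<in> \<Union>c \<Longrightarrow> \<sigma> \<in> Iner \<and> sim \<sigma> (dl \<gamma>0)"
    by (rule J_elem[OF c]) blast
  obtain \<eta> where \<eta>: "\<eta> \<in> perf" "m = \<eta> +o Operf" using M unfolding quotient_set_def by auto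
  have mem: "\<zeta> \<in> perf" "absv v (\<zeta> - \<eta>) \<le> 1" if "\<zeta> \<in> m" for \<zeta>
  proof -
    have "\<zeta> - \<eta> \<in> Operf" using that unfolding \<eta>(2) coset_mem .
    then show "absv v (\<zeta> - \<eta>) \<le> 1" "\<zeta> \<in> perf" using subfldD(3)[OF perf_subfld, of "\<zeta> - \<eta>" \<eta>] \<eta>(1) by (simp_all add: Operf_iff)
  qed
  have key: "kummer vinf v \<psi> \<zeta> \<sigma> = kummer vinf v \<psi> \<eta> \<gamma>0" if "\<zeta> \<in> m" "\<sigma> \<in> \<Union>c" for \<zeta> \<sigma>
  proof (rule kummer_cong[OF conjunct1[OF \<gamma>0(2)[OF that(2)]] \<gamma>0(1) mem(1)[OF that(1)] \<eta>(1) mem(2)[OF that(1)]])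
    fix a x assume "a \<in> A" "a \<noteq> 0" "act a x \<in> perf"
    then have "absv v (dl \<sigma> x - dl \<gamma>0 x) < 1" using conjunct2[OF \<gamma>0(2)[OF that(2)]] unfolding sim_def by blast
    then show "absv v (\<sigma> x - \<gamma>0 x) < 1" by simp
  qed
  have "(THE f. \<exists>\<xi>\<in>m. \<exists>\<gamma>\<in>\<Union>c. f = kummer vinf v \<psi> \<xi> \<gamma>) = kummer vinf v \<psi> \<eta> \<gamma>0"
  proof (rule the_equality)
    show "\<exists>\<xi>\<in>m. \<exists>\<gamma>\<in>\<Union>c. kummer vinf v \<psi> \<eta> \<gamma>0 = kummer vinf v \<psi> \<xi> \<gamma>"
      by (rule bexI[OF _ \<xi>], rule bexI[OF _ \<gamma>], rule sym[OF key[OF \<xi> \<gamma>]])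
    fix f assume "\<exists>\<xi>\<in>m. \<exists>\<gamma>\<in>\<Union>c. f = kummer vinf v \<psi> \<xi> \<gamma>"
    then show "f = kummer vinf v \<psi> \<eta> \<gamma>0" by (elim bexE) (simp only: key)
  qed
  then show ?thesis unfolding rho_def using M(2) key[OF \<xi> \<gamma>] by simp
qed

end

section \<open>Normalized absolute values of a field\<close>

text \<open>The places of the field, each represented by its absolute value with value group
  generated by \<open>exp 1\<close>.\<close>

definition nval :: "('f::field \<Rightarrow> real) set" where
  "nval = absv ` {w. normalized_valuation w}"

lemma nval_nonarch: "N \<in> nval \<Longrightarrow> nonarch N"
  unfolding nval_def normalized_valuation_def using nonarch_absv by auto

lemma nval_discrete:
  assumes "N \<in> nval" "x \<noteq> 0" shows "\<exists>n::int. N x = exp (real_of_int n)"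
proof -
  obtain w where w: "normalized_valuation w" "N = absv w" using assms(1) unfolding nval_def by auto
  then have "w x \<in> range (\<lambda>n::int. ereal (real_of_int n))" using assms(2) unfolding normalized_valuation_def by blast
  then obtain n :: int where "w x = ereal (real_of_int n)" by auto
  then have "N x = exp (real_of_int (- n))" using absv_exp[of w] w unfolding normalized_valuation_def by simp
  then show ?thesis by blast
qed

lemma nval_surj:
  assumes "N \<in> nval" obtains x where "N x = exp (real_of_int n)" "x \<noteq> 0"
proof -
  obtain w where w: "normalized_valuation w" "N = absv w" using assms(1) unfolding nval_def by auto
  have "ereal (real_of_int (- n)) \<in> w ` (UNIV - {0})" using w(1) unfolding normalized_valuation_def by blast
  then obtain x where x: "ereal (real_of_int (- n)) = w x" "x \<in> UNIV - {0}" by (rule imageE)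
  then have "N x = exp (real_of_int n)"
    using absv_exp[of w x "real_of_int (- n)"] w unfolding normalized_valuation_def by simp
  then show thesis using that x(2) by blast
qed

lemma absv_inject:
  assumes "valuation w" "valuation w'" "absv w = absv w'" shows "w = w'"
proof
  fix x
  show "w x = w' x"
  proof (cases "x = 0")
    case False
    then obtain r s where rs: "w x = ereal r" "w' x = ereal s" using valuationD(2) assms by metis
    then show ?thesis using absv_exp[OF assms(1) rs(1)] absv_exp[OF assms(2) rs(2)] assms(3) by simp
  qed (simp add: valuationD(1) assms)
qed

lemma regular_outside_nval:
  assumes "normalized_valuation vinf"
  shows "a \<in> regular_outside vinf \<longleftrightarrow> (\<forall>N\<in>nval. N \<noteq> absv vinf \<longrightarrow> N a \<le> 1)"
proof -
  have "w = vinf \<longleftrightarrow> absv w = absv vinf" if "normalized_valuation w" for w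
    using absv_inject[of w vinf] \<open>normalized_valuation w\<close> assms unfolding normalized_valuation_def by metis
  then show ?thesis unfolding regular_outside_iff nval_def by auto
qed

text \<open>Otherwise every element integral for \<open>N'\<close> is integral for \<open>N\<close>,
  and units for \<open>N'\<close> are units for \<open>N\<close>. Then \<open>N\<close> is a power
  of \<open>N'\<close>, with an exponent read off at a uniformizer, and normalization makes this
  exponent 1.\<close>

lemma nval_separate:
  assumes N: "N \<in> nval" "N' \<in> nval" "N \<noteq> N'"
  shows "\<exists>x. 1 < N x \<and> N' x \<le> 1"
proof (rule ccontr)
  assume "\<not> ?thesis"
  then have sub: "N x \<le> 1" if "N' x \<le> 1" for x using that by (meson not_less)
  interpret N: nonarch N by (rule nval_nonarch[OF N(1)])
  interpret N': nonarch N' by (rule nval_nonarch[OF N(2)])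
  have unit: "N x = 1" if "N' x = 1" for x
  proof -
    have "N x \<le> 1" "N (inverse x) \<le> 1" using sub[of x] sub[of "inverse x"] that by (simp_all add: N'.nrm_inverse)
    moreover have "x \<noteq> 0" using that by auto
    ultimately show ?thesis using N.nrm_pos[of x] by (simp add: N.nrm_inverse inverse_le_1_iff)
  qed
  obtain \<pi> where \<pi>: "N' \<pi> = exp (real_of_int (- 1))" "\<pi> \<noteq> 0" by (rule nval_surj[OF N(2)])
  obtain m :: int where m: "N \<pi> = exp (real_of_int m)" using nval_discrete[OF N(1) \<pi>(2)] by auto
  have "N \<pi> \<le> 1" by (rule sub) (simp add: \<pi>(1))
  then have m0: "m \<le> 0" unfolding m by simp
  have key: "\<exists>n::int. N' x = exp (real_of_int n) \<and> N x = exp (real_of_int (- m * n))" if x: "x \<noteq> 0" for x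
  proof -
    obtain n :: int where n: "N' x = exp (real_of_int n)" using nval_discrete[OF N(2) x] by auto
    have "N' (x * \<pi> powi n) = 1"
      by (simp add: N'.nrm_mult N'.nrm_power_int n \<pi>(1) exp_power_int exp_add[symmetric])
    then have "N (x * \<pi> powi n) = 1" by (rule unit)
    then have "N x * exp (real_of_int (m * n)) = 1"
      by (simp add: N.nrm_mult N.nrm_power_int m exp_power_int mult.commute)
    then have "N x = inverse (exp (real_of_int (m * n)))" by (metis inverse_unique mult.commute)
    then show ?thesis using n by (intro exI[of _ n]) (simp add: exp_minus)
  qed
  obtain x where x: "N x = exp (real_of_int 1)" "x \<noteq> 0" by (rule nval_surj[OF N(1)])
  obtain n :: int where n: "N x = exp (real_of_int (- m * n))" using key[OF x(2)] by auto
  then have "- m * n = 1" using x(1) by (simp only: exp_inj_iff of_int_eq_iff)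
  then have "m = - 1" using m0 by (metis minus_minus zmult_eq_1_iff mult_minus_left neg_le_0_iff_le not_one_le_zero)
  then have "N x = N' x" for x using key[of x] by (cases "x = 0") auto
  then show False using N(3) by auto
qed

lemma nval_separate_strict:
  assumes N: "N \<in> nval" "N' \<in> nval" "N \<noteq> N'"
  shows "\<exists>x. 1 < N x \<and> N' x < 1"
proof -
  interpret N: nonarch N by (rule nval_nonarch[OF N(1)])
  interpret N': nonarch N' by (rule nval_nonarch[OF N(2)])
  obtain x where x: "1 < N x" "N' x \<le> 1" using nval_separate[OF N] by auto
  obtain y where y: "1 < N' y" "N y \<le> 1" using nval_separate[OF N(2,1)] N(3) by auto
  have "y \<noteq> 0" using y(1) by auto
  then have "0 < N y" by (rule N.nrm_pos)
  then have "1 < N (x / y)" using x(1) y(2) by (simp add: N.nrm_divide)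
  moreover have "N' (x / y) < 1" using x(2) y(1) by (simp add: N'.nrm_divide)
  ultimately show ?thesis by blast
qed

text \<open>Weak approximation, adding one place at a time. A large power of the old element
  \<open>x\<close>, suitably modified, is combined with an element \<open>y\<close> that separates
  \<open>N\<close> from the new place \<open>N1\<close>.\<close>

lemma nval_approx:
  assumes "finite S" "S \<subseteq> nval" "N \<in> nval" "N \<notin> S"
  shows "\<exists>x. 1 < N x \<and> (\<forall>N'\<in>S. N' x < 1)"
  using assms
proof (induction S rule: finite_induct)
  case empty
  obtain x where "N x = exp (real_of_int 1)" "x \<noteq> 0" by (rule nval_surj[OF empty(2)])
  then show ?case by (intro exI[of _ x]) simp
next
  case (insert N1 S)
  interpret N: nonarch N by (rule nval_nonarch[OF insert.prems(2)])
  have N1v: "N1 \<in> nval" using insert.prems by simp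
  interpret N1: nonarch N1 by (rule nval_nonarch[OF N1v])
  have na: "nonarch N'" if "N' \<in> S" for N' using insert.prems(1) that by (intro nval_nonarch) auto
  obtain x where x: "1 < N x" "\<And>N'. N' \<in> S \<Longrightarrow> N' x < 1"
    using insert.IH insert.prems by auto
  obtain y where y: "1 < N y" "N1 y < 1"
    using nval_separate_strict[OF insert.prems(2) N1v] insert.prems(3) by auto
  have lim: "\<forall>\<^sub>F k in sequentially. N' x ^ k * N' y < 1" if N': "N' \<in> S" for N'
  proof -
    have "(\<lambda>k. N' x ^ k) \<longlonglongrightarrow> 0" using x(2)[OF N'] nonarch.nrm_ge_0[OF na[OF N']] by (intro LIMSEQ_realpow_zero)
    then have "(\<lambda>k. N' x ^ k * N' y) \<longlonglongrightarrow> 0 * N' y" by (intro tendsto_mult tendsto_const)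
    then show ?thesis by (rule order_tendstoD(2)) simp
  qed
  have "\<forall>\<^sub>F k in sequentially. (\<forall>N'\<in>S. N' x ^ k * N' y < 1) \<and> 1 \<le> k"
    using lim by (intro eventually_conj eventually_ball_finite insert.hyps(1) ballI eventually_ge_at_top)
  then obtain k where k: "\<And>N'. N' \<in> S \<Longrightarrow> N' x ^ k * N' y < 1" "1 \<le> k"
    using eventually_happens'[OF sequentially_bot] by fast
  consider "N1 x < 1" | "N1 x = 1" | "1 < N1 x" by linarith
  then show ?case
  proof cases
    case 1
    then show ?thesis using x by auto
  next
    case 2
    have "1 < N (x ^ k * y)"
      using x(1) y(1) k(2) one_less_power[of "N x" k] mult_strict_mono[of 1 "N x ^ k" 1 "N y"]
      by (simp add: N.nrm_mult N.nrm_power)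
    moreover have "N1 (x ^ k * y) < 1" using 2 y(2) by (simp add: N1.nrm_mult N1.nrm_power)
    moreover have "N' (x ^ k * y) < 1" if "N' \<in> S" for N'
      using k(1)[OF that] nonarch.nrm_mult[OF na[OF that]] nonarch.nrm_power[OF na[OF that]] by simp
    ultimately show ?thesis by blast
  next
    case 3
    \<comment> \<open>The fraction has absolute value 1 at the places where \<open>x\<close> is
      large and tends to 0 where \<open>x\<close> is small.\<close>
    let ?z = "x ^ k / (1 + x ^ k) * y"
    have big: "N' ?z = N' y" if "nonarch N'" "1 < N' x" for N'
    proof -
      interpret N': nonarch N' by fact
      have gt: "1 < N' (x ^ k)" using that(2) k(2) by (simp add: N'.nrm_power one_less_power)
      then have "N' (1 + x ^ k) = N' (x ^ k)" by (intro N'.nrm_add_dominant) simp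
      moreover have "x \<noteq> 0" using that(2) by auto
      ultimately show ?thesis using gt by (simp add: N'.nrm_mult N'.nrm_divide)
    qed
    have "1 < N ?z" "N1 ?z < 1" using big[OF N.nonarch_axioms x(1)] big[OF N1.nonarch_axioms 3] y by simp_all
    moreover have "N' ?z < 1" if N': "N' \<in> S" for N'
    proof -
      interpret N': nonarch N' by (rule na[OF N'])
      have lt: "N' (x ^ k) < 1" using x(2)[OF N'] k(2) by (simp add: N'.nrm_power power_less_one_iff)
      have "N' (x ^ k + 1) = N' 1" by (rule N'.nrm_add_dominant) (use lt in simp)
      then show ?thesis using k(1)[OF N'] by (simp add: N'.nrm_mult N'.nrm_divide N'.nrm_power add.commute)
    qed
    ultimately show ?thesis by blast
  qed
qed

section \<open>Rational functions over the field of constants\<close>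

text \<open>The prime field, as the set of fixed points of Frobenius; \<open>pol t\<close> and
  \<open>rat t\<close> are the polynomials and the rational functions in \<open>t\<close> over
  it.\<close>

definition pconst :: "'f::field set" where
  "pconst = {z. z ^ CHAR('f) = z}"

definition pol :: "'f::field \<Rightarrow> 'f set" where
  "pol t = {poly P t | P. \<forall>i. Polynomial.coeff P i \<in> pconst}"

definition rat :: "'f::field \<Rightarrow> 'f set" where
  "rat t = {x / y | x y. x \<in> pol t \<and> y \<in> pol t \<and> y \<noteq> 0}"

context
  fixes ty :: "'f::field itself"
  assumes prime: "Factorial_Ring.prime CHAR('f)"
begin

lemma subfld_pconst: "subfld (pconst :: 'f set)"
  unfolding subfld_def
proof (intro conjI ballI)
  have p1: "1 < CHAR('f)" using prime_gt_1_nat[OF prime] .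
  show "0 \<in> (pconst :: 'f set)" "1 \<in> (pconst :: 'f set)" using p1 by (simp_all add: pconst_def)
  fix x y :: 'f assume "x \<in> pconst" "y \<in> pconst"
  then show "x + y \<in> pconst" "x * y \<in> pconst"
    using freshmans_dream[OF prime refl, of x y] by (simp_all add: pconst_def power_mult_distrib)
next
  fix x :: 'f assume "x \<in> pconst"
  then show "- x \<in> pconst" "inverse x \<in> pconst"
    using minus_power_prime_CHAR[OF refl prime, of x] by (simp_all add: pconst_def power_inverse)
qed

lemma pol_closed:
  fixes t :: 'f
  shows "c \<in> pconst \<Longrightarrow> c \<in> pol t" "t \<in> pol t"
    "x \<in> pol t \<Longrightarrow> y \<in> pol t \<Longrightarrow> x + y \<in> pol t" "x \<in> pol t \<Longrightarrow> y \<in> pol t \<Longrightarrow> x * y \<in> pol t"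
    "x \<in> pol t \<Longrightarrow> - x \<in> pol t"
proof -
  note k = subfldD[OF subfld_pconst]
  show "c \<in> pol t" if "c \<in> pconst" for c unfolding pol_def
    using that k(1) by (intro CollectI exI[of _ "[:c:]"]) (auto simp: coeff_pCons split: nat.splits)
  show "t \<in> pol t" unfolding pol_def
    using k(1,2) by (intro CollectI exI[of _ "[:0, 1:]"]) (auto simp: coeff_pCons split: nat.splits)
  show "x + y \<in> pol t" if xy: "x \<in> pol t" "y \<in> pol t" for x y
  proof -
    obtain P Q where "x = poly P t" "y = poly Q t" "\<forall>i. Polynomial.coeff P i \<in> pconst" "\<forall>i. Polynomial.coeff Q i \<in> pconst"
      using xy unfolding pol_def by auto
    then show ?thesis unfolding pol_def using k(3) by (intro CollectI exI[of _ "P + Q"]) simp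
  qed
  show "x * y \<in> pol t" if xy: "x \<in> pol t" "y \<in> pol t" for x y
  proof -
    obtain P Q where "x = poly P t" "y = poly Q t" "\<forall>i. Polynomial.coeff P i \<in> pconst" "\<forall>i. Polynomial.coeff Q i \<in> pconst"
      using xy unfolding pol_def by auto
    then show ?thesis unfolding pol_def using k(4)
      by (intro CollectI exI[of _ "P * Q"]) (simp add: coeff_mult subfld_sum[OF subfld_pconst])
  qed
  show "- x \<in> pol t" if x: "x \<in> pol t" for x
  proof -
    obtain P where "x = poly P t" "\<forall>i. Polynomial.coeff P i \<in> pconst" using x unfolding pol_def by auto
    then show ?thesis unfolding pol_def using k(5) by (intro CollectI exI[of _ "- P"]) simp
  qed
qed

lemma pol_sub_rat: "(x::'f) \<in> pol t \<Longrightarrow> x \<in> rat t"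
  unfolding rat_def using pol_closed(1)[OF subfldD(2)[OF subfld_pconst], of t]
  by (intro CollectI exI[of _ x] exI[of _ 1]) simp

lemma subfld_rat: "subfld (rat (t::'f))"
  unfolding subfld_def
proof (intro conjI ballI)
  show "0 \<in> rat t" "1 \<in> rat t" by (intro pol_sub_rat pol_closed subfldD[OF subfld_pconst])+
  fix x y assume "x \<in> rat t" "y \<in> rat t"
  then obtain a b c d where *: "x = a / b" "y = c / d" "a \<in> pol t" "b \<in> pol t" "c \<in> pol t" "d \<in> pol t" "b \<noteq> 0" "d \<noteq> 0"
    unfolding rat_def by auto
  have "x + y = (a * d + c * b) / (b * d)" using * by (simp add: field_simps)
  then show "x + y \<in> rat t" unfolding rat_def using * pol_closed(3,4)
    by (intro CollectI exI[of _ "a * d + c * b"] exI[of _ "b * d"]) simp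
  show "x * y \<in> rat t" unfolding rat_def using * pol_closed(4)
    by (intro CollectI exI[of _ "a * c"] exI[of _ "b * d"]) simp
next
  fix x assume "x \<in> rat t"
  then obtain a b where *: "x = a / b" "a \<in> pol t" "b \<in> pol t" "b \<noteq> 0" unfolding rat_def by auto
  show "- x \<in> rat t" unfolding rat_def using * pol_closed(5) by (intro CollectI exI[of _ "- a"] exI[of _ b]) simp
  show "inverse x \<in> rat t"
  proof (cases "a = 0")
    case True
    then show ?thesis using * \<open>x \<in> rat t\<close> by simp
  next
    case False
    then show ?thesis unfolding rat_def using * by (intro CollectI exI[of _ b] exI[of _ a]) simp
  qed
qed

lemma rat_common_denominator:
  assumes "finite I" "\<And>i. i \<in> I \<Longrightarrow> c i \<in> rat (t::'f)"
  shows "\<exists>h\<in>pol t. h \<noteq> 0 \<and> (\<forall>i\<in>I. h * c i \<in> pol t)"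
  using assms
proof (induction I rule: finite_induct)
  case empty
  show ?case using pol_closed(1)[OF subfldD(2)[OF subfld_pconst], of t] by (intro bexI[of _ 1]) auto
next
  case (insert i I)
  then obtain h where h: "h \<in> pol t" "h \<noteq> 0" "\<forall>i\<in>I. h * c i \<in> pol t" by auto
  obtain a b where ab: "c i = a / b" "a \<in> pol t" "b \<in> pol t" "b \<noteq> 0" using insert.prems[of i] unfolding rat_def by auto
  have "(h * b) * c j \<in> pol t" if "j \<in> insert i I" for j
  proof (cases "j = i")
    case True
    then have "(h * b) * c j = h * a" using ab by simp
    then show ?thesis using pol_closed(4)[OF h(1) ab(2)] by (simp only:)
  next
    case False
    then have "h * c j \<in> pol t" using h(3) that by auto
    then have "b * (h * c j) \<in> pol t" by (rule pol_closed(4)[OF ab(3)])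
    then show ?thesis by (simp add: mult_ac)
  qed
  then show ?case using pol_closed(4)[OF h(1) ab(3)] h(2) ab(4) by (intro bexI[of _ "h * b"]) auto
qed

lemma nval_pconst:
  assumes "N \<in> nval" "(c::'f) \<in> pconst" "c \<noteq> 0" shows "N c = 1"
proof -
  interpret N: nonarch N by (rule nval_nonarch[OF assms(1)])
  obtain k where k: "CHAR('f) = Suc k" "0 < k" using prime_gt_1_nat[OF prime] by (cases "CHAR('f)") auto
  have "c * c ^ k = c" using assms(2) unfolding pconst_def k(1) by simp
  then have "c ^ k = 1" using assms(3) by simp
  then have "N c ^ k = 1 ^ k" using N.nrm_power[of c k] by simp
  then show ?thesis using k(2) power_eq_iff_eq_base[of k "N c" 1] by simp
qed

lemma nval_pconst_le: "N \<in> nval \<Longrightarrow> (c::'f) \<in> pconst \<Longrightarrow> N c \<le> 1"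
  using nval_pconst[of N c] nonarch.nrm_0[OF nval_nonarch, of N] by (cases "c = 0") simp_all

lemma nval_pol_le:
  assumes N: "N \<in> nval" and t: "N (t::'f) \<le> 1" and x: "x \<in> pol t" shows "N x \<le> 1"
proof -
  interpret N: nonarch N by (rule nval_nonarch[OF N])
  obtain P where P: "x = poly P t" "\<forall>i. Polynomial.coeff P i \<in> pconst" using x unfolding pol_def by auto
  have "N (t ^ i) \<le> 1" for i using t by (simp add: N.nrm_power power_le_one N.nrm_ge_0)
  then show ?thesis unfolding P(1) poly_altdef
    by (intro N.nrm_sum_le N.nrm_le_1_mult) (use P(2) nval_pconst_le[OF N] in auto)
qed

text \<open>At every pole of \<open>t\<close> the top term dominates, and the next one is smaller by
  at least the factor \<open>N t\<close>. The approximating constant does not depend on the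
  pole.\<close>

lemma nval_pol_degree:
  assumes P: "\<forall>i. Polynomial.coeff P i \<in> (pconst :: 'f set)" and N: "N \<in> nval" "1 < N t"
  shows "N (poly P t / t ^ Polynomial.degree P - Polynomial.lead_coeff P) \<le> 1 / N t"
proof -
  interpret N: nonarch N by (rule nval_nonarch[OF N(1)])
  let ?m = "Polynomial.degree P"
  have t0: "t \<noteq> 0" using N(2) by auto
  have "poly P t = (\<Sum>i<?m. Polynomial.coeff P i * t ^ i) + Polynomial.lead_coeff P * t ^ ?m"
    by (simp add: poly_altdef lessThan_Suc_atMost[symmetric])
  then have e: "poly P t / t ^ ?m - Polynomial.lead_coeff P = (\<Sum>i<?m. Polynomial.coeff P i * t ^ i) / t ^ ?m"
    using t0 by (simp add: add_divide_distrib)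
  have "N (\<Sum>i<?m. Polynomial.coeff P i * t ^ i) \<le> N t ^ ?m / N t"
  proof (rule N.nrm_sum_le)
    fix i assume i: "i \<in> {..<?m}"
    have "N (Polynomial.coeff P i * t ^ i) \<le> 1 * N t ^ i"
      unfolding N.nrm_mult N.nrm_power by (intro mult_right_mono nval_pconst_le[OF N(1)]) (use P in auto)
    also have "\<dots> \<le> N t ^ (?m - 1)" using i N(2) by (simp add: power_increasing)
    also have "\<dots> = N t ^ ?m / N t" using i N(2) by (cases ?m) auto
    finally show "N (Polynomial.coeff P i * t ^ i) \<le> N t ^ ?m / N t" .
  qed (use N(2) in simp)
  then have "N (\<Sum>i<?m. Polynomial.coeff P i * t ^ i) / N t ^ ?m \<le> N t ^ ?m / N t / N t ^ ?m"
    using N(2) by (intro divide_right_mono) auto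
  moreover have cancel: "A / B / A = 1 / B" if "A \<noteq> 0" for A B :: real using that by simp
  have "N t ^ ?m / N t / N t ^ ?m = 1 / N t" by (rule cancel) (use t0 in simp)
  ultimately show ?thesis unfolding e N.nrm_divide N.nrm_power by (simp only:)
qed

text \<open>The order of the quantifiers matters: the degree \<open>e\<close> and the leading
  constant \<open>c\<close> are the same for all poles \<open>N\<close> of \<open>t\<close>.\<close>

lemma nval_rat_degree:
  assumes "d \<in> rat (t::'f)" "d \<noteq> 0"
  shows "\<exists>(e::int). \<exists>c\<in>pconst. c \<noteq> 0 \<and> (\<forall>N\<in>nval. 1 < N t \<longrightarrow> N (d * t powi (- e) - c) \<le> 1 / N t)"
proof -
  obtain x y where xy: "d = x / y" "x \<in> pol t" "y \<in> pol t" "y \<noteq> 0" using assms(1) unfolding rat_def by auto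
  obtain P where P: "x = poly P t" "\<forall>i. Polynomial.coeff P i \<in> pconst" using xy(2) unfolding pol_def by auto
  obtain R where R: "y = poly R t" "\<forall>i. Polynomial.coeff R i \<in> pconst" using xy(3) unfolding pol_def by auto
  have P0: "P \<noteq> 0" and R0: "R \<noteq> 0" using xy assms(2) P R by auto
  let ?m = "Polynomial.degree P" and ?k = "Polynomial.degree R"
  let ?a = "Polynomial.lead_coeff P" and ?b = "Polynomial.lead_coeff R"
  have ab: "?a \<noteq> 0" "?b \<noteq> 0" "?a \<in> pconst" "?b \<in> pconst" using P0 R0 P(2) R(2) by auto
  show ?thesis
  proof (intro exI[of _ "int ?m - int ?k"] bexI[of _ "?a / ?b"] conjI ballI impI)
    show "?a / ?b \<noteq> 0" using ab by simp
    show "?a / ?b \<in> pconst" using ab by (intro subfldD(8)[OF subfld_pconst])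
    fix N :: "'f \<Rightarrow> real" assume N: "N \<in> nval" "1 < N t"
    interpret N: nonarch N by (rule nval_nonarch[OF N(1)])
    have t0: "t \<noteq> 0" using N(2) by auto
    let ?A = "x / t ^ ?m" and ?B = "y / t ^ ?k"
    have A: "N (?A - ?a) \<le> 1 / N t" unfolding P(1) by (rule nval_pol_degree[OF P(2) N])
    have B: "N (?B - ?b) \<le> 1 / N t" unfolding R(1) by (rule nval_pol_degree[OF R(2) N])
    have Na: "N ?a = 1" "N ?b = 1" using nval_pconst[OF N(1)] ab by auto
    have lt: "1 / N t < 1" using N(2) by simp
    have "N ((?B - ?b) + ?b) = N ?b" by (rule N.nrm_add_dominant) (use B lt Na in simp)
    then have NB: "N ?B = 1" using Na by simp
    have B0: "?B \<noteq> 0" using xy(4) t0 by simp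
    have "t powi (- (int ?m - int ?k)) = t ^ ?k / t ^ ?m" using t0 by (simp add: power_int_diff)
    then have "d * t powi (- (int ?m - int ?k)) = ?A / ?B" unfolding xy(1) using t0 by simp
    have gen: "A / B - a / b = (b * (A - a) - a * (B - b)) / (b * B)" if "b \<noteq> 0" "B \<noteq> 0" for A B a b :: 'f
      using that by (simp add: field_simps)
    from \<open>d * t powi (- (int ?m - int ?k)) = ?A / ?B\<close> have e: "d * t powi (- (int ?m - int ?k)) - ?a / ?b = (?b * (?A - ?a) - ?a * (?B - ?b)) / (?b * ?B)"
      using gen[OF ab(2) B0] by (simp only:)
    have NbB: "N (?b * ?B) = 1" unfolding N.nrm_mult[of ?b] NB Na by simp
    have "N (?b * (?A - ?a) - ?a * (?B - ?b)) \<le> 1 / N t"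
      by (rule order_trans[OF N.nrm_diff]) (use A B Na in \<open>simp add: N.nrm_mult\<close>)
    then show "N (d * t powi (- (int ?m - int ?k)) - ?a / ?b) \<le> 1 / N t"
      unfolding e N.nrm_divide[of _ "?b * ?B"] using NbB by (simp only: div_by_1)
  qed
qed

text \<open>\<open>e\<close> is the largest degree in the family. Members of smaller degree become
  small after division by this power of \<open>t\<close> and receive the constant 0.\<close>

lemma nval_rat_family:
  fixes J :: "'b set"
  assumes "finite J" "\<And>j. j \<in> J \<Longrightarrow> d j \<in> rat (t::'f)" "\<exists>j\<in>J. d j \<noteq> 0"
  shows "\<exists>(e::int) c. (\<forall>j\<in>J. c j \<in> pconst) \<and> (\<exists>j\<in>J. c j \<noteq> 0) \<and>
    (\<forall>j\<in>J. \<forall>N\<in>nval. 1 < N t \<longrightarrow> N (d j * t powi (- e) - c j) \<le> 1 / N t)"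
proof -
  let ?J = "{j \<in> J. d j \<noteq> 0}"
  have "\<forall>j\<in>?J. \<exists>z::int \<times> 'f. snd z \<in> pconst \<and> snd z \<noteq> 0 \<and>
    (\<forall>N\<in>nval. 1 < N t \<longrightarrow> N (d j * t powi (- fst z) - snd z) \<le> 1 / N t)"
  proof
    fix j assume "j \<in> ?J"
    then obtain e c where "c \<in> pconst" "c \<noteq> 0" "\<forall>N\<in>nval. 1 < N t \<longrightarrow> N (d j * t powi (- e) - c) \<le> 1 / N t"
      using nval_rat_degree[of "d j" t] assms(2)[of j] by auto
    then show "\<exists>z::int \<times> 'f. snd z \<in> pconst \<and> snd z \<noteq> 0 \<and>
      (\<forall>N\<in>nval. 1 < N t \<longrightarrow> N (d j * t powi (- fst z) - snd z) \<le> 1 / N t)" by (intro exI[of _ "(e, c)"]) simp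
  qed
  then obtain z :: "'b \<Rightarrow> int \<times> 'f" where z: "\<forall>j\<in>?J. snd (z j) \<in> pconst \<and> snd (z j) \<noteq> 0 \<and>
    (\<forall>N\<in>nval. 1 < N t \<longrightarrow> N (d j * t powi (- fst (z j)) - snd (z j)) \<le> 1 / N t)" by (rule bchoice[THEN exE])
  define e where "e = (\<lambda>j. fst (z j))"
  define c where "c = (\<lambda>j. snd (z j))"
  have ec: "\<And>j. j \<in> ?J \<Longrightarrow> c j \<in> pconst" "\<And>j. j \<in> ?J \<Longrightarrow> c j \<noteq> 0"
    "\<And>j N. j \<in> ?J \<Longrightarrow> N \<in> nval \<Longrightarrow> 1 < N t \<Longrightarrow> N (d j * t powi (- e j) - c j) \<le> 1 / N t"
    using z unfolding e_def c_def by blast+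
  define m :: int where "m = Max (e ` ?J)"
  have fin: "finite ?J" "?J \<noteq> {}" using assms by auto
  have em: "e j \<le> m" if "j \<in> ?J" for j unfolding m_def using fin that by (intro Max_ge) auto
  have "m \<in> e ` ?J" unfolding m_def using fin by (intro Max_in) auto
  then obtain j0 where j0: "j0 \<in> ?J" "e j0 = m" by auto
  define c' where "c' = (\<lambda>j. if j \<in> ?J \<and> e j = m then c j else 0)"
  show ?thesis
  proof (intro exI[of _ m] exI[of _ c'] conjI ballI impI)
    show "c' j \<in> pconst" if "j \<in> J" for j unfolding c'_def using ec(1) subfldD(1)[OF subfld_pconst] by auto
    show "\<exists>j\<in>J. c' j \<noteq> 0" using j0 ec(2)[of j0] by (intro bexI[of _ j0]) (auto simp: c'_def)
    fix j and N :: "'f \<Rightarrow> real" assume j: "j \<in> J" and N: "N \<in> nval" "1 < N t"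
    interpret N: nonarch N by (rule nval_nonarch[OF N(1)])
    show "N (d j * t powi (- m) - c' j) \<le> 1 / N t"
    proof (cases "j \<in> ?J \<and> e j = m")
      case True
      then show ?thesis unfolding c'_def using ec(3)[of j N] N by simp
    next
      case False
      show ?thesis
      proof (cases "d j = 0")
        case True
        then show ?thesis unfolding c'_def using N(2) by simp
      next
        case d: False
        then have jJ: "j \<in> ?J" using j by simp
        then have lt: "e j < m" using em[of j] False by force
        have t0: "t \<noteq> 0" using N(2) by auto
        let ?x = "d j * t powi (- e j)"
        have "N (?x - c j) \<le> 1 / N t" by (rule ec(3)[OF jJ N])
        moreover have "N (c j) = 1" by (rule nval_pconst[OF N(1) ec(1)[OF jJ] ec(2)[OF jJ]])
        moreover have "1 / N t < 1" using N(2) by simp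
        ultimately have x1: "N ?x \<le> 1" using N.nrm_add[of "?x - c j" "c j"] by simp
        have "d j * t powi (- m) = ?x * t powi (e j - m)"
          using t0 by (simp add: power_int_add[symmetric] mult.assoc)
        then have "N (d j * t powi (- m)) = N ?x * N t powi (e j - m)" by (simp only: N.nrm_mult N.nrm_power_int)
        also have "\<dots> \<le> 1 * N t powi (- 1)"
          using N(2) lt x1 by (intro mult_mono power_int_increasing) auto
        also have "\<dots> = 1 / N t" by (simp add: power_int_minus inverse_eq_divide)
        finally show ?thesis unfolding c'_def using False by auto
      qed
    qed
  qed
qed

end

context
  fixes ty :: "'f::field itself"
  assumes prime: "Factorial_Ring.prime CHAR('f)"
begin

text \<open>If the polynomial vanished at \<open>t\<close>, its leading coefficient would be small
  at the pole \<open>N\<close>, whereas non-zero constants have absolute value 1.\<close>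

lemma pol_transcendental:
  assumes P: "\<forall>i. Polynomial.coeff P i \<in> (pconst :: 'f set)" "P \<noteq> 0" and N: "N \<in> nval" "1 < N t"
  shows "poly P t \<noteq> 0"
proof
  assume 0: "poly P t = 0"
  interpret N: nonarch N by (rule nval_nonarch[OF N(1)])
  have "N (- Polynomial.lead_coeff P) \<le> 1 / N t" using nval_pol_degree[OF prime P(1) N] 0 by simp
  moreover have "N (- Polynomial.lead_coeff P) = 1"
    using nval_pconst[OF prime N(1), of "Polynomial.lead_coeff P"] P by (simp add: N.nrm_minus)
  ultimately show False using N(2) by simp
qed

lemma algebraic_integral_equation:
  assumes "algebraic_over (rat (t::'f)) x"
  obtains P where "P \<noteq> 0" "\<forall>i. Polynomial.coeff P i \<in> pol t" "poly P x = 0"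
proof -
  obtain P where P: "P \<noteq> 0" "\<forall>i. Polynomial.coeff P i \<in> rat t" "poly P x = 0"
    using assms unfolding algebraic_over_def by auto
  obtain h where h: "h \<in> pol t" "h \<noteq> 0" "\<forall>i\<in>{..Polynomial.degree P}. h * Polynomial.coeff P i \<in> pol t"
    using rat_common_denominator[OF prime, of "{..Polynomial.degree P}" "Polynomial.coeff P" t] P(2) by auto
  have "0 \<in> pol t" by (intro pol_closed[OF prime] subfldD[OF subfld_pconst[OF prime]])
  then have "h * Polynomial.coeff P i \<in> pol t" for i
    using h(3) by (cases "i \<le> Polynomial.degree P") (auto simp: coeff_eq_0)
  then show thesis using P(1,3) h(2) by (intro that[of "Polynomial.smult h P"]) simp_all
qed

text \<open>The exchange property: a polynomial relation between \<open>t\<close> and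
  \<open>u\<close> over the constants is rearranged by powers of \<open>t\<close>. It stays
  non-trivial because \<open>u\<close>, having a pole, is transcendental.\<close>

lemma algebraic_swap:
  assumes alg: "algebraic_over (rat t) (u::'f)" and N: "N \<in> nval" "1 < N u"
  shows "algebraic_over (rat u) t"
proof -
  obtain P where P: "P \<noteq> 0" "\<forall>i. Polynomial.coeff P i \<in> pol t" "poly P u = 0"
    by (rule algebraic_integral_equation[OF alg])
  let ?m = "Polynomial.degree P"
  have "\<forall>i. \<exists>Q. Polynomial.coeff P i = poly Q t \<and> (\<forall>j. Polynomial.coeff Q j \<in> pconst)"
    using P(2) unfolding pol_def by blast
  then obtain Q where Q: "\<And>i. Polynomial.coeff P i = poly (Q i) t" "\<And>i j. Polynomial.coeff (Q i) j \<in> pconst"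
    by metis
  define D where "D = (\<Sum>i\<le>?m. Polynomial.degree (Q i))"
  have D: "Polynomial.degree (Q i) \<le> D" if "i \<le> ?m" for i
    unfolding D_def using that by (intro member_le_sum) auto
  have Qt: "poly (Q i) t = (\<Sum>j\<le>D. Polynomial.coeff (Q i) j * t ^ j)" if "i \<le> ?m" for i
    unfolding poly_altdef using D[OF that] by (intro sum.mono_neutral_left) (auto simp: coeff_eq_0)
  \<comment> \<open>\<open>poly (W j) u\<close> is the coefficient of \<open>t ^ j\<close> in the
    rearranged relation.\<close>
  define W where "W = (\<lambda>j. \<Sum>i\<le>?m. Polynomial.monom (Polynomial.coeff (Q i) j) i)"
  have Wc: "Polynomial.coeff (W j) i = (if i \<le> ?m then Polynomial.coeff (Q i) j else 0)" for i j
    unfolding W_def by (simp add: coeff_sum)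
  have Wp: "\<forall>i. Polynomial.coeff (W j) i \<in> pconst" for j
    unfolding Wc using Q(2) subfldD(1)[OF subfld_pconst[OF prime]] by auto
  have Wu: "poly (W j) u = (\<Sum>i\<le>?m. Polynomial.coeff (Q i) j * u ^ i)" for j
    unfolding W_def by (simp add: poly_sum poly_monom)
  define R where "R = (\<Sum>j\<le>D. Polynomial.monom (poly (W j) u) j)"
  have Rc: "Polynomial.coeff R j = (if j \<le> D then poly (W j) u else 0)" for j
    unfolding R_def by (simp add: coeff_sum)
  have "poly R t = (\<Sum>j\<le>D. \<Sum>i\<le>?m. Polynomial.coeff (Q i) j * u ^ i * t ^ j)"
    unfolding R_def by (simp add: poly_sum poly_monom Wu sum_distrib_right)
  also have "\<dots> = (\<Sum>i\<le>?m. \<Sum>j\<le>D. Polynomial.coeff (Q i) j * t ^ j * u ^ i)"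
    by (subst sum.swap) (simp add: mult_ac)
  also have "\<dots> = (\<Sum>i\<le>?m. poly (Q i) t * u ^ i)"
    by (intro sum.cong refl) (simp add: Qt sum_distrib_right)
  also have "\<dots> = 0" using P(3) unfolding poly_altdef Q(1) by simp
  finally have R0: "poly R t = 0" .
  have "poly (Q ?m) t \<noteq> 0" using P(1) Q(1)[of ?m] by auto
  then obtain j where j: "Polynomial.coeff (Q ?m) j \<noteq> 0" by (metis poly_0 poly_eqI coeff_0)
  then have jD: "j \<le> D" using D[of ?m] le_degree[of "Q ?m" j] by simp
  have "Polynomial.coeff (W j) ?m \<noteq> 0" using j by (simp add: Wc)
  then have "W j \<noteq> 0" by auto
  then have "poly (W j) u \<noteq> 0" by (rule pol_transcendental[OF Wp _ N])
  then have "Polynomial.coeff R j \<noteq> 0" using jD by (simp add: Rc)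
  then have "R \<noteq> 0" by auto
  moreover have "Polynomial.coeff R i \<in> rat u" for i
  proof -
    have "poly (W i) u \<in> pol u" unfolding pol_def using Wp by blast
    then show ?thesis unfolding Rc using pol_sub_rat[OF prime] subfldD(1)[OF subfld_rat[OF prime]] by auto
  qed
  ultimately show ?thesis unfolding algebraic_over_def using R0 by blast
qed

lemma finite_span_algebraic:
  assumes E: "subfld E" and J: "finite J" "\<And>n. (x::'f) ^ n \<in> lspan E b J"
  shows "algebraic_over E x"
proof -
  have "\<not> linindep E (\<lambda>i. x ^ i) {..card J}" by (rule lspan_dependent[OF E J(1)]) (use J(2) in auto)
  then obtain c i where c: "\<forall>j\<in>{..card J}. c j \<in> E" "(\<Sum>j\<le>card J. c j * x ^ j) = 0" "i \<le> card J" "c i \<noteq> 0"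
    unfolding linindep_def by auto
  let ?P = "\<Sum>j\<le>card J. Polynomial.monom (c j) j"
  have co: "Polynomial.coeff ?P j = (if j \<le> card J then c j else 0)" for j by (simp add: coeff_sum)
  have "?P \<noteq> 0" using co[of i] c(3,4) by (metis coeff_0)
  moreover have "\<forall>j. Polynomial.coeff ?P j \<in> E" unfolding co using c(1) subfldD(1)[OF E] by auto
  moreover have "poly ?P x = 0" using c(2) by (simp add: poly_sum poly_monom)
  ultimately show ?thesis unfolding algebraic_over_def by blast
qed

text \<open>The definition gives finiteness over the rational functions in one element
  \<open>t\<close>. Exchanging \<open>t\<close> with \<open>u\<close> makes \<open>t\<close>
  algebraic over \<open>rat u\<close>, and products of two spanning families then span the field
  over \<open>rat u\<close>.\<close>

lemma function_field_span:
  assumes gff: "global_function_field TYPE('f)" and N: "N \<in> nval" "1 < N (u::'f)"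
  obtains J where "finite J" "linindep (rat u) (\<lambda>x. x) J" "lspan (rat u) (\<lambda>x. x) J = UNIV"
proof -
  interpret field "ring_of_type_algebra :: 'f ring" by (rule field_from_type_algebra)
  have R: "carrier (ring_of_type_algebra :: 'f ring) = UNIV" "\<zero>\<^bsub>ring_of_type_algebra\<^esub> = (0::'f)"
    "\<And>x y. x \<otimes>\<^bsub>ring_of_type_algebra\<^esub> y = (x::'f) * y" "\<And>x y. x \<oplus>\<^bsub>ring_of_type_algebra\<^esub> y = (x::'f) + y"
    by (simp_all add: ring_of_type_algebra_def)
  obtain t where "ring.finite_dimension (ring_of_type_algebra :: 'f ring) (generate_field ring_of_type_algebra {t}) UNIV"
    using gff unfolding global_function_field_def Let_def by blast
  then obtain n where n: "dimension n (generate_field ring_of_type_algebra {t}) (UNIV :: 'f set)"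
    unfolding finite_dimension_def by blast
  have sr: "subfld (rat t)" by (rule subfld_rat[OF prime])
  have tr: "t \<in> rat t" by (intro pol_sub_rat[OF prime] pol_closed[OF prime])
  have gen: "generate_field ring_of_type_algebra {t} \<subseteq> rat t"
    by (rule generate_field_min_subfield1[OF _ subfield_of_subfld[OF sr]]) (use tr R in auto)
  have "\<exists>J. finite J \<and> V \<subseteq> lspan (rat t) (\<lambda>x. x) J" if "dimension k K V" "K \<subseteq> rat t" for k K V
    using that
  proof (induction rule: dimension.induct)
    case zero_dim
    then show ?case using R lspan_zero[OF sr] by (intro exI[of _ "{}"]) auto
  next
    case (Suc_dim v V k K)
    then obtain J where J: "finite J" "V \<subseteq> lspan (rat t) (\<lambda>x. x) J" by blast
    have "line_extension K v V \<subseteq> lspan (rat t) (\<lambda>x. x) (insert v J)"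
    proof
      fix y assume "y \<in> line_extension K v V"
      then obtain c w where y: "c \<in> K" "w \<in> V" "y = c * v + w"
        unfolding line_extension_mem_iff R by blast
      have "w \<in> lspan (rat t) (\<lambda>x. x) (insert v J)"
        using y(2) J lspan_mono[OF sr, of "insert v J" J "\<lambda>x. x"] by auto
      moreover have "v \<in> lspan (rat t) (\<lambda>x. x) (insert v J)"
        using lspan_base[OF sr, of "insert v J" v "\<lambda>x. x"] J(1) by simp
      ultimately show "y \<in> lspan (rat t) (\<lambda>x. x) (insert v J)"
        unfolding y(3) using Suc_dim.prems y(1) by (intro lspan_add[OF sr] lspan_scale[OF sr]) auto
    qed
    then show ?case using J(1) by (intro exI[of _ "insert v J"]) simp
  qed
  from this[OF n gen] obtain J where J: "finite J" "\<And>x. x \<in> lspan (rat t) (\<lambda>x. x) J" by auto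
  have "algebraic_over (rat t) u" by (rule finite_span_algebraic[OF sr J])
  then have at: "algebraic_over (rat u) t" by (rule algebraic_swap[OF _ N])
  have su: "subfld (rat u)" by (rule subfld_rat[OF prime])
  obtain B J' where B: "finite J'" "B \<subseteq> lspan (rat u) (\<lambda>x. x) J'" "rat u \<subseteq> B" "t \<in> B"
    "\<And>x y. x \<in> B \<Longrightarrow> y \<in> B \<Longrightarrow> x + y \<in> B \<and> x * y \<in> B"
    using finite_algebra[OF su, of "{t}"] at by auto
  \<comment> \<open>All elements of the finite-dimensional ring \<open>B\<close> are algebraic, so
    \<open>B\<close> is a field and contains \<open>rat t\<close> once it contains
    \<open>t\<close>.\<close>
  have Binv: "inverse x \<in> B" if x: "x \<in> B" for x
  proof (cases "x = 0")
    case False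
    have pw: "x ^ k \<in> B" for k
      using B(3,5) subfldD(2)[OF su] x by (induction k) auto
    have "algebraic_over (rat u) x"
      by (rule finite_span_algebraic[OF su B(1)]) (use pw B(2) in blast)
    then show ?thesis by (rule subring_inverse[OF _ su B(3) x False B(5)])
  qed (use x in simp)
  have pu: "pconst \<subseteq> B" using B(3) pol_sub_rat[OF prime] pol_closed(1)[OF prime] by blast
  have pB: "pol t \<subseteq> B"
  proof
    fix y assume "y \<in> pol t"
    then obtain P where P: "y = poly P t" "\<forall>i. Polynomial.coeff P i \<in> pconst" unfolding pol_def by auto
    have "t ^ k \<in> B" for k
      using B(3,4,5) subfldD(2)[OF su] by (induction k) auto
    then have tm: "Polynomial.coeff P i * t ^ i \<in> B" for i using P(2) pu B(5) by blast
    have "(\<Sum>i\<le>k. Polynomial.coeff P i * t ^ i) \<in> B" for k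
    proof (induction k)
      case 0
      show ?case using tm[of 0] by (simp only: atMost_0 sum.insert finite.emptyI sum.empty) simp
    next
      case (Suc k)
      then show ?case using B(5)[OF Suc tm[of "Suc k"]] by (simp only: sum.atMost_Suc)
    qed
    then show "y \<in> B" unfolding P(1) poly_altdef .
  qed
  have rB: "rat t \<subseteq> B"
  proof
    fix y assume "y \<in> rat t"
    then obtain a b where "y = a / b" "a \<in> pol t" "b \<in> pol t" unfolding rat_def by auto
    then show "y \<in> B" using pB B(5)[of a "inverse b"] Binv[of b] by (auto simp: divide_inverse)
  qed
  have span: "x \<in> lspan (rat u) (\<lambda>(a, b). a * b) (J' \<times> J)" for x
  proof -
    obtain c where c: "x = (\<Sum>j\<in>J. c j * j)" "\<forall>j\<in>J. c j \<in> rat t" using J(2)[of x] unfolding lspan_def by auto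
    have "c j * j \<in> lspan (rat u) (\<lambda>(a, b). a * b) (J' \<times> J)" if j: "j \<in> J" for j
    proof -
      have "c j \<in> lspan (rat u) (\<lambda>x. x) J'" using c(2) j rB B(2) by blast
      then obtain d where d: "c j = (\<Sum>i\<in>J'. d i * i)" "\<forall>i\<in>J'. d i \<in> rat u" unfolding lspan_def by auto
      have "d i * (i * j) \<in> lspan (rat u) (\<lambda>(a, b). a * b) (J' \<times> J)" if i: "i \<in> J'" for i
        using lspan_base[OF su, of "J' \<times> J" "(i, j)" "\<lambda>(a, b). a * b"] i j d(2) B(1) J(1)
        by (intro lspan_scale[OF su, of "i * j"]) auto
      then show ?thesis unfolding d(1) sum_distrib_right mult.assoc by (intro lspan_sum[OF su])
    qed
    then show ?thesis unfolding c(1) by (intro lspan_sum[OF su])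
  qed
  \<comment> \<open>The sizes of independent sets are bounded by that of the spanning family; a
    largest independent set is a basis.\<close>
  let ?P = "\<lambda>k. \<exists>J0. finite J0 \<and> linindep (rat u) (\<lambda>x. x) J0 \<and> card J0 = k"
  have bound: "k \<le> card (J' \<times> J)" if "?P k" for k
  proof (rule ccontr)
    assume a: "\<not> k \<le> card (J' \<times> J)"
    obtain J0 where J0: "finite J0" "linindep (rat u) (\<lambda>x. x) J0" "card J0 = k" using \<open>?P k\<close> by auto
    have "\<not> linindep (rat u) (\<lambda>x. x) J0"
      by (rule lspan_dependent[OF su, of "J' \<times> J"]) (use span a J0 B(1) J(1) in auto)
    then show False using J0(2) by simp
  qed
  have "?P 0" by (intro exI[of _ "{}"]) (simp add: linindep_def)
  then have "?P (GREATEST k. ?P k)" using GreatestI_nat[of ?P 0 "card (J' \<times> J)"] bound by blast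
  then obtain J0 where J0: "finite J0" "linindep (rat u) (\<lambda>x. x) J0" "card J0 = (GREATEST k. ?P k)" by auto
  have "x \<in> lspan (rat u) (\<lambda>x. x) J0" for x
  proof (rule ccontr)
    assume x: "x \<notin> lspan (rat u) (\<lambda>x. x) J0"
    then have nx: "x \<notin> J0" using lspan_base[OF su J0(1), of x "\<lambda>x. x"] by auto
    have "linindep (rat u) (\<lambda>x. x) (insert x J0)" by (rule linindep_extend[OF su J0(2,1) nx]) (use x in simp)
    then have "?P (Suc (card J0))" using J0(1) nx by (intro exI[of _ "insert x J0"]) simp
    then have "Suc (card J0) \<le> (GREATEST k. ?P k)" using Greatest_le_nat[of ?P _ "card (J' \<times> J)"] bound by blast
    then show False using J0(3) by simp
  qed
  then show thesis using that J0 by blast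
qed

text \<open>Multiplication by the leading coefficient of an equation over \<open>pol u\<close> makes
  \<open>x\<close> integral over \<open>pol u\<close>, hence bounded by 1 at every place where
  \<open>u\<close> is.\<close>

lemma integral_multiple:
  assumes "algebraic_over (rat u) (x::'f)"
  shows "\<exists>h\<in>pol u. h \<noteq> 0 \<and> (\<forall>N\<in>nval. N u \<le> 1 \<longrightarrow> N h \<le> 1 \<and> N (h * x) \<le> 1)"
proof -
  obtain P where P: "P \<noteq> 0" "\<forall>i. Polynomial.coeff P i \<in> pol u" "poly P x = 0"
    by (rule algebraic_integral_equation[OF assms])
  let ?m = "Polynomial.degree P" and ?h = "Polynomial.lead_coeff P"
  show ?thesis
  proof (intro bexI[of _ ?h] conjI ballI impI)
    show "?h \<noteq> 0" using P(1) by simp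
    show "?h \<in> pol u" using P(2) by simp
    fix N :: "'f \<Rightarrow> real" assume N: "N \<in> nval" "N u \<le> 1"
    interpret N: nonarch N by (rule nval_nonarch[OF N(1)])
    have le: "N (Polynomial.coeff P i) \<le> 1" for i using nval_pol_le[OF prime N] P(2) by blast
    then show "N ?h \<le> 1" .
    show "N (?h * x) \<le> 1"
    proof (cases "N x \<le> 1")
      case True
      then show ?thesis by (intro N.nrm_le_1_mult le)
    next
      case False
      have "?m \<noteq> 0"
      proof
        assume "?m = 0"
        then obtain c where "P = [:c:]" by (rule degree_eq_zeroE)
        then show False using P(1,3) by simp
      qed
      then obtain k where k: "?m = Suc k" by (cases ?m) auto
      have "(\<Sum>i<?m. Polynomial.coeff P i * x ^ i) + ?h * x ^ ?m = 0"
        using P(3) by (simp add: poly_altdef lessThan_Suc_atMost[symmetric])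
      then have e: "?h * x ^ ?m = - (\<Sum>i<?m. Polynomial.coeff P i * x ^ i)"
        by (metis add_eq_0_iff minus_unique add.commute)
      have "N (\<Sum>i<?m. Polynomial.coeff P i * x ^ i) \<le> N x ^ k"
      proof (rule N.nrm_sum_le)
        fix i assume i: "i \<in> {..<?m}"
        have "N (Polynomial.coeff P i * x ^ i) \<le> 1 * N x ^ i"
          unfolding N.nrm_mult N.nrm_power by (intro mult_right_mono le) (use False in auto)
        also have "\<dots> \<le> N x ^ k" using i False k by (simp add: power_increasing)
        finally show "N (Polynomial.coeff P i * x ^ i) \<le> N x ^ k" .
      qed (use False in simp)
      then have "N (?h * x ^ ?m) \<le> N x ^ k" unfolding e N.nrm_minus .
      then have "N (?h * x) * N x ^ k \<le> 1 * N x ^ k" by (simp add: k N.nrm_mult N.nrm_power mult_ac)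
      then show ?thesis by (rule mult_right_le_imp_le) (use False in simp)
    qed
  qed
qed

text \<open>In a linear relation over \<open>rat u\<close>, divide by the highest power of \<open>u\<close> that occurs and
  keep the leading coefficients.\<close>

lemma valuation_dependence:
  fixes x :: "'i \<Rightarrow> 'f" and J :: "'f set"
  assumes J: "finite J" "lspan (rat u) (\<lambda>x. x) J = UNIV" and I: "finite I" "card J < card I"
  shows "\<exists>c. (\<forall>i\<in>I. c i \<in> pconst) \<and> (\<exists>i\<in>I. c i \<noteq> 0) \<and>
    (\<forall>N\<in>nval. \<forall>C. 1 < N u \<longrightarrow> 0 \<le> C \<longrightarrow> (\<forall>i\<in>I. N (x i) \<le> C) \<longrightarrow> N (\<Sum>i\<in>I. c i * x i) \<le> C / N u)"
proof -
  have su: "subfld (rat u)" by (rule subfld_rat[OF prime])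
  have "\<not> linindep (rat u) x I" by (rule lspan_dependent[OF su J(1) I]) (use J(2) in auto)
  then obtain d where d: "\<forall>i\<in>I. d i \<in> rat u" "(\<Sum>i\<in>I. d i * x i) = 0" "\<exists>i\<in>I. d i \<noteq> 0"
    unfolding linindep_def by auto
  obtain e :: int and c where c: "\<forall>i\<in>I. c i \<in> pconst" "\<exists>i\<in>I. c i \<noteq> 0"
    "\<forall>i\<in>I. \<forall>N\<in>nval. 1 < N u \<longrightarrow> N (d i * u powi (- e) - c i) \<le> 1 / N u"
    using nval_rat_family[OF prime I(1), of d u] d by blast
  show ?thesis
  proof (intro exI[of _ c] conjI ballI allI impI c(2))
    show "c i \<in> pconst" if "i \<in> I" for i using c(1) that by simp
    fix N :: "'f \<Rightarrow> real" and C :: real assume N: "N \<in> nval" "1 < N u" "0 \<le> C" "\<forall>i\<in>I. N (x i) \<le> C"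
    interpret N: nonarch N by (rule nval_nonarch[OF N(1)])
    have "(\<Sum>i\<in>I. (d i * u powi (- e) - c i) * x i) = u powi (- e) * (\<Sum>i\<in>I. d i * x i) - (\<Sum>i\<in>I. c i * x i)"
      by (simp add: sum_subtractf[symmetric] sum_distrib_left algebra_simps)
    then have "(\<Sum>i\<in>I. c i * x i) = - (\<Sum>i\<in>I. (d i * u powi (- e) - c i) * x i)" using d(2) by simp
    then have "N (\<Sum>i\<in>I. c i * x i) = N (\<Sum>i\<in>I. (d i * u powi (- e) - c i) * x i)" by (simp only: N.nrm_minus)
    also have "\<dots> \<le> C / N u"
    proof (rule N.nrm_sum_le)
      fix i assume i: "i \<in> I"
      have "N (d i * u powi (- e) - c i) * N (x i) \<le> (1 / N u) * C"
        using c(3) N i by (intro mult_mono) (auto simp: N.nrm_ge_0)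
      then show "N ((d i * u powi (- e) - c i) * x i) \<le> C / N u" by (simp add: N.nrm_mult)
    qed (use N in simp)
    finally show "N (\<Sum>i\<in>I. c i * x i) \<le> C / N u" .
  qed
qed

text \<open>Given more than \<open>card J\<close> poles, choose for each a function that is large
  there and small at the others. A relation as in \<open>valuation_dependence\<close> must be
  smaller by the factor \<open>M u\<close> at a pole \<open>M\<close> with non-zero coefficient, but
  its term at \<open>M\<close> dominates.\<close>

lemma finite_poles:
  fixes J :: "'f set"
  assumes J: "finite J" "lspan (rat u) (\<lambda>x. x) J = UNIV"
  shows "finite {N\<in>nval. 1 < N u}"
proof (rule ccontr)
  assume "infinite {N\<in>nval. 1 < N u}"
  then obtain I where I: "finite I" "card I = Suc (card J)" "I \<subseteq> {N\<in>nval. 1 < N u}"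
    using infinite_arbitrarily_large[of "{N\<in>nval. 1 < N u}" "Suc (card J)"] by auto
  have "\<forall>N\<in>I. \<exists>x. 1 < N x \<and> (\<forall>N'\<in>I - {N}. N' x < 1)"
    using I by (intro ballI nval_approx) auto
  then obtain x :: "('f \<Rightarrow> real) \<Rightarrow> 'f" where x: "\<forall>N\<in>I. 1 < N (x N) \<and> (\<forall>N'\<in>I - {N}. N' (x N) < 1)"
    by (rule bchoice[THEN exE])
  obtain c M where c: "\<forall>N\<in>I. c N \<in> pconst" "M \<in> I" "c M \<noteq> 0"
    "\<forall>N\<in>nval. \<forall>C. 1 < N u \<longrightarrow> 0 \<le> C \<longrightarrow> (\<forall>i\<in>I. N (x i) \<le> C) \<longrightarrow> N (\<Sum>i\<in>I. c i * x i) \<le> C / N u"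
    using valuation_dependence[OF J I(1), of x] I(2) by auto
  have M: "M \<in> nval" "1 < M u" using I(3) c(2) by auto
  interpret M: nonarch M by (rule nval_nonarch[OF M(1)])
  have x1: "1 < M (x M)" using x c(2) by blast
  have lt: "M (x i) < 1" if "i \<in> I" "i \<noteq> M" for i using x that c(2) by blast
  have nz: "c M * x M \<noteq> 0" using c(3) x1 by auto
  have "M (\<Sum>i\<in>I. c i * x i) = M (c M * x M)"
  proof (rule M.nrm_sum_dominant[where f = "\<lambda>i. c i * x i", OF I(1) c(2) _ nz])
    fix i assume i: "i \<in> I" "i \<noteq> M"
    have "M (c i) * M (x i) \<le> 1 * M (x i)"
      using nval_pconst_le[OF prime M(1)] c(1) i by (intro mult_right_mono) (auto simp: M.nrm_ge_0)
    also have "\<dots> < M (x M)" using lt[OF i] x1 by simp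
    also have "\<dots> = M (c M * x M)" using nval_pconst[OF prime M(1), of "c M"] c by (simp add: M.nrm_mult)
    finally show "M (c i * x i) < M (c M * x M)" by (simp add: M.nrm_mult)
  qed
  also have "\<dots> = M (x M)" using nval_pconst[OF prime M(1), of "c M"] c by (simp add: M.nrm_mult)
  finally have "M (x M) \<le> M (x M) / M u"
    using c(4)[rule_format, OF M, of "M (x M)"] lt x1 by (metis less_eq_real_def less_trans order_refl M.nrm_ge_0)
  then show False using M(2) x1 by (simp add: field_simps)
qed

text \<open>An auxiliary function \<open>z\<close>, larger than all \<open>x i\<close> at
  \<open>N0\<close> and bounded by 1 on \<open>S\<close>, raises the number of functions to
  \<open>card J + 1\<close>. In the resulting relation \<open>z\<close> would dominate at
  \<open>N0\<close>, so its coefficient is 0. Dropping the condition at \<open>N0\<close> thus saves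
  one function.\<close>

lemma dependence_away_from_pole:
  fixes J :: "'f set" and x :: "'i \<Rightarrow> 'f"
  assumes J: "finite J" "lspan (rat u) (\<lambda>x. x) J = UNIV" and N0: "N0 \<in> nval" "1 < N0 u"
    and S: "S \<subseteq> {N \<in> nval. N \<noteq> N0 \<and> 1 < N u}"
    and I: "finite I" "card I = card J" and x: "\<And>i N. i \<in> I \<Longrightarrow> N \<in> S \<Longrightarrow> N (x i) \<le> 1"
  shows "\<exists>c. (\<forall>i\<in>I. c i \<in> pconst) \<and> (\<exists>i\<in>I. c i \<noteq> 0) \<and> (\<forall>N\<in>S. N (\<Sum>i\<in>I. c i * x i) \<le> 1 / N u)"
proof -
  interpret N0: nonarch N0 by (rule nval_nonarch[OF N0(1)])
  have "finite S" using finite_poles[OF J] by (rule finite_subset[rotated]) (use S in auto)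
  then obtain z0 where z0: "1 < N0 z0" "\<forall>N\<in>S. N z0 < 1" using nval_approx[of S N0] S N0(1) by blast
  obtain k where k: "(\<Sum>i\<in>I. N0 (x i)) < N0 z0 ^ k" using real_arch_pow[OF z0(1)] by auto
  define z where "z = z0 ^ k"
  have zx: "N0 (x i) < N0 z" if "i \<in> I" for i
    using member_le_sum[OF that, of "\<lambda>i. N0 (x i)"] I(1) k N0.nrm_ge_0 unfolding z_def N0.nrm_power by fastforce
  have zS: "N z \<le> 1" if N: "N \<in> S" for N
  proof -
    interpret N: nonarch N by (rule nval_nonarch) (use N S in auto)
    show ?thesis unfolding z_def N.nrm_power
      using z0(2) N by (intro power_le_one) (auto simp: N.nrm_ge_0 less_imp_le)
  qed
  have z1: "z \<noteq> 0" using z0(1) unfolding z_def by auto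
  define y where "y = case_option z x"
  define I' where "I' = insert None (Some ` I)"
  have I': "finite I'" "card J < card I'" unfolding I'_def using I by (auto simp: card_image)
  have sumI: "(\<Sum>i\<in>I'. f i) = f None + (\<Sum>i\<in>I. f (Some i))" for f :: "'i option \<Rightarrow> 'f"
    unfolding I'_def using I(1) by (simp add: sum.reindex)
  obtain c where c: "\<forall>i\<in>I'. c i \<in> pconst" "\<exists>i\<in>I'. c i \<noteq> 0"
    "\<forall>N\<in>nval. \<forall>C. 1 < N u \<longrightarrow> 0 \<le> C \<longrightarrow> (\<forall>i\<in>I'. N (y i) \<le> C) \<longrightarrow> N (\<Sum>i\<in>I'. c i * y i) \<le> C / N u"
    using valuation_dependence[OF J I', of y] by blast
  have "c None = 0"
  proof (rule ccontr)
    assume c0: "c None \<noteq> 0"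
    have cN: "N0 (c None) = 1" by (rule nval_pconst[OF prime N0(1) _ c0]) (use c(1) I'_def in auto)
    have "N0 (\<Sum>i\<in>I'. c i * y i) = N0 (c None * y None)"
    proof (rule N0.nrm_sum_dominant[OF I'(1)])
      show "None \<in> I'" "c None * y None \<noteq> 0" using c0 z1 by (auto simp: I'_def y_def)
      fix i assume i: "i \<in> I'" "i \<noteq> None"
      then obtain j where j: "i = Some j" "j \<in> I" unfolding I'_def by auto
      have "N0 (c i) * N0 (x j) \<le> 1 * N0 (x j)"
        using nval_pconst_le[OF prime N0(1)] c(1) i(1) by (intro mult_right_mono N0.nrm_ge_0) auto
      then show "N0 (c i * y i) < N0 (c None * y None)" using zx[OF j(2)] cN j(1) by (simp add: N0.nrm_mult y_def)
    qed
    also have "\<dots> = N0 z" using cN by (simp add: N0.nrm_mult y_def)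
    finally have e: "N0 (\<Sum>i\<in>I'. c i * y i) = N0 z" .
    have "N0 (\<Sum>i\<in>I'. c i * y i) \<le> N0 z / N0 u"
      using c(3) N0 zx N0.nrm_ge_0[of z] unfolding I'_def y_def by (force simp: less_imp_le)
    then have "N0 z \<le> N0 z / N0 u" unfolding e .
    then show False using N0(2) N0.nrm_pos[OF z1] by (simp add: field_simps)
  qed
  then have e: "(\<Sum>i\<in>I'. c i * y i) = (\<Sum>i\<in>I. c (Some i) * x i)" unfolding sumI by (simp add: y_def)
  show ?thesis
  proof (intro exI[of _ "\<lambda>i. c (Some i)"] conjI ballI)
    show "c (Some i) \<in> pconst" if "i \<in> I" for i using c(1) that by (auto simp: I'_def)
    show "\<exists>i\<in>I. c (Some i) \<noteq> 0" using c(2) \<open>c None = 0\<close> by (auto simp: I'_def)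
    fix N assume N: "N \<in> S"
    have "\<forall>i\<in>I'. N (y i) \<le> 1" using x[OF _ N] zS[OF N] by (auto simp: I'_def y_def)
    then show "N (\<Sum>i\<in>I. c (Some i) * x i) \<le> 1 / N u"
      using c(3)[rule_format, of N 1] N S unfolding e by auto
  qed
qed

text \<open>At the poles of \<open>u\<close> other than \<open>N0\<close>, the functions bounded by \<open>1\<close> modulo those bounded by
  \<open>1 / N u\<close> form a space of some dimension \<open>d < card J\<close> over the constants. Hence there are more
  products \<open>u\<^sup>i h\<^sub>b b\<close> with \<open>i < l\<close>, \<open>b \<in> J\<close> than conditions at these poles if \<open>l\<close> is large.\<close>

lemma global_section:
  fixes J :: "'f set"
  assumes J: "finite J" "linindep (rat u) (\<lambda>x. x) J" "lspan (rat u) (\<lambda>x. x) J = UNIV"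
    and N0: "N0 \<in> nval" "1 < N0 u"
  shows "\<exists>a. a \<noteq> 0 \<and> (\<forall>N\<in>nval. N u \<le> 1 \<longrightarrow> N a \<le> 1) \<and> (\<forall>N\<in>nval. N \<noteq> N0 \<and> 1 < N u \<longrightarrow> N a < 1)"
proof -
  define S where "S = {N \<in> nval. N \<noteq> N0 \<and> 1 < N u}"
  have finS: "finite S" using finite_poles[OF J(1,3)] unfolding S_def by (rule finite_subset[rotated]) auto
  have SN: "nonarch N" "1 < N u" "N \<in> nval" if "N \<in> S" for N using that nval_nonarch unfolding S_def by auto
  note k = subfldD[OF subfld_pconst[OF prime]]
  have u0: "u \<noteq> 0" using N0(2) nonarch.nrm_0[OF nval_nonarch[OF N0(1)]] by auto
  have "J \<noteq> {}"
  proof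
    assume "J = {}"
    then have "(1::'f) \<in> lspan (rat u) (\<lambda>x. x) {}" using J(3) by simp
    then show False by (simp add: lspan_def)
  qed
  then have n0: "0 < card J" using J(1) by (simp add: card_gt_0_iff)
  \<comment> \<open>\<open>P k g\<close>: the first \<open>k\<close> functions \<open>g i\<close>
    are bounded by 1 on \<open>S\<close> and independent over the constants modulo functions bounded
    by \<open>1 / N u\<close>.\<close>
  define P where "P = (\<lambda>k (g :: nat \<Rightarrow> 'f). (\<forall>i<k. \<forall>N\<in>S. N (g i) \<le> 1) \<and>
    (\<forall>c. (\<forall>i<k. c i \<in> pconst) \<and> (\<forall>N\<in>S. N (\<Sum>i<k. c i * g i) \<le> 1 / N u) \<longrightarrow> (\<forall>i<k. c i = 0)))"
  have bound: "k < card J" if "P k g" for k g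
  proof (rule ccontr)
    assume a: "\<not> k < card J"
    have "\<exists>c. (\<forall>i\<in>{..<card J}. c i \<in> pconst) \<and> (\<exists>i\<in>{..<card J}. c i \<noteq> 0) \<and>
      (\<forall>N\<in>S. N (\<Sum>i<card J. c i * g i) \<le> 1 / N u)"
      by (rule dependence_away_from_pole[OF J(1,3) N0]) (use \<open>P k g\<close> a in \<open>auto simp: P_def S_def\<close>)
    then obtain c where c: "\<forall>i<card J. c i \<in> pconst" "\<exists>i<card J. c i \<noteq> 0" "\<forall>N\<in>S. N (\<Sum>i<card J. c i * g i) \<le> 1 / N u"
      by auto
    define c' where "c' = (\<lambda>i. if i < card J then c i else 0)"
    have "(\<Sum>i<k. c' i * g i) = (\<Sum>i<card J. c' i * g i)"
      by (rule sum.mono_neutral_right) (use a in \<open>auto simp: c'_def\<close>)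
    also have "\<dots> = (\<Sum>i<card J. c i * g i)" by (intro sum.cong refl) (simp add: c'_def)
    finally have e: "(\<Sum>i<k. c' i * g i) = (\<Sum>i<card J. c i * g i)" .
    have "\<forall>i<k. c' i \<in> pconst" unfolding c'_def using c(1) k(1) by simp
    moreover have "\<forall>N\<in>S. N (\<Sum>i<k. c' i * g i) \<le> 1 / N u" unfolding e by (rule c(3))
    ultimately have "\<forall>i<k. c' i = 0" using \<open>P k g\<close> unfolding P_def by blast
    moreover obtain i where "i < card J" "c i \<noteq> 0" using c(2) by auto
    ultimately show False using a unfolding c'_def by (metis less_le_trans not_less)
  qed
  have "\<exists>g. P 0 g" unfolding P_def by simp
  then have "\<exists>g. P (GREATEST k. \<exists>g. P k g) g"
    using GreatestI_nat[of "\<lambda>k. \<exists>g. P k g" 0 "card J"] bound by (metis less_imp_le)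
  then obtain d g where d: "P d g" "d = (GREATEST k. \<exists>g. P k g)" by blast
  have maxd: "\<not> P (Suc d) g'" for g'
    using Greatest_le_nat[of "\<lambda>k. \<exists>g. P k g" "Suc d" "card J"] bound d(2) by (metis less_imp_le not_less_eq_eq order_refl)
  have dn: "d < card J" by (rule bound[OF d(1)])
  \<comment> \<open>By maximality of \<open>d\<close>, adding \<open>x\<close> to the
    \<open>g i\<close> creates a relation modulo small functions; the coefficient of
    \<open>x\<close> in it is non-zero.\<close>
  have rep: "\<exists>c. (\<forall>i. c i \<in> pconst) \<and> (\<forall>N\<in>S. N (x - (\<Sum>i<d. c i * g i)) \<le> 1 / N u)"
    if x: "\<forall>N\<in>S. N x \<le> 1" for x
  proof -
    have "\<forall>i<Suc d. \<forall>N\<in>S. N ((g(d := x)) i) \<le> 1" using d(1) x unfolding P_def by (simp add: less_Suc_eq)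
    then obtain c where c: "\<forall>i<Suc d. c i \<in> pconst" "\<forall>N\<in>S. N (\<Sum>i<Suc d. c i * (g(d := x)) i) \<le> 1 / N u"
      "\<not> (\<forall>i<Suc d. c i = 0)" using maxd[of "g(d := x)"] unfolding P_def by blast
    have e: "(\<Sum>i<Suc d. c i * (g(d := x)) i) = (\<Sum>i<d. c i * g i) + c d * x" by simp
    have cd: "c d \<noteq> 0"
    proof
      assume "c d = 0"
      then have "\<forall>i<d. c i = 0" using c(1,2) d(1) unfolding e P_def by simp
      then show False using c(3) \<open>c d = 0\<close> by (simp add: less_Suc_eq)
    qed
    show ?thesis
    proof (intro exI[of _ "\<lambda>i. if i < d then - c i / c d else 0"] conjI allI ballI)
      fix i show "(if i < d then - c i / c d else 0) \<in> pconst"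
        using c(1) k(1,5,8) by simp
    next
      fix N assume N: "N \<in> S"
      interpret N: nonarch N by (rule SN[OF N])
      have "(\<Sum>i<d. (if i < d then - c i / c d else 0) * g i) = - (\<Sum>i<d. c i * g i) / c d"
        by (simp add: sum_divide_distrib sum_negf)
      then have "x - (\<Sum>i<d. (if i < d then - c i / c d else 0) * g i) = ((\<Sum>i<d. c i * g i) + c d * x) / c d"
        using cd by (simp add: field_simps)
      then have "N (x - (\<Sum>i<d. (if i < d then - c i / c d else 0) * g i)) = N ((\<Sum>i<d. c i * g i) + c d * x) / N (c d)"
        by (simp only: N.nrm_divide)
      also have "N (c d) = 1" using nval_pconst[OF prime SN(3)[OF N] _ cd] c(1) by simp
      finally show "N (x - (\<Sum>i<d. (if i < d then - c i / c d else 0) * g i)) \<le> 1 / N u" using c(2) N unfolding e by simp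
    qed
  qed
  \<comment> \<open>Dividing by the top power of \<open>u\<close>, applying \<open>rep\<close> and
    multiplying back lowers the order of the pole by one. The process yields
    \<open>(k + 1) * d\<close> constants.\<close>
  have rep_k: "\<exists>a. (\<forall>j i. a j i \<in> pconst) \<and> (\<forall>N\<in>S. N (x - (\<Sum>j\<le>k. \<Sum>i<d. a j i * (u ^ j * g i))) \<le> 1 / N u)"
    if "\<forall>N\<in>S. N x \<le> N u ^ k" for k x using that
  proof (induction k arbitrary: x)
    case 0
    then obtain c where "\<forall>i. c i \<in> pconst" "\<forall>N\<in>S. N (x - (\<Sum>i<d. c i * g i)) \<le> 1 / N u" using rep[of x] by auto
    then show ?case by (intro exI[of _ "\<lambda>_. c"]) simp
  next
    case (Suc k)
    have "\<forall>N\<in>S. N (x / u ^ Suc k) \<le> 1"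
    proof
      fix N assume N: "N \<in> S"
      interpret N: nonarch N by (rule SN[OF N])
      have "N x \<le> N (u ^ Suc k)" using Suc.prems N unfolding N.nrm_power by blast
      moreover have "0 < N (u ^ Suc k)" by (rule N.nrm_pos) (use u0 in simp)
      ultimately show "N (x / u ^ Suc k) \<le> 1" unfolding N.nrm_divide by (simp only: divide_le_eq_1_pos)
    qed
    then obtain c where c: "\<forall>i. c i \<in> pconst" "\<forall>N\<in>S. N (x / u ^ Suc k - (\<Sum>i<d. c i * g i)) \<le> 1 / N u"
      using rep by blast
    let ?x = "x - (\<Sum>i<d. c i * (u ^ Suc k * g i))"
    have ex: "?x = u ^ Suc k * (x / u ^ Suc k - (\<Sum>i<d. c i * g i))"
      using u0 by (simp add: right_diff_distrib sum_distrib_left mult.left_commute)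
    have "\<forall>N\<in>S. N ?x \<le> N u ^ k"
    proof
      fix N assume N: "N \<in> S"
      interpret N: nonarch N by (rule SN[OF N])
      have "N ?x \<le> N u ^ Suc k * (1 / N u)"
        unfolding ex N.nrm_mult[of "u ^ Suc k"] N.nrm_power using c(2) N by (intro mult_left_mono) (auto simp: N.nrm_ge_0)
      also have "\<dots> = N u ^ k" using SN(2)[OF N] u0 by simp
      finally show "N ?x \<le> N u ^ k" .
    qed
    from Suc.IH[OF this] obtain a where a: "\<forall>j i. a j i \<in> pconst"
      "\<forall>N\<in>S. N (?x - (\<Sum>j\<le>k. \<Sum>i<d. a j i * (u ^ j * g i))) \<le> 1 / N u" by blast
    have e: "?x - (\<Sum>j\<le>k. \<Sum>i<d. a j i * (u ^ j * g i)) =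
      x - (\<Sum>j\<le>Suc k. \<Sum>i<d. (a(Suc k := c)) j i * (u ^ j * g i))" by simp
    show ?case
    proof (intro exI[of _ "a(Suc k := c)"] conjI allI)
      show "(a(Suc k := c)) j i \<in> pconst" for j i using a(1) c(1) by simp
    qed (use a(2) in \<open>unfold e\<close>)
  qed
  have "\<forall>b. \<exists>h. h \<in> pol u \<and> h \<noteq> 0 \<and> (\<forall>N\<in>nval. N u \<le> 1 \<longrightarrow> N h \<le> 1 \<and> N (h * b) \<le> 1)"
  proof
    fix b :: 'f
    have "algebraic_over (rat u) b"
      by (rule finite_span_algebraic[OF subfld_rat[OF prime] J(1)]) (use J(3) in auto)
    then show "\<exists>h. h \<in> pol u \<and> h \<noteq> 0 \<and> (\<forall>N\<in>nval. N u \<le> 1 \<longrightarrow> N h \<le> 1 \<and> N (h * b) \<le> 1)"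
      using integral_multiple by blast
  qed
  then obtain h where h: "\<And>b. h b \<in> pol u" "\<And>b. h b \<noteq> 0" "\<And>b N. N \<in> nval \<Longrightarrow> N u \<le> 1 \<Longrightarrow> N (h b * b) \<le> 1"
    by metis
  have "\<exists>s. \<forall>N\<in>S. \<forall>b\<in>J. N (h b * b) \<le> N u ^ s"
  proof -
    have "\<forall>\<^sub>F s in sequentially. N (h b * b) \<le> N u ^ s" if N: "N \<in> S" for N b
    proof -
      obtain s0 where s0: "N (h b * b) < N u ^ s0" using real_arch_pow[OF SN(2)[OF N]] by blast
      have "N (h b * b) \<le> N u ^ s" if "s0 \<le> s" for s
        using s0 power_increasing[OF that, of "N u"] SN(2)[OF N] by linarith
      then show ?thesis unfolding eventually_sequentially by blast
    qed
    then have "\<forall>\<^sub>F s in sequentially. \<forall>N\<in>S. \<forall>b\<in>J. N (h b * b) \<le> N u ^ s"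
      by (intro eventually_ball_finite finS J(1) ballI)
    then show ?thesis using eventually_happens'[OF sequentially_bot] by blast
  qed
  then obtain s where s: "\<And>N b. N \<in> S \<Longrightarrow> b \<in> J \<Longrightarrow> N (h b * b) \<le> N u ^ s" by blast
  \<comment> \<open>With \<open>n = card J\<close> and \<open>d \<le> n - 1\<close> there are
    \<open>l * n\<close> unknowns and at most \<open>(l + s + 1) * (n - 1)\<close> conditions. The
    former number is larger exactly if \<open>(s + 1) * (n - 1) < l\<close>.\<close>
  define l where "l = (s + 1) * card J"
  define I where "I = {..<l} \<times> J"
  define x where "x = (\<lambda>(i :: nat, b). u ^ i * (h b * b))"
  have xS: "\<forall>N\<in>S. N (x q) \<le> N u ^ (l + s)" if q: "q \<in> I" for q
  proof
    fix N assume N: "N \<in> S"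
    interpret N: nonarch N by (rule SN[OF N])
    obtain i b where ib: "q = (i, b)" "i < l" "b \<in> J" using q unfolding I_def by auto
    have "N u ^ i * N (h b * b) \<le> N u ^ l * N u ^ s"
      using SN(2)[OF N] ib s[OF N] by (intro mult_mono power_increasing) (auto simp: N.nrm_ge_0)
    then show "N (x q) \<le> N u ^ (l + s)" unfolding ib(1) x_def by (simp add: N.nrm_mult[of "u ^ i"] N.nrm_power power_add)
  qed
  have "\<forall>q\<in>I. \<exists>a. (\<forall>j i. a j i \<in> pconst) \<and> (\<forall>N\<in>S. N (x q - (\<Sum>j\<le>l + s. \<Sum>i<d. a j i * (u ^ j * g i))) \<le> 1 / N u)"
    using rep_k[OF xS] by blast
  then obtain A where "\<forall>q\<in>I. (\<forall>j i. A q j i \<in> pconst) \<and> (\<forall>N\<in>S. N (x q - (\<Sum>j\<le>l + s. \<Sum>i<d. A q j i * (u ^ j * g i))) \<le> 1 / N u)"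
    by (rule bchoice[THEN exE])
  then have A: "\<And>q j i. q \<in> I \<Longrightarrow> A q j i \<in> pconst"
    "\<And>q N. q \<in> I \<Longrightarrow> N \<in> S \<Longrightarrow> N (x q - (\<Sum>j\<le>l + s. \<Sum>i<d. A q j i * (u ^ j * g i))) \<le> 1 / N u" by blast+
  have finI: "finite I" unfolding I_def using J(1) by simp
  obtain D where D: "card J = Suc D" using n0 by (cases "card J") auto
  have "(l + s + 1) * d \<le> (l + s + 1) * D" using dn D by (intro mult_le_mono2) simp
  also have "\<dots> < l * card J" unfolding l_def D by (simp add: algebra_simps)
  finally have "card ({..l + s} \<times> {..<d}) < card I" unfolding I_def by (simp add: card_cartesian_product)
  then have "\<exists>c. (\<forall>q\<in>I. c q \<in> pconst) \<and> (\<exists>q\<in>I. c q \<noteq> 0) \<and>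
    (\<forall>r\<in>{..l + s} \<times> {..<d}. (\<Sum>q\<in>I. A q (fst r) (snd r) * c q) = 0)"
    by (intro homogeneous_system subfld_pconst prime finI) (use A(1) in simp_all)
  then obtain c where c0: "\<forall>q\<in>I. c q \<in> pconst" "\<exists>q\<in>I. c q \<noteq> 0"
    "\<forall>r\<in>{..l + s} \<times> {..<d}. (\<Sum>q\<in>I. A q (fst r) (snd r) * c q) = 0" by (elim exE conjE)
  have c: "\<forall>q\<in>I. c q \<in> pconst" "\<exists>q\<in>I. c q \<noteq> 0"
    "\<forall>j\<le>l + s. \<forall>i<d. (\<Sum>q\<in>I. A q j i * c q) = 0" using c0 by simp_all
  define a where "a = (\<Sum>q\<in>I. c q * x q)"
  have "a = (\<Sum>i<l. \<Sum>b\<in>J. c (i, b) * (u ^ i * (h b * b)))"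
    by (simp add: a_def I_def x_def sum.cartesian_product case_prod_beta)
  also have "\<dots> = (\<Sum>b\<in>J. \<Sum>i<l. c (i, b) * (u ^ i * (h b * b)))" by (rule sum.swap)
  also have "\<dots> = (\<Sum>b\<in>J. (h b * (\<Sum>i<l. c (i, b) * u ^ i)) * b)"
    by (simp add: sum_distrib_left sum_distrib_right mult_ac)
  finally have ea: "a = (\<Sum>b\<in>J. (h b * (\<Sum>i<l. c (i, b) * u ^ i)) * b)" .
  \<comment> \<open>Independence of \<open>J\<close> over \<open>rat u\<close> makes every inner
    polynomial vanish at \<open>u\<close>, and \<open>u\<close> is transcendental, so all
    coefficients \<open>c\<close> would be zero.\<close>
  have "a \<noteq> 0"
  proof
    assume "a = 0"
    then have sum0: "(\<Sum>b\<in>J. (h b * (\<Sum>i<l. c (i, b) * u ^ i)) * b) = 0" unfolding ea .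
    have mem: "h b * (\<Sum>i<l. c (i, b) * u ^ i) \<in> rat u" if b: "b \<in> J" for b
    proof -
      have "u ^ i \<in> pol u" for i
        by (induction i) (use pol_closed[OF prime] k(2) in simp_all)
      then have "c (i, b) * u ^ i \<in> rat u" if "i < l" for i
        using pol_sub_rat[OF prime] pol_closed[OF prime] c(1) b that unfolding I_def by simp
      then have "(\<Sum>i<l. c (i, b) * u ^ i) \<in> rat u" by (intro subfld_sum[OF subfld_rat[OF prime]]) simp
      then show ?thesis by (rule subfldD(4)[OF subfld_rat[OF prime] pol_sub_rat[OF prime h(1)]])
    qed
    have z: "\<forall>b\<in>J. h b * (\<Sum>i<l. c (i, b) * u ^ i) = 0"
      by (rule J(2)[unfolded linindep_def, THEN spec, THEN mp], intro conjI ballI mem sum0)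
    have "c (i, b) = 0" if "i < l" "b \<in> J" for i b
    proof (rule ccontr)
      assume nz: "c (i, b) \<noteq> 0"
      let ?P = "\<Sum>i<l. Polynomial.monom (c (i, b)) i"
      have co: "Polynomial.coeff ?P j = (if j < l then c (j, b) else 0)" for j by (simp add: coeff_sum)
      have "?P \<noteq> 0" using co[of i] nz \<open>i < l\<close> by (metis coeff_0)
      then have "poly ?P u \<noteq> 0"
        by (rule pol_transcendental[rotated, OF _ N0]) (use co c(1) \<open>b \<in> J\<close> k(1) in \<open>auto simp: I_def\<close>)
      then show False using z \<open>b \<in> J\<close> h(2) by (simp add: poly_sum poly_monom)
    qed
    then show False using c(2) unfolding I_def by auto
  qed
  moreover have "N a \<le> 1" if N: "N \<in> nval" "N u \<le> 1" for N
  proof -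
    interpret N: nonarch N by (rule nval_nonarch[OF N(1)])
    have "N (x q) \<le> 1" for q
    proof (cases q)
      case (Pair i b)
      have "N (u ^ i) \<le> 1" using N(2) by (simp add: N.nrm_power power_le_one N.nrm_ge_0)
      then show ?thesis unfolding x_def Pair prod.case by (intro N.nrm_le_1_mult h(3)[OF N])
    qed
    then show ?thesis unfolding a_def
      using c(1) nval_pconst_le[OF prime N(1)] by (intro N.nrm_sum_le N.nrm_le_1_mult) auto
  qed
  moreover have "N a < 1" if N: "N \<in> S" for N
  proof -
    interpret N: nonarch N by (rule SN[OF N])
    \<comment> \<open>The choice of \<open>c\<close> cancels the main parts, so \<open>a\<close> is
      a combination of the errors, each bounded by \<open>1 / N u\<close>.\<close>
    have "(\<Sum>q\<in>I. c q * (\<Sum>j\<le>l + s. \<Sum>i<d. A q j i * (u ^ j * g i))) =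
      (\<Sum>q\<in>I. \<Sum>j\<le>l + s. \<Sum>i<d. (A q j i * c q) * (u ^ j * g i))" by (simp add: sum_distrib_left mult_ac)
    also have "\<dots> = (\<Sum>j\<le>l + s. \<Sum>q\<in>I. \<Sum>i<d. (A q j i * c q) * (u ^ j * g i))" by (rule sum.swap)
    also have "\<dots> = (\<Sum>j\<le>l + s. \<Sum>i<d. \<Sum>q\<in>I. (A q j i * c q) * (u ^ j * g i))"
      by (intro sum.cong refl sum.swap)
    also have "\<dots> = (\<Sum>j\<le>l + s. \<Sum>i<d. (\<Sum>q\<in>I. A q j i * c q) * (u ^ j * g i))"
      by (simp only: sum_distrib_right)
    also have "\<dots> = 0" using c(3) by (intro sum.neutral ballI) simp
    finally have e: "a = (\<Sum>q\<in>I. c q * (x q - (\<Sum>j\<le>l + s. \<Sum>i<d. A q j i * (u ^ j * g i))))"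
      unfolding a_def by (simp add: right_diff_distrib sum_subtractf)
    have "N a \<le> 1 / N u" unfolding e
    proof (rule N.nrm_sum_le)
      fix q assume q: "q \<in> I"
      have "N (c q) * N (x q - (\<Sum>j\<le>l + s. \<Sum>i<d. A q j i * (u ^ j * g i))) \<le> 1 * (1 / N u)"
        using A(2)[OF q N] c(1) q nval_pconst_le[OF prime SN(3)[OF N]] by (intro mult_mono) (auto simp: N.nrm_ge_0)
      then show "N (c q * (x q - (\<Sum>j\<le>l + s. \<Sum>i<d. A q j i * (u ^ j * g i)))) \<le> 1 / N u" by (simp add: N.nrm_mult)
    qed (use SN(2)[OF N] in simp)
    also have "\<dots> < 1" using SN(2)[OF N] by simp
    finally show ?thesis .
  qed
  ultimately show ?thesis unfolding S_def by (intro exI[of _ a]) simp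
qed

end

text \<open>Take \<open>u\<close> with a pole at the place of \<open>vinf\<close>. The factor
  \<open>h\<close> makes \<open>h\<close> and \<open>h * f\<close> regular where \<open>u\<close>
  is; at the finitely many other poles of \<open>u\<close> a high power of the small function
  \<open>a\<close> from \<open>global_section\<close> compensates.\<close>

lemma regular_outside_fraction:
  fixes vinf :: "'f::field \<Rightarrow> ereal"
  assumes gff: "global_function_field TYPE('f)" and vinf: "normalized_valuation vinf"
  shows "\<exists>a\<in>regular_outside vinf - {0}. a * f \<in> regular_outside vinf"
proof -
  have prime: "Factorial_Ring.prime CHAR('f)" using gff unfolding global_function_field_def by blast
  define N0 where "N0 = absv vinf"
  have N0: "N0 \<in> nval" unfolding N0_def nval_def using vinf by blast
  obtain u where "N0 u = exp (real_of_int 1)" "u \<noteq> 0" by (rule nval_surj[OF N0])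
  then have u: "1 < N0 u" by simp
  obtain J where J: "finite J" "linindep (rat u) (\<lambda>x. x) J" "lspan (rat u) (\<lambda>x. x) J = UNIV"
    by (rule function_field_span[OF prime gff N0 u])
  obtain a where a: "a \<noteq> 0" "\<And>N. N \<in> nval \<Longrightarrow> N u \<le> 1 \<Longrightarrow> N a \<le> 1"
    "\<And>N. N \<in> nval \<Longrightarrow> N \<noteq> N0 \<Longrightarrow> 1 < N u \<Longrightarrow> N a < 1" using global_section[OF prime J N0 u] by blast
  have "algebraic_over (rat u) f"
    by (rule finite_span_algebraic[OF prime subfld_rat[OF prime] J(1)]) (use J(3) in auto)
  then obtain h where h: "h \<noteq> 0" "\<And>N. N \<in> nval \<Longrightarrow> N u \<le> 1 \<Longrightarrow> N h \<le> 1 \<and> N (h * f) \<le> 1"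
    using integral_multiple[OF prime] by blast
  let ?S = "{N \<in> nval. N \<noteq> N0 \<and> 1 < N u}"
  have "finite ?S" using finite_poles[OF prime J(1,3)] by (rule finite_subset[rotated]) auto
  have lim: "\<forall>\<^sub>F k in sequentially. N (a ^ k * y) \<le> 1" if N: "N \<in> ?S" for N y
  proof -
    interpret N: nonarch N by (rule nval_nonarch) (use N in simp)
    have "(\<lambda>k. N a ^ k) \<longlonglongrightarrow> 0" using a(3)[of N] N by (intro LIMSEQ_realpow_zero N.nrm_ge_0) auto
    then have "(\<lambda>k. N a ^ k * N y) \<longlonglongrightarrow> 0 * N y" by (intro tendsto_mult tendsto_const)
    then have "\<forall>\<^sub>F k in sequentially. N a ^ k * N y < 1" by (rule order_tendstoD(2)) simp
    then show ?thesis by (rule eventually_mono) (simp add: N.nrm_mult N.nrm_power)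
  qed
  have "\<forall>\<^sub>F k in sequentially. \<forall>N\<in>?S. N (a ^ k * h) \<le> 1 \<and> N (a ^ k * (h * f)) \<le> 1"
    by (intro eventually_ball_finite \<open>finite ?S\<close> ballI eventually_conj lim)
  then obtain k where k: "\<forall>N\<in>?S. N (a ^ k * h) \<le> 1 \<and> N (a ^ k * (h * f)) \<le> 1"
    using eventually_happens'[OF sequentially_bot] by blast
  have "N (a ^ k * h) \<le> 1 \<and> N (a ^ k * (h * f)) \<le> 1" if N: "N \<in> nval" "N \<noteq> N0" for N
  proof (cases "N u \<le> 1")
    case True
    interpret N: nonarch N by (rule nval_nonarch[OF N(1)])
    have "N (a ^ k) \<le> 1" using a(2)[OF N(1) True] by (simp add: N.nrm_power power_le_one N.nrm_ge_0)
    then show ?thesis using h(2)[OF N(1) True] N.nrm_le_1_mult by blast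
  next
    case False
    then show ?thesis using k N by auto
  qed
  then show ?thesis unfolding regular_outside_nval[OF vinf] using a(1) h(1)
    by (intro bexI[of _ "a ^ k * h"]) (auto simp: N0_def mult.assoc regular_outside_nval[OF vinf])
qed

section \<open>Compactness\<close>

text \<open>Tychonoff for a product of finite discrete spaces: a condition depending on finitely
  many coordinates defines a closed set, and compactness passes from finite subfamilies to
  \<open>\<Q>\<close>.\<close>

lemma compactness_finite_choice:
  fixes C :: "'a \<Rightarrow> 'b set" and \<Q> :: "(('a \<Rightarrow> 'b) \<Rightarrow> bool) set"
  assumes fin: "\<And>x. finite (C x)"
    and dep: "\<And>Q. Q \<in> \<Q> \<Longrightarrow> \<exists>D. finite D \<and> (\<forall>\<sigma> \<tau>. (\<forall>x\<in>D. \<sigma> x = \<tau> x) \<longrightarrow> Q \<sigma> \<longrightarrow> Q \<tau>)"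
    and sat: "\<And>F. finite F \<Longrightarrow> F \<subseteq> \<Q> \<Longrightarrow> \<exists>\<sigma>. (\<forall>x. \<sigma> x \<in> C x) \<and> (\<forall>Q\<in>F. Q \<sigma>)"
  shows "\<exists>\<sigma>. (\<forall>x. \<sigma> x \<in> C x) \<and> (\<forall>Q\<in>\<Q>. Q \<sigma>)"
proof -
  define T where "T = product_topology (\<lambda>x. discrete_topology (C x)) UNIV"
  have top: "topspace T = {\<sigma>. \<forall>x. \<sigma> x \<in> C x}" unfolding T_def by (auto simp: PiE_def)
  have "compact_space T" unfolding T_def compact_space_product_topology
    using fin by (simp add: compact_space_discrete_topology)
  then have fip: "(\<forall>S\<in>\<U>. closedin T S) \<Longrightarrow> (\<forall>\<F>. finite \<F> \<and> \<F> \<subseteq> \<U> \<longrightarrow> \<Inter>\<F> \<noteq> {}) \<Longrightarrow> \<Inter>\<U> \<noteq> {}" for \<U>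
    unfolding compact_space_fip by blast
  define Z where "Z = (\<lambda>Q. {\<sigma> \<in> topspace T. Q \<sigma>})"
  have closed: "closedin T (Z Q)" if Q: "Q \<in> \<Q>" for Q
  proof -
    obtain D where D: "finite D" "\<And>\<sigma> \<tau>. (\<forall>x\<in>D. \<sigma> x = \<tau> x) \<Longrightarrow> Q \<sigma> \<Longrightarrow> Q \<tau>" using dep[OF Q] by blast
    have "openin T (topspace T - Z Q)"
    proof (subst openin_subopen, intro ballI)
      fix \<sigma> assume \<sigma>: "\<sigma> \<in> topspace T - Z Q"
      let ?S = "\<lambda>x. if x \<in> D then {\<sigma> x} else C x"
      have "openin T (PiE UNIV ?S)" unfolding T_def openin_PiE_gen
        using \<sigma> D(1) by (intro disjI2 conjI) (auto simp: top intro: finite_subset[OF _ D(1)] split: if_splits)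
      moreover have "\<sigma> \<in> PiE UNIV ?S" using \<sigma> by (auto simp: top)
      moreover have "PiE UNIV ?S \<subseteq> topspace T - Z Q"
      proof
        fix \<tau> assume \<tau>: "\<tau> \<in> PiE UNIV ?S"
        then have t: "\<tau> x \<in> ?S x" for x using PiE_mem[OF \<tau>, of x] by simp
        have eq: "\<forall>x\<in>D. \<tau> x = \<sigma> x" using t by (metis singletonD)
        have "\<tau> x \<in> C x" for x using t[of x] \<sigma> by (auto simp: top split: if_splits)
        moreover have "\<not> Q \<tau>" using D(2)[OF eq] \<sigma> by (auto simp: Z_def)
        ultimately show "\<tau> \<in> topspace T - Z Q" by (auto simp: top Z_def)
      qed
      ultimately show "\<exists>V. openin T V \<and> \<sigma> \<in> V \<and> V \<subseteq> topspace T - Z Q" by blast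
    qed
    then show ?thesis unfolding closedin_def Z_def by auto
  qed
  have "\<Inter>(insert (topspace T) (Z ` \<Q>)) \<noteq> {}"
  proof (rule fip)
    show "\<forall>S\<in>insert (topspace T) (Z ` \<Q>). closedin T S" using closed by auto
    show "\<forall>\<F>. finite \<F> \<and> \<F> \<subseteq> insert (topspace T) (Z ` \<Q>) \<longrightarrow> \<Inter>\<F> \<noteq> {}"
    proof (intro allI impI)
      fix \<F> assume F: "finite \<F> \<and> \<F> \<subseteq> insert (topspace T) (Z ` \<Q>)"
      then have "finite (\<F> - {topspace T})" "\<F> - {topspace T} \<subseteq> Z ` \<Q>" by auto
      then obtain F where F': "F \<subseteq> \<Q>" "finite F" "\<F> - {topspace T} = Z ` F"
        using finite_subset_image by metis
      obtain \<sigma> where \<sigma>: "\<forall>x. \<sigma> x \<in> C x" "\<forall>Q\<in>F. Q \<sigma>" using sat[OF F'(2,1)] by blast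
      have "\<sigma> \<in> S" if "S \<in> \<F>" for S
      proof (cases "S = topspace T")
        case False
        then have "S \<in> Z ` F" using that F'(3) by blast
        then show ?thesis using \<sigma> by (auto simp: Z_def top)
      qed (use \<sigma> in \<open>simp add: top\<close>)
      then show "\<Inter>\<F> \<noteq> {}" by blast
    qed
  qed
  then show ?thesis by (auto simp: top Z_def)
qed

section \<open>The image of inertia at finite level\<close>

context local_closure
begin

lemma res_add: "nrm x \<le> 1 \<Longrightarrow> nrm y \<le> 1 \<Longrightarrow> res (x + y) = res x + res y"
proof -
  assume xy: "nrm x \<le> 1" "nrm y \<le> 1"
  have "nrm ((x - res x) + (y - res y)) < 1" by (intro nrm_less_1_add res xy)
  then have "nrm ((x + y) - (res x + res y)) < 1" by (simp add: algebra_simps)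
  then show ?thesis by (rule res_unique[OF subfldD(3)[OF subfld_kb res(1)[OF xy(1)] res(1)[OF xy(2)]]])
qed

lemma res_cong: "nrm x \<le> 1 \<Longrightarrow> nrm (x - y) < 1 \<Longrightarrow> res x = res y"
proof -
  assume x: "nrm x \<le> 1" "nrm (x - y) < 1"
  have "nrm ((x - res x) - (x - y)) < 1" by (intro nrm_less_1_diff res x)
  then show ?thesis by (intro res_unique[symmetric] res(1) x) simp
qed

lemma res_kb: "z \<in> kb \<Longrightarrow> res z = z"
  by (rule res_unique) simp_all

lemma kb_le_1: "z \<in> kb \<Longrightarrow> nrm z \<le> 1"
  using kb_nrm[of z] by (cases "z = 0") auto

lemma res_power: "nrm y \<le> 1 \<Longrightarrow> res (y ^ (p ^ n)) = res y ^ (p ^ n)"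
proof -
  assume y: "nrm y \<le> 1"
  have "nrm ((y - res y) ^ (p ^ n)) < 1"
    using res(2)[OF y] p_gt_1 by (simp add: nrm_power power_less_one_iff)
  then show ?thesis
    by (intro res_unique subfldD(9)[OF subfld_kb res(1)[OF y]]) (simp add: frob_diff)
qed

text \<open>These constants are roots of the polynomial whose coefficients are the residues of the
  \<open>b k\<close>; it is non-zero because \<open>b n\<close> is a unit.\<close>

lemma finite_addpoly_residues:
  assumes b: "\<And>k. k \<le> n \<Longrightarrow> nrm (b k) \<le> 1" "nrm (b n) = 1"
  shows "finite {w \<in> kb. nrm (addpoly b n w) < 1}"
proof -
  define G where "G = (\<Sum>k\<le>n. Polynomial.monom (res (b k)) (p ^ k))"
  have "Polynomial.coeff G (p ^ n) = (\<Sum>k\<le>n. if p ^ k = p ^ n then res (b k) else 0)"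
    unfolding G_def by (simp add: coeff_sum)
  also have "\<dots> = res (b n)" unfolding p_pow_inj by simp
  also have "\<dots> \<noteq> 0" using res(2)[of "b n"] b(2) by auto
  finally have G0: "G \<noteq> 0" by auto
  have "poly G w = 0" if w: "w \<in> kb" "nrm (addpoly b n w) < 1" for w
  proof -
    have G: "poly G w = (\<Sum>k\<le>n. res (b k) * w ^ (p ^ k))" unfolding G_def by (simp add: poly_sum poly_monom)
    have wk: "w ^ (p ^ k) \<in> kb" for k by (rule subfldD(9)[OF subfld_kb w(1)])
    have "nrm (\<Sum>k\<le>n. w ^ (p ^ k) * (b k - res (b k))) < 1"
      by (intro nrm_sum_less nrm_less_1_mult[OF kb_le_1[OF wk] res(2)]) (use b(1) in auto)
    moreover have "(\<Sum>k\<le>n. w ^ (p ^ k) * (b k - res (b k))) = addpoly b n w - poly G w"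
      unfolding G addpoly_def by (simp add: algebra_simps sum_subtractf)
    ultimately have "nrm (addpoly b n w - poly G w) < 1" by (simp only:)
    from nrm_less_1_diff[OF w(2) this] have "nrm (poly G w) < 1" by simp
    moreover have "poly G w \<in> kb" unfolding G
      by (intro subfld_sum[OF subfld_kb] subfldD(4)[OF subfld_kb] wk res(1) b(1)) simp
    ultimately show ?thesis by (intro kb_nrm_less_1)
  qed
  then show ?thesis using poly_roots_finite[OF G0] by (auto intro: rev_finite_subset)
qed

end

text \<open>\<open>\<xi>_dist\<close> is the multiplicative form of distinct invariants: Frobenius
  powers change the exponent of an absolute value only by powers of \<open>p\<close>.\<close>

locale kummer_family = drinfeld v vinf \<psi>
  for v :: "'k::field alg_closure \<Rightarrow> ereal" and vinf :: "'f::field \<Rightarrow> ereal" and \<psi> :: "'f \<Rightarrow> 'k poly" +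
  fixes r :: nat and \<xi> :: "nat \<Rightarrow> 'k alg_closure"
  assumes \<xi>_perf: "i < r \<Longrightarrow> \<xi> i \<in> perf" and \<xi>_gt_1: "i < r \<Longrightarrow> 1 < absv v (\<xi> i)"
    and \<xi>_dist: "i < r \<Longrightarrow> j < r \<Longrightarrow> absv v (\<xi> i) ^ (CHAR('k) ^ k) = absv v (\<xi> j) ^ (CHAR('k) ^ l) \<Longrightarrow> i = j"
begin

definition rt :: "'f \<Rightarrow> nat \<Rightarrow> 'k alg_closure" where
  "rt a i = (SOME x. act a x = \<xi> i)"

lemma rt: "a \<in> A \<Longrightarrow> a \<noteq> 0 \<Longrightarrow> act a (rt a i) = \<xi> i"
  unfolding rt_def by (rule someI_ex) (metis act_surj)

lemma rt_le_1: "\<sigma> \<in> Iner \<Longrightarrow> a \<in> A \<Longrightarrow> a \<noteq> 0 \<Longrightarrow> i < r \<Longrightarrow> absv v (dl \<sigma> (rt a i)) \<le> 1"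
  using dl_le_1(1)[of \<sigma> a "rt a i"] rt \<xi>_perf by simp

text \<open>The \<open>a\<close>-torsion of the reduced Drinfeld module, realized by
  constants.\<close>

definition Xs :: "'f \<Rightarrow> 'k alg_closure set" where
  "Xs a = {w \<in> kb. absv v (act a w) < 1}"

lemma Xs_finite: "a \<in> A \<Longrightarrow> a \<noteq> 0 \<Longrightarrow> finite (Xs a)"
  unfolding Xs_def act_addpoly by (rule finite_addpoly_residues) (auto intro: cf_le_1 cf_lead)

text \<open>Tuples are functions that vanish outside \<open>{..<r}\<close>, so that they form a group.\<close>

definition Xr :: "'f \<Rightarrow> (nat \<Rightarrow> 'k alg_closure) set" where
  "Xr a = {h. \<forall>i. if i < r then h i \<in> Xs a else h i = 0}"

text \<open>The reduced Kummer differences of \<open>\<sigma>\<close> at level \<open>a\<close>, for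
  all \<open>\<xi> i\<close> at once. The choice of division points in \<open>rt\<close> affects the
  differences only by small elements.\<close>

definition lv :: "'f \<Rightarrow> ('k alg_closure \<Rightarrow> 'k alg_closure) \<Rightarrow> nat \<Rightarrow> 'k alg_closure" where
  "lv a \<sigma> i = (if i < r then res (dl \<sigma> (rt a i)) else 0)"

definition H :: "'f \<Rightarrow> (nat \<Rightarrow> 'k alg_closure) set" where
  "H a = lv a ` Iner"

text \<open>The transition map of the inverse system, from level \<open>a * b\<close> to level
  \<open>a\<close>.\<close>

definition tr :: "'f \<Rightarrow> (nat \<Rightarrow> 'k alg_closure) \<Rightarrow> nat \<Rightarrow> 'k alg_closure" where
  "tr b h i = (if i < r then res (act b (h i)) else 0)"

lemma Xs_0: "0 \<in> Xs a"
  unfolding Xs_def using subfldD(1)[OF subfld_kb] by (simp add: act_arg)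

lemma Xs_diff: "x \<in> Xs a \<Longrightarrow> y \<in> Xs a \<Longrightarrow> x - y \<in> Xs a"
  unfolding Xs_def using subfldD(7)[OF subfld_kb] nrm_less_1_diff by (simp add: act_arg)

lemma Xs_add: "x \<in> Xs a \<Longrightarrow> y \<in> Xs a \<Longrightarrow> x + y \<in> Xs a"
  unfolding Xs_def using subfldD(3)[OF subfld_kb] nrm_less_1_add by (simp add: act_arg)

lemma Xr_diff: "g \<in> Xr a \<Longrightarrow> h \<in> Xr a \<Longrightarrow> g - h \<in> Xr a"
  unfolding Xr_def using Xs_diff by simp

lemma Xr_add: "g \<in> Xr a \<Longrightarrow> h \<in> Xr a \<Longrightarrow> g + h \<in> Xr a"
  unfolding Xr_def using Xs_add by simp

lemma Xr_card:
  assumes "a \<in> A" "a \<noteq> 0" shows "finite (Xr a)" "card (Xr a) \<le> card (Xs a) ^ r"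
proof -
  have inj: "inj_on (\<lambda>h. restrict h {..<r}) (Xr a)"
  proof (rule inj_onI)
    fix g h assume gh: "g \<in> Xr a" "h \<in> Xr a" "restrict g {..<r} = restrict h {..<r}"
    show "g = h"
    proof
      fix i
      show "g i = h i"
      proof (cases "i < r")
        case True
        then show ?thesis using fun_cong[OF gh(3), of i] by simp
      next
        case False
        then show ?thesis using gh(1,2) unfolding Xr_def by (auto split: if_splits)
      qed
    qed
  qed
  have sub: "(\<lambda>h. restrict h {..<r}) ` Xr a \<subseteq> PiE {..<r} (\<lambda>_. Xs a)"
    unfolding Xr_def by (auto split: if_splits)
  have fin: "finite (PiE {..<r} (\<lambda>_. Xs a))" by (intro finite_PiE) (use Xs_finite[OF assms] in auto)
  show "finite (Xr a)" using finite_imageD[OF finite_subset[OF sub fin] inj] .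
  show "card (Xr a) \<le> card (Xs a) ^ r"
    using card_inj_on_le[OF inj sub fin] by (simp add: card_PiE)
qed

lemma lv_Xr:
  assumes "\<sigma> \<in> Iner" "a \<in> A" "a \<noteq> 0" shows "lv a \<sigma> \<in> Xr a"
proof -
  have "res (dl \<sigma> (rt a i)) \<in> Xs a" if i: "i < r" for i
  proof -
    have le: "absv v (dl \<sigma> (rt a i)) \<le> 1" by (rule rt_le_1[OF assms i])
    have z: "act a (dl \<sigma> (rt a i)) = 0" using dl_le_1(2)[OF assms, of "rt a i"] rt[OF assms(2,3)] \<xi>_perf[OF i] by simp
    have "absv v (act a (dl \<sigma> (rt a i) - res (dl \<sigma> (rt a i)))) < 1" by (rule act_less_1[OF assms(2) res(2)[OF le]])
    moreover have "act a (dl \<sigma> (rt a i) - res (dl \<sigma> (rt a i))) = - act a (res (dl \<sigma> (rt a i)))"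
      unfolding act_arg(2)[of a "dl \<sigma> (rt a i)"] z by simp
    ultimately have "absv v (act a (res (dl \<sigma> (rt a i)))) < 1" by (simp only: nrm_minus)
    then show ?thesis unfolding Xs_def using res(1)[OF le] by simp
  qed
  then show ?thesis unfolding Xr_def lv_def by simp
qed

lemma H_sub: "a \<in> A \<Longrightarrow> a \<noteq> 0 \<Longrightarrow> H a \<subseteq> Xr a"
  unfolding H_def using lv_Xr by auto

lemma lv_comp:
  assumes "\<sigma> \<in> Iner" "\<tau> \<in> Iner" "a \<in> A" "a \<noteq> 0"
  shows "lv a (\<sigma> \<circ> \<tau>) = lv a \<sigma> + lv a \<tau>"
proof
  fix i
  show "lv a (\<sigma> \<circ> \<tau>) i = (lv a \<sigma> + lv a \<tau>) i"
  proof (cases "i < r")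
    case i: True
    have p: "act a (rt a i) \<in> perf" using rt[OF assms(3,4)] \<xi>_perf[OF i] by simp
    have "res (dl (\<sigma> \<circ> \<tau>) (rt a i)) = res (dl \<sigma> (rt a i) + dl \<tau> (rt a i))"
      by (rule res_cong[OF rt_le_1[OF Iner_comp[OF assms(1,2)] assms(3,4) i] dl_comp[OF assms p]])
    also have "\<dots> = res (dl \<sigma> (rt a i)) + res (dl \<tau> (rt a i))"
      by (intro res_add rt_le_1 assms i)
    finally show ?thesis using i by (simp add: lv_def)
  qed (simp add: lv_def)
qed

lemma lv_id: "lv a id = 0"
  using subfldD(1)[OF subfld_kb] res_kb[of 0] by (intro ext) (simp add: lv_def)

lemma H_closed:
  assumes a: "a \<in> A" "a \<noteq> 0"
  shows "0 \<in> H a" "g \<in> H a \<Longrightarrow> h \<in> H a \<Longrightarrow> g - h \<in> H a" "g \<in> H a \<Longrightarrow> - g \<in> H a"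
proof -
  show 0: "0 \<in> H a" unfolding H_def using lv_id id_Iner by (intro image_eqI[of _ _ id]) auto
  show d: "g - h \<in> H a" if gh: "g \<in> H a" "h \<in> H a" for g h
  proof -
    obtain \<sigma> \<tau> where s: "\<sigma> \<in> Iner" "g = lv a \<sigma>" "\<tau> \<in> Iner" "h = lv a \<tau>" using gh unfolding H_def by auto
    have i: "inv_into UNIV \<tau> \<in> Iner" by (rule Iner_inv[OF s(3)])
    have "\<tau> \<circ> inv_into UNIV \<tau> = id" using field_autD(1)[OF InerD(1)[OF s(3)]] by (auto simp: bij_def surj_iff)
    then have "lv a \<tau> + lv a (inv_into UNIV \<tau>) = 0" using lv_comp[OF s(3) i a] lv_id by simp
    then have "lv a (inv_into UNIV \<tau>) = - h" using s(4) by (simp add: add_eq_0_iff)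
    then have "lv a (\<sigma> \<circ> inv_into UNIV \<tau>) = g - h" using lv_comp[OF s(1) i a] s(2) by simp
    then show ?thesis unfolding H_def using Iner_comp[OF s(1) i] by (metis image_eqI)
  qed
  show "- g \<in> H a" if "g \<in> H a" for g using d[OF 0 that] by simp
qed

lemma tr_add:
  assumes "g \<in> Xr a" "h \<in> Xr a" "b \<in> A" shows "tr b (g + h) = tr b g + tr b h" "tr b (g - h) = tr b g - tr b h"
proof -
  have le: "absv v (act b (g i)) \<le> 1" if "g \<in> Xr a" "i < r" for g i
    using that assms(3) act_le_1 kb_le_1 unfolding Xr_def Xs_def by (auto split: if_splits)
  have 1: "tr b (g + h) = tr b g + tr b h" if "g \<in> Xr a" "h \<in> Xr a" for g h
    using le[OF that(1)] le[OF that(2)] by (intro ext) (simp add: tr_def act_arg res_add)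
  show "tr b (g + h) = tr b g + tr b h" by (rule 1[OF assms(1,2)])
  show "tr b (g - h) = tr b g - tr b h"
    using 1[OF Xr_diff[OF assms(1,2)] assms(2)] by simp
qed

text \<open>The image of \<open>rt (a * b) i\<close> under \<open>b\<close> and the chosen
  \<open>rt a i\<close> are division points of the same element, so \<open>dl_close\<close>
  applies.\<close>

lemma tr_lv:
  assumes "\<sigma> \<in> Iner" "a \<in> A" "a \<noteq> 0" "b \<in> A" "b \<noteq> 0"
  shows "tr b (lv (a * b) \<sigma>) = lv a \<sigma>"
proof
  fix i
  have ab: "a * b \<in> A" "a * b \<noteq> 0" using assms A_closed(4) by auto
  show "tr b (lv (a * b) \<sigma>) i = lv a \<sigma> i"
  proof (cases "i < r")
    case i: True
    let ?y = "dl \<sigma> (rt (a * b) i)"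
    have le: "absv v ?y \<le> 1" by (rule rt_le_1[OF assms(1) ab i])
    have "act a (act b (rt (a * b) i)) = act a (rt a i)"
      using act_mult[OF assms(2,4)] rt[OF ab] rt[OF assms(2,3)] by simp
    then have 1: "absv v (dl \<sigma> (act b (rt (a * b) i)) - dl \<sigma> (rt a i)) < 1"
      by (intro dl_close[OF assms(1-3)]) simp
    have 2: "absv v (act b (?y - res ?y)) < 1" by (rule act_less_1[OF assms(4) res(2)[OF le]])
    have "res (act b (res ?y)) = res (act b ?y)"
      by (rule res_cong[symmetric]) (use 2 act_le_1[OF assms(4) le] in \<open>simp_all add: act_arg\<close>)
    also have "\<dots> = res (dl \<sigma> (rt a i))"
      by (rule res_cong) (use 1 act_le_1[OF assms(4) le] in \<open>simp_all only: dl_act[OF assms(1)]\<close>)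
    finally show ?thesis using i by (simp add: tr_def lv_def)
  qed (simp add: tr_def lv_def)
qed

lemma tr_H: "a \<in> A \<Longrightarrow> a \<noteq> 0 \<Longrightarrow> b \<in> A \<Longrightarrow> b \<noteq> 0 \<Longrightarrow> h \<in> H (a * b) \<Longrightarrow> tr b h \<in> H a"
  unfolding H_def using tr_lv by auto

text \<open>A preimage of the constant \<open>w\<close> under \<open>b\<close> exists in the
  algebraic closure, is integral by good reduction, and can be replaced by its residue.\<close>

lemma tr_surj:
  assumes a: "a \<in> A" "a \<noteq> 0" "b \<in> A" "b \<noteq> 0" and h: "h \<in> Xr a"
  shows "\<exists>g\<in>Xr (a * b). tr b g = h"
proof -
  have "\<exists>w'\<in>Xs (a * b). res (act b w') = w" if w: "w \<in> Xs a" for w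
  proof -
    obtain y where y: "act b y = w" by (rule act_surj[OF a(3,4)])
    have wk: "w \<in> kb" "absv v (act a w) < 1" using w unfolding Xs_def by auto
    have y1: "absv v y \<le> 1" using act_le_1_iff[OF a(3,4), of y] kb_le_1[OF wk(1)] y by simp
    have 1: "absv v (act b (y - res y)) < 1" by (rule act_less_1[OF a(3) res(2)[OF y1]])
    then have 2: "absv v (w - act b (res y)) < 1" unfolding act_arg(2) y .
    have "absv v (act a w - act a (w - act b (res y))) < 1"
      by (rule nrm_less_1_diff[OF wk(2) act_less_1[OF a(1) 2]])
    then have "absv v (act (a * b) (res y)) < 1" using act_mult[OF a(1,3)] by (simp add: act_arg)
    then have "res y \<in> Xs (a * b)" unfolding Xs_def using res(1)[OF y1] by simp
    moreover have "res (act b (res y)) = w"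
      by (rule res_unique[OF wk(1)]) (use 2 in \<open>simp add: nrm_diff_commute\<close>)
    ultimately show ?thesis by blast
  qed
  then obtain f where f: "\<And>w. w \<in> Xs a \<Longrightarrow> f w \<in> Xs (a * b) \<and> res (act b (f w)) = w" by metis
  have hi: "h i \<in> Xs a" if "i < r" for i using h that unfolding Xr_def by (auto split: if_splits)
  have ho: "h i = 0" if "\<not> i < r" for i using h that unfolding Xr_def by (auto split: if_splits)
  show ?thesis
  proof (rule bexI[of _ "\<lambda>i. if i < r then f (h i) else 0"])
    show "(\<lambda>i. if i < r then f (h i) else 0) \<in> Xr (a * b)" unfolding Xr_def using f hi by simp
    show "tr b (\<lambda>i. if i < r then f (h i) else 0) = h" using f hi ho by (intro ext) (simp add: tr_def)
  qed
qed

text \<open>\<open>level_bound\<close> requires \<open>\<xi> i\<close> in \<open>K\<close> and a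
  non-zero linear coefficient. Both are achieved by Frobenius powers, which change neither the
  number of residues nor the size of the image.\<close>

lemma level_index:
  "\<exists>B::nat. \<forall>a. a \<in> A \<longrightarrow> a \<noteq> 0 \<longrightarrow> card (Xs a) ^ r \<le> B * card (H a)"
proof -
  let ?p = "CHAR('k)"
  have "\<exists>t. \<forall>i\<in>{..<r}. \<xi> i ^ (?p ^ t) \<in> range to_ac"
  proof -
    have "\<forall>\<^sub>F t in sequentially. \<xi> i ^ (?p ^ t) \<in> range to_ac" if i: "i \<in> {..<r}" for i
    proof -
      obtain n where n: "\<xi> i ^ (?p ^ n) \<in> range to_ac" using \<xi>_perf[of i] i unfolding perfection_def by auto
      have "\<xi> i ^ (?p ^ t) \<in> range to_ac" if "n \<le> t" for t
      proof -
        have "\<xi> i ^ (?p ^ t) = (\<xi> i ^ (?p ^ n)) ^ (?p ^ (t - n))" using that by (simp add: power_mult[symmetric] power_add[symmetric])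
        then show ?thesis using subfldD(9)[OF K n] by simp
      qed
      then show ?thesis unfolding eventually_sequentially by blast
    qed
    then have "\<forall>\<^sub>F t in sequentially. \<forall>i\<in>{..<r}. \<xi> i ^ (?p ^ t) \<in> range to_ac"
      by (intro eventually_ball_finite) auto
    then show ?thesis using eventually_happens'[OF sequentially_bot] by blast
  qed
  then obtain t where t: "\<And>i. i < r \<Longrightarrow> \<xi> i ^ (?p ^ t) \<in> range to_ac" by auto
  \<comment> \<open>\<open>t\<close> and \<open>N\<close> are fixed before \<open>a\<close>, so the
    resulting bound is uniform in \<open>a\<close>.\<close>
  obtain N where N: "\<And>i. i < r \<Longrightarrow> absv v (\<xi> i ^ (?p ^ t)) < exp (real (?p ^ N))"
  proof -
    obtain N :: nat where N: "(\<Sum>i<r. absv v (\<xi> i ^ (?p ^ t))) < real N" using reals_Archimedean2 by blast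
    have "absv v (\<xi> i ^ (?p ^ t)) < exp (real (?p ^ N))" if "i < r" for i
    proof -
      have "absv v (\<xi> i ^ (?p ^ t)) \<le> (\<Sum>i<r. absv v (\<xi> i ^ (?p ^ t)))"
        using that by (intro member_le_sum) (auto simp: nrm_ge_0)
      also have "\<dots> < real N" by (rule N)
      also have "\<dots> \<le> real (?p ^ N)" using power_gt_expt[of ?p N] p_gt_1 by simp
      also have "\<dots> < exp (real (?p ^ N))" by (rule exp_gt_self)
      finally show ?thesis .
    qed
    then show thesis by (rule that)
  qed
  show ?thesis
  proof (intro exI[of _ "?p ^ (r * N)"] allI impI)
    fix a assume a: "a \<in> A" "a \<noteq> 0"
    \<comment> \<open>The inseparable part: the twisted polynomial of \<open>a\<close> has lowest
      term of degree \<open>s\<close>, so it is divisible by the \<open>s\<close>-th power of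
      Frobenius on the right.\<close>
    define s where "s = (LEAST s. cf a s \<noteq> 0)"
    have lead0: "cf a (dg a) \<noteq> 0" using cf_lead[OF a] by auto
    have s: "cf a s \<noteq> 0" unfolding s_def using lead0 by (rule LeastI)
    have sle: "s \<le> dg a" unfolding s_def using lead0 by (rule Least_le)
    have below: "cf a k = 0" if "k < s" for k using not_less_Least that unfolding s_def by blast
    define n where "n = dg a - s"
    \<comment> \<open>The separable part with its coefficients raised to the power
      \<open>p ^ t\<close>. Then the p^t-th power of \<open>act a x\<close> is an additive
      polynomial, with non-zero linear term, in the p^q-th power of \<open>x\<close>.\<close>
    define b where "b = (\<lambda>k. cf a (k + s) ^ (?p ^ t))"
    define q where "q = s + t"
    have eval: "addpoly b n (x ^ (?p ^ q)) = act a x ^ (?p ^ t)" for x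
    proof -
      have "act a x = (\<Sum>k\<in>{s..dg a}. cf a k * x ^ (?p ^ k))"
        unfolding act_addpoly addpoly_def by (rule sum.mono_neutral_right) (use below in auto)
      also have "\<dots> = (\<Sum>k\<le>n. cf a (k + s) * x ^ (?p ^ (k + s)))"
        by (rule sum.reindex_bij_witness[of _ "\<lambda>k. k + s" "\<lambda>k. k - s"]) (use sle in \<open>auto simp: n_def\<close>)
      finally have "act a x ^ (?p ^ t) = (\<Sum>k\<le>n. (cf a (k + s) * x ^ (?p ^ (k + s))) ^ (?p ^ t))"
        by (simp only: char_p_sum_power[OF prime_char[folded p_eq], folded p_eq] p_eq char_p_sum_power[OF prime_char])
      also have "\<dots> = addpoly b n (x ^ (?p ^ q))"
        unfolding addpoly_def b_def q_def
        by (intro sum.cong refl) (simp add: power_mult_distrib power_mult[symmetric] power_add[symmetric] add_ac)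
      finally show ?thesis by simp
    qed
    have frob_less: "absv v (y ^ (?p ^ t)) < 1 \<longleftrightarrow> absv v y < 1" for y
      using p_gt_1 by (simp add: nrm_power power_less_one_iff nrm_ge_0)
    define x where "x = (\<lambda>i. rt a i ^ (?p ^ q))"
    define L where "L = (\<lambda>\<sigma>. \<lambda>i\<in>{..<r}. res (\<sigma> (x i) - x i)) ` Iner"
    have bound: "card {w \<in> kb. absv v (addpoly b n w) < 1} ^ r \<le> ?p ^ (r * N) * card L"
      unfolding L_def
    proof (rule level_bound[where \<xi> = "\<lambda>i. \<xi> i ^ (?p ^ t)"])
      show "b k \<in> range to_ac" for k unfolding b_def by (intro subfldD(9)[OF K] cf_K)
      show "absv v (b k) \<le> 1" for k
        unfolding b_def nrm_power by (intro power_le_one cf_le_1 a nrm_ge_0)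
      show "b 0 \<noteq> 0" unfolding b_def using s by simp
      show "absv v (b n) = 1" unfolding b_def n_def nrm_power using cf_lead[OF a] sle by simp
      show "1 < absv v (\<xi> i ^ (?p ^ t))" if "i < r" for i
        unfolding nrm_power using \<xi>_gt_1[OF that] p_gt_1 by (intro one_less_power) auto
      show "i = j" if "i < r" "j < r" "absv v (\<xi> i ^ (?p ^ t)) ^ (?p ^ k) = absv v (\<xi> j ^ (?p ^ t)) ^ (?p ^ l)" for i j k l
        using \<xi>_dist[OF that(1,2), of "t + k" "t + l"] that(3) by (simp add: nrm_power power_mult[symmetric] power_add)
      show "addpoly b n (x i) = \<xi> i ^ (?p ^ t)" for i unfolding x_def eval rt[OF a] ..
    qed (use t N in auto)
    have "card (Xs a) \<le> card {w \<in> kb. absv v (addpoly b n w) < 1}"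
    proof (rule card_inj_on_le[where f = "\<lambda>w. w ^ (?p ^ q)"])
      show "inj_on (\<lambda>w. w ^ (?p ^ q)) (Xs a)" by (rule inj_onI) (simp only: frob_inj)
      show "(\<lambda>w. w ^ (?p ^ q)) ` Xs a \<subseteq> {w \<in> kb. absv v (addpoly b n w) < 1}"
        unfolding Xs_def using subfldD(9)[OF subfld_kb] by (auto simp: eval frob_less)
      show "finite {w \<in> kb. absv v (addpoly b n w) < 1}"
        by (rule finite_addpoly_residues)
          (use cf_lead[OF a] sle cf_le_1[OF a(1)] in \<open>auto simp: b_def n_def nrm_power nrm_ge_0 intro!: power_le_one\<close>)
    qed
    then have "card (Xs a) ^ r \<le> card {w \<in> kb. absv v (addpoly b n w) < 1} ^ r" by (intro power_mono) auto
    also have "\<dots> \<le> ?p ^ (r * N) * card L" by (rule bound)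
    also have "card L \<le> card (H a)"
    proof -
      have "(\<lambda>i\<in>{..<r}. res (\<sigma> (x i) - x i)) = (\<lambda>i\<in>{..<r}. lv a \<sigma> i ^ (?p ^ q))" if \<sigma>: "\<sigma> \<in> Iner" for \<sigma>
      proof (rule restrict_ext)
        fix i assume i: "i \<in> {..<r}"
        have "\<sigma> (x i) - x i = dl \<sigma> (rt a i) ^ (?p ^ q)"
          unfolding x_def field_autD(8)[OF InerD(1)[OF \<sigma>]] frob_diff ..
        then show "res (\<sigma> (x i) - x i) = lv a \<sigma> i ^ (?p ^ q)"
          using i res_power[OF rt_le_1[OF \<sigma> a, of i]] by (simp add: lv_def)
      qed
      then have "L = (\<lambda>f. \<lambda>i\<in>{..<r}. f i ^ (?p ^ q)) ` H a" unfolding L_def H_def image_image by (intro image_cong refl) simp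
      then show ?thesis using finite_subset[OF H_sub[OF a] Xr_card(1)[OF a]] by (simp add: card_image_le)
    qed
    finally show "card (Xs a) ^ r \<le> ?p ^ (r * N) * card (H a)" by simp
  qed
qed

text \<open>The index of \<open>H a\<close> is bounded, so from some \<open>a0\<close> on it does not grow any more.\<close>

lemma kernel_in_image:
  "\<exists>a0\<in>A - {0}. \<forall>b\<in>A - {0}. \<forall>z\<in>Xr (a0 * b). tr b z = 0 \<longrightarrow> z \<in> H (a0 * b)"
proof -
  obtain B :: nat where B: "\<And>a. a \<in> A \<Longrightarrow> a \<noteq> 0 \<Longrightarrow> card (Xs a) ^ r \<le> B * card (H a)"
    using level_index by blast
  \<comment> \<open>\<open>C\<close> represents distinct cosets of \<open>H a\<close> in
    \<open>Xr a\<close>, so its size is at most the index and hence at most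
    \<open>B\<close>.\<close>
  define good where "good = (\<lambda>a C. C \<subseteq> Xr a \<and> finite C \<and> (\<forall>c\<in>C. \<forall>d\<in>C. c \<noteq> d \<longrightarrow> c - d \<notin> H a))"
  let ?P = "\<lambda>k. \<exists>a\<in>A - {0}. \<exists>C. good a C \<and> card C = k"
  have bound: "k \<le> B" if "?P k" for k
  proof -
    obtain a C where a: "a \<in> A" "a \<noteq> 0" and C: "good a C" "card C = k" using \<open>?P k\<close> by auto
    have fH: "finite (H a)" by (rule finite_subset[OF H_sub[OF a] Xr_card(1)[OF a]])
    have hpos: "0 < card (H a)" using fH H_closed(1)[OF a] by (auto simp: card_gt_0_iff)
    have "inj_on (\<lambda>(c, h). c + h) (C \<times> H a)"
    proof (rule inj_onI, clarify)
      fix c h d g assume *: "c \<in> C" "h \<in> H a" "d \<in> C" "g \<in> H a" "c + h = d + g"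
      have "c - d = g - h" using *(5) by (simp add: algebra_simps)
      then have "c - d \<in> H a" using H_closed(2)[OF a *(4,2)] by simp
      then have "c = d" using C(1) * unfolding good_def by blast
      then show "c = d \<and> h = g" using *(5) by simp
    qed
    moreover have "(\<lambda>(c, h). c + h) ` (C \<times> H a) \<subseteq> Xr a"
      using C(1) H_sub[OF a] unfolding good_def by (auto intro!: Xr_add intro: subsetD)
    ultimately have "card (C \<times> H a) \<le> card (Xr a)" by (rule card_inj_on_le[OF _ _ Xr_card(1)[OF a]])
    also have "\<dots> \<le> B * card (H a)" using Xr_card(2)[OF a] B[OF a] by simp
    finally show ?thesis using C(2) hpos by (simp add: card_cartesian_product)
  qed
  have "0 \<in> Xr 1" unfolding Xr_def using Xs_0 by simp
  then have "?P 1" using A_closed(2) by (intro bexI[of _ 1] exI[of _ "{0}"]) (auto simp: good_def)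
  then have "?P (GREATEST k. ?P k)" using GreatestI_nat[of ?P 1 B] bound by blast
  then obtain a0 C where a0: "a0 \<in> A" "a0 \<noteq> 0" and C: "good a0 C" "card C = (GREATEST k. ?P k)" by auto
  have max: "k \<le> card C" if "?P k" for k using Greatest_le_nat[of ?P k B] bound that C(2) by simp
  have "card C \<noteq> 0" using max[OF \<open>?P 1\<close>] by simp
  then obtain c0 where c0: "c0 \<in> C" using card_eq_0_iff[of C] by auto
  have "z \<in> H (a0 * b)" if b: "b \<in> A" "b \<noteq> 0" and z: "z \<in> Xr (a0 * b)" "tr b z = 0" for b z
  proof (rule ccontr)
    assume zH: "z \<notin> H (a0 * b)"
    have ab: "a0 * b \<in> A" "a0 * b \<noteq> 0" using a0 b A_closed(4) by auto
    have "\<forall>c\<in>C. \<exists>g. g \<in> Xr (a0 * b) \<and> tr b g = c"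
      using tr_surj[OF a0 b] C(1) unfolding good_def by blast
    then obtain g where "\<forall>c\<in>C. g c \<in> Xr (a0 * b) \<and> tr b (g c) = c" by (rule bchoice[THEN exE])
    then have g: "\<And>c. c \<in> C \<Longrightarrow> g c \<in> Xr (a0 * b)" "\<And>c. c \<in> C \<Longrightarrow> tr b (g c) = c" by auto
    \<comment> \<open>A second preimage of \<open>c0\<close>, in another coset than
      \<open>g c0\<close>. Together with the lifts of \<open>C\<close> it gives one coset more than
      the maximum allows.\<close>
    let ?y = "g c0 + z"
    have y: "?y \<in> Xr (a0 * b)" "tr b ?y = c0"
      using Xr_add[OF g(1)[OF c0] z(1)] tr_add(1)[OF g(1)[OF c0] z(1) b(1)] g(2)[OF c0] z(2) by simp_all
    have sep: "c \<in> C \<Longrightarrow> d \<in> C \<Longrightarrow> x \<in> Xr (a0 * b) \<Longrightarrow> y \<in> Xr (a0 * b) \<Longrightarrow> tr b x = c \<Longrightarrow> tr b y = d \<Longrightarrow> c \<noteq> d \<Longrightarrow>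
      x - y \<notin> H (a0 * b)" for c d x y
      using tr_H[OF a0 b, of "x - y"] tr_add(2)[of x "a0 * b" y b] b(1) C(1) unfolding good_def by auto
    have yc0: "?y - g c0 \<notin> H (a0 * b)" using zH by simp
    have c0y: "g c0 - ?y \<notin> H (a0 * b)" using H_closed(3)[OF ab, of "g c0 - ?y"] zH by auto
    have sy: "?y - g c \<notin> H (a0 * b)" "g c - ?y \<notin> H (a0 * b)" if c: "c \<in> C" for c
      using yc0 c0y sep[OF c0 c y(1) g(1)[OF c] y(2) g(2)[OF c]] sep[OF c c0 g(1)[OF c] y(1) g(2)[OF c] y(2)]
      by (cases "c = c0"; simp)+
    have ny: "?y \<notin> g ` C" using sy H_closed(1)[OF ab] by force
    have inj: "inj_on g C" using g(2) by (metis inj_onI)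
    have fC: "finite C" using C(1) unfolding good_def by simp
    have "good (a0 * b) (insert ?y (g ` C))" unfolding good_def
    proof (intro conjI ballI impI)
      show "insert ?y (g ` C) \<subseteq> Xr (a0 * b)" using y(1) g(1) by auto
      show "finite (insert ?y (g ` C))" using fC by simp
      fix c d assume cd: "c \<in> insert ?y (g ` C)" "d \<in> insert ?y (g ` C)" "c \<noteq> d"
      consider "c = ?y" "d \<in> g ` C" | "c \<in> g ` C" "d = ?y" | "c \<in> g ` C" "d \<in> g ` C" using cd by auto
      then show "c - d \<notin> H (a0 * b)"
      proof cases
        case 3
        then obtain c' d' where "c' \<in> C" "d' \<in> C" "c = g c'" "d = g d'" by auto
        then show ?thesis using sep[OF _ _ g(1) g(1) g(2) g(2)] cd(3) by metis
      qed (use sy in auto)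
    qed
    then have "?P (card (insert ?y (g ` C)))" using ab by blast
    then have "card (insert ?y (g ` C)) \<le> card C" by (rule max)
    then show False using ny fC by (simp add: card_image[OF inj])
  qed
  then show ?thesis using a0 by blast
qed

text \<open>An element of inertia is a choice of one root of \<open>P x\<close> for every
  \<open>x\<close>, subject to conditions that involve finitely many values each. Finitely many
  prescribed levels all divide one level \<open>a0 * b\<close>, and there the kernel hypothesis
  provides an element of inertia.\<close>

lemma Iner_realize:
  assumes a0: "a0 \<in> A" "a0 \<noteq> 0"
    and ker: "\<And>b z. b \<in> A \<Longrightarrow> b \<noteq> 0 \<Longrightarrow> z \<in> Xr (a0 * b) \<Longrightarrow> tr b z = 0 \<Longrightarrow> z \<in> H (a0 * b)"
    and h: "\<And>a. a \<in> A \<Longrightarrow> a \<noteq> 0 \<Longrightarrow> h a \<in> Xr a"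
    and compat: "\<And>a b. a \<in> A \<Longrightarrow> a \<noteq> 0 \<Longrightarrow> b \<in> A \<Longrightarrow> b \<noteq> 0 \<Longrightarrow> tr b (h (a * b)) = h a"
    and h0: "h a0 = 0"
  shows "\<exists>\<gamma>\<in>Iner. \<forall>a\<in>A - {0}. lv a \<gamma> = h a"
proof -
  have "\<forall>x. \<exists>P. P \<noteq> 0 \<and> (\<forall>i. Polynomial.coeff P i \<in> E) \<and> poly P x = 0"
    using algebraic_over_mono[OF alg K_sub_E] unfolding algebraic_over_def by blast
  then obtain P where P: "\<And>x. P x \<noteq> 0" "\<And>x i. Polynomial.coeff (P x) i \<in> E" "\<And>x. poly (P x) x = 0" by metis
  define C where "C = (\<lambda>x. {y. poly (P x) y = 0})"
  have IC: "\<sigma> x \<in> C x" if \<sigma>: "\<sigma> \<in> Iner" for \<sigma> x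
  proof -
    have "\<sigma> (poly (P x) x) = poly (P x) (\<sigma> x)"
      unfolding poly_altdef field_aut_sum[OF InerD(1)[OF \<sigma>]]
      by (intro sum.cong refl) (simp add: field_autD(5,8)[OF InerD(1)[OF \<sigma>]] InerD(2)[OF \<sigma> P(2)])
    then show ?thesis using P(3) field_autD(3)[OF InerD(1)[OF \<sigma>]] unfolding C_def by simp
  qed
  define Q1 where "Q1 = (\<lambda>x y. \<lambda>\<sigma> :: 'k alg_closure \<Rightarrow> 'k alg_closure. \<sigma> (x + y) = \<sigma> x + \<sigma> y)"
  define Q2 where "Q2 = (\<lambda>x y. \<lambda>\<sigma> :: 'k alg_closure \<Rightarrow> 'k alg_closure. \<sigma> (x * y) = \<sigma> x * \<sigma> y)"
  define Q3 where "Q3 = (\<lambda>x. \<lambda>\<sigma> :: 'k alg_closure \<Rightarrow> 'k alg_closure. \<sigma> x = x)"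
  define Q4 where "Q4 = (\<lambda>a. \<lambda>\<sigma>. lv a \<sigma> = h a)"
  define \<Q> where "\<Q> = {Q1 x y | x y. True} \<union> {Q2 x y | x y. True} \<union> {Q3 x | x. x \<in> E} \<union> {Q4 a | a. a \<in> A - {0}}"
  have "\<exists>\<sigma>. (\<forall>x. \<sigma> x \<in> C x) \<and> (\<forall>Q\<in>\<Q>. Q \<sigma>)"
  proof (rule compactness_finite_choice)
    show "finite (C x)" for x unfolding C_def using P(1) by (rule poly_roots_finite)
    fix Q assume "Q \<in> \<Q>"
    then consider x y where "Q = Q1 x y" | x y where "Q = Q2 x y" | x where "Q = Q3 x" | a where "Q = Q4 a"
      unfolding \<Q>_def by auto
    then show "\<exists>D. finite D \<and> (\<forall>\<sigma> \<tau>. (\<forall>x\<in>D. \<sigma> x = \<tau> x) \<longrightarrow> Q \<sigma> \<longrightarrow> Q \<tau>)"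
    proof cases
      case 1
      then show ?thesis by (intro exI[of _ "{x, y, x + y}"]) (simp add: Q1_def)
    next
      case 2
      then show ?thesis by (intro exI[of _ "{x, y, x * y}"]) (simp add: Q2_def)
    next
      case 3
      then show ?thesis by (intro exI[of _ "{x}"]) (simp add: Q3_def)
    next
      case 4
      have "lv a \<tau> = h a" if "\<forall>x\<in>rt a ` {..<r}. \<sigma> x = \<tau> x" "lv a \<sigma> = h a" for \<sigma> \<tau>
        unfolding that(2)[symmetric] using that(1) by (intro ext) (simp add: lv_def)
      then show ?thesis unfolding 4 Q4_def by (intro exI[of _ "rt a ` {..<r}"] conjI allI impI finite_imageI finite_lessThan)
    qed
  next
    fix F assume F: "finite F" "F \<subseteq> \<Q>"
    have lift: "lv a \<gamma> = h a" if "\<gamma> \<in> Iner" "a \<in> A" "a \<noteq> 0" "b \<in> A" "b \<noteq> 0" "lv (a * b) \<gamma> = h (a * b)" for a b \<gamma>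
      using tr_lv[OF that(1-5)] compat[OF that(2-5)] that(6) by simp
    \<comment> \<open>The levels occurring in \<open>F\<close> are multiplied together; the value at
      the product determines the values at the factors by \<open>lift\<close>. The remaining
      conditions hold for every element of inertia.\<close>
    have "\<exists>b\<in>A - {0}. \<forall>\<gamma>\<in>Iner. lv (a0 * b) \<gamma> = h (a0 * b) \<longrightarrow> (\<forall>Q\<in>F. Q \<gamma>)" using F
    proof (induction F rule: finite_induct)
      case empty
      show ?case using A_closed(2) by (intro bexI[of _ 1]) auto
    next
      case (insert Q F)
      then obtain b where b: "b \<in> A" "b \<noteq> 0" "\<forall>\<gamma>\<in>Iner. lv (a0 * b) \<gamma> = h (a0 * b) \<longrightarrow> (\<forall>Q\<in>F. Q \<gamma>)" by auto
      have "Q \<in> \<Q>" using insert.prems by simp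
      then consider "\<forall>\<gamma>\<in>Iner. Q \<gamma>" | a where "Q = Q4 a" "a \<in> A" "a \<noteq> 0"
        unfolding \<Q>_def Q1_def Q2_def Q3_def using field_autD(4,5)[OF InerD(1)] InerD(2) by auto
      then show ?case
      proof cases
        case 1
        then show ?thesis using b by (intro bexI[of _ b]) auto
      next
        case 2
        have ab: "b * a \<in> A" "b * a \<noteq> 0" "a0 * b \<in> A" "a0 * b \<noteq> 0" using b 2 a0 A_closed(4) by auto
        have "\<forall>Q\<in>insert Q F. Q \<gamma>" if \<gamma>: "\<gamma> \<in> Iner" "lv (a0 * (b * a)) \<gamma> = h (a0 * (b * a))" for \<gamma>
        proof -
          have "lv (a0 * b) \<gamma> = h (a0 * b)" by (rule lift[OF \<gamma>(1) ab(3,4) 2(2,3)]) (use \<gamma>(2) in \<open>simp add: mult.assoc\<close>)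
          moreover have "lv a \<gamma> = h a" by (rule lift[OF \<gamma>(1) 2(2,3) ab(3,4)]) (use \<gamma>(2) in \<open>simp add: mult_ac\<close>)
          ultimately show ?thesis using b(3) \<gamma>(1) 2(1) by (auto simp: Q4_def)
        qed
        then show ?thesis using ab by (intro bexI[of _ "b * a"]) auto
      qed
    qed
    then obtain b where b: "b \<in> A" "b \<noteq> 0" "\<forall>\<gamma>\<in>Iner. lv (a0 * b) \<gamma> = h (a0 * b) \<longrightarrow> (\<forall>Q\<in>F. Q \<gamma>)" by auto
    have ab: "a0 * b \<in> A" "a0 * b \<noteq> 0" using a0 b A_closed(4) by auto
    have "h (a0 * b) \<in> H (a0 * b)" by (rule ker[OF b(1,2) h[OF ab]]) (simp add: compat[OF a0 b(1,2)] h0)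
    then obtain \<gamma> where "\<gamma> \<in> Iner" "lv (a0 * b) \<gamma> = h (a0 * b)" unfolding H_def by auto
    then show "\<exists>\<sigma>. (\<forall>x. \<sigma> x \<in> C x) \<and> (\<forall>Q\<in>F. Q \<sigma>)" using b(3) IC by blast
  qed
  then obtain \<sigma> where \<sigma>: "\<forall>Q\<in>\<Q>. Q \<sigma>" by blast
  have mem: "Q1 x y \<in> \<Q>" "Q2 x y \<in> \<Q>" "x \<in> E \<Longrightarrow> Q3 x \<in> \<Q>" "a \<in> A - {0} \<Longrightarrow> Q4 a \<in> \<Q>" for x y a
    unfolding \<Q>_def by blast+
  have s1: "\<sigma> (x + y) = \<sigma> x + \<sigma> y" for x y using bspec[OF \<sigma> mem(1)[of x y]] by (simp add: Q1_def)
  have s2: "\<sigma> (x * y) = \<sigma> x * \<sigma> y" for x y using bspec[OF \<sigma> mem(2)[of x y]] by (simp add: Q2_def)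
  have s3: "\<sigma> x = x" if "x \<in> E" for x using bspec[OF \<sigma> mem(3)[OF that]] by (simp add: Q3_def)
  have s4: "lv a \<sigma> = h a" if "a \<in> A - {0}" for a using bspec[OF \<sigma> mem(4)[OF that]] by (simp add: Q4_def)
  have "\<sigma> \<in> Iner"
  proof (rule InerI)
    show "field_aut \<sigma>"
      by (rule algebraic_hom_aut[of E]) (use s1 s2 s3 subfldD(2)[OF subfld_E] algebraic_over_mono[OF alg K_sub_E] in auto)
  qed (rule s3)
  then show ?thesis using s4 by blast
qed

end

section \<open>The Kummer pairing as a module homomorphism\<close>

lemma quotientI: "x \<in> H \<Longrightarrow> x +o S \<in> quotient_set H S"
  unfolding quotient_set_def by simp

lemma coset_0: "0 +o S = (S :: 'a::ab_group_add set)"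
  by (auto simp: coset_mem)

context drinfeld
begin

abbreviation FA where "FA \<equiv> F_mod_A vinf"
abbreviation AM where "AM \<equiv> alg_mod_max v \<psi>"
abbreviation TM where "TM \<equiv> tate_module vinf v \<psi>"

lemma RA_simps: "carrier (ring_A vinf) = A" "\<zero>\<^bsub>ring_A vinf\<^esub> = 0"
  by (simp_all add: ring_A_def ring_of_type_algebra_def)

lemma FA_simps: "U \<oplus>\<^bsub>FA\<^esub> V = U + V" "c \<in> A \<Longrightarrow> c \<odot>\<^bsub>FA\<^esub> (f +o A) = c * f +o A"
proof -
  show "U \<oplus>\<^bsub>FA\<^esub> V = U + V" by (simp add: F_mod_A_def quotient_module_def)
  assume c: "c \<in> A"
  show "c \<odot>\<^bsub>FA\<^esub> (f +o A) = c * f +o A"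
    unfolding F_mod_A_def quotient_module_def module.select_convs
    by (rule coset_smult[OF A_sub]) (use c A_closed(4) in \<open>auto simp: right_diff_distrib\<close>)
qed

lemma AM_simps: "carrier AM = quotient_set UNIV mm" "x \<oplus>\<^bsub>AM\<^esub> y = x + y"
  "c \<in> A \<Longrightarrow> c \<odot>\<^bsub>AM\<^esub> (z +o mm) = act c z +o mm"
proof -
  show "carrier AM = quotient_set UNIV mm" "x \<oplus>\<^bsub>AM\<^esub> y = x + y"
    by (simp_all add: alg_mod_max_def quotient_module_def)
  assume c: "c \<in> A"
  show "c \<odot>\<^bsub>AM\<^esub> (z +o mm) = act c z +o mm"
    unfolding alg_mod_max_def quotient_module_def module.select_convs
    by (rule coset_smult[OF mm_sub]) (use act_less_1[OF c] in \<open>auto simp: act_arg mm_iff\<close>)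
qed

lemma tate_iff:
  "g \<in> carrier TM \<longleftrightarrow> g \<in> quotient_set UNIV A \<rightarrow>\<^sub>E quotient_set UNIV mm \<and>
     (\<forall>U\<in>quotient_set UNIV A. \<forall>V\<in>quotient_set UNIV A. g (U + V) = g U + g V) \<and>
     (\<forall>c\<in>A. \<forall>U\<in>quotient_set UNIV A. g (c \<odot>\<^bsub>FA\<^esub> U) = c \<odot>\<^bsub>AM\<^esub> g U)"
  by (simp add: tate_module_def hom_module_def module_homs_def F_carrier AM_simps(1,2) FA_simps(1) RA_simps)

lemma TM_simps: "f \<oplus>\<^bsub>TM\<^esub> g = (\<lambda>U\<in>quotient_set UNIV A. f U + g U)"
  "c \<odot>\<^bsub>TM\<^esub> f = (\<lambda>U\<in>quotient_set UNIV A. c \<odot>\<^bsub>AM\<^esub> f U)"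
  by (simp_all add: tate_module_def hom_module_def F_carrier AM_simps(2))

lemma tate_ext: "g \<in> carrier TM \<Longrightarrow> h \<in> carrier TM \<Longrightarrow> (\<And>U. U \<in> quotient_set UNIV A \<Longrightarrow> g U = h U) \<Longrightarrow> g = h"
  unfolding tate_iff by (auto intro: PiE_ext)

lemma tate_val:
  assumes "g \<in> carrier TM" "U \<in> quotient_set UNIV A" obtains y where "g U = y +o mm"
proof -
  have "g U \<in> quotient_set UNIV mm" using assms unfolding tate_iff by auto
  then show thesis using that unfolding quotient_set_def by auto
qed

lemma tate_zero:
  assumes g: "g \<in> carrier TM" shows "g A = mm"
proof -
  have AQ: "A \<in> quotient_set UNIV A" using quotientI[of 0 UNIV A] coset_0[of A] by simp
  obtain y where y: "g A = y +o mm" by (rule tate_val[OF g AQ])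
  have "A + A = A" using coset_plus[OF A_sub, of 0 0] by (simp add: coset_0)
  then have "y +o mm = (y +o mm) + (y +o mm)" using g AQ y unfolding tate_iff by metis
  then have "y +o mm = (y + y) +o mm" unfolding coset_plus[OF mm_sub] .
  then have "- y \<in> mm" unfolding coset_eq[OF mm_sub] by simp
  then have "y - 0 \<in> mm" using add_subgroupD(3)[OF mm_sub, of "- y"] by simp
  then have "y +o mm = 0 +o mm" unfolding coset_eq[OF mm_sub] .
  then show ?thesis unfolding y coset_0 .
qed

lemma tate_smult:
  assumes "g \<in> carrier TM" "c \<in> A" "g (f +o A) = y +o mm"
  shows "g (c * f +o A) = act c y +o mm"
proof -
  have "g (c \<odot>\<^bsub>FA\<^esub> (f +o A)) = c \<odot>\<^bsub>AM\<^esub> g (f +o A)"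
    using assms(1,2) quotientI[of f UNIV A] unfolding tate_iff by simp
  then show ?thesis unfolding FA_simps(2)[OF assms(2)] assms(3) AM_simps(3)[OF assms(2)] .
qed

text \<open>\<open>F / A\<close> is divisible: the value of \<open>g\<close> at the class of
  \<open>f\<close> is the value of the \<open>a\<close>-multiple of \<open>g\<close> at the class of
  \<open>f / a\<close>.\<close>

lemma tate_torsion_free:
  assumes gh: "g \<in> carrier TM" "h \<in> carrier TM" and a: "a \<in> A" "a \<noteq> 0" and eq: "a \<odot>\<^bsub>TM\<^esub> g = a \<odot>\<^bsub>TM\<^esub> h"
  shows "g = h"
proof (rule tate_ext[OF gh])
  fix U assume "U \<in> quotient_set UNIV A"
  then obtain f where f: "U = f +o A" unfolding quotient_set_def by auto
  have Q: "f / a +o A \<in> quotient_set UNIV A" by (simp add: quotientI)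
  obtain x where x: "g (f / a +o A) = x +o mm" by (rule tate_val[OF gh(1) Q])
  obtain y where y: "h (f / a +o A) = y +o mm" by (rule tate_val[OF gh(2) Q])
  have "(a \<odot>\<^bsub>TM\<^esub> g) (f / a +o A) = (a \<odot>\<^bsub>TM\<^esub> h) (f / a +o A)" using eq by simp
  then have "act a x +o mm = act a y +o mm" using Q unfolding TM_simps by (simp add: x y AM_simps(3)[OF a(1)])
  then show "g U = h U" using tate_smult[OF gh(1) a(1) x] tate_smult[OF gh(2) a(1) y] a(2) f by simp
qed

lemma F_rep2:
  assumes "U \<in> quotient_set UNIV A" "V \<in> quotient_set UNIV A"
  obtains a b c where "a \<in> A" "a \<noteq> 0" "b \<in> A" "c \<in> A" "U = b / a +o A" "V = c / a +o A"
proof -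
  obtain a b where 1: "a \<in> A" "a \<noteq> 0" "b \<in> A" "U = b / a +o A" by (rule F_rep[OF assms(1)])
  obtain a' b' where 2: "a' \<in> A" "a' \<noteq> 0" "b' \<in> A" "V = b' / a' +o A" by (rule F_rep[OF assms(2)])
  show thesis
    by (rule that[of "a * a'" "b * a'" "b' * a"]) (use 1 2 A_closed(4) in auto)
qed

lemma kummer_tate:
  assumes \<sigma>: "\<sigma> \<in> Iner" and \<xi>: "\<xi> \<in> perf" shows "kummer vinf v \<psi> \<xi> \<sigma> \<in> carrier TM"
  unfolding tate_iff
proof (intro conjI ballI)
  show "kummer vinf v \<psi> \<xi> \<sigma> \<in> quotient_set UNIV A \<rightarrow>\<^sub>E quotient_set UNIV mm"
  proof (rule PiE_I)
    fix U assume "U \<in> quotient_set UNIV A"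
    then obtain a b where ab: "a \<in> A" "a \<noteq> 0" "b \<in> A" "U = b / a +o A" by (rule F_rep)
    obtain x where x: "act a x = \<xi>" by (rule act_surj[OF ab(1,2)])
    show "kummer vinf v \<psi> \<xi> \<sigma> U \<in> quotient_set UNIV mm"
      unfolding ab(4) kummer_eq[OF \<sigma> ab(1-3) x \<xi>] by (simp add: quotientI)
  qed (simp add: kummer_ext)
next
  fix U V assume "U \<in> quotient_set UNIV A" "V \<in> quotient_set UNIV A"
  then obtain a b c where ab: "a \<in> A" "a \<noteq> 0" "b \<in> A" "c \<in> A" "U = b / a +o A" "V = c / a +o A" by (rule F_rep2)
  obtain x where x: "act a x = \<xi>" by (rule act_surj[OF ab(1,2)])
  have "U + V = (b + c) / a +o A" unfolding ab(5,6) coset_plus[OF A_sub] by (simp add: add_divide_distrib)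
  then show "kummer vinf v \<psi> \<xi> \<sigma> (U + V) = kummer vinf v \<psi> \<xi> \<sigma> U + kummer vinf v \<psi> \<xi> \<sigma> V"
    using kummer_eq[OF \<sigma> ab(1,2) A_closed(3)[OF ab(3,4)] x \<xi>] kummer_eq[OF \<sigma> ab(1,2,3) x \<xi>]
      kummer_eq[OF \<sigma> ab(1,2,4) x \<xi>] by (simp add: ab(5,6) coset_plus[OF mm_sub] act_add[OF ab(3,4)])
next
  fix c U assume c: "c \<in> A" and "U \<in> quotient_set UNIV A"
  then obtain a b where ab: "a \<in> A" "a \<noteq> 0" "b \<in> A" "U = b / a +o A" using F_rep by blast
  obtain x where x: "act a x = \<xi>" by (rule act_surj[OF ab(1,2)])
  show "kummer vinf v \<psi> \<xi> \<sigma> (c \<odot>\<^bsub>FA\<^esub> U) = c \<odot>\<^bsub>AM\<^esub> kummer vinf v \<psi> \<xi> \<sigma> U"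
    using kummer_eq[OF \<sigma> ab(1,2) A_closed(4)[OF c ab(3)] x \<xi>] kummer_eq[OF \<sigma> ab(1-3) x \<xi>]
    by (simp add: ab(4) FA_simps(2)[OF c] AM_simps(3)[OF c] act_mult[OF c ab(3)])
qed

lemma kummer_add:
  assumes \<sigma>: "\<sigma> \<in> Iner" and \<xi>: "\<xi> \<in> perf" "\<eta> \<in> perf"
  shows "kummer vinf v \<psi> (\<xi> + \<eta>) \<sigma> = kummer vinf v \<psi> \<xi> \<sigma> \<oplus>\<^bsub>TM\<^esub> kummer vinf v \<psi> \<eta> \<sigma>"
proof
  fix U
  show "kummer vinf v \<psi> (\<xi> + \<eta>) \<sigma> U = (kummer vinf v \<psi> \<xi> \<sigma> \<oplus>\<^bsub>TM\<^esub> kummer vinf v \<psi> \<eta> \<sigma>) U"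
  proof (cases "U \<in> quotient_set UNIV A")
    case True
    obtain a b where ab: "a \<in> A" "a \<noteq> 0" "b \<in> A" "U = b / a +o A" by (rule F_rep[OF True])
    obtain x where x: "act a x = \<xi>" by (rule act_surj[OF ab(1,2)])
    obtain y where y: "act a y = \<eta>" by (rule act_surj[OF ab(1,2)])
    have xy: "act a (x + y) = \<xi> + \<eta>" using x y by (simp add: act_arg)
    have "act b (dl \<sigma> (x + y)) = act b (dl \<sigma> x) + act b (dl \<sigma> y)" unfolding dl_add[OF \<sigma>] act_arg(1) ..
    then show ?thesis using True kummer_eq[OF \<sigma> ab(1-3) xy subfldD(3)[OF perf_subfld \<xi>]]
        kummer_eq[OF \<sigma> ab(1-3) x \<xi>(1)] kummer_eq[OF \<sigma> ab(1-3) y \<xi>(2)]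
      unfolding TM_simps ab(4) by (simp only: restrict_apply' coset_plus[OF mm_sub])
  qed (simp add: kummer_ext TM_simps)
qed

lemma kummer_act:
  assumes \<sigma>: "\<sigma> \<in> Iner" and \<xi>: "\<xi> \<in> perf" and c: "c \<in> A"
  shows "kummer vinf v \<psi> (act c \<xi>) \<sigma> = c \<odot>\<^bsub>TM\<^esub> kummer vinf v \<psi> \<xi> \<sigma>"
proof
  fix U
  show "kummer vinf v \<psi> (act c \<xi>) \<sigma> U = (c \<odot>\<^bsub>TM\<^esub> kummer vinf v \<psi> \<xi> \<sigma>) U"
  proof (cases "U \<in> quotient_set UNIV A")
    case True
    obtain a b where ab: "a \<in> A" "a \<noteq> 0" "b \<in> A" "U = b / a +o A" by (rule F_rep[OF True])
    obtain x where x: "act a x = \<xi>" by (rule act_surj[OF ab(1,2)])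
    have cx: "act a (act c x) = act c \<xi>"
      using act_mult[OF ab(1) c, of x] act_mult[OF c ab(1), of x] x by (simp add: mult.commute)
    have "act b (dl \<sigma> (act c x)) = act c (act b (dl \<sigma> x))"
      unfolding dl_act[OF \<sigma>] act_mult[OF ab(3) c, symmetric] act_mult[OF c ab(3), symmetric] mult.commute[of b] ..
    then show ?thesis using True kummer_eq[OF \<sigma> ab(1-3) cx perf_act[OF \<xi>]] kummer_eq[OF \<sigma> ab(1-3) x \<xi>]
      unfolding TM_simps ab(4) by (simp only: restrict_apply' AM_simps(3)[OF c])
  qed (simp add: kummer_ext TM_simps)
qed

end

context kummer_family
begin

text \<open>The summands with \<open>c i \<noteq> 0\<close> have absolute values that are p-power
  exponents of those of the \<open>\<xi> i\<close>, hence pairwise distinct and above 1; the largest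
  one dominates.\<close>

lemma family_independent:
  assumes c: "\<And>i. i < r \<Longrightarrow> c i \<in> A" and le: "absv v (\<Sum>i<r. act (c i) (\<xi> i)) \<le> 1"
  shows "\<forall>i<r. c i = 0"
proof (rule ccontr)
  assume "\<not> ?thesis"
  define I where "I = {i. i < r \<and> c i \<noteq> 0}"
  have I: "finite I" "I \<noteq> {}" unfolding I_def using \<open>\<not> _\<close> by auto
  define f where "f = (\<lambda>i. absv v (act (c i) (\<xi> i)))"
  have f: "f i = absv v (\<xi> i) ^ (CHAR('k) ^ dg (c i))" if "i \<in> I" for i
    unfolding f_def using that c \<xi>_gt_1 by (intro act_nrm) (auto simp: I_def)
  have "Max (f ` I) \<in> f ` I" using I by (intro Max_in) auto
  then obtain k where k: "k \<in> I" "f k = Max (f ` I)" by auto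
  have lt: "f i < f k" if i: "i \<in> I" "i \<noteq> k" for i
  proof -
    have "f i \<le> f k" unfolding k(2) using I i by (intro Max_ge) auto
    moreover have "f i \<noteq> f k" using \<xi>_dist[of i k] i k(1) unfolding f[OF i(1)] f[OF k(1)] by (auto simp: I_def)
    ultimately show ?thesis by simp
  qed
  have "1 < f k" unfolding f[OF k(1)]
    using \<xi>_gt_1[of k] k(1) p_gt_1 by (intro one_less_power) (auto simp: I_def)
  have "(\<Sum>i<r. act (c i) (\<xi> i)) = (\<Sum>i\<in>I. act (c i) (\<xi> i))"
    by (rule sum.mono_neutral_right) (auto simp: I_def)
  moreover have "act (c k) (\<xi> k) \<noteq> 0" using \<open>1 < f k\<close> unfolding f_def by auto
  then have "absv v (\<Sum>i\<in>I. act (c i) (\<xi> i)) = f k"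
    unfolding f_def using I(1) k(1) lt by (intro nrm_sum_dominant) (auto simp: f_def)
  ultimately show False using le \<open>1 < f k\<close> by simp
qed

text \<open>The values of \<open>f i\<close> at the classes of \<open>1 / a\<close> are residues of
  torsion points and form a compatible system \<open>k\<close>. Subtracting the system of
  \<open>\<gamma>0\<close> makes it vanish at \<open>a0\<close>, as \<open>Iner_realize\<close>
  demands.\<close>

lemma realize_family:
  assumes a0: "a0 \<in> A" "a0 \<noteq> 0"
    and ker: "\<And>b z. b \<in> A \<Longrightarrow> b \<noteq> 0 \<Longrightarrow> z \<in> Xr (a0 * b) \<Longrightarrow> tr b z = 0 \<Longrightarrow> z \<in> H (a0 * b)"
    and \<gamma>0: "\<gamma>0 \<in> Iner" and f: "\<And>i. i < r \<Longrightarrow> f i \<in> carrier TM"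
    and eq: "\<And>i. i < r \<Longrightarrow> f i (1 / a0 +o A) = kummer vinf v \<psi> (\<xi> i) \<gamma>0 (1 / a0 +o A)"
  shows "\<exists>\<gamma>\<in>Iner. \<forall>i<r. kummer vinf v \<psi> (\<xi> i) \<gamma> = f i"
proof -
  have "\<exists>w\<in>Xs a. f i (1 / a +o A) = w +o mm" if a: "a \<in> A" "a \<noteq> 0" and i: "i < r" for a i
  proof -
    obtain y where y: "f i (1 / a +o A) = y +o mm" by (rule tate_val[OF f[OF i] quotientI]) simp
    have "1 +o A = 0 +o A" unfolding coset_eq[OF A_sub] using A_closed(2) by simp
    then have "act a y +o mm = 0 +o mm"
      using tate_smult[OF f[OF i] a(1) y] a(2) tate_zero[OF f[OF i]] by (simp add: coset_0)
    then have ay: "absv v (act a y) < 1" unfolding coset_eq[OF mm_sub] mm_iff by simp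
    then have y1: "absv v y \<le> 1" using act_le_1_iff[OF a, of y] by simp
    have "absv v (act a y - act a (y - res y)) < 1" by (rule nrm_less_1_diff[OF ay act_less_1[OF a(1) res(2)[OF y1]]])
    then have "res y \<in> Xs a" unfolding Xs_def using res(1)[OF y1] by (simp add: act_arg)
    moreover have "y +o mm = res y +o mm" unfolding coset_eq[OF mm_sub] mm_iff by (rule res(2)[OF y1])
    ultimately show ?thesis using y by auto
  qed
  then obtain h' where h': "\<And>a i. a \<in> A \<Longrightarrow> a \<noteq> 0 \<Longrightarrow> i < r \<Longrightarrow> h' a i \<in> Xs a \<and> f i (1 / a +o A) = h' a i +o mm"
    by metis
  define k where "k = (\<lambda>a i. if i < r then h' a i else 0)"
  have kXr: "k a \<in> Xr a" if "a \<in> A" "a \<noteq> 0" for a unfolding Xr_def k_def using h'[OF that] by simp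
  have k_eq: "f i (1 / a +o A) = k a i +o mm" if "a \<in> A" "a \<noteq> 0" "i < r" for a i
    unfolding k_def using h'[OF that] that(3) by simp
  have kkb: "k a i \<in> kb" if "a \<in> A" "a \<noteq> 0" "i < r" for a i
    unfolding k_def using h'[OF that] that(3) by (simp add: Xs_def)
  have k_tr: "tr b (k (a * b)) = k a" if ab: "a \<in> A" "a \<noteq> 0" "b \<in> A" "b \<noteq> 0" for a b
  proof
    fix i
    have ab': "a * b \<in> A" "a * b \<noteq> 0" using ab A_closed(4) by auto
    show "tr b (k (a * b)) i = k a i"
    proof (cases "i < r")
      case i: True
      have "f i (b * (1 / (a * b)) +o A) = act b (k (a * b) i) +o mm"
        by (rule tate_smult[OF f[OF i] ab(3) k_eq[OF ab' i]])
      moreover have "b * (1 / (a * b)) = 1 / a" using ab(4) by simp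
      ultimately have "act b (k (a * b) i) +o mm = k a i +o mm" using k_eq[OF ab(1,2) i] by simp
      then have "res (act b (k (a * b) i)) = k a i"
        unfolding coset_eq[OF mm_sub] mm_iff by (rule res_unique[OF kkb[OF ab(1,2) i]])
      then show ?thesis using i by (simp add: tr_def)
    qed (simp add: tr_def k_def)
  qed
  have k0: "k a0 - lv a0 \<gamma>0 = 0"
  proof
    fix i
    show "(k a0 - lv a0 \<gamma>0) i = 0 i"
    proof (cases "i < r")
      case i: True
      have "k a0 i +o mm = dl \<gamma>0 (rt a0 i) +o mm"
        using k_eq[OF a0 i] eq[OF i] kummer_eq[OF \<gamma>0 a0 A_closed(2) rt[OF a0] \<xi>_perf[OF i]] by simp
      then have "dl \<gamma>0 (rt a0 i) - k a0 i \<in> mm" using coset_eq[OF mm_sub] by metis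
      then have "res (dl \<gamma>0 (rt a0 i)) = k a0 i" unfolding mm_iff by (rule res_unique[OF kkb[OF a0 i]])
      then show ?thesis using i by (simp add: lv_def)
    qed (simp add: lv_def k_def)
  qed
  have "\<exists>\<gamma>\<in>Iner. \<forall>a\<in>A - {0}. lv a \<gamma> = k a - lv a \<gamma>0"
  proof (rule Iner_realize[OF a0 ker])
    show "k a - lv a \<gamma>0 \<in> Xr a" if "a \<in> A" "a \<noteq> 0" for a
      by (intro Xr_diff kXr lv_Xr that \<gamma>0)
    show "tr b (k (a * b) - lv (a * b) \<gamma>0) = k a - lv a \<gamma>0" if ab: "a \<in> A" "a \<noteq> 0" "b \<in> A" "b \<noteq> 0" for a b
    proof -
      have ab': "a * b \<in> A" "a * b \<noteq> 0" using ab A_closed(4) by auto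
      show ?thesis unfolding tr_add(2)[OF kXr[OF ab'] lv_Xr[OF \<gamma>0 ab'] ab(3)] k_tr[OF ab] tr_lv[OF \<gamma>0 ab] ..
    qed
  qed (use k0 in auto)
  then obtain \<gamma>1 where \<gamma>1: "\<gamma>1 \<in> Iner" "\<forall>a\<in>A - {0}. lv a \<gamma>1 = k a - lv a \<gamma>0" by blast
  \<comment> \<open>\<open>lv\<close> is additive, so the correction \<open>\<gamma>1\<close>
    restores the prescribed system at every level.\<close>
  let ?\<gamma> = "\<gamma>0 \<circ> \<gamma>1"
  have \<gamma>: "?\<gamma> \<in> Iner" by (rule Iner_comp[OF \<gamma>0 \<gamma>1(1)])
  have "kummer vinf v \<psi> (\<xi> i) ?\<gamma> = f i" if i: "i < r" for i
  proof (rule tate_ext[OF kummer_tate[OF \<gamma> \<xi>_perf[OF i]] f[OF i]])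
    fix U assume "U \<in> quotient_set UNIV A"
    then obtain a b where ab: "a \<in> A" "a \<noteq> 0" "b \<in> A" "U = b / a +o A" by (rule F_rep)
    have "lv a ?\<gamma> = k a" using lv_comp[OF \<gamma>0 \<gamma>1(1) ab(1,2)] \<gamma>1(2) ab by simp
    then have "lv a ?\<gamma> i = k a i" by (rule fun_cong)
    then have rk: "res (dl ?\<gamma> (rt a i)) = k a i" unfolding lv_def using i by (simp only: if_True)
    have "absv v (res (dl ?\<gamma> (rt a i)) - dl ?\<gamma> (rt a i)) < 1"
      unfolding nrm_diff_commute[of "res (dl ?\<gamma> (rt a i))"] by (rule res(2)[OF rt_le_1[OF \<gamma> ab(1,2) i]])
    then have "k a i +o mm = dl ?\<gamma> (rt a i) +o mm" unfolding coset_eq[OF mm_sub] mm_iff rk .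
    then have "f i (1 / a +o A) = dl ?\<gamma> (rt a i) +o mm" using k_eq[OF ab(1,2) i] by simp
    from tate_smult[OF f[OF i] ab(3) this]
    have "f i U = act b (dl ?\<gamma> (rt a i)) +o mm" unfolding ab(4) by simp
    then show "kummer vinf v \<psi> (\<xi> i) ?\<gamma> U = f i U"
      unfolding ab(4) using kummer_eq[OF \<gamma> ab(1-3) rt[OF ab(1,2)] \<xi>_perf[OF i]] by simp
  qed
  then show ?thesis using \<gamma> by blast
qed

end

section \<open>Rank and linear independence\<close>

context drinfeld
begin

lemma A_sum: "(\<And>s. s \<in> S \<Longrightarrow> f s \<in> A) \<Longrightarrow> (\<Sum>s\<in>S. f s) \<in> A"
  by (induction S rule: infinite_finite_induct) (auto intro: A_closed)

lemma act_sum: "(\<And>s. s \<in> S \<Longrightarrow> f s \<in> A) \<Longrightarrow> act (\<Sum>s\<in>S. f s) x = (\<Sum>s\<in>S. act (f s) x)"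
  by (induction S rule: infinite_finite_induct) (auto simp: act_add A_sum)

lemma act_sum_arg: "act a (\<Sum>s\<in>S. x s) = (\<Sum>s\<in>S. act a (x s))"
  by (induction S rule: infinite_finite_induct) (auto simp: act_arg)

lemma common_denominator:
  assumes "finite S" shows "\<exists>e\<in>A - {0}. \<forall>s\<in>S. e * d s \<in> A"
  using assms
proof (induction S rule: finite_induct)
  case empty
  show ?case using A_closed(2) by (intro bexI[of _ 1]) auto
next
  case (insert s S)
  then obtain e where e: "e \<in> A" "e \<noteq> 0" "\<forall>s\<in>S. e * d s \<in> A" by auto
  obtain a where a: "a \<in> A" "a \<noteq> 0" "a * d s \<in> A" using frac[of "d s"] by auto
  have "(a * e) * d s' \<in> A" if "s' \<in> insert s S" for s'
  proof (cases "s' = s")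
    case True
    then show ?thesis using A_closed(4)[OF e(1) a(3)] by (simp add: mult_ac)
  next
    case False
    then show ?thesis using A_closed(4)[OF a(1), of "e * d s'"] e(3) that by (simp add: mult_ac)
  qed
  then show ?case using A_closed(4)[OF a(1) e(1)] a(2) e(2) by (intro bexI[of _ "a * e"]) auto
qed

definition rp :: "'k alg_closure set \<Rightarrow> 'k alg_closure" where
  "rp m = (SOME x. x \<in> m)"

lemma rp:
  assumes "m \<in> quotient_set perf Operf"
  shows "rp m \<in> m" "rp m \<in> perf" "m = rp m +o Operf"
proof -
  obtain x where x: "x \<in> perf" "m = x +o Operf" "x \<in> m" by (rule coset_rep[OF Operf_sub assms])
  show mem: "rp m \<in> m" unfolding rp_def using x(3) by (rule someI)
  then have "rp m - x \<in> perf" unfolding x(2) coset_mem Operf_iff by simp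
  then show "rp m \<in> perf" using subfldD(3)[OF perf_subfld _ x(1)] by fastforce
  show "m = rp m +o Operf" by (rule coset_of_mem[OF Operf_sub assms mem])
qed

lemma act_Operf: "c \<in> A \<Longrightarrow> z \<in> Operf \<Longrightarrow> act c z \<in> Operf"
  unfolding Operf_iff using perf_act act_le_1 by simp

lemma P_smult: "c \<in> A \<Longrightarrow> (\<Union>y\<in>x +o Operf. act c y +o Operf) = act c x +o Operf"
  by (rule coset_smult[OF Operf_sub]) (auto simp: act_arg act_Operf)

end

locale kummer_module = drinfeld v vinf \<psi>
  for v :: "'k::field alg_closure \<Rightarrow> ereal" and vinf :: "'f::field \<Rightarrow> ereal" and \<psi> :: "'f \<Rightarrow> 'k poly" +
  fixes M :: "'k alg_closure set set"
  assumes submod: "submodule M (ring_A vinf) (P_module v \<psi>)"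
begin

abbreviation PM where "PM \<equiv> P_module v \<psi> \<lparr>carrier := M\<rparr>"

lemma PM_simps: "carrier PM = M" "U \<oplus>\<^bsub>PM\<^esub> V = U + V" "\<zero>\<^bsub>PM\<^esub> = Operf"
  "c \<odot>\<^bsub>PM\<^esub> U = (\<Union>y\<in>U. act c y +o Operf)"
  by (simp_all add: P_module_def quotient_module_def)

lemma M_closed:
  shows "M \<subseteq> quotient_set perf Operf" "Operf \<in> M" "U \<in> M \<Longrightarrow> V \<in> M \<Longrightarrow> U + V \<in> M"
    "c \<in> A \<Longrightarrow> U \<in> M \<Longrightarrow> (\<Union>y\<in>U. act c y +o Operf) \<in> M"
proof -
  have sg: "subgroup M (add_monoid (P_module v \<psi>))" using submod unfolding submodule_def by simp
  show "M \<subseteq> quotient_set perf Operf" using subgroup.subset[OF sg] by (simp add: P_module_def quotient_module_def)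
  show "Operf \<in> M" using subgroup.one_closed[OF sg] by (simp add: P_module_def quotient_module_def)
  show "U + V \<in> M" if "U \<in> M" "V \<in> M"
    using subgroup.m_closed[OF sg that] by (simp add: P_module_def quotient_module_def)
  show "(\<Union>y\<in>U. act c y +o Operf) \<in> M" if "c \<in> A" "U \<in> M"
    using submodule.smult_closed[OF submod, of c U] that unfolding RA_simps
    by (simp add: P_module_def quotient_module_def)
qed

lemma rpM: "m \<in> M \<Longrightarrow> rp m \<in> m" "m \<in> M \<Longrightarrow> rp m \<in> perf" "m \<in> M \<Longrightarrow> m = rp m +o Operf"
  using rp M_closed(1) by auto

lemma smult_rp: "c \<in> A \<Longrightarrow> m \<in> M \<Longrightarrow> c \<odot>\<^bsub>PM\<^esub> m = act c (rp m) +o Operf"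
  unfolding PM_simps by (subst rpM(3)) (auto simp only: P_smult)

lemma smult_closed: "c \<in> A \<Longrightarrow> m \<in> M \<Longrightarrow> c \<odot>\<^bsub>PM\<^esub> m \<in> M"
  unfolding PM_simps by (rule M_closed(4))

lemma PM_abelian: "abelian_monoid PM"
proof (rule abelian_monoidI, unfold PM_simps)
  show "Operf + x = x" if "x \<in> M" for x
    using coset_plus[OF Operf_sub, of 0 "rp x"] rpM(3)[OF that] by (simp add: coset_0)
qed (auto simp: M_closed add_ac)

lemma finsum_PM:
  assumes "finite S" "S \<subseteq> M" "\<And>s. s \<in> S \<Longrightarrow> c s \<in> A"
  shows "finsum PM (\<lambda>s. c s \<odot>\<^bsub>PM\<^esub> s) S = (\<Sum>s\<in>S. act (c s) (rp s)) +o Operf"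
  using assms
proof (induction S rule: finite_induct)
  case empty
  then show ?case using abelian_monoid.finsum_empty[OF PM_abelian] by (simp only: PM_simps sum.empty coset_0)
next
  case (insert s S)
  have "finsum PM (\<lambda>s. c s \<odot>\<^bsub>PM\<^esub> s) (insert s S) = c s \<odot>\<^bsub>PM\<^esub> s \<oplus>\<^bsub>PM\<^esub> finsum PM (\<lambda>s. c s \<odot>\<^bsub>PM\<^esub> s) S"
    by (rule abelian_monoid.finsum_insert[OF PM_abelian insert.hyps])
      (use insert.prems smult_closed in \<open>auto simp: PM_simps(1)\<close>)
  also have "\<dots> = (act (c s) (rp s) +o Operf) + ((\<Sum>s\<in>S. act (c s) (rp s)) +o Operf)"
  proof -
    have 1: "c s \<odot>\<^bsub>PM\<^esub> s = act (c s) (rp s) +o Operf" by (rule smult_rp) (use insert.prems in auto)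
    have 2: "finsum PM (\<lambda>s. c s \<odot>\<^bsub>PM\<^esub> s) S = (\<Sum>s\<in>S. act (c s) (rp s)) +o Operf"
      by (rule insert.IH) (use insert.prems in auto)
    show ?thesis by (simp only: 1 2 PM_simps(2))
  qed
  finally show ?case unfolding coset_plus[OF Operf_sub] using insert.hyps by simp
qed

lemma lin_indep_iff:
  "lin_indep (ring_A vinf) PM S \<longleftrightarrow> finite S \<and> S \<subseteq> M \<and>
     (\<forall>c. (\<forall>s\<in>S. c s \<in> A) \<longrightarrow> absv v (\<Sum>s\<in>S. act (c s) (rp s)) \<le> 1 \<longrightarrow> (\<forall>s\<in>S. c s = 0))"
proof -
  have "finsum PM (\<lambda>s. c s \<odot>\<^bsub>PM\<^esub> s) S = Operf \<longleftrightarrow> absv v (\<Sum>s\<in>S. act (c s) (rp s)) \<le> 1"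
    if S: "finite S" "S \<subseteq> M" and c: "\<forall>s\<in>S. c s \<in> A" for c
  proof -
    have "(\<Sum>s\<in>S. act (c s) (rp s)) \<in> perf"
      by (intro subfld_sum[OF perf_subfld] perf_act rpM(2)) (use S in auto)
    then have "(\<Sum>s\<in>S. act (c s) (rp s)) +o Operf = 0 +o Operf \<longleftrightarrow> absv v (\<Sum>s\<in>S. act (c s) (rp s)) \<le> 1"
      unfolding coset_eq[OF Operf_sub] Operf_iff by simp
    then show ?thesis using finsum_PM[OF S, of c] c by (simp add: coset_0)
  qed
  then show ?thesis unfolding lin_indep_def PM_simps(1,3) RA_simps by (auto simp: Pi_iff)
qed

lemma lin_indepD:
  assumes "lin_indep (ring_A vinf) PM S" "\<forall>s\<in>S. c s \<in> A" "absv v (\<Sum>s\<in>S. act (c s) (rp s)) \<le> 1"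
  shows "\<forall>s\<in>S. c s = 0"
  using assms(1) unfolding lin_indep_iff by (elim conjE allE[of _ c] impE) (use assms(2,3) in simp_all)

text \<open>Boundedness makes the \<open>GREATEST\<close> in \<open>mod_rank\<close> meaningful.
  More elements than generators satisfy a linear relation over \<open>F\<close>, whose denominators
  are cleared by \<open>common_denominator\<close>.\<close>

lemma independent_card_bounded:
  assumes "fin_gen (ring_A vinf) PM"
  shows "\<exists>B. \<forall>S. lin_indep (ring_A vinf) PM S \<longrightarrow> card S \<le> B"
proof -
  obtain G where G: "finite G" "G \<subseteq> M"
    "M = {finsum PM (\<lambda>s. c s \<odot>\<^bsub>PM\<^esub> s) G | c. c \<in> G \<rightarrow> A}"
    using assms unfolding fin_gen_def PM_simps(1) RA_simps by blast
  have "card S \<le> card G" if S: "lin_indep (ring_A vinf) PM S" for S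
  proof (rule ccontr)
    assume lt: "\<not> card S \<le> card G"
    have fS: "finite S" "S \<subseteq> M" using S unfolding lin_indep_iff by auto
    have "\<forall>s\<in>S. \<exists>c. (\<forall>g\<in>G. c g \<in> A) \<and> absv v (rp s - (\<Sum>g\<in>G. act (c g) (rp g))) \<le> 1"
    proof
      fix s assume s: "s \<in> S"
      then have "s \<in> {finsum PM (\<lambda>s. c s \<odot>\<^bsub>PM\<^esub> s) G | c. c \<in> G \<rightarrow> A}" using fS(2) G(3) by blast
      then obtain c where c: "s = finsum PM (\<lambda>s. c s \<odot>\<^bsub>PM\<^esub> s) G" "c \<in> G \<rightarrow> A" by auto
      have cA: "c g \<in> A" if "g \<in> G" for g using c(2) that by auto
      have "rp s +o Operf = (\<Sum>g\<in>G. act (c g) (rp g)) +o Operf"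
        using finsum_PM[OF G(1,2), of c] cA c(1) rpM(3)[of s] s fS(2) by auto
      then show "\<exists>c. (\<forall>g\<in>G. c g \<in> A) \<and> absv v (rp s - (\<Sum>g\<in>G. act (c g) (rp g))) \<le> 1"
        unfolding coset_eq[OF Operf_sub] Operf_iff using cA by blast
    qed
    then obtain c where "\<forall>s\<in>S. (\<forall>g\<in>G. c s g \<in> A) \<and> absv v (rp s - (\<Sum>g\<in>G. act (c s g) (rp g))) \<le> 1"
      by (rule bchoice[THEN exE])
    then have c: "\<And>s g. s \<in> S \<Longrightarrow> g \<in> G \<Longrightarrow> c s g \<in> A"
      "\<And>s. s \<in> S \<Longrightarrow> absv v (rp s - (\<Sum>g\<in>G. act (c s g) (rp g))) \<le> 1" by auto
    have "\<exists>d. (\<forall>s\<in>S. d s \<in> (UNIV :: 'f set)) \<and> (\<exists>s\<in>S. d s \<noteq> 0) \<and> (\<forall>g\<in>G. (\<Sum>s\<in>S. c s g * d s) = 0)"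
      by (rule homogeneous_system[OF G(1) _ fS(1)]) (use lt in \<open>auto simp: subfld_def\<close>)
    then obtain d where d: "\<exists>s\<in>S. d s \<noteq> 0" "\<forall>g\<in>G. (\<Sum>s\<in>S. c s g * d s) = 0" by blast
    obtain e where e: "e \<in> A" "e \<noteq> 0" "\<forall>s\<in>S. e * d s \<in> A" using common_denominator[OF fS(1), of d] by auto
    let ?d = "\<lambda>s. e * d s"
    have mem: "?d s * c s g \<in> A" if "g \<in> G" "s \<in> S" for s g
      by (rule A_closed(4)[OF bspec[OF e(3) that(2)] c(1)[OF that(2,1)]])
    have "(\<Sum>s\<in>S. act (?d s) (\<Sum>g\<in>G. act (c s g) (rp g))) = (\<Sum>s\<in>S. \<Sum>g\<in>G. act (?d s * c s g) (rp g))"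
      unfolding act_sum_arg by (intro sum.cong refl) (use e(3) c(1) in \<open>simp add: act_mult\<close>)
    also have "\<dots> = (\<Sum>g\<in>G. \<Sum>s\<in>S. act (?d s * c s g) (rp g))" by (rule sum.swap)
    also have "\<dots> = (\<Sum>g\<in>G. act (\<Sum>s\<in>S. ?d s * c s g) (rp g))"
      by (intro sum.cong refl act_sum[symmetric] mem)
    also have "\<dots> = 0"
    proof (intro sum.neutral ballI)
      fix g assume "g \<in> G"
      have "(\<Sum>s\<in>S. ?d s * c s g) = e * (\<Sum>s\<in>S. c s g * d s)" by (simp add: sum_distrib_left mult_ac)
      then show "act (\<Sum>s\<in>S. ?d s * c s g) (rp g) = 0" using d(2) \<open>g \<in> G\<close> by simp
    qed
    finally have z: "(\<Sum>s\<in>S. act (?d s) (\<Sum>g\<in>G. act (c s g) (rp g))) = 0" .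
    have "absv v (\<Sum>s\<in>S. act (?d s) (rp s - (\<Sum>g\<in>G. act (c s g) (rp g)))) \<le> 1"
      by (intro nrm_sum_le act_le_1) (use e(3) c(2) in auto)
    then have "absv v (\<Sum>s\<in>S. act (?d s) (rp s)) \<le> 1" unfolding act_arg(2) sum_subtractf z by simp
    with S e(3) have "\<forall>s\<in>S. ?d s = 0" by (rule lin_indepD)
    then show False using d(1) e(2) by auto
  qed
  then show ?thesis by blast
qed

text \<open>Adding \<open>m\<close> to an independent set of maximal size creates a relation, and
  the coefficient of \<open>m\<close> is non-zero because \<open>S\<close> is independent. An
  \<open>m\<close> already in \<open>S\<close> is treated apart, since inserting it does not enlarge
  the set.\<close>

lemma maximal_independent_relation:
  assumes fg: "fin_gen (ring_A vinf) PM" and S: "lin_indep (ring_A vinf) PM S"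
    and card: "card S = mod_rank (ring_A vinf) PM" and m: "m \<in> M"
  shows "\<exists>a\<in>A - {0}. \<exists>c. (\<forall>s\<in>S. c s \<in> A) \<and> absv v (act a (rp m) - (\<Sum>s\<in>S. act (c s) (rp s))) \<le> 1"
proof -
  have fS: "finite S" "S \<subseteq> M" using S unfolding lin_indep_iff by auto
  show ?thesis
  proof (cases "m \<in> S")
    case True
    have "(\<Sum>s\<in>S. act (if s = m then 1 else 0) (rp s)) = (\<Sum>s\<in>S. if s = m then rp s else 0)"
      by (intro sum.cong refl) simp
    also have "\<dots> = rp m" using fS(1) True by simp
    finally show ?thesis using A_closed(1,2)
      by (intro bexI[of _ 1] exI[of _ "\<lambda>s. if s = m then 1 else 0"]) auto
  next
    case False
    obtain B where B: "\<And>S. lin_indep (ring_A vinf) PM S \<Longrightarrow> card S \<le> B"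
      using independent_card_bounded[OF fg] by blast
    have "\<not> lin_indep (ring_A vinf) PM (insert m S)"
    proof
      assume "lin_indep (ring_A vinf) PM (insert m S)"
      then have "card (insert m S) \<le> mod_rank (ring_A vinf) PM" unfolding mod_rank_def
        using B by (intro Greatest_le_nat[of _ _ B]) auto
      then show False using card False fS(1) by simp
    qed
    then obtain c where c: "\<forall>s\<in>insert m S. c s \<in> A" "absv v (\<Sum>s\<in>insert m S. act (c s) (rp s)) \<le> 1"
      "\<not> (\<forall>s\<in>insert m S. c s = 0)" unfolding lin_indep_iff using fS m by auto
    have e: "(\<Sum>s\<in>insert m S. act (c s) (rp s)) = act (c m) (rp m) + (\<Sum>s\<in>S. act (c s) (rp s))"
      using fS(1) False by simp
    have "c m \<noteq> 0"
    proof
      assume z: "c m = 0"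
      then have le: "absv v (\<Sum>s\<in>S. act (c s) (rp s)) \<le> 1" using c(2) unfolding e by simp
      have "\<forall>s\<in>S. c s \<in> A" using c(1) by blast
      from lin_indepD[OF S this le] have "\<forall>s\<in>S. c s = 0" .
      then show False using c(3) z by simp
    qed
    moreover have "(\<Sum>s\<in>S. act (- c s) (rp s)) = - (\<Sum>s\<in>S. act (c s) (rp s))"
      unfolding sum_negf[symmetric] by (intro sum.cong refl act_minus) (use c(1) in simp)
    ultimately show ?thesis using c(1,2) A_closed(5) unfolding e
      by (intro bexI[of _ "c m"] exI[of _ "\<lambda>s. - c s"]) auto
  qed
qed

lemma module_homs_iff:
  "f \<in> module_homs (ring_A vinf) PM TM \<longleftrightarrow> f \<in> M \<rightarrow>\<^sub>E carrier TM \<and>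
     (\<forall>x\<in>M. \<forall>y\<in>M. f (x + y) = f x \<oplus>\<^bsub>TM\<^esub> f y) \<and> (\<forall>a\<in>A. \<forall>x\<in>M. f (a \<odot>\<^bsub>PM\<^esub> x) = a \<odot>\<^bsub>TM\<^esub> f x)"
  unfolding module_homs_def PM_simps(1,2) RA_simps by simp

text \<open>A non-zero multiple of each \<open>m\<close> is a combination of \<open>S\<close>, where
  both maps agree; \<open>tate_torsion_free\<close> then cancels the multiplier.\<close>

lemma module_homs_eq:
  assumes f: "f \<in> module_homs (ring_A vinf) PM TM" and g: "g \<in> module_homs (ring_A vinf) PM TM"
    and S: "finite S" "S \<subseteq> M" "\<And>s. s \<in> S \<Longrightarrow> f s = g s"
    and rel: "\<And>m. m \<in> M \<Longrightarrow> \<exists>a\<in>A - {0}. \<exists>c. (\<forall>s\<in>S. c s \<in> A) \<and>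
      absv v (act a (rp m) - (\<Sum>s\<in>S. act (c s) (rp s))) \<le> 1"
  shows "f = g"
proof -
  have fM: "f \<in> M \<rightarrow>\<^sub>E carrier TM" "g \<in> M \<rightarrow>\<^sub>E carrier TM"
    "\<And>x y. x \<in> M \<Longrightarrow> y \<in> M \<Longrightarrow> f (x + y) = f x \<oplus>\<^bsub>TM\<^esub> f y" "\<And>x y. x \<in> M \<Longrightarrow> y \<in> M \<Longrightarrow> g (x + y) = g x \<oplus>\<^bsub>TM\<^esub> g y"
    "\<And>a x. a \<in> A \<Longrightarrow> x \<in> M \<Longrightarrow> f (a \<odot>\<^bsub>PM\<^esub> x) = a \<odot>\<^bsub>TM\<^esub> f x" "\<And>a x. a \<in> A \<Longrightarrow> x \<in> M \<Longrightarrow> g (a \<odot>\<^bsub>PM\<^esub> x) = a \<odot>\<^bsub>TM\<^esub> g x"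
    using f g unfolding module_homs_iff by auto
  have zero: "f Operf = g Operf"
  proof -
    have z: "0 \<odot>\<^bsub>PM\<^esub> Operf = Operf"
      unfolding smult_rp[OF A_closed(1) M_closed(2)] by (simp add: coset_0)
    have "0 \<odot>\<^bsub>TM\<^esub> f Operf = 0 \<odot>\<^bsub>TM\<^esub> g Operf"
      unfolding TM_simps
    proof (rule restrict_ext)
      fix U assume U: "U \<in> quotient_set UNIV A"
      have fg: "f Operf \<in> carrier TM" "g Operf \<in> carrier TM" using fM(1,2) M_closed(2) by auto
      obtain x where x: "f Operf U = x +o mm" by (rule tate_val[OF fg(1) U])
      obtain y where y: "g Operf U = y +o mm" by (rule tate_val[OF fg(2) U])
      show "0 \<odot>\<^bsub>AM\<^esub> f Operf U = 0 \<odot>\<^bsub>AM\<^esub> g Operf U" unfolding x y AM_simps(3)[OF A_closed(1)] by simp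
    qed
    then show ?thesis using fM(5,6)[OF A_closed(1) M_closed(2)] unfolding z by simp
  qed
  have comb: "(\<Sum>s\<in>S'. act (c s) (rp s)) +o Operf \<in> M \<and>
      f ((\<Sum>s\<in>S'. act (c s) (rp s)) +o Operf) = g ((\<Sum>s\<in>S'. act (c s) (rp s)) +o Operf)"
    if "finite S'" "S' \<subseteq> S" "\<forall>s\<in>S. c s \<in> A" for c S'
    using that(1,2)
  proof (induction S' rule: finite_induct)
    case empty
    then show ?case using zero M_closed(2) by (simp add: coset_0)
  next
    case (insert s S')
    let ?T = "(\<Sum>s\<in>S'. act (c s) (rp s)) +o Operf"
    have s: "s \<in> M" "c s \<in> A" "f s = g s" using insert.prems S(2,3) that(3) by auto
    have T: "?T \<in> M" "f ?T = g ?T" using insert by auto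
    have e: "(\<Sum>s\<in>insert s S'. act (c s) (rp s)) +o Operf = c s \<odot>\<^bsub>PM\<^esub> s + ?T"
      unfolding smult_rp[OF s(2,1)] coset_plus[OF Operf_sub] using insert.hyps by simp
    have cs: "c s \<odot>\<^bsub>PM\<^esub> s \<in> M" by (rule smult_closed[OF s(2,1)])
    have "f (c s \<odot>\<^bsub>PM\<^esub> s + ?T) = g (c s \<odot>\<^bsub>PM\<^esub> s + ?T)"
      unfolding fM(3)[OF cs T(1)] fM(4)[OF cs T(1)] fM(5)[OF s(2,1)] fM(6)[OF s(2,1)] s(3) T(2) ..
    then show ?case unfolding e using M_closed(3)[OF cs T(1)] by blast
  qed
  have "f m = g m" if m: "m \<in> M" for m
  proof -
    obtain a c where a: "a \<in> A" "a \<noteq> 0" "\<forall>s\<in>S. c s \<in> A" "absv v (act a (rp m) - (\<Sum>s\<in>S. act (c s) (rp s))) \<le> 1"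
      using rel[OF m] by auto
    have "act a (rp m) - (\<Sum>s\<in>S. act (c s) (rp s)) \<in> perf"
      by (intro subfldD(7)[OF perf_subfld] subfld_sum[OF perf_subfld] perf_act rpM(2)) (use S(2) m in auto)
    then have "act a (rp m) +o Operf = (\<Sum>s\<in>S. act (c s) (rp s)) +o Operf"
      unfolding coset_eq[OF Operf_sub] Operf_iff using a(4) by simp
    then have "a \<odot>\<^bsub>PM\<^esub> m = (\<Sum>s\<in>S. act (c s) (rp s)) +o Operf" unfolding smult_rp[OF a(1) m] .
    then have "f (a \<odot>\<^bsub>PM\<^esub> m) = g (a \<odot>\<^bsub>PM\<^esub> m)" using comb[OF S(1) order_refl a(3)] by simp
    then have "a \<odot>\<^bsub>TM\<^esub> f m = a \<odot>\<^bsub>TM\<^esub> g m" unfolding fM(5)[OF a(1) m] fM(6)[OF a(1) m] .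
    then show ?thesis by (rule tate_torsion_free[rotated -1]) (use fM(1,2) m a in auto)
  qed
  then show ?thesis by (rule PiE_ext[OF fM(1,2)])
qed

lemma rho_hom:
  assumes c: "c \<in> carrier (J_group v)"
  shows "rho vinf v \<psi> M c \<in> module_homs (ring_A vinf) PM TM"
proof -
  obtain \<gamma> where \<gamma>: "\<gamma> \<in> Iner" "\<gamma> \<in> \<Union>c" by (rule J_elem[OF c])
  have val: "rho vinf v \<psi> M c m = kummer vinf v \<psi> x \<gamma>" if "m \<in> M" "x \<in> m" for m x
    by (rule rho_eq[OF c \<gamma>(2) M_closed(1) that])
  show ?thesis unfolding module_homs_iff
  proof (intro conjI ballI)
    show "rho vinf v \<psi> M c \<in> M \<rightarrow>\<^sub>E carrier TM"
    proof (rule PiE_I)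
      show "rho vinf v \<psi> M c m \<in> carrier TM" if "m \<in> M" for m
        unfolding val[OF that rpM(1)[OF that]] by (rule kummer_tate[OF \<gamma>(1) rpM(2)[OF that]])
    qed (simp add: rho_def)
    fix x y assume xy: "x \<in> M" "y \<in> M"
    have "x + y = (rp x + rp y) +o Operf" using coset_plus[OF Operf_sub, of "rp x" "rp y"] rpM(3) xy by simp
    then have "rp x + rp y \<in> x + y" using add_subgroupD(1)[OF Operf_sub] by (simp only: coset_mem diff_self)
    then show "rho vinf v \<psi> M c (x + y) = rho vinf v \<psi> M c x \<oplus>\<^bsub>TM\<^esub> rho vinf v \<psi> M c y"
      using val[OF M_closed(3)[OF xy]] val[OF xy(1) rpM(1)[OF xy(1)]] val[OF xy(2) rpM(1)[OF xy(2)]]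
        kummer_add[OF \<gamma>(1) rpM(2)[OF xy(1)] rpM(2)[OF xy(2)]] by simp
  next
    fix a x assume ax: "a \<in> A" "x \<in> M"
    have "act a (rp x) \<in> a \<odot>\<^bsub>PM\<^esub> x"
      unfolding smult_rp[OF ax] using add_subgroupD(1)[OF Operf_sub] by (simp only: coset_mem diff_self)
    then show "rho vinf v \<psi> M c (a \<odot>\<^bsub>PM\<^esub> x) = a \<odot>\<^bsub>TM\<^esub> rho vinf v \<psi> M c x"
      using val[OF smult_closed[OF ax]] val[OF ax(2) rpM(1)[OF ax(2)]] kummer_act[OF \<gamma>(1) rpM(2)[OF ax(2)] ax(1)]
      by simp
  qed
qed

text \<open>All representatives of such a class have the absolute value of \<open>rp m\<close>, so
  \<open>j_inv\<close> depends only on that value. The assumed equation shifts the exponent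
  \<open>\<nu>\<close> by \<open>k - l\<close>, hence the defining predicates of the two invariants
  coincide.\<close>

lemma j_inv_cong:
  assumes m: "m \<in> M" "m' \<in> M" and gt: "1 < absv v (rp m)" "1 < absv v (rp m')"
    and eq: "absv v (rp m) ^ (CHAR('k) ^ k) = absv v (rp m') ^ (CHAR('k) ^ l)"
  shows "j_inv v m = j_inv v m'"
proof -
  let ?p = "real CHAR('k)"
  have p0: "?p \<noteq> 0" using p_gt_1 by simp
  have key: "(\<exists>x\<in>m. \<exists>\<nu>::int. v x = ereal (- (?p powi \<nu> * real j))) \<longleftrightarrow> (\<exists>\<nu>::int. absv v (rp m) = exp (?p powi \<nu> * real j))"
    if m: "m \<in> M" and gt: "1 < absv v (rp m)" for m j
  proof -
    have ab: "absv v x = absv v (rp m)" if x: "x \<in> m" for x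
    proof -
      have "x \<in> rp m +o Operf" using x rpM(3)[OF m] by simp
      then have "absv v (x - rp m) < absv v (rp m)" using gt unfolding coset_mem Operf_iff by simp
      then show ?thesis using nrm_add_dominant[of "x - rp m" "rp m"] by simp
    qed
    have vx: "v x = ereal (- s) \<longleftrightarrow> absv v (rp m) = exp s" if x: "x \<in> m" for x s
    proof -
      have "x \<noteq> 0" using ab[OF x] gt by auto
      then obtain q where q: "v x = ereal q" using valuationD(2)[OF val] by blast
      then have "absv v (rp m) = exp (- q)" using absv_exp[OF val q] ab[OF x] by simp
      then show ?thesis using q by auto
    qed
    show ?thesis using vx rpM(1)[OF m] by blast
  qed
  have pos: "0 < absv v (rp m)" "0 < absv v (rp m')" using gt by auto
  have "(\<exists>\<nu>::int. absv v (rp m) = exp (?p powi \<nu> * real j)) \<longleftrightarrow> (\<exists>\<nu>::int. absv v (rp m') = exp (?p powi \<nu> * real j))" for j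
  proof -
    have tr: "\<exists>\<nu>::int. y = exp (?p powi \<nu> * real j)"
      if x: "x = exp (?p powi \<mu> * real j)" and xy: "x ^ (CHAR('k) ^ k) = y ^ (CHAR('k) ^ l)" and y: "0 < y"
      for x y :: real and k l and \<mu> :: int
    proof -
      have "real (CHAR('k) ^ k) * ln x = real (CHAR('k) ^ l) * ln y"
        using arg_cong[OF xy, of ln] x y by (simp add: ln_realpow)
      then have "?p ^ k * (?p powi \<mu> * real j) = ?p ^ l * ln y" unfolding x by simp
      then have "ln y = ?p ^ k * (?p powi \<mu> * real j) / ?p ^ l" using p0 by (simp add: field_simps)
      also have "\<dots> = ?p powi (int k + \<mu> - int l) * real j" using p0 by (simp add: power_int_add power_int_diff)
      finally have "y = exp (?p powi (int k + \<mu> - int l) * real j)" using y by (metis exp_ln)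
      then show ?thesis by blast
    qed
    show ?thesis using tr[OF _ eq pos(2)] tr[OF _ eq[symmetric] pos(1)] by blast
  qed
  then show ?thesis unfolding j_inv_def key[OF m(1) gt(1)] key[OF m(2) gt(2)] by simp
qed

theorem openin_rho_image:
  assumes fg: "fin_gen (ring_A vinf) PM" and fin: "finite (j_set v M)"
    and rank: "card (j_set v M) = mod_rank (ring_A vinf) PM"
  shows "openin (hom_topology vinf v \<psi> M) (rho vinf v \<psi> M ` carrier (J_group v))"
proof -
  define r where "r = card (j_set v M)"
  obtain e where e: "bij_betw e {..<r} (j_set v M)"
    unfolding r_def using ex_bij_betw_nat_finite[OF fin] by (auto simp: atLeast0LessThan)
  have "\<exists>m. m \<in> M \<and> m \<noteq> Operf \<and> j_inv v m = e i" if "i < r" for i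
  proof -
    have "e i \<in> j_inv v ` (M - {Operf})" using bij_betwE[OF e] that unfolding j_set_def by auto
    then obtain m where "e i = j_inv v m" "m \<in> M - {Operf}" by (rule imageE)
    then show ?thesis by (intro exI[of _ m]) simp
  qed
  then obtain m where m: "\<And>i. i < r \<Longrightarrow> m i \<in> M" "\<And>i. i < r \<Longrightarrow> m i \<noteq> Operf" "\<And>i. i < r \<Longrightarrow> j_inv v (m i) = e i"
    by metis
  have gt: "1 < absv v (rp (m i))" if i: "i < r" for i
  proof (rule ccontr)
    assume "\<not> ?thesis"
    then have "rp (m i) - 0 \<in> Operf" using rpM(2)[OF m(1)[OF i]] unfolding Operf_iff by simp
    then have "rp (m i) +o Operf = 0 +o Operf" unfolding coset_eq[OF Operf_sub] .
    then show False using rpM(3)[OF m(1)[OF i]] m(2)[OF i] unfolding coset_0 by simp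
  qed
  interpret kf: kummer_family v vinf \<psi> r "\<lambda>i. rp (m i)"
  proof
    show "rp (m i) \<in> perf" if "i < r" for i by (rule rpM(2)[OF m(1)[OF that]])
    show "1 < absv v (rp (m i))" if "i < r" for i by (rule gt[OF that])
    show "i = j" if ij: "i < r" "j < r" and eq: "absv v (rp (m i)) ^ (CHAR('k) ^ k) = absv v (rp (m j)) ^ (CHAR('k) ^ l)" for i j k l
    proof -
      have "e i = e j" using j_inv_cong[OF m(1)[OF ij(1)] m(1)[OF ij(2)] gt[OF ij(1)] gt[OF ij(2)] eq] m(3) ij by simp
      then show ?thesis using bij_betw_imp_inj_on[OF e] ij unfolding inj_on_def by simp
    qed
  qed
  define S where "S = m ` {..<r}"
  have inj: "inj_on m {..<r}"
    using m(3) bij_betw_imp_inj_on[OF e] unfolding inj_on_def by (metis lessThan_iff)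
  have S: "finite S" "S \<subseteq> M" "card S = r" unfolding S_def using m(1) card_image[OF inj] by auto
  have indep: "lin_indep (ring_A vinf) PM S" unfolding lin_indep_iff
  proof (intro conjI allI impI S(1,2))
    fix c assume c: "\<forall>s\<in>S. c s \<in> A" "absv v (\<Sum>s\<in>S. act (c s) (rp s)) \<le> 1"
    have "absv v (\<Sum>i<r. act (c (m i)) (rp (m i))) \<le> 1" using c(2) unfolding S_def by (simp add: sum.reindex[OF inj])
    then have "\<forall>i<r. c (m i) = 0" using c(1) by (intro kf.family_independent) (auto simp: S_def)
    then show "\<forall>s\<in>S. c s = 0" unfolding S_def by auto
  qed
  \<comment> \<open>Here the rank hypothesis enters: the \<open>r\<close> independent elements of
    \<open>S\<close> form an independent set of maximal size.\<close>
  note rel = maximal_independent_relation[OF fg indep S(3)[unfolded r_def rank]]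
  obtain a0 where a0: "a0 \<in> A" "a0 \<noteq> 0"
    and ker: "\<And>b z. b \<in> A \<Longrightarrow> b \<noteq> 0 \<Longrightarrow> z \<in> kf.Xr (a0 * b) \<Longrightarrow> kf.tr b z = 0 \<Longrightarrow> z \<in> kf.H (a0 * b)"
    using kf.kernel_in_image by blast
  define basis where "basis = {{g \<in> carrier TM. \<forall>U \<in> frac_mod_A vinf a. g U = f U} | a f.
        a \<in> A - {0} \<and> f \<in> carrier TM}"
  have tt: "tate_topology vinf v \<psi> = topology_generated_by basis"
    unfolding tate_topology_def basis_def ..
  have top: "carrier TM \<subseteq> topspace (tate_topology vinf v \<psi>)"
  proof
    fix g assume g: "g \<in> carrier TM"
    have "{g' \<in> carrier TM. \<forall>U \<in> frac_mod_A vinf 1. g' U = g U} \<in> basis"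
      unfolding basis_def by (intro CollectI exI[of _ 1] exI[of _ g] conjI refl) (use g A_closed(2) in simp_all)
    then show "g \<in> topspace (tate_topology vinf v \<psi>)"
      unfolding tt topology_generated_by_topspace by (rule UnionI) (use g in simp)
  qed
  show ?thesis
  proof (subst openin_subopen, intro ballI)
    fix f0 assume "f0 \<in> rho vinf v \<psi> M ` carrier (J_group v)"
    then obtain c0 where c0: "c0 \<in> carrier (J_group v)" "f0 = rho vinf v \<psi> M c0" by blast
    obtain \<gamma>0 where \<gamma>0: "\<gamma>0 \<in> Iner" "\<gamma>0 \<in> \<Union>c0" by (rule J_elem[OF c0(1)])
    have f0: "f0 \<in> module_homs (ring_A vinf) PM TM" unfolding c0(2) by (rule rho_hom[OF c0(1)])
    have f0c: "f0 x \<in> carrier TM" if "x \<in> M" for x using f0 that unfolding module_homs_iff by auto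
    \<comment> \<open>A neighbourhood of \<open>f0\<close> that constrains only the finitely many
      coordinates in \<open>S\<close>, and there only the values on the
      \<open>a0\<close>-torsion.\<close>
    define B where "B = (\<lambda>x. if x \<in> S then {g \<in> carrier TM. \<forall>U \<in> frac_mod_A vinf a0. g U = f0 x U}
      else topspace (tate_topology vinf v \<psi>))"
    define W where "W = PiE M B \<inter> module_homs (ring_A vinf) PM TM"
    have Bopen: "openin (tate_topology vinf v \<psi>) (B x)" if x: "x \<in> M" for x
    proof (cases "x \<in> S")
      case True
      have "B x = {g \<in> carrier TM. \<forall>U \<in> frac_mod_A vinf a0. g U = f0 x U}" unfolding B_def using True by simp
      then have "B x \<in> basis" unfolding basis_def
        by (intro CollectI exI[of _ a0] exI[of _ "f0 x"] conjI) (use a0 f0c[OF x] in simp_all)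
      then show ?thesis unfolding tt by (rule topology_generated_by_Basis)
    qed (simp add: B_def)
    have "finite {x \<in> M. B x \<noteq> topspace (tate_topology vinf v \<psi>)}"
      by (rule finite_subset[OF _ S(1)]) (auto simp: B_def)
    then have "openin (product_topology (\<lambda>_. tate_topology vinf v \<psi>) M) (PiE M B)"
      unfolding openin_PiE_gen using Bopen by simp
    then have Wopen: "openin (hom_topology vinf v \<psi> M) W"
      unfolding hom_topology_def W_def by (rule openin_subtopology_Int)
    have "f0 x \<in> B x" if "x \<in> M" for x unfolding B_def using f0c[OF that] top by auto
    moreover have "f0 \<in> extensional M" using f0 unfolding module_homs_iff by (simp add: PiE_iff)
    ultimately have "f0 \<in> W" unfolding W_def using f0 by (simp add: PiE_iff)
    moreover have "W \<subseteq> rho vinf v \<psi> M ` carrier (J_group v)"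
    proof
      fix f assume "f \<in> W"
      then have f: "f \<in> module_homs (ring_A vinf) PM TM" "f \<in> PiE M B" unfolding W_def by auto
      have fB: "f (m i) \<in> B (m i)" "m i \<in> S" if "i < r" for i using f(2) m(1)[OF that] that by (auto simp: S_def)
      have "\<exists>\<gamma>\<in>Iner. \<forall>i<r. kummer vinf v \<psi> (rp (m i)) \<gamma> = f (m i)"
      proof (rule kf.realize_family[OF a0 ker \<gamma>0(1)])
        fix i assume i: "i < r"
        show "f (m i) \<in> carrier TM" using fB[OF i] by (simp add: B_def)
        \<comment> \<open>The class of \<open>1 / a0\<close> generates the
          \<open>a0\<close>-torsion, so agreement at this class is all that
          \<open>realize_family\<close> asks for.\<close>
        have "1 / a0 +o A \<in> frac_mod_A vinf a0"
          unfolding frac_mod_A_def by (intro quotientI imageI A_closed(2))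
        then have "f (m i) (1 / a0 +o A) = f0 (m i) (1 / a0 +o A)" using fB[OF i] by (simp add: B_def)
        also have "f0 (m i) = kummer vinf v \<psi> (rp (m i)) \<gamma>0"
          unfolding c0(2) by (rule rho_eq[OF c0(1) \<gamma>0(2) M_closed(1) m(1)[OF i] rpM(1)[OF m(1)[OF i]]])
        finally show "f (m i) (1 / a0 +o A) = kummer vinf v \<psi> (rp (m i)) \<gamma>0 (1 / a0 +o A)" .
      qed
      then obtain \<gamma> where \<gamma>: "\<gamma> \<in> Iner" "\<And>i. i < r \<Longrightarrow> kummer vinf v \<psi> (rp (m i)) \<gamma> = f (m i)" by blast
      obtain c where c: "c \<in> carrier (J_group v)" "\<gamma> \<in> \<Union>c" using J_surj[OF \<gamma>(1)] by blast
      have "f = rho vinf v \<psi> M c"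
      proof (rule module_homs_eq[OF f(1) rho_hom[OF c(1)] S(1,2) _ rel])
        fix s assume "s \<in> S"
        then obtain i where i: "i < r" "s = m i" unfolding S_def by auto
        show "f s = rho vinf v \<psi> M c s"
          unfolding i(2) \<gamma>(2)[OF i(1), symmetric]
          by (rule rho_eq[OF c M_closed(1) m(1)[OF i(1)] rpM(1)[OF m(1)[OF i(1)]], symmetric])
      qed
      then show "f \<in> rho vinf v \<psi> M ` carrier (J_group v)" using c(1) by blast
    qed
    ultimately show "\<exists>T. openin (hom_topology vinf v \<psi> M) T \<and> f0 \<in> T \<and> T \<subseteq> rho vinf v \<psi> M ` carrier (J_group v)"
      using Wopen by blast
  qed
qed

end

theorem theorem13p5:
  fixes v :: "'k::field alg_closure \<Rightarrow> ereal"
    and vinf :: "'f::field \<Rightarrow> ereal"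
    and \<psi> :: "'f \<Rightarrow> 'k poly"
    and M :: "'k alg_closure set set"
  assumes "Factorial_Ring.prime CHAR('k)"
    and "valuation v"
    and "local_field (base_val v)"
    and "global_function_field TYPE('f)"
    and "CHAR('f) = CHAR('k)"
    and "normalized_valuation vinf"
    and "good_drinfeld_module vinf (base_val v) \<psi>"
    and "submodule M (ring_A vinf) (P_module v \<psi>)"
    and "fin_gen (ring_A vinf) (P_module v \<psi> \<lparr>carrier := M\<rparr>)"
    and "finite (j_set v M)"
    and "card (j_set v M) = mod_rank (ring_A vinf) (P_module v \<psi> \<lparr>carrier := M\<rparr>)"
  shows "openin (hom_topology vinf v \<psi> M) (rho vinf v \<psi> M ` carrier (J_group v))"
proof -
  \<comment> \<open>The locale assumption \<open>frac\<close> is discharged by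
    \<open>regular_outside_fraction\<close>, from the hypotheses on the function field and on
    \<open>vinf\<close>.\<close>
  interpret kummer_module v vinf \<psi> M
    by (intro kummer_module.intro drinfeld.intro kummer_module_axioms.intro assms regular_outside_fraction)
  show ?thesis by (rule openin_rho_image[OF assms(9-11)])
qed

end
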